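(* Let $G$ be a finite group and let $R$ be a unital commutative ring. Suppose $\mathscr{C}$ is a set of subgroups of $G$ closed under conjugation which satisfies the following: (1) if $K\le G$ is a cyclic subgroup, then the centralizer $C_G(K)$ is in $\mathscr{C}$; (2) if $K\le G$ is a subgroup such that $K/O_p(K)$ is cyclic for some prime $p$ with $pR\ne R$, then the centralizer $C_G(K)$ is in $\mathscr{C}$. Then the trivial representation $R$ can be written as $$R=\sum_{H\in\mathscr{C}}\frac{-\mu_{\mathscr{C}_{-}}(-\infty,H)}{|G:C_G(H)|}\,\mathrm{ind}_{C_G(H)}^{G}(R)\ \in\ A_R(G),$$ where $\mathscr{C}_{-}$ is the poset obtained from $\mathscr{C}$ (ordered by inclusion) by adding a unique minimum element $-\infty$, and $\mu_{\mathscr{C}_{-}}$ is its Möbius function.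
   Context: For a finite group $H$ and a prime $p$, $O_p(H)$ is the largest normal $p$-subgroup of $H$. For a finite group $H$, $a_R(H)$ is the Grothendieck ring of the semiring of isomorphism classes of finitely generated $RH$-modules under direct sum and tensor product, and $A_R(H)=\mathbb{Q}\otimes_{\mathbb{Z}}a_R(H)$. $\mathrm{ind}_K^G(R)\cong R[G/K]$ is the module induced from the trivial $RK$-module $R$; modules are identified with their classes in $A_R(G)$. *)

theory Defs
  imports
    Complex_Main
    "HOL-Library.Option_ord"
    "HOL-Algebra.Left_Coset"
    "HOL-Algebra.Elementary_Groups"
    "HOL-Algebra.Module"
    "HOL-Algebra.IntRing"
begin

section \<open>Finite groups and posets\<close>

definition centralizer :: "('g, 'x) monoid_scheme \<Rightarrow> 'g set \<Rightarrow> 'g set" where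
  "centralizer G K = {g \<in> carrier G. \<forall>k\<in>K. g \<otimes>\<^bsub>G\<^esub> k = k \<otimes>\<^bsub>G\<^esub> g}"

text \<open>\<open>O\<^sub>p(H)\<close>, for a finite group \<open>H\<close>.\<close>

definition p_core :: "nat \<Rightarrow> ('g, 'x) monoid_scheme \<Rightarrow> 'g set" where
  "p_core p H = (GREATEST N. N \<lhd> H \<and> (\<exists>n. card N = p ^ n))"

text \<open>
  The Moebius function of the subposet \<open>P\<close> of a partially ordered type: \<open>\<mu>(x,x) = 1\<close>, and
  \<open>\<mu>(x,y) = - (\<Sum>x\<le>z<y. \<mu>(x,z))\<close> if \<open>x < y\<close>.  It is only meaningful for \<open>x, y \<in> P\<close> when the
  intervals of \<open>P\<close> are finite.
\<close>

function moebius :: "'a::order set \<Rightarrow> 'a \<Rightarrow> 'a \<Rightarrow> int" where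
  "moebius P x y =
     (if x = y then 1
      else if x < y \<and> finite {z \<in> P. x \<le> z \<and> z < y}
        then - (\<Sum>z \<in> {z \<in> P. x \<le> z \<and> z < y}. moebius P x z)
      else 0)"
  by pat_completeness auto
termination
proof (relation "measure (\<lambda>(P, x, y). card {z \<in> P. x \<le> z \<and> z < y})")
  fix P :: "'a set" and x y z
  assume "x < y \<and> finite {z \<in> P. x \<le> z \<and> z < y}" and z: "z \<in> {z \<in> P. x \<le> z \<and> z < y}"
  moreover from z have "{w \<in> P. x \<le> w \<and> w < z} \<subset> {z \<in> P. x \<le> z \<and> z < y}"
    by (auto dest: less_trans)
  ultimately have "card {w \<in> P. x \<le> w \<and> w < z} < card {z \<in> P. x \<le> z \<and> z < y}"
    by (intro psubset_card_mono) auto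
  then show "((P, x, z), P, x, y) \<in> measure (\<lambda>(P, x, y). card {z \<in> P. x \<le> z \<and> z < y})"
    by simp
qed simp

declare moebius.simps [simp del]

text \<open>
  In the order on options, \<open>None\<close> lies below every \<open>Some x\<close>, and \<open>Some\<close> is an order embedding;
  so \<open>None\<close> is the new minimum \<open>-\<infinity>\<close>.
\<close>

definition adjoin_bot :: "'a set \<Rightarrow> 'a option set" where
  "adjoin_bot P = insert None (Some ` P)"


section \<open>Free modules, quotients and tensor products\<close>

text \<open>
  The records of modules extend those of rings; the fields \<open>mult\<close> and \<open>one\<close> play no role
  in a module and are left unspecified.
\<close>

definition free_module :: "('r, 'x) ring_scheme \<Rightarrow> 'b set \<Rightarrow> ('r, 'b \<Rightarrow> 'r) module" where
  "free_module R B =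
     \<lparr>carrier = {f \<in> B \<rightarrow>\<^sub>E carrier R. finite {b \<in> B. f b \<noteq> \<zero>\<^bsub>R\<^esub>}},
      monoid.mult = undefined, one = undefined,
      zero = (\<lambda>b\<in>B. \<zero>\<^bsub>R\<^esub>),
      add = (\<lambda>f h. \<lambda>b\<in>B. f b \<oplus>\<^bsub>R\<^esub> h b),
      smult = (\<lambda>r f. \<lambda>b\<in>B. r \<otimes>\<^bsub>R\<^esub> f b)\<rparr>"

definition free_gen :: "('r, 'x) ring_scheme \<Rightarrow> 'b set \<Rightarrow> 'b \<Rightarrow> 'b \<Rightarrow> 'r" where
  "free_gen R B c = (\<lambda>b\<in>B. if b = c then \<one>\<^bsub>R\<^esub> else \<zero>\<^bsub>R\<^esub>)"

definition quotient_module ::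
  "('r, 'x) ring_scheme \<Rightarrow> ('r, 'm, 'y) module_scheme \<Rightarrow> 'm set \<Rightarrow> ('r, 'm set) module" where
  "quotient_module R M N =
     \<lparr>carrier = a_rcosets\<^bsub>M\<^esub> N,
      monoid.mult = undefined, one = undefined,
      zero = N,
      add = set_add M,
      smult = (\<lambda>r X. \<Union>x\<in>X. N +>\<^bsub>M\<^esub> (r \<odot>\<^bsub>M\<^esub> x))\<rparr>"

text \<open>
  \<open>M \<otimes>\<^sub>R N\<close> is the quotient of the free module on \<open>M \<times> N\<close> by the submodule generated by the
  bilinearity relations.
\<close>

definition tensor_free ::
  "('r, 'x) ring_scheme \<Rightarrow> ('r, 'm, 'y) module_scheme \<Rightarrow> ('r, 'n, 'z) module_scheme
    \<Rightarrow> ('r, 'm \<times> 'n \<Rightarrow> 'r) module" where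
  "tensor_free R M N = free_module R (carrier M \<times> carrier N)"

definition tensor_gen ::
  "('r, 'x) ring_scheme \<Rightarrow> ('r, 'm, 'y) module_scheme \<Rightarrow> ('r, 'n, 'z) module_scheme
    \<Rightarrow> 'm \<Rightarrow> 'n \<Rightarrow> 'm \<times> 'n \<Rightarrow> 'r" where
  "tensor_gen R M N m n = free_gen R (carrier M \<times> carrier N) (m, n)"

definition tensor_relators ::
  "('r, 'x) ring_scheme \<Rightarrow> ('r, 'm, 'y) module_scheme \<Rightarrow> ('r, 'n, 'z) module_scheme
    \<Rightarrow> ('m \<times> 'n \<Rightarrow> 'r) set" where
  "tensor_relators R M N =
    (let F = tensor_free R M N; e = tensor_gen R M N in
      {e (m \<oplus>\<^bsub>M\<^esub> m') n \<ominus>\<^bsub>F\<^esub> (e m n \<oplus>\<^bsub>F\<^esub> e m' n) | m m' n.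
         m \<in> carrier M \<and> m' \<in> carrier M \<and> n \<in> carrier N} \<union>
      {e m (n \<oplus>\<^bsub>N\<^esub> n') \<ominus>\<^bsub>F\<^esub> (e m n \<oplus>\<^bsub>F\<^esub> e m n') | m n n'.
         m \<in> carrier M \<and> n \<in> carrier N \<and> n' \<in> carrier N} \<union>
      {e (r \<odot>\<^bsub>M\<^esub> m) n \<ominus>\<^bsub>F\<^esub> (r \<odot>\<^bsub>F\<^esub> e m n) | r m n.
         r \<in> carrier R \<and> m \<in> carrier M \<and> n \<in> carrier N} \<union>
      {e m (r \<odot>\<^bsub>N\<^esub> n) \<ominus>\<^bsub>F\<^esub> (r \<odot>\<^bsub>F\<^esub> e m n) | r m n.
         r \<in> carrier R \<and> m \<in> carrier M \<and> n \<in> carrier N})"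

definition tensor_kernel ::
  "('r, 'x) ring_scheme \<Rightarrow> ('r, 'm, 'y) module_scheme \<Rightarrow> ('r, 'n, 'z) module_scheme
    \<Rightarrow> ('m \<times> 'n \<Rightarrow> 'r) set" where
  "tensor_kernel R M N =
     (\<lambda>U. submodule U R (tensor_free R M N)) hull (tensor_relators R M N)"

definition tensor_module ::
  "('r, 'x) ring_scheme \<Rightarrow> ('r, 'm, 'y) module_scheme \<Rightarrow> ('r, 'n, 'z) module_scheme
    \<Rightarrow> ('r, ('m \<times> 'n \<Rightarrow> 'r) set) module" where
  "tensor_module R M N = quotient_module R (tensor_free R M N) (tensor_kernel R M N)"

definition pure_tensor ::
  "('r, 'x) ring_scheme \<Rightarrow> ('r, 'm, 'y) module_scheme \<Rightarrow> ('r, 'n, 'z) module_scheme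
    \<Rightarrow> 'm \<Rightarrow> 'n \<Rightarrow> ('m \<times> 'n \<Rightarrow> 'r) set" where
  "pure_tensor R M N m n = tensor_kernel R M N +>\<^bsub>tensor_free R M N\<^esub> tensor_gen R M N m n"

text \<open>
  For algebras \<open>M\<close> and \<open>N\<close>, the product on \<open>M \<otimes>\<^sub>R N\<close> with \<open>(m \<otimes> n)(m' \<otimes> n') = mm' \<otimes> nn'\<close>; it is
  induced by the corresponding bilinear product on the free module.
\<close>

definition tensor_free_mult ::
  "('r, 'x) ring_scheme \<Rightarrow> ('r, 'm, 'y) module_scheme \<Rightarrow> ('r, 'n, 'z) module_scheme
    \<Rightarrow> ('m \<times> 'n \<Rightarrow> 'r) \<Rightarrow> ('m \<times> 'n \<Rightarrow> 'r) \<Rightarrow> 'm \<times> 'n \<Rightarrow> 'r" where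
  "tensor_free_mult R M N f h =
    (let supp = (\<lambda>k. {p \<in> carrier M \<times> carrier N. k p \<noteq> \<zero>\<^bsub>R\<^esub>}) in
      finsum (tensor_free R M N)
        (\<lambda>(p, q). (f p \<otimes>\<^bsub>R\<^esub> h q) \<odot>\<^bsub>tensor_free R M N\<^esub>
          tensor_gen R M N (fst p \<otimes>\<^bsub>M\<^esub> fst q) (snd p \<otimes>\<^bsub>N\<^esub> snd q))
        (supp f \<times> supp h))"

definition tensor_algebra ::
  "('r, 'x) ring_scheme \<Rightarrow> ('r, 'm, 'y) module_scheme \<Rightarrow> ('r, 'n, 'z) module_scheme
    \<Rightarrow> ('r, ('m \<times> 'n \<Rightarrow> 'r) set) module" where
  "tensor_algebra R M N = (tensor_module R M N)
     \<lparr>monoid.mult := (\<lambda>X Y. \<Union>f\<in>X. \<Union>h\<in>Y.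
                tensor_kernel R M N +>\<^bsub>tensor_free R M N\<^esub> tensor_free_mult R M N f h),
      one := pure_tensor R M N \<one>\<^bsub>M\<^esub> \<one>\<^bsub>N\<^esub>\<rparr>"

text \<open>A ring as an algebra over the integers.\<close>

definition int_algebra :: "('a, 'x) ring_scheme \<Rightarrow> (int, 'a) module" where
  "int_algebra A =
     \<lparr>carrier = carrier A, monoid.mult = monoid.mult A, one = one A, zero = zero A, add = add A,
      smult = (\<lambda>n x. [n] \<cdot>\<^bsub>A\<^esub> x)\<rparr>"

definition rat_ring :: "rat ring" where
  "rat_ring = \<lparr>carrier = UNIV, monoid.mult = (*), one = 1, zero = 0, add = (+)\<rparr>"


section \<open>The Grothendieck ring of a semiring\<close>

text \<open>
  The pair \<open>(a, b)\<close> represents the formal difference \<open>a - b\<close>; as addition in a semiring need not be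
  cancellative, the equivalence involves an auxiliary summand \<open>e\<close>.
\<close>

definition grothendieck_rel :: "('a, 'x) ring_scheme \<Rightarrow> (('a \<times> 'a) \<times> ('a \<times> 'a)) set" where
  "grothendieck_rel S =
    {((a, b), (c, d)). a \<in> carrier S \<and> b \<in> carrier S \<and> c \<in> carrier S \<and> d \<in> carrier S \<and>
       (\<exists>e\<in>carrier S. a \<oplus>\<^bsub>S\<^esub> d \<oplus>\<^bsub>S\<^esub> e = c \<oplus>\<^bsub>S\<^esub> b \<oplus>\<^bsub>S\<^esub> e)}"

definition grothendieck_diff :: "('a, 'x) ring_scheme \<Rightarrow> 'a \<Rightarrow> 'a \<Rightarrow> ('a \<times> 'a) set" where
  "grothendieck_diff S a b = grothendieck_rel S `` {(a, b)}"

definition grothendieck_ring :: "('a, 'x) ring_scheme \<Rightarrow> ('a \<times> 'a) set ring" where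
  "grothendieck_ring S =
     \<lparr>carrier = (carrier S \<times> carrier S) // grothendieck_rel S,
      monoid.mult = (\<lambda>X Y. \<Union>(a, b)\<in>X. \<Union>(c, d)\<in>Y.
        grothendieck_diff S (a \<otimes>\<^bsub>S\<^esub> c \<oplus>\<^bsub>S\<^esub> b \<otimes>\<^bsub>S\<^esub> d) (a \<otimes>\<^bsub>S\<^esub> d \<oplus>\<^bsub>S\<^esub> b \<otimes>\<^bsub>S\<^esub> c)),
      one = grothendieck_diff S \<one>\<^bsub>S\<^esub> \<zero>\<^bsub>S\<^esub>,
      zero = grothendieck_diff S \<zero>\<^bsub>S\<^esub> \<zero>\<^bsub>S\<^esub>,
      add = (\<lambda>X Y. \<Union>(a, b)\<in>X. \<Union>(c, d)\<in>Y. grothendieck_diff S (a \<oplus>\<^bsub>S\<^esub> c) (b \<oplus>\<^bsub>S\<^esub> d))\<rparr>"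


section \<open>Modules over a group ring\<close>

text \<open>An \<open>RG\<close>-module is given by an \<open>R\<close>-module together with an \<open>R\<close>-linear action of \<open>G\<close>.\<close>

record ('g, 'r, 'm) rgmod = "('r, 'm) module" +
  act :: "'g \<Rightarrow> 'm \<Rightarrow> 'm"

locale rg_module = G: group G + module R M
  for G :: "('g, 'x) monoid_scheme" and R :: "('r, 'y) ring_scheme" and
    M :: "('g, 'r, 'm, 'z) rgmod_scheme" +
  assumes act_closed: "\<lbrakk>g \<in> carrier G; x \<in> carrier M\<rbrakk> \<Longrightarrow> act M g x \<in> carrier M"
    and act_add: "\<lbrakk>g \<in> carrier G; x \<in> carrier M; y \<in> carrier M\<rbrakk>
      \<Longrightarrow> act M g (x \<oplus>\<^bsub>M\<^esub> y) = act M g x \<oplus>\<^bsub>M\<^esub> act M g y"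
    and act_smult: "\<lbrakk>g \<in> carrier G; r \<in> carrier R; x \<in> carrier M\<rbrakk>
      \<Longrightarrow> act M g (r \<odot>\<^bsub>M\<^esub> x) = r \<odot>\<^bsub>M\<^esub> act M g x"
    and act_one: "x \<in> carrier M \<Longrightarrow> act M \<one>\<^bsub>G\<^esub> x = x"
    and act_mult: "\<lbrakk>g \<in> carrier G; h \<in> carrier G; x \<in> carrier M\<rbrakk>
      \<Longrightarrow> act M (g \<otimes>\<^bsub>G\<^esub> h) x = act M g (act M h x)"

definition rg_submodule ::
  "('g, 'x) monoid_scheme \<Rightarrow> ('r, 'y) ring_scheme \<Rightarrow> ('g, 'r, 'm, 'z) rgmod_scheme
    \<Rightarrow> 'm set \<Rightarrow> bool" where
  "rg_submodule G R M U \<longleftrightarrow>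
     submodule U R M \<and> (\<forall>g\<in>carrier G. \<forall>x\<in>U. act M g x \<in> U)"

definition fg_rg_module ::
  "('g, 'x) monoid_scheme \<Rightarrow> ('r, 'y) ring_scheme \<Rightarrow> ('g, 'r, 'm, 'z) rgmod_scheme \<Rightarrow> bool" where
  "fg_rg_module G R M \<longleftrightarrow> rg_module G R M \<and>
     (\<exists>S. finite S \<and> S \<subseteq> carrier M \<and> rg_submodule G R M hull S = carrier M)"

definition rg_isomorphic ::
  "('g, 'x) monoid_scheme \<Rightarrow> ('r, 'y) ring_scheme \<Rightarrow> ('g, 'r, 'm, 'z) rgmod_scheme
    \<Rightarrow> ('g, 'r, 'n, 'w) rgmod_scheme \<Rightarrow> bool" where
  "rg_isomorphic G R M N \<longleftrightarrow> (\<exists>\<phi>. bij_betw \<phi> (carrier M) (carrier N) \<and>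
     (\<forall>x\<in>carrier M. \<forall>y\<in>carrier M. \<phi> (x \<oplus>\<^bsub>M\<^esub> y) = \<phi> x \<oplus>\<^bsub>N\<^esub> \<phi> y) \<and>
     (\<forall>r\<in>carrier R. \<forall>x\<in>carrier M. \<phi> (r \<odot>\<^bsub>M\<^esub> x) = r \<odot>\<^bsub>N\<^esub> \<phi> x) \<and>
     (\<forall>g\<in>carrier G. \<forall>x\<in>carrier M. \<phi> (act M g x) = act N g (\<phi> x)))"

definition rg_trivial :: "('r, 'y) ring_scheme \<Rightarrow> ('g, 'r, 'r) rgmod" where
  "rg_trivial R =
     \<lparr>carrier = carrier R, monoid.mult = undefined, one = undefined, zero = \<zero>\<^bsub>R\<^esub>, add = add R,
      smult = monoid.mult R, act = (\<lambda>g x. x)\<rparr>"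

text \<open>
  \<open>ind\<^sub>K\<^sup>G(R) = R[G/K]\<close>: the free \<open>R\<close>-module on the left cosets of \<open>K\<close>, where \<open>g\<close> maps the basis
  element \<open>xK\<close> to \<open>gxK\<close>.  On a coefficient function \<open>f\<close> this is \<open>(g f)(xK) = f(g\<^sup>-\<^sup>1xK)\<close>.
\<close>

definition ind_trivial ::
  "('g, 'x) monoid_scheme \<Rightarrow> ('r, 'y) ring_scheme \<Rightarrow> 'g set \<Rightarrow> ('g, 'r, 'g set \<Rightarrow> 'r) rgmod" where
  "ind_trivial G R K = module.extend (free_module R (lcosets\<^bsub>G\<^esub> K))
     \<lparr>act = (\<lambda>g f. \<lambda>X \<in> lcosets\<^bsub>G\<^esub> K. f (inv\<^bsub>G\<^esub> g <#\<^bsub>G\<^esub> X))\<rparr>"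

definition rg_direct_sum ::
  "('g, 'r, 'm, 'z) rgmod_scheme \<Rightarrow> ('g, 'r, 'n, 'w) rgmod_scheme \<Rightarrow> ('g, 'r, 'm \<times> 'n) rgmod" where
  "rg_direct_sum M N =
     \<lparr>carrier = carrier M \<times> carrier N, monoid.mult = undefined, one = undefined,
      zero = (\<zero>\<^bsub>M\<^esub>, \<zero>\<^bsub>N\<^esub>),
      add = (\<lambda>(x, y) (x', y'). (x \<oplus>\<^bsub>M\<^esub> x', y \<oplus>\<^bsub>N\<^esub> y')),
      smult = (\<lambda>r (x, y). (r \<odot>\<^bsub>M\<^esub> x, r \<odot>\<^bsub>N\<^esub> y)),
      act = (\<lambda>g (x, y). (act M g x, act N g y))\<rparr>"

text \<open>
  The tensor product over \<open>R\<close> with the diagonal action \<open>g(m \<otimes> n) = gm \<otimes> gn\<close>.  The free module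
  on \<open>M \<times> N\<close> is permuted by \<open>(g f)(m, n) = f(g\<^sup>-\<^sup>1m, g\<^sup>-\<^sup>1n)\<close>, which maps the relations onto
  themselves and hence cosets onto cosets.
\<close>

definition rg_tensor ::
  "('g, 'x) monoid_scheme \<Rightarrow> ('r, 'y) ring_scheme \<Rightarrow> ('g, 'r, 'm, 'z) rgmod_scheme
    \<Rightarrow> ('g, 'r, 'n, 'w) rgmod_scheme \<Rightarrow> ('g, 'r, ('m \<times> 'n \<Rightarrow> 'r) set) rgmod" where
  "rg_tensor G R M N = module.extend (tensor_module R M N)
     \<lparr>act = (\<lambda>g X. (\<lambda>f. \<lambda>p \<in> carrier M \<times> carrier N.
        f (act M (inv\<^bsub>G\<^esub> g) (fst p), act N (inv\<^bsub>G\<^esub> g) (snd p))) ` X)\<rparr>"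


section \<open>The ring \<open>A\<^sub>R(G)\<close>\<close>

text \<open>
  To form a set of isomorphism classes, the underlying sets of modules are confined to one type.
  For finite \<open>G\<close> a finitely generated \<open>RG\<close>-module is a quotient of some \<open>R\<^sup>n\<close> as an \<open>R\<close>-module,
  and its elements then correspond to cosets in \<open>R\<^sup>n\<close>; so sets of sequences in \<open>R\<close> suffice to
  represent every isomorphism class, as \<open>iso_class_nonempty\<close> below confirms for modules over
  an arbitrary type.
\<close>

type_synonym ('g, 'r) rep = "('g, 'r, (nat \<Rightarrow> 'r) set) rgmod"

definition iso_class ::
  "('g, 'x) monoid_scheme \<Rightarrow> ('r, 'y) ring_scheme \<Rightarrow> ('g, 'r, 'm, 'z) rgmod_scheme
    \<Rightarrow> ('g, 'r) rep set" where
  "iso_class G R M = {L. fg_rg_module G R L \<and> rg_isomorphic G R M L}"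

lemma (in module) submodule_zero: "submodule N R M \<Longrightarrow> \<zero>\<^bsub>M\<^esub> \<in> N"
  using subgroup.one_closed[OF submodule.axioms(1)] by fastforce

lemma (in module) submodule_add: "submodule N R M \<Longrightarrow> x \<in> N \<Longrightarrow> y \<in> N \<Longrightarrow> x \<oplus>\<^bsub>M\<^esub> y \<in> N"
  using subgroup.m_closed[OF submodule.axioms(1)] by fastforce

lemma (in module) submodule_span:
  assumes "T \<subseteq> carrier M"
  shows "submodule ((\<lambda>N. submodule N R M) hull T) R M"
proof (intro submoduleI)
  show "(\<lambda>N. submodule N R M) hull T \<subseteq> carrier M"
    using assms by (intro hull_minimal carrier_is_submodule)
qed (auto simp: hull_def submoduleE submodule_zero)

lemma (in module) finite_span_surj:
  assumes "finite T" "T \<subseteq> carrier M"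
  shows "\<exists>\<phi> :: (nat \<Rightarrow> 'a) \<Rightarrow> 'c. (\<lambda>N. submodule N R M) hull T \<subseteq> range \<phi>"
  using assms
proof (induction T rule: finite_induct)
  case empty
  have "submodule {\<zero>\<^bsub>M\<^esub>} R M" by (rule submoduleI) auto
  then have "(\<lambda>N. submodule N R M) hull {} \<subseteq> {\<zero>\<^bsub>M\<^esub>}" by (intro hull_minimal) auto
  then show ?case by (intro exI[of _ "\<lambda>_. \<zero>\<^bsub>M\<^esub>"]) auto
next
  case (insert t T)
  define N where "N = (\<lambda>N. submodule N R M) hull T"
  from insert obtain \<phi> :: "(nat \<Rightarrow> 'a) \<Rightarrow> 'c" where \<phi>: "N \<subseteq> range \<phi>" by (auto simp: N_def)
  have N: "submodule N R M" and NM: "N \<subseteq> carrier M"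
    using insert.prems submodule_span[of T] submoduleE(1) unfolding N_def by auto
  have t: "t \<in> carrier M" using insert.prems by simp
  define V where "V = {r \<odot>\<^bsub>M\<^esub> t \<oplus>\<^bsub>M\<^esub> y | r y. r \<in> carrier R \<and> y \<in> N}"
  have "submodule V R M"
  proof (rule submoduleI)
    show "V \<subseteq> carrier M" using t NM by (auto simp: V_def)
    show "\<zero>\<^bsub>M\<^esub> \<in> V"
      unfolding V_def using t submodule_zero[OF N]
      by (auto intro!: exI[of _ "\<zero>\<^bsub>R\<^esub>"] exI[of _ "\<zero>\<^bsub>M\<^esub>"])
  next
    fix a assume "a \<in> V"
    then obtain r y where a: "a = r \<odot>\<^bsub>M\<^esub> t \<oplus>\<^bsub>M\<^esub> y" "r \<in> carrier R" "y \<in> N" by (auto simp: V_def)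
    then have "\<ominus>\<^bsub>M\<^esub> a = (\<ominus>\<^bsub>R\<^esub> r) \<odot>\<^bsub>M\<^esub> t \<oplus>\<^bsub>M\<^esub> \<ominus>\<^bsub>M\<^esub> y"
      using t NM by (auto simp: smult_l_minus M.minus_add M.a_comm)
    then show "\<ominus>\<^bsub>M\<^esub> a \<in> V" using a submoduleE(3)[OF N] by (auto simp: V_def)
  next
    fix a b assume "a \<in> V" "b \<in> V"
    then obtain r y s z where a: "a = r \<odot>\<^bsub>M\<^esub> t \<oplus>\<^bsub>M\<^esub> y" "r \<in> carrier R" "y \<in> N"
      and b: "b = s \<odot>\<^bsub>M\<^esub> t \<oplus>\<^bsub>M\<^esub> z" "s \<in> carrier R" "z \<in> N" by (auto simp: V_def)
    then have "a \<oplus>\<^bsub>M\<^esub> b = (r \<oplus>\<^bsub>R\<^esub> s) \<odot>\<^bsub>M\<^esub> t \<oplus>\<^bsub>M\<^esub> (y \<oplus>\<^bsub>M\<^esub> z)"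
      using t NM by (auto simp: smult_l_distr M.a_ac subset_eq)
    then show "a \<oplus>\<^bsub>M\<^esub> b \<in> V" using a b submodule_add[OF N] by (auto simp: V_def)
  next
    fix a x assume "a \<in> carrier R" "x \<in> V"
    then obtain r y where x: "x = r \<odot>\<^bsub>M\<^esub> t \<oplus>\<^bsub>M\<^esub> y" "r \<in> carrier R" "y \<in> N" by (auto simp: V_def)
    then have "a \<odot>\<^bsub>M\<^esub> x = (a \<otimes>\<^bsub>R\<^esub> r) \<odot>\<^bsub>M\<^esub> t \<oplus>\<^bsub>M\<^esub> a \<odot>\<^bsub>M\<^esub> y"
      using t NM \<open>a \<in> carrier R\<close> by (auto simp: smult_r_distr smult_assoc1 subset_eq)
    then show "a \<odot>\<^bsub>M\<^esub> x \<in> V"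
      using x \<open>a \<in> carrier R\<close> submoduleE(4)[OF N] by (auto simp: V_def)
  qed
  moreover have "insert t T \<subseteq> V"
  proof -
    have "t \<in> V" unfolding V_def using t submodule_zero[OF N]
      by (auto intro!: exI[of _ "\<one>\<^bsub>R\<^esub>"] exI[of _ "\<zero>\<^bsub>M\<^esub>"])
    moreover have "T \<subseteq> N" unfolding N_def by (rule hull_subset)
    then have "T \<subseteq> V" unfolding V_def using t NM
      by (force intro!: exI[of _ "\<zero>\<^bsub>R\<^esub>"])
    ultimately show ?thesis by simp
  qed
  ultimately have "(\<lambda>N. submodule N R M) hull (insert t T) \<subseteq> V" by (intro hull_minimal)
  moreover have "V \<subseteq> range (\<lambda>c. c 0 \<odot>\<^bsub>M\<^esub> t \<oplus>\<^bsub>M\<^esub> \<phi> (\<lambda>i. c (Suc i)))"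
  proof
    fix x assume "x \<in> V"
    then obtain r c where "x = r \<odot>\<^bsub>M\<^esub> t \<oplus>\<^bsub>M\<^esub> \<phi> c" using \<phi> by (auto simp: V_def)
    then show "x \<in> range (\<lambda>c. c 0 \<odot>\<^bsub>M\<^esub> t \<oplus>\<^bsub>M\<^esub> \<phi> (\<lambda>i. c (Suc i)))"
      by (intro image_eqI[of _ _ "\<lambda>i. case i of 0 \<Rightarrow> r | Suc j \<Rightarrow> c j"]) auto
  qed
  ultimately show ?case by (meson subset_trans)
qed

lemma fg_rg_module_surj:
  fixes M :: "('g, 'r, 'm, 'z) rgmod_scheme"
  assumes "finite (carrier G)" "fg_rg_module G R M"
  shows "\<exists>\<phi> :: (nat \<Rightarrow> 'r) \<Rightarrow> 'm. carrier M \<subseteq> range \<phi>"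
proof -
  from assms(2) obtain S where "rg_module G R M" and S: "finite S" "S \<subseteq> carrier M"
    "rg_submodule G R M hull S = carrier M"
    by (auto simp: fg_rg_module_def)
  interpret rg_module G R M by fact
  define T where "T = (\<Union>g\<in>carrier G. act M g ` S)"
  have T: "finite T" "T \<subseteq> carrier M"
    using S assms(1) act_closed by (auto simp: T_def)
  define N where "N = (\<lambda>N. submodule N R M) hull T"
  have N: "submodule N R M" unfolding N_def by (rule submodule_span[OF T(2)])
  have TN: "T \<subseteq> N" unfolding N_def by (rule hull_subset)
  note NM = submoduleE(1)[OF N]
  have "rg_submodule G R M N"
    unfolding rg_submodule_def
  proof (intro conjI ballI N)
    fix g x assume g: "g \<in> carrier G" and "x \<in> N"
    have act0: "act M g \<zero>\<^bsub>M\<^esub> = \<zero>\<^bsub>M\<^esub>"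
      using act_smult[OF g, of "\<zero>\<^bsub>R\<^esub>" "\<zero>\<^bsub>M\<^esub>"] act_closed[OF g] by simp
    have "submodule {x \<in> N. act M g x \<in> N} R M"
    proof (rule submoduleI)
      fix a assume a: "a \<in> {x \<in> N. act M g x \<in> N}"
      then have "\<ominus>\<^bsub>M\<^esub> a = (\<ominus>\<^bsub>R\<^esub> \<one>\<^bsub>R\<^esub>) \<odot>\<^bsub>M\<^esub> a" using NM by (auto simp: smult_l_minus)
      then show "\<ominus>\<^bsub>M\<^esub> a \<in> {x \<in> N. act M g x \<in> N}"
        using a NM submoduleE(4)[OF N, of "\<ominus>\<^bsub>R\<^esub> \<one>\<^bsub>R\<^esub>"] act_smult[OF g, of "\<ominus>\<^bsub>R\<^esub> \<one>\<^bsub>R\<^esub>" a]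
        by auto
    qed (use g NM act0 submodule_zero[OF N] submodule_add[OF N] submoduleE(4)[OF N] in
        \<open>auto simp: act_add act_smult subset_eq\<close>)
    moreover have "act M g y \<in> T" if "y \<in> T" for y
    proof -
      from that obtain h s where "h \<in> carrier G" "s \<in> S" "y = act M h s" by (auto simp: T_def)
      then have "act M g y = act M (g \<otimes>\<^bsub>G\<^esub> h) s" using act_mult g S(2) by auto
      then show ?thesis using g \<open>h \<in> carrier G\<close> \<open>s \<in> S\<close> by (auto simp: T_def)
    qed
    ultimately have "N \<subseteq> {x \<in> N. act M g x \<in> N}"
      using TN unfolding N_def by (intro hull_minimal) auto
    then show "act M g x \<in> N" using \<open>x \<in> N\<close> by auto
  qed
  moreover have "S \<subseteq> N"
  proof
    fix s assume "s \<in> S"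
    then have "s = act M \<one>\<^bsub>G\<^esub> s" using act_one S(2) by auto
    then show "s \<in> N" using \<open>s \<in> S\<close> TN by (auto simp: T_def)
  qed
  ultimately have "carrier M \<subseteq> N" using S(3) hull_minimal[of S N] by metis
  with finite_span_surj[OF T] show ?thesis unfolding N_def by (meson subset_trans)
qed

lemma iso_class_nonempty:
  fixes M :: "('g, 'r, 'm, 'z) rgmod_scheme"
  assumes "finite (carrier G)" and M: "fg_rg_module G R M"
  shows "iso_class G R M \<noteq> {}"
proof -
  obtain \<phi> :: "(nat \<Rightarrow> 'r) \<Rightarrow> 'm" where \<phi>: "carrier M \<subseteq> range \<phi>"
    using fg_rg_module_surj[OF assms] by auto
  define \<iota> where "\<iota> x = {c. \<phi> c = x}" for x
  have inj: "inj_on \<iota> (carrier M)" using \<phi> by (fastforce simp: inj_on_def \<iota>_def)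
  define \<psi> where "\<psi> = inv_into (carrier M) \<iota>"
  have \<psi>\<iota>: "\<psi> (\<iota> x) = x" if "x \<in> carrier M" for x
    using that inj by (simp add: \<psi>_def)
  define L :: "('g, 'r) rep" where "L =
    \<lparr>carrier = \<iota> ` carrier M, monoid.mult = undefined, one = undefined, zero = \<iota> \<zero>\<^bsub>M\<^esub>,
     add = (\<lambda>X Y. \<iota> (\<psi> X \<oplus>\<^bsub>M\<^esub> \<psi> Y)), smult = (\<lambda>r X. \<iota> (r \<odot>\<^bsub>M\<^esub> \<psi> X)),
     act = (\<lambda>g X. \<iota> (act M g (\<psi> X)))\<rparr>"
  from M obtain S where "rg_module G R M" and S: "finite S" "S \<subseteq> carrier M"
    "rg_submodule G R M hull S = carrier M"
    by (auto simp: fg_rg_module_def)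
  interpret rg_module G R M by fact
  have "abelian_group L"
  proof (rule abelian_groupI)
    fix X assume "X \<in> carrier L"
    then obtain x where x: "x \<in> carrier M" "X = \<iota> x" by (auto simp: L_def)
    then show "\<exists>Y\<in>carrier L. Y \<oplus>\<^bsub>L\<^esub> X = \<zero>\<^bsub>L\<^esub>"
      by (intro bexI[of _ "\<iota> (\<ominus>\<^bsub>M\<^esub> x)"]) (auto simp: L_def \<psi>\<iota> M.l_neg)
  qed (auto simp: L_def \<psi>\<iota> M.a_ac)
  then have "module R L"
    by (intro moduleI) (auto simp: L_def \<psi>\<iota> smult_l_distr smult_r_distr smult_assoc1 R.is_cring)
  then interpret L: module R L .
  have "rg_module G R L"
    by unfold_locales (auto simp: L_def \<psi>\<iota> act_closed act_add act_smult act_one act_mult)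
  moreover have "rg_submodule G R L hull (\<iota> ` S) = carrier L"
  proof (rule antisym)
    have "rg_submodule G R L (carrier L)"
      using L.carrier_is_submodule by (auto simp: rg_submodule_def L_def \<psi>\<iota> act_closed)
    then show "rg_submodule G R L hull (\<iota> ` S) \<subseteq> carrier L"
      using S(2) by (intro hull_minimal) (auto simp: L_def)
  next
    have "carrier L \<subseteq> V" if V: "rg_submodule G R L V" and SV: "\<iota> ` S \<subseteq> V" for V
    proof -
      have sub: "submodule V R L" and st: "\<And>g X. g \<in> carrier G \<Longrightarrow> X \<in> V \<Longrightarrow> act L g X \<in> V"
        using V by (auto simp: rg_submodule_def)
      have "rg_submodule G R M {x \<in> carrier M. \<iota> x \<in> V}"
        unfolding rg_submodule_def
      proof (intro conjI ballI submoduleI)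
        show "\<zero>\<^bsub>M\<^esub> \<in> {x \<in> carrier M. \<iota> x \<in> V}"
          using L.submodule_zero[OF sub] by (auto simp: L_def)
        fix a assume a: "a \<in> {x \<in> carrier M. \<iota> x \<in> V}"
        show "r \<odot>\<^bsub>M\<^esub> a \<in> {x \<in> carrier M. \<iota> x \<in> V}" if "r \<in> carrier R" for r
          using a that L.submoduleE(4)[OF sub, of r "\<iota> a"] by (auto simp: L_def \<psi>\<iota>)
        from this[of "\<ominus>\<^bsub>R\<^esub> \<one>\<^bsub>R\<^esub>"] show "\<ominus>\<^bsub>M\<^esub> a \<in> {x \<in> carrier M. \<iota> x \<in> V}"
          using a by (auto simp: smult_l_minus)
        show "act M g a \<in> {x \<in> carrier M. \<iota> x \<in> V}" if "g \<in> carrier G" for g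
          using a that st[of g "\<iota> a"] by (auto simp: L_def \<psi>\<iota> act_closed)
        show "a \<oplus>\<^bsub>M\<^esub> b \<in> {x \<in> carrier M. \<iota> x \<in> V}" if "b \<in> {x \<in> carrier M. \<iota> x \<in> V}" for b
          using a that L.submodule_add[OF sub, of "\<iota> a" "\<iota> b"] by (auto simp: L_def \<psi>\<iota>)
      qed auto
      then have "carrier M \<subseteq> {x \<in> carrier M. \<iota> x \<in> V}"
        using S SV hull_minimal[of S "{x \<in> carrier M. \<iota> x \<in> V}" "rg_submodule G R M"] by auto
      then show ?thesis by (auto simp: L_def)
    qed
    then show "carrier L \<subseteq> rg_submodule G R L hull (\<iota> ` S)"
      by (auto simp: hull_def)
  qed
  ultimately have "fg_rg_module G R L"
    using S by (auto simp: fg_rg_module_def L_def intro!: exI[of _ "\<iota> ` S"])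
  moreover have "rg_isomorphic G R M L"
    unfolding rg_isomorphic_def
    by (intro exI[of _ \<iota>]) (auto simp: L_def \<psi>\<iota> bij_betw_def inj)
  ultimately show ?thesis by (auto simp: iso_class_def)
qed

definition iso_class_semiring ::
  "('g, 'x) monoid_scheme \<Rightarrow> ('r, 'y) ring_scheme \<Rightarrow> ('g, 'r) rep set ring" where
  "iso_class_semiring G R =
     \<lparr>carrier = {iso_class G R M | M :: ('g, 'r) rep. fg_rg_module G R M},
      monoid.mult = (\<lambda>X Y. \<Union>M\<in>X. \<Union>N\<in>Y. iso_class G R (rg_tensor G R M N)),
      one = iso_class G R (rg_trivial R :: ('g, 'r, 'r) rgmod),
      zero = {L. fg_rg_module G R L \<and> carrier L = {\<zero>\<^bsub>L\<^esub>}},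
      add = (\<lambda>X Y. \<Union>M\<in>X. \<Union>N\<in>Y. iso_class G R (rg_direct_sum M N))\<rparr>"

text \<open>\<open>a\<^sub>R(G)\<close> and \<open>A\<^sub>R(G) = \<rat> \<otimes>\<^sub>\<int> a\<^sub>R(G)\<close>.\<close>

definition rep_ring ::
  "('g, 'x) monoid_scheme \<Rightarrow> ('r, 'y) ring_scheme
    \<Rightarrow> (('g, 'r) rep set \<times> ('g, 'r) rep set) set ring" where
  "rep_ring G R = grothendieck_ring (iso_class_semiring G R)"

definition rat_rep_ring ::
  "('g, 'x) monoid_scheme \<Rightarrow> ('r, 'y) ring_scheme
    \<Rightarrow> (int, (rat \<times> (('g, 'r) rep set \<times> ('g, 'r) rep set) set \<Rightarrow> int) set) module" where
  "rat_rep_ring G R =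
     tensor_algebra int_ring (int_algebra rat_ring) (int_algebra (rep_ring G R))"

definition rep_class ::
  "('g, 'x) monoid_scheme \<Rightarrow> ('r, 'y) ring_scheme \<Rightarrow> ('g, 'r, 'm, 'z) rgmod_scheme
    \<Rightarrow> (('g, 'r) rep set \<times> ('g, 'r) rep set) set" where
  "rep_class G R M =
     grothendieck_diff (iso_class_semiring G R) (iso_class G R M) \<zero>\<^bsub>iso_class_semiring G R\<^esub>"

text \<open>The rational multiple \<open>q [M] = q \<otimes> [M]\<close> in \<open>A\<^sub>R(G)\<close> of the class of \<open>M\<close>.\<close>

definition rat_rep_class ::
  "('g, 'x) monoid_scheme \<Rightarrow> ('r, 'y) ring_scheme \<Rightarrow> rat \<Rightarrow> ('g, 'r, 'm, 'z) rgmod_scheme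
    \<Rightarrow> (rat \<times> (('g, 'r) rep set \<times> ('g, 'r) rep set) set \<Rightarrow> int) set" where
  "rat_rep_class G R q M =
     pure_tensor int_ring (int_algebra rat_ring) (int_algebra (rep_ring G R)) q (rep_class G R M)"

end

theory Submission
  imports Defs "Jordan_Normal_Form.Determinant" "HOL-Algebra.Sylow" "HOL-Algebra.Zassenhaus" "HOL-Number_Theory.Cong"
begin

text \<open>
  Both sides of the formula are rational combinations of permutation modules, and Moebius inversion
  shows that the marks (numbers of fixed points) of the two sides agree at every subgroup \<open>K\<close> with
  \<open>C\<^sub>G(K)\<close> in \<open>C\<close>. So it suffices that a virtual permutation module vanishes in \<open>A\<^sub>R(G)\<close> if its
  marks vanish on all \<open>K\<close> that are cyclic, or cyclic modulo \<open>O\<^sub>p(K)\<close> for some \<open>p\<close> with \<open>pR \<noteq> R\<close>.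

  By induction, and by induction of modules from \<open>K\<close> to \<open>G\<close>, this follows if every other \<open>K\<close> has a
  virtual \<open>K\<close>-set with nonzero mark at \<open>K\<close> whose even and odd parts have isomorphic permutation
  modules over \<open>R\<close>. Such an isomorphism is produced as an invariant odd integer matrix whose square
  is a scalar \<open>d\<close>. Tensor products combine scalars \<open>d\<close> and \<open>e\<close> to \<open>gcd d e\<close>, so for each prime \<open>p\<close>
  it is enough to find a \<open>d\<close> prime to \<open>p\<close>, and after inflation \<open>K\<close> is not cyclic and has no normal
  \<open>p\<close>-subgroup.

  In that case start from a virtual set \<open>X - Y\<close> with nonzero mark at \<open>K\<close> and zero mark at all proper
  subgroups. In a tensor power of it one finds an odd matrix with square \<open>c - \<tau>\<close>, where \<open>p\<close> does
  not divide \<open>c\<close> and \<open>\<tau>\<close> is a sum over the orbits of a group set; the stabilizers in this set are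
  \<open>p\<close>-groups, made smaller step by step until they are trivial. Then Fitting's lemma, with ranks
  read off from traces, shows that the even and odd parts of the tensor product with \<open>X - Y\<close> have equally many equivariant
  maps into every representation over the field with \<open>p\<close> elements. By Lovasz's counting argument the
  two parts become isomorphic modulo \<open>p\<close>, and the adjugate matrix lifts this to the integers.
\<close>

section \<open>Finite group sets and marks\<close>

text \<open>The two properties of \<open>K\<close> are used at different places. As \<open>K\<close>
  is not cyclic, \<open>X\<close> and \<open>Y\<close> have equal marks at all cyclic subgroups, so
  each element of \<open>K\<close> has as many fixed points on \<open>X\<close> as on
  \<open>Y\<close>; the traces, and with them the ranks in Fitting's lemma, depend on nothing else.
  As no nontrivial \<open>p\<close>-subgroup \<open>D\<close> is normal in \<open>K\<close>, its
  normalizer is proper, so \<open>X\<close> and \<open>Y\<close> are isomorphic over the normalizer.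
  These isomorphisms, chosen compatibly with conjugation, are odd involutions, and the odd matrix is
  assembled from them. Every lowering of the bound on the stabilizers consumes one involution that
  commutes with everything built before. Hence a new tensor factor is added each time, and the
  number of factors is the exponent of \<open>p\<close> in the group order. Integer matrices are
  kept throughout, rather than matrices over a field, because scalars found for different primes
  have to be combined, and because traces of lifted powers determine ranks that traces modulo
  \<open>p\<close> do not.\<close>

definition gset :: "('g, 'm) monoid_scheme => 'x set => ('g => 'x => 'x) => bool" where
 "gset G X a \<longleftrightarrow> (\<forall>g\<in>carrier G. \<forall>x\<in>X. a g x \<in> X) \<and> (\<forall>x\<in>X. a \<one>\<^bsub>G\<^esub> x = x) \<and>
   (\<forall>g\<in>carrier G. \<forall>h\<in>carrier G. \<forall>x\<in>X. a (g \<otimes>\<^bsub>G\<^esub> h) x = a g (a h x))"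

definition gstab :: "('g, 'm) monoid_scheme => ('g => 'x => 'x) => 'x => 'g set" where
 "gstab G a x = {g \<in> carrier G. a g x = x}"

definition gorb :: "('g, 'm) monoid_scheme => ('g => 'x => 'x) => 'x => 'x set" where
 "gorb G a x = (\<lambda>g. a g x) ` carrier G"

text \<open>The intersection with \<open>carrier G\<close> makes the value sensible for an arbitrary
  set \<open>H\<close>, so that identities between marks are identities of functions on all
  sets.\<close>

definition fixpts :: "('g, 'm) monoid_scheme => 'x set => ('g => 'x => 'x) => 'g set => 'x set" where
 "fixpts G X a H = {x \<in> X. \<forall>h\<in>H \<inter> carrier G. a h x = x}"

definition giso :: "('g, 'm) monoid_scheme => 'x set => ('g => 'x => 'x) => 'y set => ('g => 'y => 'y)
  => ('x => 'y) => bool" where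
 "giso G X a Y b f \<longleftrightarrow> bij_betw f X Y \<and> (\<forall>g\<in>carrier G. \<forall>x\<in>X. f (a g x) = b g (f x))"

lemma gsetD:
 assumes "gset G X a"
 shows "\<And>g x. g \<in> carrier G ==> x \<in> X ==> a g x \<in> X"
  and "\<And>x. x \<in> X ==> a \<one>\<^bsub>G\<^esub> x = x"
  and "\<And>g h x. g \<in> carrier G ==> h \<in> carrier G ==> x \<in> X ==> a (g \<otimes>\<^bsub>G\<^esub> h) x = a g (a h x)"
 using assms by (auto simp: gset_def)

lemma gset_subset:
 assumes "gset G X a" "Y \<subseteq> X" "\<And>g y. g \<in> carrier G ==> y \<in> Y ==> a g y \<in> Y"
 shows "gset G Y a"
 using assms unfolding gset_def by blast

lemma gorbE:
 assumes "z \<in> gorb G a x" obtains g where "g \<in> carrier G" "z = a g x"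
 using assms by (auto simp: gorb_def)

context group
begin

lemma gset_inv1:
 assumes X: "gset G X a" and g: "g \<in> carrier G" and x: "x \<in> X"
 shows "a (inv g) (a g x) = x"
proof -
 have "a (inv g) (a g x) = a (inv g \<otimes> g) x" by (rule gsetD(3)[OF X inv_closed[OF g] g x, symmetric])
 also have "\<dots> = x" unfolding l_inv[OF g] by (rule gsetD(2)[OF X x])
 finally show ?thesis .
qed

lemma gset_inv2:
 assumes X: "gset G X a" and g: "g \<in> carrier G" and x: "x \<in> X"
 shows "a g (a (inv g) x) = x"
 using gset_inv1[OF X inv_closed[OF g] x] unfolding inv_inv[OF g] .

lemma gset_inj:
 assumes X: "gset G X a" and g: "g \<in> carrier G" and x: "x \<in> X" and y: "y \<in> X"
 shows "a g x = a g y \<longleftrightarrow> x = y"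
proof
 assume "a g x = a g y"
 then have "a (inv g) (a g x) = a (inv g) (a g y)" by (rule arg_cong)
 then show "x = y" unfolding gset_inv1[OF X g x] gset_inv1[OF X g y] .
qed (rule arg_cong)

lemma gset_bij:
 assumes X: "gset G X a" and g: "g \<in> carrier G"
 shows "bij_betw (a g) X X"
 by (rule bij_betw_byWitness[where f' = "a (inv g)"])
   (use gset_inv1[OF X g] gset_inv2[OF X g] gsetD(1)[OF X g] gsetD(1)[OF X inv_closed[OF g]] in auto)

lemma gstab_subgroup:
 assumes "gset G X a" "x \<in> X" shows "subgroup (gstab G a x) G"
proof
 show "gstab G a x \<subseteq> carrier G" by (auto simp: gstab_def)
 show "g \<otimes> h \<in> gstab G a x" if "g \<in> gstab G a x" "h \<in> gstab G a x" for g h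
  using that assms by (auto simp: gstab_def gsetD[OF assms(1)])
 show "\<one> \<in> gstab G a x" using assms by (auto simp: gstab_def gsetD[OF assms(1)])
 show "inv g \<in> gstab G a x" if "g \<in> gstab G a x" for g
  using that gset_inv1[OF assms(1) _ assms(2), of g] by (auto simp: gstab_def)
qed

lemma gset_restrict:
 assumes "gset G X a" "subgroup H G" shows "gset (G\<lparr>carrier := H\<rparr>) X a"
 using assms subgroup.mem_carrier[OF assms(2)] unfolding gset_def by auto

lemma gset_transport:
 assumes X: "gset G X a" and f: "bij_betw f X Y"
 shows "gset G Y (\<lambda>g y. f (a g (inv_into X f y)))" (is "gset G Y ?b")
  and "giso G X a Y (\<lambda>g y. f (a g (inv_into X f y))) f"
proof -
 have 1: "inv_into X f y \<in> X" "f (inv_into X f y) = y" if "y \<in> Y" for y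
  using f that by (auto simp: bij_betw_def inv_into_into f_inv_into_f)
 have 2: "inv_into X f (f x) = x" "f x \<in> Y" if "x \<in> X" for x
  using f that by (auto simp: bij_betw_def)
 show "gset G Y ?b" using X 1 2 by (auto simp: gset_def)
 show "giso G X a Y ?b f" using f X by (auto simp: giso_def 2)
qed

lemma giso_inv:
 assumes "gset G X a" "giso G X a Y b f"
 shows "giso G Y b X a (inv_into X f)"
proof -
 have f: "bij_betw f X Y" and e: "\<And>g x. g \<in> carrier G ==> x \<in> X ==> f (a g x) = b g (f x)"
  using assms by (auto simp: giso_def)
 show ?thesis unfolding giso_def
 proof (intro conjI ballI bij_betw_inv_into[OF f])
  fix g y assume g: "g \<in> carrier G" "y \<in> Y"
  then obtain x where x: "x \<in> X" "y = f x" using f by (auto simp: bij_betw_def)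
  then show "inv_into X f (b g y) = a g (inv_into X f y)"
   using e[OF g(1) x(1), symmetric] g f gsetD(1)[OF assms(1) g(1) x(1)] by (simp add: bij_betw_def)
 qed
qed

lemma giso_fixpts:
 assumes "gset G X a" "giso G X a Y b f"
 shows "bij_betw f (fixpts G X a H) (fixpts G Y b H)"
proof (rule bij_betw_subset[of f X Y])
 have f: "bij_betw f X Y" and e: "\<And>g x. g \<in> carrier G ==> x \<in> X ==> f (a g x) = b g (f x)"
  using assms by (auto simp: giso_def)
 show "bij_betw f X Y" by fact
 show "f ` fixpts G X a H = fixpts G Y b H"
 proof (intro equalityI subsetI)
  fix y assume y: "y \<in> fixpts G Y b H"
  then obtain x where x: "x \<in> X" "y = f x" using f by (auto simp: fixpts_def bij_betw_def)
  have "a h x = x" if "h \<in> H \<inter> carrier G" for h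
  proof -
   have "f (a h x) = f x" using e x y that by (auto simp: fixpts_def)
   then show ?thesis using f x gsetD(1)[OF assms(1)] that by (auto simp: bij_betw_def inj_on_def)
  qed
  then show "y \<in> f ` fixpts G X a H" using x by (auto simp: fixpts_def)
 next
  fix y assume "y \<in> f ` fixpts G X a H"
  then obtain x where x: "x \<in> X" "y = f x" "\<And>h. h \<in> H \<inter> carrier G ==> a h x = x"
   by (auto simp: fixpts_def)
  then have "b h y = y" if "h \<in> H \<inter> carrier G" for h using e[of h x] that by auto
  then show "y \<in> fixpts G Y b H" using f x by (auto simp: fixpts_def bij_betw_def)
 qed
qed (auto simp: fixpts_def)

section \<open>Orbits, Burnside's theorem on marks, and equivariant choices\<close>

lemma gorb_props:
 assumes X: "gset G X a" and x: "x \<in> X"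
 shows "x \<in> gorb G a x" "gorb G a x \<subseteq> X" "\<And>g z. g \<in> carrier G ==> z \<in> gorb G a x ==> a g z \<in> gorb G a x"
  "\<And>g z. g \<in> carrier G ==> z \<in> X ==> a g z \<in> gorb G a x ==> z \<in> gorb G a x"
proof -
 show "x \<in> gorb G a x" unfolding gorb_def using gsetD(2)[OF X x] by (intro image_eqI[of _ _ "\<one>"]) auto
 show "gorb G a x \<subseteq> X" using gsetD(1)[OF X _ x] by (auto simp: gorb_def)
 show 1: "a g z \<in> gorb G a x" if "g \<in> carrier G" and z: "z \<in> gorb G a x" for g z
 proof -
  obtain h where h: "h \<in> carrier G" "z = a h x" using gorbE[OF z] .
  then have "a g z = a (g \<otimes> h) x" using gsetD(3)[OF X that(1) h(1) x] by simp
  then show ?thesis unfolding gorb_def using h(1) that(1) by (intro image_eqI[of _ _ "g \<otimes> h"]) auto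
 qed
 show "z \<in> gorb G a x" if "g \<in> carrier G" "z \<in> X" "a g z \<in> gorb G a x" for g z
  using 1[OF inv_closed[OF that(1)] that(3)] unfolding gset_inv1[OF X that(1,2)] .
qed

lemma gset_act_eq_iff:
 assumes X: "gset G X a" and x: "x \<in> X" and g: "g \<in> carrier G" and h: "h \<in> carrier G"
 shows "a g x = a h x \<longleftrightarrow> inv h \<otimes> g \<in> gstab G a x"
proof -
 have "a (inv h \<otimes> g) x = a (inv h) (a g x)" by (rule gsetD(3)[OF X inv_closed[OF h] g x])
 then have "inv h \<otimes> g \<in> gstab G a x \<longleftrightarrow> a (inv h) (a g x) = a (inv h) (a h x)"
  using g h by (simp add: gstab_def gset_inv1[OF X h x])
 then show ?thesis
  using gset_inj[OF X inv_closed[OF h] gsetD(1)[OF X g x] gsetD(1)[OF X h x]] by simp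
qed

text \<open>The map \<open>a g x \<mapsto> b g y\<close> is well defined and injective because
  equality on either side means that \<open>inv h \<otimes> g\<close> lies in the common
  stabilizer.\<close>

lemma orbit_map:
 assumes X: "gset G X a" and x: "x \<in> X" and Y: "gset G Y b" and y: "y \<in> Y"
  and s: "gstab G a x = gstab G b y"
 shows "\<exists>f. giso G (gorb G a x) a (gorb G b y) b f"
proof -
 define f where "f z = b (SOME g. g \<in> carrier G \<and> a g x = z) y" for z
 have f: "f (a g x) = b g y" if g: "g \<in> carrier G" for g
 proof -
  define h where "h = (SOME h. h \<in> carrier G \<and> a h x = a g x)"
  have h: "h \<in> carrier G \<and> a h x = a g x" unfolding h_def by (rule someI) (use g in auto)
  then have "b h y = b g y" using gset_act_eq_iff[OF X x] gset_act_eq_iff[OF Y y] s g by auto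
  then show ?thesis by (simp add: f_def h_def)
 qed
 have "bij_betw f (gorb G a x) (gorb G b y)"
  unfolding bij_betw_def gorb_def
 proof
  show "inj_on f ((\<lambda>g. a g x) ` carrier G)"
  proof (rule inj_onI)
   fix u v assume "u \<in> (\<lambda>g. a g x) ` carrier G" "v \<in> (\<lambda>g. a g x) ` carrier G" and fuv: "f u = f v"
   then obtain g h where gh: "g \<in> carrier G" "u = a g x" "h \<in> carrier G" "v = a h x" by blast
   then have "b g y = b h y" using fuv f by simp
   then show "u = v" using gset_act_eq_iff[OF X x] gset_act_eq_iff[OF Y y] s gh by simp
  qed
  show "f ` (\<lambda>g. a g x) ` carrier G = (\<lambda>g. b g y) ` carrier G"
   unfolding image_image by (rule image_cong) (simp_all add: f)
 qed
 moreover have "f (a g z) = b g (f z)" if "g \<in> carrier G" and z: "z \<in> gorb G a x" for g z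
 proof -
  obtain h where h: "h \<in> carrier G" "z = a h x" using gorbE[OF z] .
  then show ?thesis using f[of "g \<otimes> h"] f[of h] gsetD(3)[OF X that(1) h(1) x]
   gsetD(3)[OF Y that(1) h(1) y] that by simp
 qed
 ultimately show ?thesis by (auto simp: giso_def)
qed

text \<open>Take a point \<open>x\<close> of \<open>X\<close> whose stabilizer \<open>H\<close> has
  the largest order. The mark at \<open>H\<close> yields a point \<open>y\<close> of
  \<open>Y\<close> fixed by \<open>H\<close>, and the mark at the stabilizer of \<open>y\<close>
  shows that this stabilizer is contained in one that occurs in \<open>X\<close>, so it is no larger
  than \<open>H\<close>. The two orbits are therefore isomorphic, and after removing them the marks
  still agree.\<close>

theorem burnside_iso:
 assumes fG: "finite (carrier G)" and "finite X" "finite Y" and "gset G X a" "gset G Y b"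
  and "\<And>H. subgroup H G ==> card (fixpts G X a H) = card (fixpts G Y b H)"
 shows "\<exists>f. giso G X a Y b f"
 using assms(2-)
proof (induction "card X" arbitrary: X Y rule: less_induct)
 case less
 note finX = less.prems(1) and finY = less.prems(2)
 note X = less.prems(3) and Y = less.prems(4) and mk = less.prems(5)
 have cXY: "card X = card Y"
 proof -
  have "fixpts G X a {\<one>} = X" "fixpts G Y b {\<one>} = Y"
   using gsetD(2)[OF X] gsetD(2)[OF Y] by (auto simp: fixpts_def)
  then show ?thesis using mk[OF triv_subgroup] by simp
 qed
 show ?case
 proof (cases "X = {}")
  case True
  then have "Y = {}" using cXY finY by simp
  then show ?thesis using True by (auto simp: giso_def bij_betw_def)
 next
  case False
  have "\<exists>x\<in>X. \<forall>z\<in>X. card (gstab G a z) \<le> card (gstab G a x)"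
  proof -
   define S where "S = (\<lambda>x. card (gstab G a x)) ` X"
   have S: "finite S" "S \<noteq> {}" using finX False by (auto simp: S_def)
   obtain x where x: "x \<in> X" "Max S = card (gstab G a x)" using Max_in[OF S] unfolding S_def by blast
   have "card (gstab G a z) \<le> card (gstab G a x)" if "z \<in> X" for z
    using Max_ge[OF S(1), of "card (gstab G a z)"] that x(2) by (auto simp: S_def)
   then show ?thesis using x(1) by blast
  qed
  then obtain x where x: "x \<in> X" "\<And>z. z \<in> X ==> card (gstab G a z) \<le> card (gstab G a x)" by auto
  define H where "H = gstab G a x"
  have fs: "finite (gstab G c z)" for c :: "'a => 'z => 'z" and z
   using fG by (auto simp: gstab_def)
  have "x \<in> fixpts G X a H" using x by (auto simp: fixpts_def H_def gstab_def)
  then have "card (fixpts G X a H) \<noteq> 0" using finite_subset[OF _ finX] by (auto simp: fixpts_def)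
  then have "card (fixpts G Y b H) \<noteq> 0" using mk gstab_subgroup[OF X x(1)] by (simp add: H_def)
  then obtain y where y: "y \<in> fixpts G Y b H" by fastforce
  then have yY: "y \<in> Y" by (simp add: fixpts_def)
  have sub: "H \<subseteq> gstab G b y" using y by (auto simp: fixpts_def H_def gstab_def)
  have "y \<in> fixpts G Y b (gstab G b y)" using yY by (auto simp: fixpts_def gstab_def)
  then have "card (fixpts G Y b (gstab G b y)) \<noteq> 0" using finite_subset[OF _ finY] by (auto simp: fixpts_def)
  then have "card (fixpts G X a (gstab G b y)) \<noteq> 0" using mk gstab_subgroup[OF Y yY] by simp
  then obtain x' where x': "x' \<in> fixpts G X a (gstab G b y)" by fastforce
  then have "gstab G b y \<subseteq> gstab G a x'" by (auto simp: fixpts_def gstab_def)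
  then have "card (gstab G b y) \<le> card (gstab G a x')" using fs by (intro card_mono) auto
  also have "\<dots> \<le> card H" using x(2) x' by (auto simp: H_def fixpts_def)
  finally have s: "gstab G a x = gstab G b y"
   using card_seteq[OF fs sub] by (simp add: H_def)
  obtain f where f: "giso G (gorb G a x) a (gorb G b y) b f"
   using orbit_map[OF X x(1) Y yY s] by auto
  note ox = gorb_props[OF X x(1)] and oy = gorb_props[OF Y yY]
  have gox: "gset G (gorb G a x) a" by (rule gset_subset[OF X ox(2,3)])
  define X' Y' where "X' = X - gorb G a x" and "Y' = Y - gorb G b y"
  have X': "gset G X' a"
  proof (rule gset_subset[OF X])
   show "X' \<subseteq> X" by (auto simp: X'_def)
   show "a g z \<in> X'" if "g \<in> carrier G" "z \<in> X'" for g z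
    using that gsetD(1)[OF X that(1), of z] ox(4)[OF that(1), of z] unfolding X'_def by blast
  qed
  have Y': "gset G Y' b"
  proof (rule gset_subset[OF Y])
   show "Y' \<subseteq> Y" by (auto simp: Y'_def)
   show "b g z \<in> Y'" if "g \<in> carrier G" "z \<in> Y'" for g z
    using that gsetD(1)[OF Y that(1), of z] oy(4)[OF that(1), of z] unfolding Y'_def by blast
  qed
  have "card X' < card X" unfolding X'_def using ox(1) x(1) finX by (intro psubset_card_mono) auto
  moreover have "card (fixpts G X' a K) = card (fixpts G Y' b K)" if K: "subgroup K G" for K
  proof -
   have "fixpts G X' a K = fixpts G X a K - fixpts G (gorb G a x) a K"
    "fixpts G Y' b K = fixpts G Y b K - fixpts G (gorb G b y) b K"
    by (auto simp: fixpts_def X'_def Y'_def)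
   moreover have "card (fixpts G (gorb G a x) a K) = card (fixpts G (gorb G b y) b K)"
    using bij_betw_same_card[OF giso_fixpts[OF gox f]] .
   moreover have "fixpts G (gorb G a x) a K \<subseteq> fixpts G X a K" "fixpts G (gorb G b y) b K \<subseteq> fixpts G Y b K"
    using ox(2) oy(2) by (auto simp: fixpts_def)
   moreover have "finite (fixpts G (gorb G a x) a K)" "finite (fixpts G (gorb G b y) b K)"
    using finite_subset[OF _ finX] finite_subset[OF _ finY] ox(2) oy(2) by (auto simp: fixpts_def)
   ultimately show ?thesis using mk[OF K] by (simp add: card_Diff_subset)
  qed
  moreover have "finite X'" "finite Y'" using finX finY by (auto simp: X'_def Y'_def)
  ultimately obtain f' where f': "giso G X' a Y' b f'"
   using less.hyps[of X' Y'] X' Y' by blast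
  define h where "h z = (if z \<in> gorb G a x then f z else f' z)" for z
  have "bij_betw h (gorb G a x \<union> X') (gorb G b y \<union> Y')"
  proof (rule bij_betw_combine)
   show "bij_betw h (gorb G a x) (gorb G b y)"
    using f by (auto simp: giso_def h_def cong: bij_betw_cong)
   have "bij_betw f' X' Y'" using f' by (simp add: giso_def)
   then show "bij_betw h X' Y'"
    by (subst bij_betw_cong[of _ _ f']) (auto simp: h_def X'_def)
  qed (auto simp: Y'_def)
  moreover have "gorb G a x \<union> X' = X" "gorb G b y \<union> Y' = Y" using ox(2) oy(2) by (auto simp: X'_def Y'_def)
  moreover have "h (a g z) = b g (h z)" if g: "g \<in> carrier G" "z \<in> X" for g z
  proof (cases "z \<in> gorb G a x")
   case True
   then show ?thesis using f ox(3)[OF g(1) True] g by (auto simp: h_def giso_def)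
  next
   case False
   then have "z \<in> X'" "a g z \<notin> gorb G a x" using g ox(4)[OF g] by (auto simp: X'_def)
   then show ?thesis using f' g False by (auto simp: h_def giso_def)
  qed
  ultimately have "giso G X a Y b h" unfolding giso_def by simp
  then show ?thesis by blast
 qed
qed

text \<open>One bijection is chosen for each orbit representative \<open>r b\<close> and carried to
  \<open>b\<close> by an element \<open>k b\<close>. The outcome is independent of
  \<open>k b\<close>, since the bijection commutes with the stabilizer of \<open>r b\<close>. In the
  application \<open>B\<close> consists of \<open>p\<close>-subgroups under conjugation, and the
  stabilizers are normalizers.\<close>

lemma equivariant_choice:
 assumes B: "gset G B c" and X: "gset G X a" and Y: "gset G Y a'"
  and ex: "\<And>b. b \<in> B ==> \<exists>f. bij_betw f X Y \<and> (\<forall>g\<in>gstab G c b. \<forall>x\<in>X. f (a g x) = a' g (f x))"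
 shows "\<exists>F. (\<forall>b\<in>B. bij_betw (F b) X Y) \<and>
  (\<forall>g\<in>carrier G. \<forall>b\<in>B. \<forall>x\<in>X. F (c g b) (a g x) = a' g (F b x))"
proof -
 have "\<forall>b\<in>B. \<exists>f. bij_betw f X Y \<and> (\<forall>g\<in>gstab G c b. \<forall>x\<in>X. f (a g x) = a' g (f x))"
  using ex by blast
 from bchoice[OF this] obtain f where f: "\<And>b. b \<in> B ==> bij_betw (f b) X Y"
  "\<And>b g x. b \<in> B ==> g \<in> gstab G c b ==> x \<in> X ==> f b (a g x) = a' g (f b x)" by blast
 define r where "r b = (SOME b'. b' \<in> gorb G c b)" for b
 define k where "k b = (SOME k. k \<in> carrier G \<and> c k (r b) = b)" for b
 have rin: "r b \<in> gorb G c b" if "b \<in> B" for b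
  unfolding r_def by (rule someI) (rule gorb_props(1)[OF B that])
 have rB: "r b \<in> B" if "b \<in> B" for b using rin[OF that] gorb_props(2)[OF B that] by auto
 have k: "k b \<in> carrier G \<and> c (k b) (r b) = b" if b: "b \<in> B" for b
 proof -
  obtain h where h: "h \<in> carrier G" "r b = c h b" using rin[OF b] by (auto simp: gorb_def)
  then have "c (inv h) (r b) = b" using gset_inv1[OF B h(1) b] by simp
  then show ?thesis unfolding k_def using h(1) by (rule_tac someI[where x = "inv h"]) simp
 qed
 have rg: "r (c g b) = r b" if g: "g \<in> carrier G" and b: "b \<in> B" for g b
 proof -
  have "gorb G c (c g b) = gorb G c b"
  proof (intro equalityI subsetI)
   fix z assume "z \<in> gorb G c (c g b)"
   then obtain h where "h \<in> carrier G" "z = c h (c g b)" by (auto simp: gorb_def)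
   then show "z \<in> gorb G c b" using gorb_props(3)[OF B b] gorb_props(1)[OF B b] g by auto
  next
   fix z assume "z \<in> gorb G c b"
   then obtain h where h: "h \<in> carrier G" "z = c h b" by (auto simp: gorb_def)
   then have "z = c (h \<otimes> inv g) (c g b)" using gsetD(3)[OF B, of "h" "inv g" "c g b"] g b
    gset_inv1[OF B g b] gsetD(1)[OF B g b] by simp
   then show "z \<in> gorb G c (c g b)" using h g by (auto simp: gorb_def)
  qed
  then show ?thesis by (simp add: r_def)
 qed
 define F where "F b x = a' (k b) (f (r b) (a (inv (k b)) x))" for b x
 have "bij_betw (F b) X Y" if b: "b \<in> B" for b
 proof -
  have 1: "bij_betw (a (inv (k b))) X X" "bij_betw (a' (k b)) Y Y"
   using gset_bij[OF X] gset_bij[OF Y] k[OF b] by auto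
  have "bij_betw (a' (k b) \<circ> (f (r b) \<circ> a (inv (k b)))) X Y"
   using bij_betw_trans[OF bij_betw_trans[OF 1(1) f(1)[OF rB[OF b]]] 1(2)] by (simp add: comp_assoc)
  then show ?thesis by (simp add: F_def[abs_def] comp_def)
 qed
 moreover have "F (c g b) (a g x) = a' g (F b x)" if g: "g \<in> carrier G" and b: "b \<in> B" and x: "x \<in> X" for g b x
 proof -
  define l where "l = k (c g b)"
  \<comment> \<open>The transporter to \<open>c g b\<close> and the product of \<open>g\<close> with
    the transporter to \<open>b\<close> both move the representative to \<open>c g b\<close>;
    \<open>s\<close> is their discrepancy and stabilizes the representative.\<close>
  define s where "s = inv l \<otimes> (g \<otimes> k b)"
  have cgb: "c g b \<in> B" using gsetD(1)[OF B g b] .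
  have l: "l \<in> carrier G" "c l (r b) = c g b" using k[OF cgb] rg[OF g b] by (auto simp: l_def)
  have kb: "k b \<in> carrier G" "c (k b) (r b) = b" using k[OF b] by auto
  note rb = rB[OF b]
  have "c (g \<otimes> k b) (r b) = c l (r b)" using gsetD(3)[OF B g kb(1) rb] kb l by simp
  then have s: "s \<in> gstab G c (r b)" unfolding s_def
   using gset_act_eq_iff[OF B rb, of "g \<otimes> k b" l] l g kb by simp
  have sc: "s \<in> carrier G" using s by (auto simp: gstab_def)
  define w where "w = a (inv (k b)) x"
  have w: "w \<in> X" using gsetD(1)[OF X] kb x by (simp add: w_def)
  have ls: "l \<otimes> s = g \<otimes> k b" using l g kb by (simp add: s_def m_assoc[symmetric])
  have "inv l \<otimes> g = s \<otimes> inv (k b)" using l g kb by (simp add: s_def m_assoc)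
  then have "a (inv l) (a g x) = a s w"
   using gsetD(3)[OF X, of "inv l" g x] gsetD(3)[OF X sc, of "inv (k b)" x] l g kb x
   by (simp add: w_def)
  then have "F (c g b) (a g x) = a' l (a' s (f (r b) w))"
   using f(2)[OF rb s w] by (simp add: F_def l_def[symmetric] rg[OF g b])
  also have "\<dots> = a' (l \<otimes> s) (f (r b) w)"
   using gsetD(3)[OF Y l(1) sc] f(1)[OF rb] w by (auto simp: bij_betw_def)
  also have "\<dots> = a' g (F b x)" unfolding ls
   using gsetD(3)[OF Y g kb(1)] f(1)[OF rb] w by (auto simp: bij_betw_def F_def w_def)
  finally show ?thesis .
 qed
 ultimately show ?thesis by (intro exI[of _ F]) auto
qed

end

section \<open>Signed group sets and odd operators\<close>

text \<open>A signed group set stands for the difference of its even points (\<open>s x = False\<close>) and its odd points.\<close>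

definition sgset :: "('g, 'm) monoid_scheme => 'x set => ('g => 'x => 'x) => ('x => bool) => bool" where
 "sgset G X a s \<longleftrightarrow> finite X \<and> gset G X a \<and> (\<forall>g\<in>carrier G. \<forall>x\<in>X. s (a g x) = s x)"

definition sgn_of :: "bool => int" where "sgn_of b = (if b then -1 else 1)"

lemma sgn_of_simps: "sgn_of (b = (\<not> c)) = sgn_of b * sgn_of c" "sgn_of (\<not> b) = - sgn_of b" "sgn_of b * sgn_of b = 1"
 "sgn_of False = 1" "sgn_of True = -1"
 by (auto simp: sgn_of_def)

definition smark :: "('g, 'm) monoid_scheme => 'x set => ('g => 'x => 'x) => ('x => bool) => 'g set => int" where
 "smark G X a s H = (\<Sum>x\<in>fixpts G X a H. sgn_of (s x))"

text \<open>The two off-diagonal blocks are inverse to each other up to the scalar \<open>d\<close>.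
  Over a ring in which \<open>d\<close> is a unit they make the permutation modules on the even and
  on the odd points isomorphic.\<close>

definition oddop :: "('g, 'm) monoid_scheme => 'x set => ('g => 'x => 'x) => ('x => bool) => ('x => 'x => int) => int => bool" where
 "oddop G X a s f d \<longleftrightarrow> (\<forall>x\<in>X. \<forall>y\<in>X. f x y \<noteq> 0 \<longrightarrow> s x \<noteq> s y) \<and>
   (\<forall>g\<in>carrier G. \<forall>x\<in>X. \<forall>y\<in>X. f (a g x) (a g y) = f x y) \<and>
   (\<forall>x\<in>X. \<forall>y\<in>X. (\<Sum>z\<in>X. f x z * f z y) = (if x = y then d else 0))"

text \<open>Marks of virtual group sets. The points are natural numbers so that the existential
  ranges over a single type; \<open>Vm_intro\<close> admits any type of points.\<close>

definition Vm :: "('g, 'm) monoid_scheme => ('g set => int) => bool" where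
 "Vm G m \<longleftrightarrow> (\<exists>(X :: nat set) a s. sgset G X a s \<and> m = smark G X a s)"

text \<open>These are the marks of virtual group sets whose class vanishes over every ring in which
  \<open>d\<close> is invertible, see \<open>yv_Rel\<close>.\<close>

definition Rel :: "('g, 'm) monoid_scheme => int => ('g set => int) => bool" where
 "Rel G d m \<longleftrightarrow> (\<exists>(X :: nat set) a s f. sgset G X a s \<and> oddop G X a s f d \<and> m = smark G X a s)"

lemma oddopD:
 assumes "oddop G X a s f d"
 shows "\<And>x y. x \<in> X ==> y \<in> X ==> s x = s y ==> f x y = 0"
  "\<And>g x y. g \<in> carrier G ==> x \<in> X ==> y \<in> X ==> f (a g x) (a g y) = f x y"
  "\<And>x y. x \<in> X ==> y \<in> X ==> (\<Sum>z\<in>X. f x z * f z y) = (if x = y then d else 0)"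
 using assms by (auto simp: oddop_def)

lemma sgsetD:
 assumes "sgset G X a s"
 shows "finite X" "gset G X a" "\<And>g x. g \<in> carrier G ==> x \<in> X ==> s (a g x) = s x"
 using assms by (auto simp: sgset_def)

lemma Rel_Vm: "Rel G d m ==> Vm G m" unfolding Rel_def Vm_def by blast

lemma finite_fixpts: "finite X ==> finite (fixpts G X a H)" by (simp add: fixpts_def)

context group
begin

lemma sgset_transport:
 assumes X: "sgset G X a s" and f: "bij_betw f X Y"
 defines "b \<equiv> (\<lambda>g y. f (a g (inv_into X f y)))" and "t \<equiv> (\<lambda>y. s (inv_into X f y))"
 shows "sgset G Y b t" "smark G Y b t = smark G X a s"
  "oddop G X a s h d ==> oddop G Y b t (\<lambda>y y'. h (inv_into X f y) (inv_into X f y')) d"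
proof -
 note X' = sgsetD[OF X]
 note tr = gset_transport[OF X'(2) f]
 have i: "inv_into X f (f x) = x" if "x \<in> X" for x using f that by (simp add: bij_betw_def)
 have i': "inv_into X f y \<in> X" if "y \<in> Y" for y using f that by (metis bij_betw_def inv_into_into)
 have ib: "inv_into X f (b g y) = a g (inv_into X f y)" if "g \<in> carrier G" "y \<in> Y" for g y
  unfolding b_def using i[OF gsetD(1)[OF X'(2) that(1) i'[OF that(2)]]] .
 show "sgset G Y b t" unfolding sgset_def
 proof (intro conjI ballI)
  show "finite Y" using bij_betw_finite[OF f] X'(1) by simp
  show "gset G Y b" using tr(1) by (simp add: b_def)
  show "t (b g y) = t y" if "g \<in> carrier G" "y \<in> Y" for g y
   using ib[OF that] X'(3)[OF that(1) i'[OF that(2)]] by (simp add: t_def)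
 qed
 have "giso G X a Y b f" using tr(2) by (simp add: b_def)
 note fx = giso_fixpts[OF X'(2) this]
 show "smark G Y b t = smark G X a s"
 proof
  fix H
  have "smark G Y b t H = (\<Sum>x\<in>fixpts G X a H. sgn_of (t (f x)))"
   unfolding smark_def by (rule sum.reindex_bij_betw[OF fx, symmetric])
  also have "\<dots> = smark G X a s H" unfolding smark_def t_def
   by (rule sum.cong) (auto simp: i fixpts_def)
  finally show "smark G Y b t H = smark G X a s H" .
 qed
 assume h: "oddop G X a s h d"
 note h' = oddopD[OF h]
 show "oddop G Y b t (\<lambda>y y'. h (inv_into X f y) (inv_into X f y')) d"
  unfolding oddop_def
 proof (intro conjI ballI impI)
  fix y y' assume y: "y \<in> Y" "y' \<in> Y"
  show "t y \<noteq> t y'" if "h (inv_into X f y) (inv_into X f y') \<noteq> 0"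
   using h'(1)[OF i'[OF y(1)] i'[OF y(2)]] that by (auto simp: t_def)
  show "h (inv_into X f (b g y)) (inv_into X f (b g y')) = h (inv_into X f y) (inv_into X f y')"
   if "g \<in> carrier G" for g using h'(2)[OF that i'[OF y(1)] i'[OF y(2)]] ib that y by simp
  have "(\<Sum>z\<in>Y. h (inv_into X f y) (inv_into X f z) * h (inv_into X f z) (inv_into X f y')) =
   (\<Sum>z\<in>X. h (inv_into X f y) z * h z (inv_into X f y'))"
   by (rule sum.reindex_bij_betw[OF bij_betw_inv_into[OF f]])
  also have "\<dots> = (if inv_into X f y = inv_into X f y' then d else 0)" by (rule h'(3)[OF i'[OF y(1)] i'[OF y(2)]])
  also have "inv_into X f y = inv_into X f y' \<longleftrightarrow> y = y'"
   using bij_betw_inv_into[OF f] y by (auto simp: bij_betw_def inj_on_def)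
  finally show "(\<Sum>z\<in>Y. h (inv_into X f y) (inv_into X f z) * h (inv_into X f z) (inv_into X f y')) =
   (if y = y' then d else 0)" .
 qed
qed

lemma Vm_intro:
 assumes "sgset G X a s" shows "Vm G (smark G X a s)"
proof -
 obtain f where f: "bij_betw f X {0..<card X}" using ex_bij_betw_finite_nat[OF sgsetD(1)[OF assms]] by blast
 show ?thesis unfolding Vm_def using sgset_transport(1,2)[OF assms f] by metis
qed

lemma Rel_intro:
 assumes "sgset G X a s" "oddop G X a s h d" shows "Rel G d (smark G X a s)"
proof -
 obtain f where f: "bij_betw f X {0..<card X}" using ex_bij_betw_finite_nat[OF sgsetD(1)[OF assms(1)]] by blast
 show ?thesis unfolding Rel_def using sgset_transport(1,2)[OF assms(1) f] sgset_transport(3)[OF assms(1) f assms(2)] by metis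
qed

lemma gset_prod: "gset G X a ==> gset G Y b ==> gset G (X \<times> Y) (\<lambda>g (x, y). (a g x, b g y))"
 unfolding gset_def by auto

lemma sgset_prod:
 assumes X: "sgset G X a s" and Y: "sgset G Y b t"
 shows "sgset G (X \<times> Y) (\<lambda>g (x, y). (a g x, b g y)) (\<lambda>(x, y). s x \<noteq> t y)"
  and "smark G (X \<times> Y) (\<lambda>g (x, y). (a g x, b g y)) (\<lambda>(x, y). s x \<noteq> t y) = (\<lambda>H. smark G X a s H * smark G Y b t H)"
proof -
 show "sgset G (X \<times> Y) (\<lambda>g (x, y). (a g x, b g y)) (\<lambda>(x, y). s x \<noteq> t y)"
  using gset_prod[OF sgsetD(2)[OF X] sgsetD(2)[OF Y]] sgsetD(1,3)[OF X] sgsetD(1,3)[OF Y] by (auto simp: sgset_def)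
 have "fixpts G (X \<times> Y) (\<lambda>g (x, y). (a g x, b g y)) H = fixpts G X a H \<times> fixpts G Y b H" for H
  by (auto simp: fixpts_def)
 then show "smark G (X \<times> Y) (\<lambda>g (x, y). (a g x, b g y)) (\<lambda>(x, y). s x \<noteq> t y) = (\<lambda>H. smark G X a s H * smark G Y b t H)"
  by (intro ext) (simp add: smark_def sum_product sum.cartesian_product case_prod_unfold sgn_of_simps)
qed

lemma Vm_mult: assumes "Vm G m" "Vm G m'" shows "Vm G (\<lambda>H. m H * m' H)"
proof -
 obtain X :: "nat set" and a s where X: "sgset G X a s" "m = smark G X a s" using assms(1) unfolding Vm_def by blast
 obtain Y :: "nat set" and b t where Y: "sgset G Y b t" "m' = smark G Y b t" using assms(2) unfolding Vm_def by blast
 show ?thesis using Vm_intro[OF sgset_prod(1)[OF X(1) Y(1)]] unfolding sgset_prod(2)[OF X(1) Y(1)] by (simp add: X(2) Y(2))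
qed

lemma sgset_sum:
 assumes X: "sgset G X a s" and Y: "sgset G Y b t"
 shows "sgset G (X <+> Y) (\<lambda>g. map_sum (a g) (b g)) (case_sum s t)"
  and "smark G (X <+> Y) (\<lambda>g. map_sum (a g) (b g)) (case_sum s t) = (\<lambda>H. smark G X a s H + smark G Y b t H)"
proof -
 have "gset G (X <+> Y) (\<lambda>g. map_sum (a g) (b g))"
  using gsetD[OF sgsetD(2)[OF X]] gsetD[OF sgsetD(2)[OF Y]] by (auto simp: gset_def)
 then show "sgset G (X <+> Y) (\<lambda>g. map_sum (a g) (b g)) (case_sum s t)"
  using sgsetD(1,3)[OF X] sgsetD(1,3)[OF Y] by (auto simp: sgset_def)
 show "smark G (X <+> Y) (\<lambda>g. map_sum (a g) (b g)) (case_sum s t) = (\<lambda>H. smark G X a s H + smark G Y b t H)"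
 proof
  fix H
  have "fixpts G (X <+> Y) (\<lambda>g. map_sum (a g) (b g)) H = fixpts G X a H <+> fixpts G Y b H"
   by (auto simp: fixpts_def)
  moreover have "finite (fixpts G X a H)" "finite (fixpts G Y b H)"
   using sgsetD(1)[OF X] sgsetD(1)[OF Y] by (auto simp: finite_fixpts)
  ultimately show "smark G (X <+> Y) (\<lambda>g. map_sum (a g) (b g)) (case_sum s t) H = smark G X a s H + smark G Y b t H"
   by (simp add: smark_def sum.Plus)
 qed
qed

lemma Vm_add: assumes "Vm G m" "Vm G m'" shows "Vm G (\<lambda>H. m H + m' H)"
proof -
 obtain X :: "nat set" and a s where X: "sgset G X a s" "m = smark G X a s" using assms(1) unfolding Vm_def by blast
 obtain Y :: "nat set" and b t where Y: "sgset G Y b t" "m' = smark G Y b t" using assms(2) unfolding Vm_def by blast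
 show ?thesis using Vm_intro[OF sgset_sum(1)[OF X(1) Y(1)]] unfolding sgset_sum(2)[OF X(1) Y(1)] by (simp add: X(2) Y(2))
qed

lemma Vm_const: "Vm G (\<lambda>H. c)"
proof -
 have 1: "sgset G {0..<nat \<bar>c\<bar>} (\<lambda>g x. x) (\<lambda>x. c < 0)" by (auto simp: sgset_def gset_def)
 have "smark G {0..<nat \<bar>c\<bar>} (\<lambda>g x. x) (\<lambda>x. c < 0) H = c" for H
  by (auto simp: smark_def fixpts_def sgn_of_def)
 then show ?thesis using Vm_intro[OF 1] by presburger
qed

lemma Vm_minus: "Vm G m ==> Vm G (\<lambda>H. - m H)"
 using Vm_mult[OF Vm_const[of "-1"], of m] by simp

lemma Vm_diff: "Vm G m ==> Vm G m' ==> Vm G (\<lambda>H. m H - m' H)"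
 using Vm_add[OF _ Vm_minus, of m m'] by simp

lemma Vm_sum: "finite I ==> (\<And>i. i \<in> I ==> Vm G (m i)) ==> Vm G (\<lambda>H. \<Sum>i\<in>I. m i H)"
 by (induction I rule: finite_induct) (auto simp: Vm_const Vm_add)

lemma Vm_prod: "finite I ==> (\<And>i. i \<in> I ==> Vm G (m i)) ==> Vm G (\<lambda>H. \<Prod>i\<in>I. m i H)"
 by (induction I rule: finite_induct) (auto simp: Vm_const Vm_mult)

text \<open>Only the rows at odd points are multiplied by \<open>c\<close>. A nonzero product in the
  square passes through one even and one odd point, so it picks up exactly one factor
  \<open>c\<close>.\<close>

lemma Rel_scale: assumes "Rel G d m" shows "Rel G (c * d) m"
proof -
 obtain X :: "nat set" and a s f where X: "sgset G X a s" "oddop G X a s f d" "m = smark G X a s"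
  using assms unfolding Rel_def by blast
 note f = oddopD[OF X(2)]
 define h where "h x y = (if s x then c else 1) * f x y" for x y
 have "oddop G X a s h (c * d)" unfolding oddop_def
 proof (intro conjI ballI impI)
  fix x y assume xy: "x \<in> X" "y \<in> X"
  show "h x y \<noteq> 0 ==> s x \<noteq> s y" using f(1)[OF xy] by (auto simp: h_def)
  show "h (a g x) (a g y) = h x y" if "g \<in> carrier G" for g
   using f(2)[OF that xy] sgsetD(3)[OF X(1) that xy(1)] by (simp add: h_def)
  have "h x z * h z y = c * (f x z * f z y)" if "z \<in> X" for z
   using f(1)[OF xy(1) that] by (cases "s x = s z") (auto simp: h_def)
  then show "(\<Sum>z\<in>X. h x z * h z y) = (if x = y then c * d else 0)"
   using f(3)[OF xy] by (simp add: sum_distrib_left[symmetric])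
 qed
 then show ?thesis unfolding Rel_def using X by blast
qed

text \<open>This is the graded tensor product: the first matrix tensored with the identity, plus the
  sign of the first factor tensored with the second matrix. An odd matrix anticommutes with the
  sign, so the mixed terms cancel and the scalars add up.\<close>

lemma oddop_prod:
 assumes X: "sgset G X a s" and Y: "sgset G Y b t" and f: "oddop G X a s f d" and h: "oddop G Y b t h e"
 shows "oddop G (X \<times> Y) (\<lambda>g (x, y). (a g x, b g y)) (\<lambda>(x, y). s x \<noteq> t y)
  (\<lambda>(x, u) (y, v). (if u = v then f x y else 0) + (if x = y then sgn_of (s x) * h u v else 0)) (d + e)"
  (is "oddop G _ ?a ?s ?F _")
 unfolding oddop_def
proof (intro conjI ballI impI)
 note f' = oddopD[OF f] and h' = oddopD[OF h]
 have fin: "finite X" "finite Y" using sgsetD(1)[OF X] sgsetD(1)[OF Y] by auto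
 fix p q assume p: "p \<in> X \<times> Y" and q: "q \<in> X \<times> Y"
 obtain x u y v where pq: "p = (x, u)" "q = (y, v)" by (cases p, cases q)
 have x: "x \<in> X" "y \<in> X" "u \<in> Y" "v \<in> Y" using p q pq by auto
 show "?s p \<noteq> ?s q" if "?F p q \<noteq> 0"
  using that f'(1)[OF x(1,2)] h'(1)[OF x(3,4)] by (auto simp: pq split: if_splits)
 show "?F (?a g p) (?a g q) = ?F p q" if g: "g \<in> carrier G" for g
  using f'(2)[OF g x(1,2)] h'(2)[OF g x(3,4)] sgsetD(3)[OF X g x(1)]
   gset_inj[OF sgsetD(2)[OF X] g x(1,2)] gset_inj[OF sgsetD(2)[OF Y] g x(3,4)] by (auto simp: pq)
 have split: "(\<Sum>r\<in>X \<times> Y. ?F p r * ?F r q) =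
  (\<Sum>z\<in>X. \<Sum>w\<in>Y. ((if u = w then f x z else 0) + (if x = z then sgn_of (s x) * h u w else 0)) *
    ((if w = v then f z y else 0) + (if z = y then sgn_of (s z) * h w v else 0)))"
  unfolding sum.cartesian_product by (rule sum.cong) (auto simp: pq)
 also have "\<dots> = (\<Sum>z\<in>X. \<Sum>w\<in>Y. (if u = w then f x z * (if w = v then f z y else 0) else 0)) +
   (\<Sum>z\<in>X. \<Sum>w\<in>Y. (if u = w then if z = y then f x z * sgn_of (s z) * h w v else 0 else 0)) +
   (\<Sum>z\<in>X. \<Sum>w\<in>Y. (if w = v then if x = z then sgn_of (s x) * h u w * f z y else 0 else 0)) +
   (\<Sum>z\<in>X. \<Sum>w\<in>Y. (if x = z then if z = y then sgn_of (s x) * h u w * sgn_of (s z) * h w v else 0 else 0))"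
  unfolding sum.distrib[symmetric] by (intro sum.cong refl) (auto simp: algebra_simps)
 also have "(\<Sum>z\<in>X. \<Sum>w\<in>Y. (if u = w then f x z * (if w = v then f z y else 0) else 0)) =
   (if u = v then (\<Sum>z\<in>X. f x z * f z y) else 0)"
  using x fin by simp
 also have "(\<Sum>z\<in>X. \<Sum>w\<in>Y. (if u = w then if z = y then f x z * sgn_of (s z) * h w v else 0 else 0)) =
   f x y * sgn_of (s y) * h u v" using x fin by simp
 also have "(\<Sum>z\<in>X. \<Sum>w\<in>Y. (if w = v then if x = z then sgn_of (s x) * h u w * f z y else 0 else 0)) =
   sgn_of (s x) * h u v * f x y" using x fin by simp
 also have "(\<Sum>z\<in>X. \<Sum>w\<in>Y. (if x = z then if z = y then sgn_of (s x) * h u w * sgn_of (s z) * h w v else 0 else 0)) =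
   (\<Sum>w\<in>Y. \<Sum>z\<in>X. (if x = z then if z = y then sgn_of (s x) * h u w * sgn_of (s z) * h w v else 0 else 0))"
  by (rule sum.swap)
 also have "\<dots> = (\<Sum>w\<in>Y. if x = y then h u w * h w v else 0)"
  using x fin by (intro sum.cong refl) (auto simp: sgn_of_def)
 also have "\<dots> = (if x = y then (\<Sum>w\<in>Y. h u w * h w v) else 0)" by simp
 finally have "(\<Sum>r\<in>X \<times> Y. ?F p r * ?F r q) = (if u = v then (\<Sum>z\<in>X. f x z * f z y) else 0) +
   f x y * sgn_of (s y) * h u v + sgn_of (s x) * h u v * f x y + (if x = y then (\<Sum>w\<in>Y. h u w * h w v) else 0)" .
 moreover have "f x y * sgn_of (s y) * h u v + sgn_of (s x) * h u v * f x y = 0"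
  using f'(1)[OF x(1,2)] by (auto simp: sgn_of_def)
 ultimately show "(\<Sum>r\<in>X \<times> Y. ?F p r * ?F r q) = (if p = q then d + e else 0)"
  using f'(3)[OF x(1,2)] h'(3)[OF x(3,4)] by (auto simp: pq)
qed

lemma Rel_mult: assumes "Rel G d m" "Rel G e m'" shows "Rel G (d + e) (\<lambda>H. m H * m' H)"
proof -
 obtain X :: "nat set" and a s f where X: "sgset G X a s" "oddop G X a s f d" "m = smark G X a s"
  using assms(1) unfolding Rel_def by blast
 obtain Y :: "nat set" and b t h where Y: "sgset G Y b t" "oddop G Y b t h e" "m' = smark G Y b t"
  using assms(2) unfolding Rel_def by blast
 show ?thesis using Rel_intro[OF sgset_prod(1)[OF X(1) Y(1)] oddop_prod[OF X(1) Y(1) X(2) Y(2)]]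
  unfolding sgset_prod(2)[OF X(1) Y(1)] by (simp add: X(3) Y(3))
qed

text \<open>Every signed set carries the odd operator \<open>0\<close> with scalar \<open>0\<close>;
  hence the relations with scalar \<open>d\<close> are stable under products with arbitrary virtual
  sets.\<close>

lemma Rel_mult_Vm: assumes "Rel G d m" "Vm G m'" shows "Rel G d (\<lambda>H. m H * m' H)"
proof -
 obtain X :: "nat set" and a s f where X: "sgset G X a s" "oddop G X a s f d" "m = smark G X a s"
  using assms(1) unfolding Rel_def by blast
 obtain Y :: "nat set" and b t where Y: "sgset G Y b t" "m' = smark G Y b t"
  using assms(2) unfolding Vm_def by blast
 have "oddop G Y b t (\<lambda>x y. 0) 0" by (simp add: oddop_def)
 from Rel_intro[OF sgset_prod(1)[OF X(1) Y(1)] oddop_prod[OF X(1) Y(1) X(2) this]] show ?thesis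
  unfolding sgset_prod(2)[OF X(1) Y(1)] by (simp add: X(3) Y(2))
qed

text \<open>Bezout: scaling provides the multiples \<open>u * d\<close> and \<open>v * e\<close>,
  and the tensor product adds them.\<close>

lemma Rel_gcd: assumes "Rel G d m" "Rel G e m'" shows "Rel G (gcd d e) (\<lambda>H. m H * m' H)"
proof -
 obtain u v where "u * d + v * e = gcd d e" using bezout_int by blast
 then show ?thesis using Rel_mult[OF Rel_scale[OF assms(1), of u] Rel_scale[OF assms(2), of v]] by simp
qed

lemma coset_gset:
 assumes K: "subgroup K G" shows "gset G (lcosets K) (\<lambda>g X. g <# X)"
 unfolding gset_def
proof (intro conjI ballI)
 have Ks: "K \<subseteq> carrier G" using K by (rule subgroup.subset)
 fix X assume X: "X \<in> lcosets K"
 then obtain x where x: "x \<in> carrier G" "X = x <# K" by (auto simp: LCOSETS_def)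
 show "g <# X \<in> lcosets K" if "g \<in> carrier G" for g
  using x that lcos_m_assoc[OF Ks that x(1)] by (auto simp: LCOSETS_def)
 have Xs: "X \<subseteq> carrier G" using l_coset_subset_G[OF Ks x(1)] x by simp
 show "\<one> <# X = X" by (rule lcos_mult_one[OF Xs])
 show "(g \<otimes> h) <# X = g <# (h <# X)" if "g \<in> carrier G" "h \<in> carrier G" for g h
  using lcos_m_assoc[OF Xs that] by simp
qed

lemma lcosets_finite: "finite (carrier G) ==> finite (lcosets K)"
 by (auto simp: LCOSETS_def)

end

section \<open>Removing large stabilizers\<close>

text \<open>Subrings are sets within a ring type, because the construction moves through a growing
  chain of them inside one fixed operator ring.\<close>

definition subrng :: "'r::ring_1 set => bool" where
 "subrng B \<longleftrightarrow> 1 \<in> B \<and> (\<forall>x\<in>B. \<forall>y\<in>B. x + y \<in> B \<and> x - y \<in> B \<and> x * y \<in> B)"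

lemma subrngD:
 assumes "subrng B"
 shows "1 \<in> B" "0 \<in> B" "\<And>x y. x \<in> B ==> y \<in> B ==> x + y \<in> B"
  "\<And>x y. x \<in> B ==> y \<in> B ==> x - y \<in> B" "\<And>x y. x \<in> B ==> y \<in> B ==> x * y \<in> B"
  "\<And>x. x \<in> B ==> - x \<in> B"
proof -
 show 1: "1 \<in> B" using assms by (simp add: subrng_def)
 show d: "x - y \<in> B" if "x \<in> B" "y \<in> B" for x y using assms that by (simp add: subrng_def)
 show 0: "0 \<in> B" using d[OF 1 1] by simp
 show "x + y \<in> B" "x * y \<in> B" if "x \<in> B" "y \<in> B" for x y using assms that by (simp_all add: subrng_def)
 show "- x \<in> B" if "x \<in> B" for x using d[OF 0 that] by simp
qed

lemma subrng_sum: "subrng B ==> (\<And>i. i \<in> I ==> f i \<in> B) ==> sum f I \<in> B"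
 by (induction I rule: infinite_finite_induct) (auto simp: subrngD)

lemma subrng_power: "subrng B ==> x \<in> B ==> x ^ n \<in> B"
 by (induction n) (auto simp: subrngD)

lemma subrng_of_nat: "subrng B ==> of_nat n \<in> B"
 by (induction n) (auto simp: subrngD)

lemma subrng_of_int: "subrng B ==> of_int n \<in> B"
 by (cases n rule: int_cases2) (auto simp: subrngD subrng_of_nat)

text \<open>As \<open>y\<close> commutes with \<open>a + w\<close>, the commutator of
  \<open>a\<close> with \<open>y\<close> equals that of \<open>y\<close> with \<open>w\<close>.
  Expanding the commutator of \<open>a * a\<close> with \<open>y\<close> by the product rule then
  leaves exactly one \<open>a\<close> and one \<open>w\<close> in each term. For \<open>a\<close>
  itself the terms would contain only \<open>w\<close>, which is why squares appear in
  \<open>green_step\<close>.\<close>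

lemma square_commutator:
 fixes x y :: "'r::ring_1"
 assumes "(a + w) * y = y * (a + w)"
 shows "a * a * y - y * (a * a) = a * y * w - a * w * y - w * y * a + y * w * a"
proof -
 have 1: "a * y = y * a + y * w - w * y" using assms by (simp add: algebra_simps)
 have "a * (a * y) = a * y * a + a * y * w - a * w * y"
  by (subst 1) (simp add: algebra_simps)
 also have "a * y * a = y * a * a + y * w * a - w * y * a" by (subst 1) (simp add: algebra_simps)
 finally show ?thesis by (simp add: algebra_simps)
qed

lemma comm_add: "a * f = f * a ==> b * f = f * b ==> (a + b) * f = f * (a + (b::'r::ring_1))"
 by (simp add: algebra_simps)

lemma comm_mult: "a * f = f * a ==> b * f = f * b ==> (a * b) * f = f * (a * (b::'r::ring_1))"
 by (metis mult.assoc)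

text \<open>\<open>P\<close> and \<open>Q\<close> stand for the complementary idempotents that
  project to the even and to the odd part.\<close>

definition evenP :: "'r::ring_1 => 'r => 'r => bool" where
 "evenP P Q x \<longleftrightarrow> x * P = P * x \<and> x * Q = Q * x"
definition oddP :: "'r::ring_1 => 'r => 'r => bool" where
 "oddP P Q x \<longleftrightarrow> x * P = Q * x \<and> x * Q = P * x"

lemma parity_mult:
 "evenP P Q x ==> evenP P Q y ==> evenP P Q (x * y)"
 "evenP P Q x ==> oddP P Q y ==> oddP P Q (x * y)"
 "oddP P Q x ==> evenP P Q y ==> oddP P Q (x * y)"
 "oddP P Q x ==> oddP P Q y ==> evenP P Q (x * y)"
 by (auto simp: evenP_def oddP_def mult.assoc) (simp_all add: mult.assoc[symmetric])

lemma parity_add: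
 "evenP P Q x ==> evenP P Q y ==> evenP P Q (x + y)"
 "evenP P Q x ==> evenP P Q y ==> evenP P Q (x - y)"
 "oddP P Q x ==> oddP P Q y ==> oddP P Q (x + y)"
 "oddP P Q x ==> oddP P Q y ==> oddP P Q (x - y)"
 by (auto simp: evenP_def oddP_def algebra_simps)

lemma evenP_simps: "evenP P Q 1" "evenP P Q 0" "oddP P Q 0"
 by (auto simp: evenP_def oddP_def)

lemma subrng_evenP: "subrng B ==> subrng {x \<in> B. evenP P Q x}"
 by (auto simp: subrng_def evenP_simps parity_mult parity_add)

lemma oddP_sum: "(\<And>i. i \<in> I ==> oddP P Q (f i)) ==> oddP P Q (sum f I)"
 by (induction I rule: infinite_finite_induct) (auto simp: evenP_simps parity_add)

section \<open>Sums of conjugates over group sets, and the step that makes the stabilizers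
  smaller\<close>

locale ring_action = group G for G (structure) +
 fixes rho :: "'a => 'r::ring_1"
 assumes finG: "finite (carrier G)"
  and rho_one: "rho \<one> = 1"
  and rho_mult: "g \<in> carrier G ==> h \<in> carrier G ==> rho (g \<otimes> h) = rho g * rho h"
begin

definition cj :: "'a => 'r => 'r" where "cj g x = rho g * x * rho (inv g)"
definition inve :: "'r => bool" where "inve x \<longleftrightarrow> (\<forall>g\<in>carrier G. cj g x = x)"

lemma rho_inv: "g \<in> carrier G ==> rho g * rho (inv g) = 1" "g \<in> carrier G ==> rho (inv g) * rho g = 1"
 using rho_mult[of g "inv g"] rho_mult[of "inv g" g] by (simp_all add: rho_one)

lemma rho_inv_mid: "g \<in> carrier G ==> rho (inv g) * (rho g * x) = x" "g \<in> carrier G ==> rho g * (rho (inv g) * x) = x"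
 by (simp_all add: mult.assoc[symmetric] rho_inv)

lemma cj_mult: "g \<in> carrier G ==> cj g (x * y) = cj g x * cj g y"
 by (simp add: cj_def mult.assoc rho_inv_mid)
lemma cj_add: "cj g (x + y) = cj g x + cj g y"
 by (simp add: cj_def algebra_simps)
lemma cj_diff: "cj g (x - y) = cj g x - cj g y"
 by (simp add: cj_def algebra_simps)
lemma cj_one: "g \<in> carrier G ==> cj g 1 = 1"
 by (simp add: cj_def rho_inv)
lemma cj_zero: "cj g 0 = 0" by (simp add: cj_def)
lemma cj_minus: "cj g (- x) = - cj g x" by (simp add: cj_def)
lemma cj_sum: "cj g (sum f I) = (\<Sum>i\<in>I. cj g (f i))"
 by (simp add: cj_def sum_distrib_left sum_distrib_right)
lemma cj_of_nat: assumes g: "g \<in> carrier G" shows "cj g (of_nat n) = of_nat n"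
proof (induction n)
 case 0 show ?case by (simp add: cj_zero)
next
 case (Suc n) then show ?case by (simp add: cj_add cj_one[OF g])
qed
lemma cj_of_int: assumes g: "g \<in> carrier G" shows "cj g (of_int n) = of_int n"
 by (cases n rule: int_cases2) (simp_all add: cj_of_nat[OF g] cj_minus)
lemma cj_power: assumes g: "g \<in> carrier G" shows "cj g (x ^ n) = cj g x ^ n"
 by (induction n) (simp_all add: cj_mult[OF g] cj_one[OF g])

lemma inve_simps:
 "inve 1" "inve (of_int z)" "inve x ==> inve y ==> inve (x + y)" "inve x ==> inve y ==> inve (x - y)"
 "inve x ==> inve y ==> inve (x * y)" "inve x ==> inve (x ^ n)"
 by (auto simp: inve_def cj_one cj_of_int cj_add cj_diff cj_mult cj_power)

text \<open>The induction parameter \<open>k\<close> bounds the orders \<open>p ^ j\<close> of the stabilizers.\<close>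

definition Jt :: "nat => nat => 'r set => 'r => bool" where
 "Jt p k C x \<longleftrightarrow> (\<exists>(T::nat set) b l. finite T \<and> gset G T b \<and> (\<forall>t\<in>T. \<exists>j\<le>k. card (gstab G b t) = p ^ j) \<and>
   (\<forall>t\<in>T. l t \<in> C) \<and> (\<forall>g\<in>carrier G. \<forall>t\<in>T. l (b g t) = cj g (l t)) \<and> x = (\<Sum>t\<in>T. l t))"

lemma Jt_intro:
 assumes T: "finite T" and b: "gset G T b" and st: "\<And>t. t \<in> T ==> \<exists>j\<le>k. card (gstab G b t) = p ^ j"
  and C: "\<And>t. t \<in> T ==> l t \<in> C" and eq: "\<And>g t. g \<in> carrier G ==> t \<in> T ==> l (b g t) = cj g (l t)"
  and x: "x = (\<Sum>t\<in>T. l t)"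
 shows "Jt p k C x"
proof -
 from ex_bij_betw_finite_nat[OF T] obtain f where f: "bij_betw f T {0..<card T}" by blast
 define f' where "f' = inv_into T f"
 have f': "f' y \<in> T" "f (f' y) = y" if "y \<in> {0..<card T}" for y
  using f that by (auto simp: bij_betw_def inv_into_into f_inv_into_f f'_def)
 have f'f: "f' (f t) = t" if "t \<in> T" for t using f that by (simp add: bij_betw_def f'_def)
 define b' where "b' g y = f (b g (f' y))" for g y
 have b': "gset G {0..<card T} b'" using gset_transport(1)[OF b f] by (simp add: b'_def[abs_def] f'_def)
 have gs: "gstab G b' y = gstab G b (f' y)" if y: "y \<in> {0..<card T}" for y
 proof -
  have "f (b g (f' y)) = y \<longleftrightarrow> b g (f' y) = f' y" if "g \<in> carrier G" for g
   using f'f[OF gsetD(1)[OF b that f'(1)[OF y]]] f'(2)[OF y] by metis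
  then show ?thesis by (auto simp: gstab_def b'_def)
 qed
 have "x = (\<Sum>y\<in>{0..<card T}. l (f' y))"
  unfolding x by (rule sum.reindex_bij_betw[symmetric]) (use bij_betw_inv_into[OF f] in \<open>simp add: f'_def\<close>)
 moreover have "l (f' (b' g y)) = cj g (l (f' y))" if "g \<in> carrier G" "y \<in> {0..<card T}" for g y
  using eq[OF that(1) f'(1)[OF that(2)]] f'f[OF gsetD(1)[OF b that(1) f'(1)[OF that(2)]]] by (simp add: b'_def)
 moreover have "\<exists>j\<le>k. card (gstab G b' y) = p ^ j" if "y \<in> {0..<card T}" for y
  unfolding gs[OF that] by (rule st[OF f'(1)[OF that]])
 ultimately show ?thesis unfolding Jt_def using b' C f'(1)
  by (intro exI[of _ "{0..<card T}"] exI[of _ b'] exI[of _ "\<lambda>y. l (f' y)"]) auto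
qed

lemma Jt_add:
 assumes "Jt p k C x" "Jt p k C y" shows "Jt p k C (x + y)"
proof -
 obtain T b l where T: "finite (T::nat set)" "gset G T b" "\<And>t. t \<in> T ==> \<exists>j\<le>k. card (gstab G b t) = p ^ j"
  "\<And>t. t \<in> T ==> l t \<in> C" "\<And>g t. g \<in> carrier G ==> t \<in> T ==> l (b g t) = cj g (l t)" "x = (\<Sum>t\<in>T. l t)"
  using assms(1) unfolding Jt_def by blast
 obtain T' b' l' where T': "finite (T'::nat set)" "gset G T' b'" "\<And>t. t \<in> T' ==> \<exists>j\<le>k. card (gstab G b' t) = p ^ j"
  "\<And>t. t \<in> T' ==> l' t \<in> C" "\<And>g t. g \<in> carrier G ==> t \<in> T' ==> l' (b' g t) = cj g (l' t)" "y = (\<Sum>t\<in>T'. l' t)"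
  using assms(2) unfolding Jt_def by blast
 define c where "c g = map_sum (b g) (b' g)" for g
 have "gset G (T <+> T') c"
  using gsetD[OF T(2)] gsetD[OF T'(2)] by (auto simp: gset_def c_def)
 moreover have "gstab G c (Inl t) = gstab G b t" "gstab G c (Inr t) = gstab G b' t" for t
  by (auto simp: gstab_def c_def)
 moreover have "x + y = (\<Sum>t\<in>T <+> T'. case_sum l l' t)"
  using T T' by (simp add: sum.Plus)
 ultimately show ?thesis using T T'
  by (intro Jt_intro[of "T <+> T'" c k p "case_sum l l'"]) (auto simp: c_def)
qed

lemma Jt_mult:
 assumes "Jt p k C x" and "inve u" "inve v" and "\<And>c. c \<in> C ==> u * c * v \<in> C'"
 shows "Jt p k C' (u * x * v)"
proof -
 obtain T b l where T: "finite (T::nat set)" "gset G T b" "\<And>t. t \<in> T ==> \<exists>j\<le>k. card (gstab G b t) = p ^ j"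
  "\<And>t. t \<in> T ==> l t \<in> C" "\<And>g t. g \<in> carrier G ==> t \<in> T ==> l (b g t) = cj g (l t)" "x = (\<Sum>t\<in>T. l t)"
  using assms(1) unfolding Jt_def by blast
 show ?thesis
  by (rule Jt_intro[OF T(1,2,3), where l = "\<lambda>t. u * l t * v"])
    (use T assms in \<open>auto simp: cj_mult inve_def sum_distrib_left sum_distrib_right\<close>)
qed

definition csub :: "'a => 'a set => 'a set" where "csub g D = (\<lambda>x. g \<otimes> x \<otimes> inv g) ` D"

lemma gstab_act:
 assumes b: "gset G T b" and g: "g \<in> carrier G" and t: "t \<in> T"
 shows "gstab G b (b g t) = csub g (gstab G b t)"
proof (intro equalityI subsetI)
 note gt = gsetD(1)[OF b g t]
 fix x assume "x \<in> gstab G b (b g t)"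
 then have x: "x \<in> carrier G" "b x (b g t) = b g t" by (auto simp: gstab_def)
 have "b (inv g \<otimes> x \<otimes> g) t = b (inv g) (b x (b g t))"
  using g x t gsetD(3)[OF b, of "inv g \<otimes> x" g t] gsetD(3)[OF b, of "inv g" x "b g t"] gt by simp
 then have "b (inv g \<otimes> x \<otimes> g) t = t" using x(2) gset_inv1[OF b g t] by simp
 then have "inv g \<otimes> x \<otimes> g \<in> gstab G b t" using g x by (simp add: gstab_def)
 moreover have "x = g \<otimes> (inv g \<otimes> x \<otimes> g) \<otimes> inv g"
  using g x by (simp add: m_assoc inv_solve_right) (simp add: m_assoc[symmetric])
 ultimately show "x \<in> csub g (gstab G b t)" unfolding csub_def by (rule rev_image_eqI)
next
 note gt = gsetD(1)[OF b g t]
 fix x assume "x \<in> csub g (gstab G b t)"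
 then obtain y where y: "y \<in> carrier G" "b y t = t" "x = g \<otimes> y \<otimes> inv g" by (auto simp: csub_def gstab_def)
 have "b x (b g t) = b (g \<otimes> y) (b (inv g) (b g t))"
  using gsetD(3)[OF b, of "g \<otimes> y" "inv g" "b g t"] g y gt by simp
 also have "\<dots> = b g t" using gset_inv1[OF b g t] gsetD(3)[OF b g y(1) t] y by simp
 finally show "x \<in> gstab G b (b g t)" using g y by (simp add: gstab_def)
qed

lemma csub_inj: "g \<in> carrier G ==> D \<subseteq> carrier G ==> E \<subseteq> carrier G ==> csub g D = csub g E \<longleftrightarrow> D = E"
 unfolding csub_def by (rule inj_on_image_eq_iff[of _ "carrier G"]) (auto simp: inj_on_def)

lemma card_csub:
 assumes g: "g \<in> carrier G" and D: "D \<subseteq> carrier G" shows "card (csub g D) = card D"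
 unfolding csub_def
proof (rule card_image, rule inj_onI)
 fix x y assume "x \<in> D" "y \<in> D" "g \<otimes> x \<otimes> inv g = g \<otimes> y \<otimes> inv g"
 then show "x = y" using g D by (auto simp: subset_iff)
qed

text \<open>The stabilizer of a pair \<open>(t, u)\<close> is the intersection of the two
  stabilizers. When the one of \<open>t\<close> has the maximal order \<open>p ^ k\<close> and
  differs from that of \<open>u\<close>, the intersection is a proper subgroup of it, so its order
  is at most \<open>p ^ (k - 1)\<close>. All error terms of \<open>green_step\<close> that involve
  two points are of this kind.\<close>

lemma Jt_pairs:
 assumes p: "Factorial_Ring.prime (p::nat)" and T: "finite T" and b: "gset G T b"
  and st: "\<And>t. t \<in> T ==> \<exists>j\<le>k. card (gstab G b t) = p ^ j"
  and T1: "T1 = {t \<in> T. card (gstab G b t) = p ^ k}"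
  and C: "\<And>t u. t \<in> T1 ==> u \<in> T ==> gstab G b u \<noteq> gstab G b t ==> m t u \<in> C"
  and eq: "\<And>g t u. g \<in> carrier G ==> t \<in> T1 ==> u \<in> T ==> m (b g t) (b g u) = cj g (m t u)"
 shows "Jt p (k - 1) C (\<Sum>t\<in>T1. \<Sum>u | u \<in> T \<and> gstab G b u \<noteq> gstab G b t. m t u)"
proof (rule Jt_intro[where T = "Sigma T1 (\<lambda>t. {u \<in> T. gstab G b u \<noteq> gstab G b t})"
   and b = "\<lambda>g (t, u). (b g t, b g u)" and l = "\<lambda>(t, u). m t u"])
 let ?S = "Sigma T1 (\<lambda>t. {u \<in> T. gstab G b u \<noteq> gstab G b t})"
 have sc: "gstab G b t \<subseteq> carrier G" for t by (auto simp: gstab_def)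
 have T1g: "b g t \<in> T1" if "g \<in> carrier G" "t \<in> T1" for g t
  using that gsetD(1)[OF b that(1)] gstab_act[OF b that(1)] card_csub[OF that(1) sc] by (auto simp: T1)
 show "finite ?S" using T by (auto simp: T1)
 show "gset G ?S (\<lambda>g (t, u). (b g t, b g u))"
  using T1g gsetD[OF b] gstab_act[OF b] csub_inj[OF _ sc sc] by (auto simp: gset_def T1)
 show "(\<Sum>t\<in>T1. \<Sum>u | u \<in> T \<and> gstab G b u \<noteq> gstab G b t. m t u) = (\<Sum>x\<in>?S. case x of (t, u) => m t u)"
  using T by (subst sum.Sigma) (auto simp: T1)
 fix x assume x: "x \<in> ?S"
 obtain t u where tu: "x = (t, u)" by (cases x)
 have t: "t \<in> T" "card (gstab G b t) = p ^ k" and u: "u \<in> T" "gstab G b u \<noteq> gstab G b t"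
  using x by (auto simp: tu T1)
 have fin: "finite (gstab G b t)" "finite (gstab G b u)" using finG by (auto simp: gstab_def)
 have H: "gstab G (\<lambda>g (t, u). (b g t, b g u)) x = gstab G b t \<inter> gstab G b u" by (auto simp: gstab_def tu)
 let ?H = "gstab G b t \<inter> gstab G b u"
 have "subgroup ?H G" by (intro subgroups_Inter_pair gstab_subgroup[OF b] t u)
 have Hsub: "subgroup ?H (G\<lparr>carrier := gstab G b t\<rparr>)"
  by (rule subgroup_incl[OF \<open>subgroup ?H G\<close> gstab_subgroup[OF b t(1)]]) auto
 interpret Dt: group "G\<lparr>carrier := gstab G b t\<rparr>"
  using subgroup.subgroup_is_group[OF gstab_subgroup[OF b t(1)] is_group] .
 have "card ?H dvd Coset.order (G\<lparr>carrier := gstab G b t\<rparr>)"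
  unfolding Dt.lagrange[OF Hsub, symmetric] by simp
 then have "card ?H dvd p ^ k" using t(2) by (simp add: Coset.order_def)
 then obtain j where j: "j \<le> k" "card ?H = p ^ j" using divides_primepow_nat[OF p] by blast
 have "?H \<noteq> gstab G b t"
 proof
  assume "?H = gstab G b t"
  then have "gstab G b t \<subseteq> gstab G b u" by auto
  moreover have "card (gstab G b u) \<le> card (gstab G b t)"
   using st[OF u(1)] t(2) power_increasing[of _ k p] prime_gt_0_nat[OF p] by fastforce
  ultimately show False using card_seteq[OF fin(2)] u(2) by auto
 qed
 then have "card ?H < card (gstab G b t)" using fin by (intro psubset_card_mono) auto
 then have "j \<noteq> k" using j t by auto
 then show "\<exists>j\<le>k - 1. card (gstab G (\<lambda>g (t, u). (b g t, b g u)) x) = p ^ j"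
  unfolding H using j by (intro exI[of _ j]) auto
 show "(case x of (t, u) => m t u) \<in> C" using C x by (auto simp: tu)
 fix g assume g: "g \<in> carrier G"
 show "(\<lambda>(t, u). m t u) ((\<lambda>(t, u). (b g t, b g u)) x) = cj g (case x of (t, u) => m t u)"
  using eq[OF g, of t u] x by (auto simp: tu)
qed

text \<open>\<open>B\<close> consists of the operators on the old tensor factors, \<open>u\<close>
  and \<open>v\<close> are the projections of the new factor, and \<open>s D\<close> is an odd
  involution of the new factor for each \<open>D\<close> of order \<open>p ^ k\<close>. Let
  \<open>al D\<close> be the part of \<open>tau\<close> with stabilizer \<open>D\<close>. The new
  operator is \<open>Phi = psi + Psi\<close>, where \<open>psi\<close> comes from \<open>f\<close>
  and has the square \<open>c ^ 4 - tau ^ 4\<close>, and \<open>Psi\<close> is the sum of all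
  \<open>ep * al D * al D * s D\<close>. The diagonal terms of the square of \<open>Psi\<close> are
  the fourth powers of the \<open>al D\<close>, and these cancel the part of \<open>tau ^ 4\<close>
  with large stabilizers. What remains are products with two different stabilizers, or summands of
  \<open>tau\<close> whose stabilizer was small already.\<close>

theorem green_step:
 fixes B B' :: "'r set"
 assumes p: "Factorial_Ring.prime (p::nat)" and k: "k \<ge> 1"
  and B: "subrng B" and B': "subrng B'" and BB': "B \<subseteq> B'"
  and P: "P \<in> B" "Q \<in> B" "P + Q = 1" "P * Q = 0" "Q * P = 0" "P * P = P" "Q * Q = Q" "inve P" "inve Q"
  and u: "u \<in> B'" "v \<in> B'" "\<And>x. x \<in> B ==> x * u = u * x" "\<And>x. x \<in> B ==> x * v = v * x"
  and s: "\<And>D. subgroup D G ==> card D = p ^ k ==> s D \<in> B' \<and> s D * s D = 1 \<and> s D * u = v * s D \<and> s D * v = u * s D"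
  and sB: "\<And>D x. subgroup D G ==> card D = p ^ k ==> x \<in> B ==> x * s D = s D * x"
  and scj: "\<And>D g. subgroup D G ==> card D = p ^ k ==> g \<in> carrier G ==> cj g (s D) = s (csub g D)"
  and f: "f \<in> B" "oddP P Q f" "inve f" and c: "coprime c (int p)"
  and ff: "f * f = of_int c - tau" and tau: "Jt p k {x \<in> B. evenP P Q x} tau"
 shows "\<exists>f' c' tau'. f' \<in> B' \<and> oddP (P * u + Q * v) (P * v + Q * u) f' \<and> inve f' \<and> coprime c' (int p) \<and>
  f' * f' = of_int c' - tau' \<and> Jt p (k - 1) {x \<in> B'. evenP (P * u + Q * v) (P * v + Q * u) x} tau'"
proof -
 let ?P = "P * u + Q * v" and ?Q = "P * v + Q * u"
 let ?C = "{x \<in> B. evenP P Q x}" and ?C' = "{x \<in> B'. evenP ?P ?Q x}"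
 note Bs = subrngD[OF B] and B's = subrngD[OF B']
 have even': "evenP ?P ?Q x" if x: "x \<in> B" "evenP P Q x" for x
 proof -
  have "x * (P * u) = P * u * x" "x * (Q * v) = Q * v * x" "x * (P * v) = P * v * x" "x * (Q * u) = Q * u * x"
   using x u(3,4)[OF x(1)] by (simp_all add: evenP_def mult.assoc[symmetric]) (simp_all add: mult.assoc)
  then show ?thesis by (simp add: evenP_def algebra_simps)
 qed
 have odd': "oddP ?P ?Q x" if x: "x \<in> B" "oddP P Q x" for x
 proof -
  have "x * (P * u) = Q * u * x" "x * (Q * v) = P * v * x" "x * (P * v) = Q * v * x" "x * (Q * u) = P * u * x"
   using x u(3,4)[OF x(1)] by (simp_all add: oddP_def mult.assoc[symmetric]) (simp_all add: mult.assoc)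
  then show ?thesis by (simp add: oddP_def algebra_simps)
 qed
 have sodd: "oddP ?P ?Q (s D)" if D: "subgroup D G" "card D = p ^ k" for D
 proof -
  have 1: "P * s D = s D * P" "Q * s D = s D * Q" using sB[OF D] P by auto
  have 2: "s D * u = v * s D" "s D * v = u * s D" using s[OF D] by auto
  have "s D * (P * u) = P * v * s D" "s D * (P * v) = P * u * s D"
   "s D * (Q * u) = Q * v * s D" "s D * (Q * v) = Q * u * s D"
   by (simp_all add: mult.assoc[symmetric] 1[symmetric]) (simp_all add: mult.assoc 2)
  then show ?thesis by (simp add: oddP_def algebra_simps)
 qed
 have C': "subrng ?C'" by (rule subrng_evenP[OF B'])
 have CC': "x \<in> ?C'" if "x \<in> ?C" for x using that even' BB' by auto
 obtain T b l where T: "finite (T::nat set)" and b: "gset G T b"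
  and st: "\<And>t. t \<in> T ==> \<exists>j\<le>k. card (gstab G b t) = p ^ j"
  and l: "\<And>t. t \<in> T ==> l t \<in> ?C" and leq: "\<And>g t. g \<in> carrier G ==> t \<in> T ==> l (b g t) = cj g (l t)"
  and tau_sum: "tau = (\<Sum>t\<in>T. l t)"
  using tau unfolding Jt_def by blast
 define S where "S t = gstab G b t" for t
 define T1 where "T1 = {t \<in> T. card (S t) = p ^ k}"
 define D1 where "D1 = S ` T1"
 have finT1: "finite T1" "finite D1" using T by (auto simp: T1_def D1_def)
 have D1: "subgroup D G" "card D = p ^ k" "D \<subseteq> carrier G" if "D \<in> D1" for D
  using that gstab_subgroup[OF b] by (auto simp: D1_def T1_def S_def gstab_def)
 have Sg: "S (b g t) = csub g (S t)" if "g \<in> carrier G" "t \<in> T" for g t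
  using gstab_act[OF b that] by (simp add: S_def)
 have ScG: "S t \<subseteq> carrier G" for t by (auto simp: S_def gstab_def)
 \<comment> \<open>\<open>al D\<close> gathers the summands with stabilizer exactly
   \<open>D\<close>, \<open>om D\<close> all the others. A product with one factor from each, where
   \<open>D\<close> has order \<open>p ^ k\<close>, is harmless by \<open>Jt_pairs\<close>.\<close>
 define al where "al D = (\<Sum>t | t \<in> T \<and> S t = D. l t)" for D
 define om where "om D = (\<Sum>t | t \<in> T \<and> S t \<noteq> D. l t)" for D
 have alom: "al D + om D = tau" for D
 proof -
  have "(\<Sum>t\<in>{t \<in> T. S t = D} \<union> {t \<in> T. S t \<noteq> D}. l t) = al D + om D"
   unfolding al_def om_def using T by (intro sum.union_disjoint) auto
  moreover have "{t \<in> T. S t = D} \<union> {t \<in> T. S t \<noteq> D} = T" by auto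
  ultimately show ?thesis by (simp add: tau_sum)
 qed
 have Cs: "subrng ?C" by (rule subrng_evenP[OF B])
 note Css = subrngD[OF Cs]
 have alC: "al D \<in> ?C" "om D \<in> ?C" for D unfolding al_def om_def by (rule subrng_sum[OF Cs], use l in blast)+
 have tauC: "tau \<in> ?C" unfolding tau_sum by (rule subrng_sum[OF Cs]) (use l in blast)
 have ci: "of_int z * x = x * of_int z" for z and x :: 'r by (rule mult_of_int_commute)
 have tau_f: "tau * f = f * tau"
 proof -
  have t: "tau = of_int c - f * f" using ff by simp
  show ?thesis unfolding t by (simp add: left_diff_distrib right_diff_distrib mult.assoc ci[of c f])
 qed
 have tau_inv: "inve tau"
 proof -
  have "tau = of_int c - f * f" using ff by simp
  then show ?thesis using f(3) by (simp add: inve_simps)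
 qed
 have al_cj: "cj g (al D) = al (csub g D)" if g: "g \<in> carrier G" and D: "D \<subseteq> carrier G" for g D
 proof -
  have "bij_betw (b g) {t \<in> T. S t = D} {t \<in> T. S t = csub g D}"
  proof (rule bij_betw_subset[OF gset_bij[OF b g]])
   show "b g ` {t \<in> T. S t = D} = {t \<in> T. S t = csub g D}"
   proof (intro equalityI subsetI)
    fix t assume t: "t \<in> {t \<in> T. S t = csub g D}"
    then obtain t' where t': "t' \<in> T" "t = b g t'" using gset_bij[OF b g] by (auto simp: bij_betw_def)
    then show "t \<in> b g ` {t \<in> T. S t = D}" using t Sg[OF g t'(1)] csub_inj[OF g ScG D] by auto
   qed (use Sg[OF g] gsetD(1)[OF b g] in auto)
  qed auto
  then have "al (csub g D) = (\<Sum>t | t \<in> T \<and> S t = D. l (b g t))"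
   unfolding al_def by (rule sum.reindex_bij_betw[symmetric])
  also have "\<dots> = cj g (al D)" using leq[OF g] by (simp add: al_def cj_sum)
  finally show ?thesis by simp
 qed
 \<comment> \<open>An expression that is additive in one occurrence of \<open>al D\<close>, summed
   over the subgroups \<open>D\<close>, becomes a sum over points. Only in that form can it be
   recognized as an instance of \<open>Jt\<close>.\<close>
 have al_group: "(\<Sum>D\<in>D1. F D (al D)) = (\<Sum>t\<in>T1. F (S t) (l t))"
  if Fsum: "\<And>D (X :: nat set) h. F D (\<Sum>t\<in>X. h t) = (\<Sum>t\<in>X. F D (h t))" for F :: "'a set => 'r => 'r"
 proof -
  have "F D (al D) = (\<Sum>t | t \<in> T1 \<and> S t = D. F (S t) (l t))" if "D \<in> D1" for D
  proof -
   have "{t \<in> T. S t = D} = {t \<in> T1. S t = D}" using D1[OF that] by (auto simp: T1_def)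
   then have "F D (al D) = F D (\<Sum>t | t \<in> T1 \<and> S t = D. l t)" by (simp add: al_def)
   also have "\<dots> = (\<Sum>t | t \<in> T1 \<and> S t = D. F D (l t))" by (rule Fsum)
   also have "\<dots> = (\<Sum>t | t \<in> T1 \<and> S t = D. F (S t) (l t))" by (rule sum.cong) auto
   finally show ?thesis .
  qed
  then have "(\<Sum>D\<in>D1. F D (al D)) = (\<Sum>D\<in>D1. \<Sum>t | t \<in> T1 \<and> S t = D. F (S t) (l t))" by simp
  also have "\<dots> = (\<Sum>t\<in>T1. F (S t) (l t))" by (rule sum.group) (use finT1 in \<open>auto simp: D1_def\<close>)
  finally show ?thesis .
 qed
 have tauR: "tau ^ n \<in> ?C" for n by (rule subrng_power[OF Cs tauC])
 \<comment> \<open>The geometric sum with \<open>(c - tau) * q = c ^ 4 - tau ^ 4\<close>. The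
   exponent 4 is dictated by \<open>Psi\<close>: its coefficients have to be squares of the
   \<open>al D\<close>, and squaring them again gives fourth powers.\<close>
 define q where "q = of_int (c^3) + of_int (c^2) * tau + of_int c * tau^2 + tau^3"
 have q: "q \<in> ?C" unfolding q_def
  by (intro Css(3) Css(5) subrng_of_int[OF Cs] tauR tauC)
 have q_comm: "q * y = y * q" if "tau * y = y * tau" for y unfolding q_def
  by (intro comm_add comm_mult ci power_commuting_commutes that)
 have q_tau: "q * tau = tau * q" by (rule q_comm) simp
 have q_f: "q * f = f * q" by (rule q_comm[OF tau_f])
 have q_c: "(of_int c - tau) * q = of_int (c^4) - tau^4"
 proof -
  have c: "of_int c * tau^n = tau^n * of_int c" for n by (rule ci)
  have "q = of_int c^3 + of_int c^2 * tau + of_int c * tau^2 + tau^3" by (simp add: q_def)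
  moreover have "of_int c * of_int c^3 = (of_int c^4 :: 'r)" "of_int c * (of_int c^2 * tau) = of_int c^3 * tau"
   "of_int c * (of_int c * tau^2) = of_int c^2 * tau^2"
   by (simp_all add: power4_eq_xxxx power2_eq_square power3_eq_cube mult.assoc)
  moreover have "tau * of_int c^3 = of_int c^3 * tau" using ci[of "c^3" tau] by simp
  moreover have "tau * (of_int c^2 * tau) = of_int c^2 * tau^2"
   using ci[of "c^2" tau, symmetric] by (simp add: mult.assoc[symmetric] power2_eq_square[of tau])
  moreover have "tau * (of_int c * tau^2) = of_int c * tau^3" "tau * tau^3 = tau^4"
   using ci[of c tau, symmetric] by (simp_all add: mult.assoc[symmetric] power4_eq_xxxx power2_eq_square[of tau] power3_eq_cube[of tau])
  ultimately show ?thesis by (simp add: left_diff_distrib distrib_left)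
 qed
 have q_P: "q * P = P * q" "q * Q = Q * q" using q by (auto simp: evenP_def)
 \<comment> \<open>As in \<open>Rel_scale\<close>, the factor \<open>q\<close> is inserted on one
   parity only, which multiplies the square of \<open>f\<close> by \<open>q\<close> without a square
   root of \<open>q\<close>.\<close>
 define R where "R = P + q * Q"
 define R' where "R' = Q + q * P"
 have Rf: "R * f = f * R'"
 proof -
  have "P * f = f * Q" "Q * f = f * P" using f(2) by (auto simp: oddP_def)
  moreover have "q * Q * f = f * (q * P)"
   by (simp add: mult.assoc \<open>Q * f = f * P\<close>) (simp add: mult.assoc[symmetric] q_f)
  ultimately show ?thesis unfolding R_def R'_def by (simp add: distrib_left distrib_right)
 qed
 have "R' * R = Q * P + Q * (q * Q) + q * (P * P) + q * (P * (q * Q))" unfolding R_def R'_def by (simp add: algebra_simps)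
 also have "Q * (q * Q) = q * Q" by (simp add: mult.assoc[symmetric] q_P(2)[symmetric]) (simp add: mult.assoc P)
 also have "P * (q * Q) = 0" by (simp add: mult.assoc[symmetric] q_P(1)[symmetric]) (simp add: mult.assoc P)
 also have "Q * P + q * Q + q * (P * P) + q * 0 = q * (P + Q)" unfolding distrib_left by (simp add: P(5,6))
 finally have R'R: "R' * R = q" by (simp add: P)
 define psi where "psi = f * R"
 have psi2: "psi * psi = of_int (c^4) - tau^4"
 proof -
  have "psi * psi = f * (R * f) * R" by (simp add: psi_def mult.assoc)
  also have "\<dots> = f * f * (R' * R)" by (simp add: Rf mult.assoc)
  finally show ?thesis using q_c by (simp add: R'R ff)
 qed
 have RC: "R \<in> ?C" unfolding R_def using q P by (intro Css(3) Css(5)) (auto simp: evenP_def)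
 have psi: "psi \<in> B" "oddP P Q psi" using f RC by (auto simp: psi_def Bs parity_mult)
 have q_inv: "inve q" unfolding q_def by (intro inve_simps tau_inv)
 have psi_inv: "inve psi" unfolding psi_def R_def by (intro inve_simps f P q_inv)
 have tau_PQ: "tau * P = P * tau" "tau * Q = Q * tau" using tauC by (auto simp: evenP_def)
 have R_tau: "R * tau = tau * R" unfolding R_def by (intro comm_add comm_mult q_tau) (simp_all add: tau_PQ)
 have "psi * tau = tau * psi" unfolding psi_def by (intro comm_mult R_tau) (simp add: tau_f)
 then have tau_psi: "tau * psi = psi * tau" by simp
 \<comment> \<open>The sign operator. It commutes with even elements of \<open>B\<close> and
   anticommutes with \<open>psi\<close>, so that the sum \<open>psi * Psi + Psi * psi\<close> turns
   into commutators of \<open>psi\<close> with the \<open>be D\<close>.\<close>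
 define ep where "ep = P - Q"
 have epB: "ep \<in> B" "inve ep" using P by (auto simp: ep_def Bs inve_simps)
 have ep2: "ep * ep = 1" using P by (simp add: ep_def algebra_simps)
 have ep_even: "ep * x = x * ep" if "x \<in> ?C" for x using that by (simp add: ep_def evenP_def algebra_simps)
 have epC: "ep \<in> ?C" using epB P by (simp add: ep_def evenP_def algebra_simps)
 have psi_ep: "psi * ep = - (ep * psi)" using psi by (simp add: ep_def oddP_def algebra_simps)
 define be where "be D = al D * al D" for D
 define Psi where "Psi = (\<Sum>D\<in>D1. ep * be D * s D)"
 define Phi where "Phi = psi + Psi"

 have Jerr: "Jt p (k - 1) ?C' (\<Sum>t\<in>T1. \<Sum>w | w \<in> T \<and> S w \<noteq> S t. m t w)"
  if mC: "\<And>t w. t \<in> T1 ==> w \<in> T ==> S w \<noteq> S t ==> m t w \<in> ?C'"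
   and meq: "\<And>g t w. g \<in> carrier G ==> t \<in> T1 ==> w \<in> T ==> m (b g t) (b g w) = cj g (m t w)" for m
  unfolding S_def
  by (rule Jt_pairs[OF p T b st]) (use mC meq in \<open>auto simp: T1_def S_def\<close>)
 have Jdiff: "Jt p (k - 1) ?C' (x - y)" if "Jt p (k - 1) ?C' x" "Jt p (k - 1) ?C' y" for x y
 proof -
  have "Jt p (k - 1) ?C' (of_int (- 1) * y * 1)"
   by (rule Jt_mult[OF that(2)]) (auto simp: inve_simps(1) inve_simps(2)[of "-1", simplified] B's parity_mult evenP_def)
  from Jt_add[OF that(1) this] show ?thesis by simp
 qed
 have lC': "l t \<in> B'" "evenP ?P ?Q (l t)" if "t \<in> T" for t using CC'[OF l[OF that]] by auto
 have epC': "ep \<in> B'" "evenP ?P ?Q ep" using CC'[OF epC] by auto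
 have alC': "al D \<in> B'" "evenP ?P ?Q (al D)" for D using CC'[OF alC(1)] by auto
 have psi': "psi \<in> B'" "oddP ?P ?Q psi" using odd'[OF psi] psi BB' by auto
 have T1: "t \<in> T" "subgroup (S t) G" "card (S t) = p ^ k" if "t \<in> T1" for t
  using that gstab_subgroup[OF b] by (auto simp: T1_def S_def)
 have sS: "s (S t) \<in> B'" "oddP ?P ?Q (s (S t))" "s (S t) * s (S t) = 1" if "t \<in> T1" for t
  using T1[OF that] s sodd by auto
 have scS: "cj g (s (S t)) = s (S (b g t))" if "g \<in> carrier G" "t \<in> T1" for g t
  using scj[OF T1(2,3)[OF that(2)] that(1)] Sg[OF that(1) T1(1)[OF that(2)]] by simp
 have alS: "cj g (al (S t)) = al (S (b g t))" if "g \<in> carrier G" "t \<in> T1" for g t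
  using al_cj[OF that(1) ScG] Sg[OF that(1) T1(1)[OF that(2)]] by simp
 have T1g: "b g t \<in> T1 \<longleftrightarrow> t \<in> T1" if "g \<in> carrier G" "t \<in> T" for g t
  using gsetD(1)[OF b that] that Sg[OF that] card_csub[OF that(1) ScG] by (auto simp: T1_def)
 have cjp: "cj g psi = psi" "cj g ep = ep" if "g \<in> carrier G" for g
  using that psi_inv epB by (auto simp: inve_def)
 note par = parity_mult[of ?P ?Q] parity_add[of ?P ?Q]

 \<comment> \<open>The four terms of \<open>square_commutator\<close>, with \<open>al\<close> and
   \<open>om\<close> resolved into their summands \<open>l t\<close> and \<open>l w\<close>.\<close>
 define m1 where "m1 t w = ep * (l t * psi * l w - l t * l w * psi - l w * psi * l t + psi * l w * l t) * s (S t)" for t w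
 define err1 where "err1 = (\<Sum>t\<in>T1. \<Sum>w | w \<in> T \<and> S w \<noteq> S t. m1 t w)"
 have J1: "Jt p (k - 1) ?C' err1" unfolding err1_def
 proof (rule Jerr)
  fix t w assume t: "t \<in> T1" and w: "w \<in> T"
  note tT = T1(1)[OF t]
  show "m1 t w \<in> ?C'" unfolding m1_def
   using lC'[OF tT] lC'[OF w] epC' psi' sS[OF t] by (simp add: B's par)
  fix g assume g: "g \<in> carrier G"
  show "m1 (b g t) (b g w) = cj g (m1 t w)"
   using leq[OF g tT] leq[OF g w] scS[OF g t] cjp[OF g]
   by (simp add: m1_def cj_mult[OF g] cj_add cj_diff)
 qed
 have err1: "(\<Sum>D\<in>D1. ep * (be D * psi - psi * be D) * s D) = err1"
 proof -
  define F where "F D x = ep * (x * psi * om D - x * om D * psi - om D * psi * x + psi * om D * x) * s D" for D x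
  have "ep * (be D * psi - psi * be D) * s D = F D (al D)" for D
   unfolding be_def F_def using square_commutator[of "al D" "om D" psi] tau_psi by (simp add: alom)
  then have "(\<Sum>D\<in>D1. ep * (be D * psi - psi * be D) * s D) = (\<Sum>D\<in>D1. F D (al D))" by simp
  also have "\<dots> = (\<Sum>t\<in>T1. F (S t) (l t))"
   by (rule al_group) (simp add: F_def sum_distrib_left sum_distrib_right sum.distrib[symmetric] sum_subtractf[symmetric])
  also have "\<dots> = err1" unfolding err1_def F_def m1_def om_def
   by (simp add: sum_distrib_left sum_distrib_right sum.distrib[symmetric] sum_subtractf[symmetric])
  finally show ?thesis .
 qed

 define y where "y t = ep * (l t * al (S t)) * s (S t)" for t
 have yC: "y t \<in> B'" "oddP ?P ?Q (y t)" if "t \<in> T1" for t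
  unfolding y_def using lC'[OF T1(1)[OF that]] epC' alC' sS[OF that] by (simp_all add: B's par)
 have ycj: "cj g (y t) = y (b g t)" if "g \<in> carrier G" "t \<in> T1" for g t
  unfolding y_def using leq[OF that(1) T1(1)[OF that(2)]] cjp[OF that(1)] alS[OF that] scS[OF that]
  by (simp add: cj_mult[OF that(1)])
 have Psi_y: "Psi = (\<Sum>t\<in>T1. y t)"
  unfolding Psi_def y_def be_def
  by (rule al_group[of "\<lambda>D x. ep * (x * al D) * s D"]) (simp add: sum_distrib_left sum_distrib_right)
 have cjPsi: "cj g Psi = Psi" if g: "g \<in> carrier G" for g
 proof -
  have "bij_betw (b g) T1 T1"
  proof (rule bij_betw_subset[OF gset_bij[OF b g]])
   show "b g ` T1 = T1"
   proof (intro equalityI subsetI)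
    fix t assume t: "t \<in> T1"
    then obtain t' where t': "t' \<in> T" "t = b g t'" using gset_bij[OF b g] T1(1) by (auto simp: bij_betw_def)
    then show "t \<in> b g ` T1" using t T1g[OF g t'(1)] by auto
   qed (use T1g[OF g] T1(1) in auto)
  qed (use T1(1) in auto)
  then have "(\<Sum>t\<in>T1. y (b g t)) = Psi" unfolding Psi_y by (rule sum.reindex_bij_betw)
  then show ?thesis using ycj[OF g] by (simp add: Psi_y cj_sum)
 qed
 \<comment> \<open>\<open>Psi\<close> involves only points of \<open>T1\<close>; the value
   \<open>0\<close> elsewhere lets \<open>w\<close> range over all of \<open>T\<close>, as
   \<open>Jt_pairs\<close> expects.\<close>
 define m2 where "m2 t w = (if w \<in> T1 then y t * y w else 0)" for t w
 define err2 where "err2 = (\<Sum>t\<in>T1. \<Sum>w | w \<in> T \<and> S w \<noteq> S t. m2 t w)"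
 have J2: "Jt p (k - 1) ?C' err2" unfolding err2_def
 proof (rule Jerr)
  fix t w assume t: "t \<in> T1" and w: "w \<in> T"
  show "m2 t w \<in> ?C'" unfolding m2_def using yC[OF t] yC[of w] by (simp add: B's par evenP_simps)
  fix g assume g: "g \<in> carrier G"
  show "m2 (b g t) (b g w) = cj g (m2 t w)" unfolding m2_def
   using ycj[OF g t] ycj[OF g, of w] T1g[OF g w] by (simp add: cj_mult[OF g] cj_zero)
 qed
 \<comment> \<open>This equals the sum of the powers \<open>al D ^ Suc n\<close>, with one factor
   resolved into summands. It is the part of \<open>tau ^ Suc n\<close> in which all factors share a
   single stabilizer of order \<open>p ^ k\<close>.\<close>
 define X where "X n = (\<Sum>t\<in>T1. l t * al (S t) ^ n)" for n
 have PsiPsi: "Psi * Psi = X 3 + err2"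
 proof -
  have "(\<Sum>w\<in>T1. y w) = (\<Sum>w | w \<in> T1 \<and> S w = S t. y w) + (\<Sum>w | w \<in> T \<and> S w \<noteq> S t. if w \<in> T1 then y w else 0)"
   if t: "t \<in> T1" for t
  proof -
   have "(\<Sum>w | w \<in> T \<and> S w \<noteq> S t. if w \<in> T1 then y w else 0) = (\<Sum>w | w \<in> T1 \<and> S w \<noteq> S t. y w)"
    using T by (subst sum.inter_filter[symmetric]) (auto intro!: sum.cong simp: T1_def)
   moreover have "T1 = {w \<in> T1. S w = S t} \<union> {w \<in> T1. S w \<noteq> S t}" by auto
   then have "(\<Sum>w\<in>T1. y w) = (\<Sum>w\<in>{w \<in> T1. S w = S t} \<union> {w \<in> T1. S w \<noteq> S t}. y w)" by simp
   ultimately show ?thesis using finT1 by (simp add: sum.union_disjoint disjoint_iff)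
  qed
  moreover have "y t * (\<Sum>w | w \<in> T1 \<and> S w = S t. y w) = l t * al (S t) ^ 3" if t: "t \<in> T1" for t
  proof -
   have "{w \<in> T1. S w = S t} = {w \<in> T. S w = S t}" using T1[OF t] by (auto simp: T1_def)
   then have "(\<Sum>w | w \<in> T1 \<and> S w = S t. y w) = (\<Sum>w | w \<in> T \<and> S w = S t. ep * (l w * al (S t)) * s (S t))"
    by (simp add: y_def)
   also have "\<dots> = ep * (al (S t) * al (S t)) * s (S t)"
    unfolding sum_distrib_left[symmetric] sum_distrib_right[symmetric] al_def[symmetric] ..
   finally have 1: "(\<Sum>w | w \<in> T1 \<and> S w = S t. y w) = ep * (al (S t) * al (S t)) * s (S t)" .
   define A where "A = al (S t)"
   define sg where "sg = s (S t)"
   have A: "ep * A = A * ep" using ep_even[OF alC(1)] by (simp add: A_def)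
   have L: "ep * l t = l t * ep" using ep_even[OF l[OF T1(1)[OF t]]] .
   have sg: "sg * ep = ep * sg" "sg * A = A * sg" "sg * sg = 1"
    using sB[OF T1(2,3)[OF t]] epB alC(1) sS[OF t] by (auto simp: A_def sg_def)
   have "ep * (l t * A) * sg * (ep * (A * A) * sg) = ep * l t * A * (sg * ep) * A * A * sg" by (simp add: mult.assoc)
   also have "\<dots> = ep * l t * (A * ep) * (sg * A) * A * sg" by (simp add: sg(1) mult.assoc)
   also have "\<dots> = ep * (l t * ep) * A * A * (sg * A) * sg" by (simp add: A[symmetric] sg(2) mult.assoc)
   also have "\<dots> = ep * ep * l t * A * A * A * (sg * sg)" by (simp add: L[symmetric] sg(2) mult.assoc)
   finally show ?thesis unfolding 1 unfolding y_def A_def[symmetric] sg_def[symmetric]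
    by (simp add: ep2 sg(3) power3_eq_cube mult.assoc)
  qed
  ultimately have "y t * (\<Sum>w\<in>T1. y w) = l t * al (S t) ^ 3 + (\<Sum>w | w \<in> T \<and> S w \<noteq> S t. m2 t w)" if "t \<in> T1" for t
   using that by (simp add: distrib_left m2_def sum_distrib_left if_distrib[of "\<lambda>x. y t * x"] cong: if_cong)
  then show ?thesis by (simp add: Psi_y sum_distrib_right X_def err2_def sum.distrib)
 qed

 have JX: "Jt p (k - 1) ?C' (tau * X n - X (Suc n))" for n
 proof -
  define m3 where "m3 t w = l w * (l t * al (S t) ^ n)" for t w
  have "Jt p (k - 1) ?C' (\<Sum>t\<in>T1. \<Sum>w | w \<in> T \<and> S w \<noteq> S t. m3 t w)"
  proof (rule Jerr)
   fix t w assume t: "t \<in> T1" and w: "w \<in> T"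
   have "al (S t) ^ n \<in> ?C'" by (rule subrng_power[OF C']) (use alC' in auto)
   then show "m3 t w \<in> ?C'" unfolding m3_def using lC'[OF w] lC'[OF T1(1)[OF t]] by (simp add: B's par)
   fix g assume g: "g \<in> carrier G"
   show "m3 (b g t) (b g w) = cj g (m3 t w)" unfolding m3_def
    using leq[OF g T1(1)[OF t]] leq[OF g w] alS[OF g t] by (simp add: cj_mult[OF g] cj_power[OF g])
  qed
  moreover have "tau * X n - X (Suc n) = (\<Sum>t\<in>T1. \<Sum>w | w \<in> T \<and> S w \<noteq> S t. m3 t w)"
  proof -
   have "(\<Sum>t\<in>T1. al (S t) * l t * al (S t) ^ n) = (\<Sum>D\<in>D1. al D * al D * al D ^ n)"
    by (rule al_group[of "\<lambda>D x. al D * x * al D ^ n", symmetric]) (simp add: sum_distrib_left sum_distrib_right)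
   also have "\<dots> = (\<Sum>D\<in>D1. al D * al D ^ Suc n)" by (simp add: mult.assoc)
   also have "\<dots> = X (Suc n)" unfolding X_def
    by (rule al_group[of "\<lambda>D x. x * al D ^ Suc n"]) (simp add: sum_distrib_left sum_distrib_right)
   finally have 1: "(\<Sum>t\<in>T1. al (S t) * l t * al (S t) ^ n) = X (Suc n)" .
   have "tau * X n = (\<Sum>t\<in>T1. tau * (l t * al (S t) ^ n))" by (simp add: X_def sum_distrib_left)
   also have "\<dots> = (\<Sum>t\<in>T1. al (S t) * l t * al (S t) ^ n + om (S t) * (l t * al (S t) ^ n))"
   proof (rule sum.cong)
    show "tau * (l t * al (S t) ^ n) = al (S t) * l t * al (S t) ^ n + om (S t) * (l t * al (S t) ^ n)" for t
     unfolding alom[of "S t", symmetric] by (simp add: distrib_right mult.assoc)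
   qed simp
   also have "\<dots> = X (Suc n) + (\<Sum>t\<in>T1. om (S t) * (l t * al (S t) ^ n))" using 1 by (simp add: sum.distrib)
   finally show ?thesis by (simp add: om_def m3_def sum_distrib_right)
  qed
  ultimately show ?thesis by simp
 qed
 have J0: "Jt p (k - 1) ?C' (tau - X 0)"
 proof (rule Jt_intro[where T = "T - T1" and b = b and l = l])
  show "finite (T - T1)" using T by simp
  show "gset G (T - T1) b" by (rule gset_subset[OF b]) (use T1g gsetD(1)[OF b] in auto)
  show "tau - X 0 = (\<Sum>t\<in>T - T1. l t)" using T by (simp add: tau_sum X_def sum_diff T1_def)
  fix t assume t: "t \<in> T - T1"
  then obtain j where j: "j \<le> k" "card (gstab G b t) = p ^ j" using st by auto
  then have "j \<noteq> k" using t by (auto simp: T1_def S_def)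
  then show "\<exists>j\<le>k - 1. card (gstab G b t) = p ^ j" using j by (intro exI[of _ j]) auto
  show "l t \<in> ?C'" using t lC' by auto
  show "l (b g t) = cj g (l t)" if "g \<in> carrier G" for g using leq that t by auto
 qed
 have JT: "Jt p (k - 1) ?C' (tau ^ n * x)" if "Jt p (k - 1) ?C' x" for n x
 proof -
  have "Jt p (k - 1) ?C' (tau ^ n * x * 1)"
   by (rule Jt_mult[OF that inve_simps(6)[OF tau_inv] inve_simps(1)]) (use CC'[OF tauR[of n]] in \<open>auto simp: B's par\<close>)
  then show ?thesis by simp
 qed
 \<comment> \<open>A telescoping sum. Each step trades one factor \<open>tau\<close> for
   \<open>al D\<close> and leaves a factor \<open>om D\<close>; the term \<open>tau - X 0\<close>
   merely drops the points of \<open>T1\<close>.\<close>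
 have "tau ^ 4 - X 3 = tau ^ 3 * (tau - X 0) + (tau ^ 2 * (tau * X 0 - X (Suc 0)) +
   (tau ^ 1 * (tau * X (Suc 0) - X (Suc (Suc 0))) + (tau * X (Suc (Suc 0)) - X (Suc (Suc (Suc 0))))))"
  by (simp add: right_diff_distrib power4_eq_xxxx power3_eq_cube power2_eq_square mult.assoc eval_nat_numeral)
 also have "Jt p (k - 1) ?C' \<dots>" by (intro Jt_add JT JX J0)
 finally have J4: "Jt p (k - 1) ?C' (tau ^ 4 - X 3)" .

 have cross: "psi * Psi + Psi * psi = err1"
 proof -
  have "psi * (ep * be D * s D) + ep * be D * s D * psi = ep * (be D * psi - psi * be D) * s D" if "D \<in> D1" for D
  proof -
   have 1: "s D * psi = psi * s D" using sB[OF D1(1,2)[OF that] psi(1)] by simp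
   have "psi * (ep * be D * s D) = - (ep * (psi * be D) * s D)"
    using arg_cong[OF psi_ep, of "\<lambda>x. x * be D * s D"] by (simp add: mult.assoc)
   moreover have "ep * be D * s D * psi = ep * (be D * psi) * s D" using 1 by (simp add: mult.assoc)
   ultimately show ?thesis by (simp add: algebra_simps)
  qed
  then show ?thesis unfolding err1[symmetric] Psi_def
   by (simp add: sum_distrib_left sum_distrib_right sum.distrib[symmetric])
 qed
 have "Phi * Phi = of_int (c ^ 4) - ((tau ^ 4 - X 3) - err1 - err2)"
  using cross PsiPsi psi2 unfolding Phi_def by (simp add: distrib_left distrib_right algebra_simps)
 moreover have "Jt p (k - 1) ?C' ((tau ^ 4 - X 3) - err1 - err2)" by (intro Jdiff J4 J1 J2)
 moreover have "Phi \<in> B'" unfolding Phi_def Psi_y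
  by (intro B's(3) psi' subrng_sum[OF B'] yC)
 moreover have "oddP ?P ?Q Phi" unfolding Phi_def Psi_y
  by (intro parity_add(3) psi' oddP_sum yC)
 moreover have "inve Phi" unfolding Phi_def by (intro inve_simps psi_inv) (simp add: inve_def cjPsi)
 moreover have "coprime (c ^ 4) (int p)" using c by simp
 ultimately show ?thesis by blast
qed

end

text \<open>The even and odd projections of a product of graded factors with projections
  \<open>u i\<close> and \<open>v i\<close>. The empty product is purely even, whence the start
  \<open>(1, 0)\<close>.\<close>

primrec parity_pair :: "(nat => 'r::ring_1) => (nat => 'r) => nat => 'r \<times> 'r" where
 "parity_pair u v 0 = (1, 0)"
| "parity_pair u v (Suc i) = (let P = fst (parity_pair u v i); Q = snd (parity_pair u v i)
   in (P * u i + Q * v i, P * v i + Q * u i))"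

context ring_action
begin

text \<open>The exponent is positive: for the trivial subgroup, which is always normal, no odd
  involution can be expected.\<close>

definition psub :: "nat => 'a set => bool" where
 "psub p D \<longleftrightarrow> subgroup D G \<and> (\<exists>m\<ge>1. card D = p ^ m)"

text \<open>Step \<open>i\<close> spends the tensor factor \<open>i\<close> and reduces the bound on
  the stabilizers from \<open>p ^ (a - i)\<close> to \<open>p ^ (a - Suc i)\<close>; after
  \<open>a\<close> steps they are trivial. The commutation hypotheses say that operators of
  different factors act independently.\<close>

lemma green_iterate:
 fixes u v :: "nat => 'r" and s :: "nat => 'a set => 'r"
 assumes p: "Factorial_Ring.prime (p::nat)" and L: "subrng L"
  and S: "subgroup S G" "card S = p ^ a" "\<not> p dvd card (lcosets S)"
  and uvL: "\<And>i. i < a ==> u i \<in> L \<and> v i \<in> L \<and> inve (u i) \<and> inve (v i)"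
  and uv: "\<And>i. i < a ==> u i + v i = 1 \<and> u i * v i = 0 \<and> v i * u i = 0"
  and uvc: "\<And>i j. i < a ==> j < a ==> u i * u j = u j * u i \<and> u i * v j = v j * u i \<and> v i * v j = v j * v i"
  and s: "\<And>i D. i < a ==> psub p D ==> s i D \<in> L \<and> s i D * s i D = 1 \<and> s i D * u i = v i * s i D \<and> s i D * v i = u i * s i D"
  and sc: "\<And>i j D. i < a ==> j < a ==> i \<noteq> j ==> psub p D ==> s i D * u j = u j * s i D \<and> s i D * v j = v j * s i D"
  and ss: "\<And>i j D E. i < a ==> j < a ==> i \<noteq> j ==> psub p D ==> psub p E ==> s i D * s j E = s j E * s i D"
  and scj: "\<And>i D g. i < a ==> psub p D ==> g \<in> carrier G ==> cj g (s i D) = s i (csub g D)"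
 shows "\<exists>f c tau. f \<in> L \<and> oddP (fst (parity_pair u v a)) (snd (parity_pair u v a)) f \<and> inve f \<and> coprime c (int p) \<and>
  f * f = of_int c - tau \<and> Jt p 0 L tau"
proof -
 \<comment> \<open>The commutant of everything that belongs to the factors from \<open>i\<close> on.
   It plays the role of the operators on the first \<open>i\<close> factors, and it contains what
   step \<open>i\<close> adds as soon as the index is raised.\<close>
 define B where "B i = {x \<in> L. \<forall>j. i \<le> j \<and> j < a \<longrightarrow> x * u j = u j * x \<and> x * v j = v j * x \<and>
   (\<forall>D. psub p D \<longrightarrow> x * s j D = s j D * x)}" for i
 define P where "P i = fst (parity_pair u v i)" for i
 define Q where "Q i = snd (parity_pair u v i)" for i
 have P0: "P 0 = 1" "Q 0 = 0" by (simp_all add: P_def Q_def)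
 have PS: "P (Suc i) = P i * u i + Q i * v i" "Q (Suc i) = P i * v i + Q i * u i" for i
  by (simp_all add: P_def Q_def Let_def)
 have cm: "x * y * z = z * (x * y)" if "x * z = z * x" "y * z = z * y" for x y z :: 'r
  using comm_mult[OF that] .
 have B: "subrng (B i)" for i
 proof -
  note Ls = subrngD[OF L]
  show ?thesis unfolding subrng_def
  proof (intro conjI ballI)
   show "1 \<in> B i" by (simp add: B_def Ls)
   fix x y assume x: "x \<in> B i" and y: "y \<in> B i"
   then show "x + y \<in> B i" "x - y \<in> B i" by (simp_all add: B_def Ls algebra_simps)
   show "x * y \<in> B i" using x y Ls(5) cm by (simp add: B_def)
  qed
 qed
 have BB: "B i \<subseteq> B (Suc i)" for i by (auto simp: B_def)
 have uB: "u i \<in> B (Suc i)" "v i \<in> B (Suc i)" if "i < a" for i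
  using uvL[OF that] uvc[OF that] uvc[OF _ that] sc[OF _ that] by (auto simp: B_def)
 have sB: "s i D \<in> B (Suc i)" if "i < a" "psub p D" for i D
  using s[OF that] sc[OF that(1) _ _ that(2)] ss[OF that(1) _ _ that(2)] by (auto simp: B_def)
 have PQ: "P i \<in> B i \<and> Q i \<in> B i \<and> P i + Q i = 1 \<and> P i * Q i = 0 \<and> Q i * P i = 0 \<and> inve (P i) \<and> inve (Q i)"
  if "i \<le> a" for i
  using that
 proof (induction i)
  case 0
  have "inve 0" by (simp add: inve_def cj_zero)
  then show ?case using subrngD[OF B[of 0]] by (simp add: P0 inve_simps)
 next
  case (Suc i)
  then have i: "i < a" and IH: "P i \<in> B i" "Q i \<in> B i" "P i + Q i = 1" "P i * Q i = 0" "Q i * P i = 0"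
   "inve (P i)" "inve (Q i)" by auto
  note Bs = subrngD[OF B[of "Suc i"]]
  have c: "P i * u i = u i * P i" "P i * v i = v i * P i" "Q i * u i = u i * Q i" "Q i * v i = v i * Q i"
   using IH(1,2) i by (auto simp: B_def)
  note uvi = uv[OF i]
  have m: "x * y * (z * w) = x * z * (y * w)" if "y * z = z * y" for x y z w :: 'r
  proof -
   have "x * y * (z * w) = x * (y * z) * w" by (simp only: mult.assoc)
   also have "\<dots> = x * z * (y * w)" by (simp only: that mult.assoc)
   finally show ?thesis .
  qed
  have "P (Suc i) * Q (Suc i) = P i * P i * (u i * v i) + P i * Q i * (u i * u i) + (Q i * P i * (v i * v i) + Q i * Q i * (v i * u i))"
   unfolding PS distrib_left distrib_right
   by (simp add: m[OF c(1)[symmetric]] m[OF c(2)[symmetric]] m[OF c(3)[symmetric]] m[OF c(4)[symmetric]] add_ac)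
  moreover have "Q (Suc i) * P (Suc i) = P i * P i * (v i * u i) + P i * Q i * (v i * v i) + (Q i * P i * (u i * u i) + Q i * Q i * (u i * v i))"
   unfolding PS distrib_left distrib_right
   by (simp add: m[OF c(1)[symmetric]] m[OF c(2)[symmetric]] m[OF c(3)[symmetric]] m[OF c(4)[symmetric]] add_ac)
  moreover have "P (Suc i) + Q (Suc i) = (P i + Q i) * (u i + v i)" unfolding PS by (simp add: algebra_simps)
  moreover have "P (Suc i) \<in> B (Suc i)" "Q (Suc i) \<in> B (Suc i)"
   unfolding PS using IH(1,2) BB uB[OF i] by (auto intro!: Bs(3,5))
  moreover have "inve (P (Suc i))" "inve (Q (Suc i))"
   unfolding PS using IH uvL[OF i] by (auto intro!: inve_simps)
  ultimately show ?case using uvi IH by simp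
 qed
 have PP: "P i * P i = P i" "Q i * Q i = Q i" if "i \<le> a" for i
 proof -
  have "P i * (P i + Q i) = P i" "Q i * (P i + Q i) = Q i" using PQ[OF that] by simp_all
  then show "P i * P i = P i" "Q i * Q i = Q i" using PQ[OF that] unfolding distrib_left by simp_all
 qed
 have "\<exists>f c tau. f \<in> B i \<and> oddP (P i) (Q i) f \<and> inve f \<and> coprime c (int p) \<and>
  f * f = of_int c - tau \<and> Jt p (a - i) {x \<in> B i. evenP (P i) (Q i) x} tau" if "i \<le> a" for i
  using that
 proof (induction i)
  case 0
  note Bs = subrngD[OF B[of 0]]
  have lc: "lcosets S = (\<lambda>g. g <# S) ` carrier G" by (auto simp: LCOSETS_def)
  \<comment> \<open>The starting point is \<open>f = 0\<close> with \<open>c\<close> and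
    \<open>tau\<close> both equal to the index of the Sylow subgroup \<open>S\<close>. As
    \<open>tau\<close> it is a sum of ones over the cosets of \<open>S\<close>, whose stabilizers
    are the conjugates of \<open>S\<close>; as \<open>c\<close> it is prime to
    \<open>p\<close>.\<close>
  have "Jt p (a - 0) {x \<in> B 0. evenP (P 0) (Q 0) x} (of_nat (card (lcosets S)))"
  proof (rule Jt_intro[OF lcosets_finite[OF finG] coset_gset[OF S(1)]])
   fix t assume t: "t \<in> lcosets S"
   then obtain x where x: "x \<in> carrier G" "t = x <# S" by (auto simp: lc)
   have 1: "S \<in> lcosets S" unfolding lc using lcos_mult_one[OF subgroup.subset[OF S(1)]]
    by (intro image_eqI[of _ _ \<one>]) auto
   have "gstab G (\<lambda>g X. g <# X) t = csub x (gstab G (\<lambda>g X. g <# X) S)"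
    unfolding x(2) by (rule gstab_act[OF coset_gset[OF S(1)] x(1) 1])
   also have "gstab G (\<lambda>g X. g <# X) S = S"
   proof (intro equalityI subsetI)
    fix y assume "y \<in> gstab G (\<lambda>g X. g <# X) S"
    then have "y \<in> carrier G" "y <# S = S" by (auto simp: gstab_def)
    then show "y \<in> S" using lcos_self[OF _ S(1), of y] by blast
   next
    fix y assume y: "y \<in> S"
    have "y \<in> carrier G" using subgroup.mem_carrier[OF S(1) y] .
    then show "y \<in> gstab G (\<lambda>g X. g <# X) S" using coset_join3[OF _ S(1) y] by (simp add: gstab_def)
   qed
   finally have "card (gstab G (\<lambda>g X. g <# X) t) = p ^ a"
    using card_csub[OF x(1) subgroup.subset[OF S(1)]] S(2) by simp
   then show "\<exists>j\<le>a - 0. card (gstab G (\<lambda>g X. g <# X) t) = p ^ j" by auto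
   show "1 \<in> {x \<in> B 0. evenP (P 0) (Q 0) x}" by (simp add: Bs evenP_simps)
  qed (auto simp: cj_one)
  moreover have "coprime (int (card (lcosets S))) (int p)"
   using prime_imp_coprime[OF p S(3)] by (simp add: coprime_commute)
  moreover have "inve 0" by (simp add: inve_def cj_zero)
  ultimately show ?case
   by (intro exI[of _ 0] exI[of _ "int (card (lcosets S))"] exI[of _ "of_nat (card (lcosets S))"])
     (auto simp: Bs evenP_simps)
 next
  case (Suc i)
  then have i: "i < a" "i \<le> a" by auto
  obtain f c tau where f: "f \<in> B i" "oddP (P i) (Q i) f" "inve f" "coprime c (int p)"
   "f * f = of_int c - tau" "Jt p (a - i) {x \<in> B i. evenP (P i) (Q i) x} tau"
   using Suc.IH[OF i(2)] by blast
  note PQi = PQ[OF i(2)] PP[OF i(2)]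
  have k: "a - i \<ge> 1" using i by simp
  have ps: "psub p D" if "subgroup D G" "card D = p ^ (a - i)" for D using that k by (auto simp: psub_def)
  have "\<exists>f' c' tau'. f' \<in> B (Suc i) \<and> oddP (P i * u i + Q i * v i) (P i * v i + Q i * u i) f' \<and> inve f' \<and> coprime c' (int p) \<and>
   f' * f' = of_int c' - tau' \<and> Jt p (a - i - 1) {x \<in> B (Suc i). evenP (P i * u i + Q i * v i) (P i * v i + Q i * u i) x} tau'"
  proof (rule green_step[OF p k B B BB, where s = "s i" and f = f and c = c and tau = tau])
   show "x * u i = u i * x" "x * v i = v i * x" if "x \<in> B i" for x using that i by (auto simp: B_def)
   show "x * s i D = s i D * x" if "subgroup D G" "card D = p ^ (a - i)" "x \<in> B i" for D x
    using that(3) ps[OF that(1,2)] i by (auto simp: B_def)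
   show "s i D \<in> B (Suc i) \<and> s i D * s i D = 1 \<and> s i D * u i = v i * s i D \<and> s i D * v i = u i * s i D"
    if "subgroup D G" "card D = p ^ (a - i)" for D
    using sB[OF i(1) ps[OF that]] s[OF i(1) ps[OF that]] by auto
   show "cj g (s i D) = s i (csub g D)" if "subgroup D G" "card D = p ^ (a - i)" "g \<in> carrier G" for D g
    using scj[OF i(1) ps[OF that(1,2)] that(3)] .
  qed (use PQi uB[OF i(1)] f in auto)
  moreover have "a - i - 1 = a - Suc i" by simp
  ultimately show ?case unfolding PS by (simp only:)
 qed
 from this[of a] obtain f c tau where f: "f \<in> B a" "oddP (P a) (Q a) f" "inve f" "coprime c (int p)"
   "f * f = of_int c - tau" "Jt p (a - a) {x \<in> B a. evenP (P a) (Q a) x} tau" by blast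
 have "Jt p (a - a) L (1 * tau * 1)"
  by (rule Jt_mult[OF f(6) inve_simps(1) inve_simps(1)]) (simp add: B_def)
 then have "Jt p 0 L tau" by simp
 then show ?thesis using f unfolding P_def Q_def B_def by blast
qed

text \<open>All orbits are regular, so \<open>(g, x) \<mapsto> b g x\<close> is a bijection from the
  product of the group with a set of orbit representatives. \<open>theta\<close> is the sum of
  \<open>l\<close> over the representatives.\<close>

lemma Jt_trivial_stabilizers:
 assumes J: "Jt p 0 L tau" and L: "subrng L"
 shows "\<exists>theta\<in>L. tau = (\<Sum>g\<in>carrier G. cj g theta)"
proof -
 obtain T b l where T: "finite (T::nat set)" and b: "gset G T b" and st: "\<And>t. t \<in> T ==> \<exists>j\<le>0. card (gstab G b t) = p ^ j"
  and l: "\<And>t. t \<in> T ==> l t \<in> L" and eq: "\<And>g t. g \<in> carrier G ==> t \<in> T ==> l (b g t) = cj g (l t)"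
  and tau: "tau = (\<Sum>t\<in>T. l t)"
  using J unfolding Jt_def by blast
 have stab: "gstab G b t = {\<one>}" if "t \<in> T" for t
 proof -
  have "card (gstab G b t) = 1" using st[OF that] by simp
  then obtain x where "gstab G b t = {x}" by (rule card_1_singletonE)
  moreover have "\<one> \<in> gstab G b t" using gsetD(2)[OF b that] by (simp add: gstab_def)
  ultimately show ?thesis by auto
 qed
 define r where "r t = (SOME x. x \<in> gorb G b t)" for t
 have r: "r t \<in> gorb G b t" if "t \<in> T" for t
  unfolding r_def by (rule someI) (rule gorb_props(1)[OF b that])
 have rT: "r t \<in> T" if "t \<in> T" for t using r[OF that] gorb_props(2)[OF b that] by auto
 have rg: "r (b g t) = r t" if g: "g \<in> carrier G" and t: "t \<in> T" for g t
 proof -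
  have "gorb G b (b g t) = gorb G b t"
  proof (intro equalityI subsetI)
   fix z assume "z \<in> gorb G b (b g t)"
   then obtain h where "h \<in> carrier G" "z = b h (b g t)" by (rule gorbE)
   then show "z \<in> gorb G b t" using gorb_props(3)[OF b t] gorb_props(1)[OF b t] g by auto
  next
   fix z assume "z \<in> gorb G b t"
   then obtain h where h: "h \<in> carrier G" "z = b h t" by (rule gorbE)
   then have "z = b (h \<otimes> inv g) (b g t)" using gsetD(3)[OF b h(1) inv_closed[OF g] gsetD(1)[OF b g t]]
    gset_inv1[OF b g t] by simp
   then show "z \<in> gorb G b (b g t)" using h g by (auto simp: gorb_def)
  qed
  then show ?thesis by (simp add: r_def)
 qed
 define R where "R = r ` T"
 have RT: "R \<subseteq> T" using rT by (auto simp: R_def)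
 have rR: "r x = x" if x: "x \<in> R" for x
 proof -
  obtain t where t: "t \<in> T" "x = r t" using x by (auto simp: R_def)
  obtain h where "h \<in> carrier G" "r t = b h t" using r[OF t(1)] by (rule gorbE)
  then show ?thesis using rg[of h t] t by simp
 qed
 have "bij_betw (\<lambda>(g, x). b g x) (carrier G \<times> R) T"
  unfolding bij_betw_def
 proof
  show "inj_on (\<lambda>(g, x). b g x) (carrier G \<times> R)"
  proof (rule inj_onI, clarsimp)
   fix g x h y assume a: "g \<in> carrier G" "x \<in> R" "h \<in> carrier G" "y \<in> R" and e: "b g x = b h y"
   have "r (b g x) = x" "r (b h y) = y" using a rg rR RT by auto
   then have xy: "x = y" using e by simp
   have x: "x \<in> T" using a RT by auto
   have "inv h \<otimes> g \<in> gstab G b x" using gset_act_eq_iff[OF b x a(1,3)] e xy by simp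
   then have "inv h \<otimes> g = \<one>" using stab[OF x] by simp
   then have "h \<otimes> (inv h \<otimes> g) = h \<otimes> \<one>" by simp
   then have "g = h" using a by (simp add: m_assoc[symmetric])
   then show "g = h \<and> x = y" using xy by simp
  qed
  show "(\<lambda>(g, x). b g x) ` (carrier G \<times> R) = T"
  proof (intro equalityI subsetI)
   fix t assume t: "t \<in> T"
   obtain h where h: "h \<in> carrier G" "r t = b h t" using r[OF t] by (rule gorbE)
   then have "t = b (inv h) (r t)" using gset_inv1[OF b h(1) t] by simp
   moreover have "r t \<in> R" using t by (simp add: R_def)
   ultimately show "t \<in> (\<lambda>(g, x). b g x) ` (carrier G \<times> R)" using h(1) by (intro image_eqI[of _ _ "(inv h, r t)"]) auto
  qed (use gsetD(1)[OF b] RT in auto)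
 qed
 from sum.reindex_bij_betw[OF this, of l]
 have "tau = (\<Sum>(g, x)\<in>carrier G \<times> R. l (b g x))" by (simp add: tau case_prod_unfold)
 also have "\<dots> = (\<Sum>g\<in>carrier G. \<Sum>x\<in>R. l (b g x))" by (simp add: sum.cartesian_product)
 also have "\<dots> = (\<Sum>g\<in>carrier G. cj g (\<Sum>x\<in>R. l x))"
  using eq RT by (intro sum.cong refl) (simp add: cj_sum subset_iff)
 finally show ?thesis using subrng_sum[OF L, of R l] l RT by blast
qed

end

section \<open>Rings of additive operators\<close>

text \<open>Operators on all integer functions on a type form a type themselves, so that the ring
  laws are available through the class \<open>ring_1\<close>. The finite set that matters enters
  only through \<open>loco\<close>.\<close>

typedef 'v aop = "{A :: ('v => int) => 'v => int. \<forall>f h. A (\<lambda>x. f x + h x) = (\<lambda>x. A f x + A h x)}"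
 morphisms ap Aop
 by (rule exI[of _ "\<lambda>f. f"]) simp

lemma ap_add: "ap A (\<lambda>x. f x + h x) = (\<lambda>x. ap A f x + ap A h x)"
 using ap[of A] by auto

lemma ap_Aop: "(\<And>f h. A (\<lambda>x. f x + h x) = (\<lambda>x. A f x + A h x)) ==> ap (Aop A) = A"
 by (rule Aop_inverse) simp

lemma aop_eqI: "(\<And>f x. ap A f x = ap B f x) ==> A = B"
 by (metis ap_inject ext)

lemma ap_zero: "ap A (\<lambda>x. 0) = (\<lambda>x. 0)"
 using ap_add[of A "\<lambda>x. 0" "\<lambda>x. 0"] by (auto simp: fun_eq_iff)

lemma ap_uminus: "ap A (\<lambda>x. - f x) = (\<lambda>x. - ap A f x)"
 using ap_add[of A f "\<lambda>x. - f x"] by (auto simp: fun_eq_iff ap_zero eq_neg_iff_add_eq_0 add.commute)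

lemma ap_diff: "ap A (\<lambda>x. f x - h x) = (\<lambda>x. ap A f x - ap A h x)"
 using ap_add[of A f "\<lambda>x. - h x"] by (simp add: ap_uminus)

lemma ap_sum: "ap A (\<lambda>x. \<Sum>i\<in>I. f i x) = (\<lambda>x. \<Sum>i\<in>I. ap A (f i) x)"
 by (induction I rule: infinite_finite_induct) (auto simp: ap_zero ap_add)

lemma ap_scale_nat: "ap A (\<lambda>x. int n * f x) = (\<lambda>x. int n * ap A f x)"
proof (induction n)
 case (Suc n)
 then show ?case using ap_add[of A f "\<lambda>x. int n * f x"] by (simp add: distrib_right)
qed (simp add: ap_zero)

lemma ap_scale: "ap A (\<lambda>x. c * f x) = (\<lambda>x. c * ap A f x)"
proof (cases c rule: int_cases2)
 case (nonpos n)
 then show ?thesis using ap_scale_nat[of A n f] ap_uminus[of A "\<lambda>x. int n * f x"] by simp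
qed (simp add: ap_scale_nat)

instantiation aop :: (type) ring_1
begin

definition "0 = Aop (\<lambda>f x. 0)"
definition "1 = Aop (\<lambda>f. f)"
definition "A + B = Aop (\<lambda>f x. ap A f x + ap B f x)"
definition "A - B = Aop (\<lambda>f x. ap A f x - ap B f x)"
definition "- A = Aop (\<lambda>f x. - ap A f x)"
definition "A * B = Aop (\<lambda>f. ap A (ap B f))"

lemma ap_ops:
 "ap 0 f x = 0" "ap 1 f x = f x" "ap (A + B) f x = ap A f x + ap B f x" "ap (A - B) f x = ap A f x - ap B f x"
 "ap (- A) f x = - ap A f x" "ap (A * B) f x = ap A (ap B f) x"
 unfolding zero_aop_def one_aop_def plus_aop_def minus_aop_def uminus_aop_def times_aop_def
 by (subst ap_Aop; simp add: ap_add fun_eq_iff)+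

instance
proof
 fix A B C :: "'a aop"
 have e: "ap (B + C) f = (\<lambda>x. ap B f x + ap C f x)" for f by (rule ext) (simp add: ap_ops)
 have e': "ap (B * C) f = ap B (ap C f)" for f by (rule ext) (simp add: ap_ops)
 have e1: "ap 1 f = f" for f :: "'a => int" by (rule ext) (simp add: ap_ops)
 show "A * B * C = A * (B * C)" by (rule aop_eqI) (simp add: ap_ops e')
 show "A * (B + C) = A * B + A * C" by (rule aop_eqI) (simp add: ap_ops e ap_add)
 show "A * 1 = A" by (rule aop_eqI) (simp add: ap_ops e1)
 show "(0::'a aop) \<noteq> 1"
 proof
  assume "(0::'a aop) = 1"
  then have "ap 0 (\<lambda>x::'a. 1::int) undefined = ap 1 (\<lambda>x. 1) undefined" by simp
  then show False by (simp add: ap_ops)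
 qed
qed (rule aop_eqI; simp add: ap_ops)+

end

lemma ap_mult: "ap (A * B) f = ap A (ap B f)"
 by (rule ext) (simp add: ap_ops)

lemma ap_of_nat: "ap (of_nat n) f x = int n * f x"
 by (induction n) (auto simp: ap_ops distrib_right)

lemma ap_of_int: "ap (of_int c) f x = c * f x"
 by (cases c rule: int_cases2) (auto simp: ap_of_nat ap_ops)

lemma ap_sum_op: "ap (\<Sum>i\<in>I. A i) f x = (\<Sum>i\<in>I. ap (A i) f x)"
 by (induction I rule: infinite_finite_induct) (auto simp: ap_ops)

definition permo :: "('v => 'v) => 'v aop" where "permo s = Aop (\<lambda>f x. f (s x))"
definition dgo :: "('v => int) => 'v aop" where "dgo c = Aop (\<lambda>f x. c x * f x)"

lemma ap_permo: "ap (permo s) f x = f (s x)" unfolding permo_def by (subst ap_Aop) auto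
lemma ap_dgo: "ap (dgo c) f x = c x * f x" unfolding dgo_def by (subst ap_Aop) (auto simp: distrib_left)

lemma permo_mult: "permo s * permo t = permo (\<lambda>x. t (s x))"
 by (rule aop_eqI) (simp add: ap_ops ap_permo)
lemma dgo_mult: "dgo c * dgo d = dgo (\<lambda>x. c x * d x)"
 by (rule aop_eqI) (simp add: ap_ops ap_dgo mult.assoc)
lemma dgo_add: "dgo c + dgo d = dgo (\<lambda>x. c x + d x)"
 by (rule aop_eqI) (simp add: ap_ops ap_dgo distrib_right)
lemma permo_dgo: "permo s * dgo c = dgo (\<lambda>x. c (s x)) * permo s"
 by (rule aop_eqI) (simp add: ap_ops ap_dgo ap_permo)
lemma dgo_one: "1 = dgo (\<lambda>x. 1)" by (rule aop_eqI) (simp add: ap_ops ap_dgo)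
lemma dgo_zero: "0 = dgo (\<lambda>x. 0)" by (rule aop_eqI) (simp add: ap_ops ap_dgo)
lemma permo_one: "permo (\<lambda>x. x) = 1" by (rule aop_eqI) (simp add: ap_ops ap_permo)

definition dlt :: "'v => 'v => int" where "dlt y z = (if z = y then 1 else 0)"
definition ent :: "'v aop => 'v => 'v => int" where "ent A x y = ap A (dlt y) x"

text \<open>Such an operator preserves the functions that vanish on \<open>V\<close>; it therefore
  acts on functions on \<open>V\<close>, and for finite \<open>V\<close> it is described there by
  the matrix \<open>ent\<close>.\<close>

definition loco :: "'v set => 'v aop => bool" where
 "loco V A \<longleftrightarrow> (\<forall>f. (\<forall>x\<in>V. f x = 0) \<longrightarrow> (\<forall>x\<in>V. ap A f x = 0))"

lemma subrng_loco: "subrng {A. loco V A}"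
 by (auto simp: subrng_def loco_def ap_ops)

lemma ap_ent:
 assumes V: "finite V" and A: "loco V A" and x: "x \<in> V"
 shows "ap A f x = (\<Sum>y\<in>V. ent A x y * f y)"
proof -
 define h where "h z = (\<Sum>y\<in>V. f y * dlt y z)" for z
 have "h z = f z" if "z \<in> V" for z using V that by (simp add: h_def dlt_def if_distrib[of "\<lambda>t. f _ * t"] cong: if_cong)
 then have "ap A (\<lambda>z. f z - h z) x = 0" using A x by (simp add: loco_def)
 then have "ap A f x = ap A h x" by (simp add: ap_diff)
 also have "\<dots> = (\<Sum>y\<in>V. f y * ap A (dlt y) x)" unfolding h_def by (simp add: ap_sum ap_scale)
 finally show ?thesis by (simp add: ent_def mult.commute)
qed

lemma ent_mult:
 assumes "finite V" "loco V A" "x \<in> V" shows "ent (A * B) x y = (\<Sum>z\<in>V. ent A x z * ent B z y)"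
 using ap_ent[OF assms, of "ap B (dlt y)"] by (simp add: ent_def ap_ops)

lemma ent_simps:
 "ent (A + B) x y = ent A x y + ent B x y" "ent (A - B) x y = ent A x y - ent B x y"
 "ent (of_int c) x y = (if x = y then c else 0)"
 by (simp_all add: ent_def ap_ops ap_of_int dlt_def)

lemma ent_sum: "ent (\<Sum>i\<in>I. A i) x y = (\<Sum>i\<in>I. ent (A i) x y)"
 by (simp add: ent_def ap_sum_op)

lemma loco_permo: "(\<And>x. x \<in> V ==> s x \<in> V) ==> loco V (permo s)"
 by (simp add: loco_def ap_permo)
lemma loco_dgo: "loco V (dgo c)"
 by (simp add: loco_def ap_dgo)

lemma parity_pair_dgo:
 "parity_pair (\<lambda>i. dgo (\<lambda>x. if s i x then 0 else 1)) (\<lambda>i. dgo (\<lambda>x. if s i x then 1 else 0)) n =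
  (dgo (\<lambda>x. if odd (card {i. i < n \<and> s i x}) then 0 else 1), dgo (\<lambda>x. if odd (card {i. i < n \<and> s i x}) then 1 else 0))"
proof (induction n)
 case 0 then show ?case by (simp add: dgo_one dgo_zero)
next
 case (Suc n)
 have "{i. i < Suc n \<and> s i x} = (if s n x then insert n {i. i < n \<and> s i x} else {i. i < n \<and> s i x})" for x
  by (auto simp: less_Suc_eq)
 then have "odd (card {i. i < Suc n \<and> s i x}) \<longleftrightarrow> odd (card {i. i < n \<and> s i x}) \<noteq> s n x" for x by auto
 then show ?case by (auto simp: Suc Let_def dgo_mult dgo_add intro!: arg_cong[of _ _ dgo])
qed

lemma (in group) csub_gset:
 fixes rho :: "'a => 'r::ring_1"
 assumes "ring_action G rho"
 shows "gset G {D. ring_action.psub G p D} (ring_action.csub G)"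
proof -
 interpret ring_action G rho by fact
 have sc: "D \<subseteq> carrier G" if "psub p D" for D using that subgroup.subset by (auto simp: psub_def)
 show ?thesis unfolding gset_def
 proof (intro conjI ballI)
  fix D assume "D \<in> {D. psub p D}"
  then have D: "psub p D" by simp
  have sg: "subgroup D G" using D by (simp add: psub_def)
  show "csub \<one> D = D" using sc[OF D] by (force simp: csub_def)
  fix g assume g: "g \<in> carrier G"
  have "subgroup (csub g D) G"
  proof
   show "csub g D \<subseteq> carrier G" using sc[OF D] g by (auto simp: csub_def)
   show "\<one> \<in> csub g D" unfolding csub_def using subgroup.one_closed[OF sg] g
    by (intro image_eqI[of _ _ \<one>]) auto
   show "x \<otimes> y \<in> csub g D" if x: "x \<in> csub g D" and y: "y \<in> csub g D" for x y
   proof -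
    obtain x' y' where xy: "x' \<in> D" "y' \<in> D" "x = g \<otimes> x' \<otimes> inv g" "y = g \<otimes> y' \<otimes> inv g"
     using x y by (auto simp: csub_def)
    have c: "x' \<in> carrier G" "y' \<in> carrier G" using xy sc[OF D] by auto
    have "inv g \<otimes> (g \<otimes> z) = z" if "z \<in> carrier G" for z using g that by (simp add: m_assoc[symmetric])
    then have "x \<otimes> y = g \<otimes> (x' \<otimes> y') \<otimes> inv g" using xy c g by (simp add: m_assoc)
    then show ?thesis unfolding csub_def using subgroup.m_closed[OF sg xy(1,2)] by (intro image_eqI) auto
   qed
   show "inv x \<in> csub g D" if x: "x \<in> csub g D" for x
   proof -
    obtain x' where xy: "x' \<in> D" "x = g \<otimes> x' \<otimes> inv g" using x by (auto simp: csub_def)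
    have c: "x' \<in> carrier G" using xy sc[OF D] by auto
    have "inv x = g \<otimes> inv x' \<otimes> inv g" using xy c g by (simp add: inv_mult_group m_assoc)
    then show ?thesis unfolding csub_def using subgroup.m_inv_closed[OF sg xy(1)] by (intro image_eqI) auto
   qed
  qed
  then show "csub g D \<in> {D. psub p D}" using D card_csub[OF g sc[OF D]] by (auto simp: psub_def)
  fix h assume h: "h \<in> carrier G"
  have "(g \<otimes> h) \<otimes> x \<otimes> inv (g \<otimes> h) = g \<otimes> (h \<otimes> x \<otimes> inv h) \<otimes> inv g" if "x \<in> carrier G" for x
   using g h that by (simp add: inv_mult_group m_assoc)
  then show "csub (g \<otimes> h) D = csub g (csub h D)"
   unfolding csub_def image_image using sc[OF D] by (intro image_cong) auto
 qed
qed

text \<open>\<open>Z\<close> is the virtual set, its even half with the action \<open>a0\<close> and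
  its odd half with \<open>a1\<close>, and the operators act on functions on the power of
  \<open>Z\<close> with exponent \<open>a\<close>. No nontrivial \<open>p\<close>-subgroup
  \<open>D\<close> is normal, so its normalizer is proper and the two halves are isomorphic over it.
  \<open>equivariant_choice\<close> makes these isomorphisms a family compatible with conjugation,
  and exchanging the halves of factor \<open>i\<close> along them gives the involutions
  \<open>s i D\<close> that \<open>green_iterate\<close> asks for.\<close>

theorem (in group) green_operator:
 fixes a0 a1 :: "'a => nat => nat"
 assumes finG: "finite (carrier G)" and p: "Factorial_Ring.prime (p::nat)"
  and nonorm: "\<And>D k. D \<lhd> G ==> card D = p ^ k ==> k = 0"
  and a0: "gset G {..<n} a0" and a1: "gset G {..<n} a1"
  and iso: "\<And>L. subgroup L G ==> L \<noteq> carrier G ==>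
   \<exists>f. bij_betw f {..<n} {..<n} \<and> (\<forall>g\<in>L. \<forall>x\<in>{..<n}. f (a0 g x) = a1 g (f x))"
 defines "Z \<equiv> {..<n} \<times> (UNIV :: bool set)"
  and "az \<equiv> (\<lambda>g z. (if snd z then a1 g (fst z) else a0 g (fst z), snd z))"
 shows "\<exists>(a::nat) f theta c.
  let V = PiE {..<a} (\<lambda>_. Z); aV = (\<lambda>g x i. if i < a then az g (x i) else x i); par = (\<lambda>x. odd (card {i. i < a \<and> snd (x i)}))
  in (\<forall>x\<in>V. \<forall>y\<in>V. f x y \<noteq> 0 \<longrightarrow> par x \<noteq> par y) \<and>
    (\<forall>g\<in>carrier G. \<forall>x\<in>V. \<forall>y\<in>V. f (aV g x) (aV g y) = f x y) \<and> coprime c (int p) \<and>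
    (\<forall>x\<in>V. \<forall>y\<in>V. (\<Sum>z\<in>V. f x z * f z y) =
     (if x = y then c else 0) - (\<Sum>g\<in>carrier G. theta (aV (inv g) x) (aV (inv g) y)))"
proof -
 define a where "a = multiplicity p (Coset.order G)"
 have ordpos: "Coset.order G \<noteq> 0" using finG by (simp add: Coset.order_def) (metis one_closed empty_iff)
 obtain m where m: "Coset.order G = p ^ a * m" "\<not> p dvd m"
  using multiplicity_decompose'[OF ordpos, of p] p unfolding a_def by (metis not_prime_unit)
 obtain S where S: "subgroup S G" "card S = p ^ a" using sylow_thm[OF p is_group m(1) finG] by blast
 have cS: "card (lcosets S) * p ^ a = p ^ a * m"
  using l_lagrange[OF finG S(1)] S(2) m(1) by simp
 then have S3: "\<not> p dvd card (lcosets S)" using m(2) p prime_gt_0_nat[OF p] by simp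

 \<comment> \<open>Extension by the identity to all pairs: the operators live on functions on the
   whole type, and \<open>rho\<close> has to be multiplicative there.\<close>
 define b where "b g z = (if fst z < n then az g z else z)" for g z
 have az: "gset G Z az"
  using gsetD[OF a0] gsetD[OF a1] by (auto simp: gset_def Z_def az_def)
 have zZ: "z \<in> Z \<longleftrightarrow> fst z < n" for z by (cases z) (auto simp: Z_def)
 have bZ: "b g z = az g z" if "z \<in> Z" for g z using that by (simp add: b_def zZ)
 have b: "gset G UNIV b"
  using gsetD[OF az] by (auto simp: gset_def b_def zZ)
 define aT where "aT g x = (\<lambda>i. if i < a then b g (x i) else x i)" for g and x :: "nat => nat \<times> bool"
 have aT: "gset G UNIV aT"
  using gsetD[OF b] by (auto simp: gset_def aT_def fun_eq_iff)
 \<comment> \<open>Pulling functions back reverses products, and the inverse restores the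
   order.\<close>
 define rho where "rho g = permo (aT (inv g))" for g
 have ra: "ring_action G rho"
 proof
  show "finite (carrier G)" by fact
  have "aT \<one> = (\<lambda>x. x)" using gsetD(2)[OF aT] by auto
  then show "rho \<one> = 1" by (simp add: rho_def permo_one)
  fix g h assume g: "g \<in> carrier G" and h: "h \<in> carrier G"
  have "aT (inv (g \<otimes> h)) = (\<lambda>x. aT (inv h) (aT (inv g) x))"
   using gsetD(3)[OF aT inv_closed[OF h] inv_closed[OF g]] g h by (auto simp: inv_mult_group)
  then show "rho (g \<otimes> h) = rho g * rho h" by (simp add: rho_def permo_mult)
 qed
 interpret ring_action G rho by (rule ra)
 have ap_cj: "ap (cj g A) f x = ap A (\<lambda>z. f (aT g z)) (aT (inv g) x)" if g: "g \<in> carrier G" for g A f x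
 proof -
  have "ap (permo (aT g)) f = (\<lambda>z. f (aT g z))" by (rule ext) (simp add: ap_permo)
  then show ?thesis using g by (simp add: cj_def rho_def ap_mult ap_permo)
 qed
 have aTi: "aT g (aT (inv g) x) = x" if "g \<in> carrier G" for g x
  using gset_inv2[OF aT that] by simp

 have Bg: "gset G {D. psub p D} csub" by (rule csub_gset[OF ra])
 have "\<exists>F. (\<forall>D\<in>{D. psub p D}. bij_betw (F D) {..<n} {..<n}) \<and>
  (\<forall>g\<in>carrier G. \<forall>D\<in>{D. psub p D}. \<forall>x\<in>{..<n}. F (csub g D) (a0 g x) = a1 g (F D x))"
 proof (rule equivariant_choice[OF Bg a0 a1])
  fix D assume D: "D \<in> {D. psub p D}"
  then obtain k where k: "subgroup D G" "k \<ge> 1" "card D = p ^ k" by (auto simp: psub_def)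
  have "gstab G csub D \<noteq> carrier G"
  proof
   assume e: "gstab G csub D = carrier G"
   have "D \<lhd> G"
   proof (rule normal_inv_iff[THEN iffD2], intro conjI ballI)
    show "subgroup D G" by fact
    fix g h assume gh: "g \<in> carrier G" "h \<in> D"
    then have "csub g D = D" using e by (auto simp: gstab_def)
    then show "g \<otimes> h \<otimes> inv g \<in> D" using gh by (auto simp: csub_def)
   qed
   then show False using nonorm[OF _ k(3)] k(2) by simp
  qed
  then show "\<exists>f. bij_betw f {..<n} {..<n} \<and> (\<forall>g\<in>gstab G csub D. \<forall>x\<in>{..<n}. f (a0 g x) = a1 g (f x))"
   by (rule iso[OF gstab_subgroup[OF Bg D]])
 qed
 then obtain F where F: "\<forall>D\<in>{D. psub p D}. bij_betw (F D) {..<n} {..<n}"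
  "\<forall>g\<in>carrier G. \<forall>D\<in>{D. psub p D}. \<forall>x\<in>{..<n}. F (csub g D) (a0 g x) = a1 g (F D x)" by blast
 have Fb: "bij_betw (F D) {..<n} {..<n}" if "psub p D" for D using F(1) that by simp
 have Fe: "F (csub g D) (a0 g x) = a1 g (F D x)" if "g \<in> carrier G" "psub p D" "x < n" for g D x
  using F(2) that by simp
 \<comment> \<open>Outside \<open>Z\<close> the involution just flips the second component. In this
   way it exchanges \<open>u i\<close> and \<open>v i\<close> as operators on all functions, not
   only on those on \<open>V\<close>.\<close>
 define sg where "sg D z = (if fst z < n then if snd z then (inv_into {..<n} (F D) (fst z), False) else (F D (fst z), True)
  else (fst z, \<not> snd z))" for D z
 have Fn: "F D x < n" "inv_into {..<n} (F D) x < n" "inv_into {..<n} (F D) (F D x) = x" "F D (inv_into {..<n} (F D) x) = x"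
  if "psub p D" "x < n" for D x
  using Fb[OF that(1)] that(2) bij_betwE[OF Fb[OF that(1)]] bij_betwE[OF bij_betw_inv_into[OF Fb[OF that(1)]]]
   bij_betw_inv_into_left[OF Fb[OF that(1)]] bij_betw_inv_into_right[OF Fb[OF that(1)]] by auto
 have sg: "sg D (sg D z) = z" "snd (sg D z) \<longleftrightarrow> \<not> snd z" "fst (sg D z) < n \<longleftrightarrow> fst z < n" if "psub p D" for D z
  using Fn[OF that] by (auto simp: sg_def prod_eq_iff)
 have sge: "sg (csub g D) (b g z) = b g (sg D z)" if g: "g \<in> carrier G" and D: "psub p D" for g D z
 proof (cases "fst z < n")
  case True
  have cD: "psub p (csub g D)" using gsetD(1)[OF Bg g] D by simp
  have A0: "a0 g x < n" "a1 g x < n" if "x < n" for x using gsetD(1)[OF a0 g] gsetD(1)[OF a1 g] that by auto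
  have "inv_into {..<n} (F (csub g D)) (a1 g x) = a0 g (inv_into {..<n} (F D) x)" if x: "x < n" for x
  proof -
   have "a1 g x = F (csub g D) (a0 g (inv_into {..<n} (F D) x))"
    using Fe[OF g D Fn(2)[OF D x]] Fn(4)[OF D x] by simp
   then show ?thesis using Fn(3)[OF cD A0(1)[OF Fn(2)[OF D x]]] by simp
  qed
  then show ?thesis using True A0 Fe[OF g D] Fn[OF D] by (auto simp: sg_def b_def az_def)
 qed (auto simp: sg_def b_def)

 define V where "V = PiE {..<a} (\<lambda>_. Z)"
 have finV: "finite V" unfolding V_def by (intro finite_PiE) (auto simp: Z_def)
 define s where "s i D = permo (\<lambda>x. x(i := sg D (x i)))" for i :: nat and D
 define u where "u i = dgo (\<lambda>x :: nat => nat \<times> bool. if snd (x i) then 0 else 1)" for i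
 define v where "v i = dgo (\<lambda>x :: nat => nat \<times> bool. if snd (x i) then 1 else 0)" for i
 define L where "L = {A. loco V A}"
 have bsnd: "snd (b g z) = snd z" for g z by (simp add: b_def az_def)
 have inve_dgo: "inve (dgo c)" if "\<And>g x. g \<in> carrier G ==> c (aT g x) = c x" for c
  unfolding inve_def
 proof
  fix g assume g: "g \<in> carrier G"
  show "cj g (dgo c) = dgo c"
   by (rule aop_eqI) (use that[OF inv_closed[OF g]] aTi[OF g] in \<open>simp add: ap_cj[OF g] ap_dgo\<close>)
 qed
 have "\<exists>f c tau. f \<in> L \<and> oddP (fst (parity_pair u v a)) (snd (parity_pair u v a)) f \<and> inve f \<and> coprime c (int p) \<and>
  f * f = of_int c - tau \<and> Jt p 0 L tau"
 proof (rule green_iterate[OF p _ S S3, where s = s])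
  show "subrng L" unfolding L_def by (rule subrng_loco)
  fix i assume i: "i < a"
  show "u i \<in> L \<and> v i \<in> L \<and> inve (u i) \<and> inve (v i)"
   unfolding u_def v_def L_def by (auto intro!: loco_dgo inve_dgo simp: aT_def bsnd)
  show "u i + v i = 1 \<and> u i * v i = 0 \<and> v i * u i = 0"
   unfolding u_def v_def dgo_mult dgo_add dgo_one dgo_zero by (intro conjI arg_cong[of _ _ dgo] ext) auto
  show "u i * u j = u j * u i \<and> u i * v j = v j * u i \<and> v i * v j = v j * v i" if "j < a" for j
   unfolding u_def v_def dgo_mult by (intro conjI arg_cong[of _ _ dgo] ext) auto
  fix D assume D: "psub p D"
  show "s i D \<in> L \<and> s i D * s i D = 1 \<and> s i D * u i = v i * s i D \<and> s i D * v i = u i * s i D"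
  proof (intro conjI)
   have "x(i := sg D (x i)) \<in> V" if x: "x \<in> V" for x
   proof -
    have "x i \<in> Z" using x i by (auto simp: V_def)
    then have "sg D (x i) \<in> Z" unfolding zZ using sg(3)[OF D] by blast
    then show ?thesis using x i by (auto simp: V_def PiE_def extensional_def)
   qed
   then show "s i D \<in> L" unfolding s_def L_def by (simp add: loco_permo)
   show "s i D * s i D = 1" unfolding s_def permo_mult permo_one[symmetric]
    by (rule arg_cong[of _ _ permo]) (auto simp: sg[OF D])
   show "s i D * u i = v i * s i D" unfolding s_def u_def v_def permo_dgo
    by (rule arg_cong[of _ _ "\<lambda>x. x * _"], rule arg_cong[of _ _ dgo]) (auto simp: sg[OF D])
   show "s i D * v i = u i * s i D" unfolding s_def u_def v_def permo_dgo
    by (rule arg_cong[of _ _ "\<lambda>x. x * _"], rule arg_cong[of _ _ dgo]) (auto simp: sg[OF D])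
  qed
  show "s i D * u j = u j * s i D \<and> s i D * v j = v j * s i D" if "j < a" "i \<noteq> j" for j
   unfolding s_def u_def v_def permo_dgo using that
   by (intro conjI arg_cong[of _ _ "\<lambda>x. x * _"] arg_cong[of _ _ dgo]) auto
  show "s i D * s j E = s j E * s i D" if "j < a" "i \<noteq> j" "psub p E" for j E
   unfolding s_def permo_mult using that by (intro arg_cong[of _ _ permo]) (auto simp: fun_upd_twist)
  fix g assume g: "g \<in> carrier G"
  show "cj g (s i D) = s i (csub g D)"
  proof (rule aop_eqI)
   fix f x
   have "aT g ((aT (inv g) x)(i := sg D (aT (inv g) x i))) = x(i := sg (csub g D) (x i))"
   proof
    fix j
    have "b g (b (inv g) (x j)) = x j" using gset_inv2[OF b g] by simp
    moreover have "b g (sg D (b (inv g) (x i))) = sg (csub g D) (b g (b (inv g) (x i)))" using sge[OF g D] by simp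
    moreover have "b g (b (inv g) (x i)) = x i" using gset_inv2[OF b g] by simp
    ultimately show "aT g ((aT (inv g) x)(i := sg D (aT (inv g) x i))) j = (x(i := sg (csub g D) (x i))) j"
     using i by (auto simp: aT_def)
   qed
   then show "ap (cj g (s i D)) f x = ap (s i (csub g D)) f x"
    by (simp add: ap_cj[OF g] s_def ap_permo)
  qed
 qed
 then obtain f c tau where f: "f \<in> L" "oddP (fst (parity_pair u v a)) (snd (parity_pair u v a)) f" "inve f" "coprime c (int p)"
  "f * f = of_int c - tau" "Jt p 0 L tau" by blast
 obtain theta where th: "tau = (\<Sum>g\<in>carrier G. cj g theta)"
  using Jt_trivial_stabilizers[OF f(6)] subrng_loco unfolding L_def by blast
 define par where "par x \<longleftrightarrow> odd (card {i. i < a \<and> snd (x i)})" for x :: "nat => nat \<times> bool"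
 have pp: "parity_pair u v a = (dgo (\<lambda>x. if par x then 0 else 1), dgo (\<lambda>x. if par x then 1 else 0))"
  using parity_pair_dgo[of "\<lambda>i x. snd (x i)" a] unfolding u_def[abs_def] v_def[abs_def] par_def by simp
 define aV where "aV = (\<lambda>g (x :: nat => nat \<times> bool) i. if i < a then az g (x i) else x i)"
 have aVT: "aT g x = aV g x" if "x \<in> V" for g x
  using that bZ by (auto simp: aT_def aV_def V_def fun_eq_iff PiE_def Pi_def)
 have entcj: "ent (cj g A) x y = ent A (aT (inv g) x) (aT (inv g) y)" if g: "g \<in> carrier G" for g A x y
 proof -
  have "(\<lambda>z. dlt y (aT g z)) = dlt (aT (inv g) y)"
  proof
   fix z
   have "aT g z = y \<longleftrightarrow> z = aT (inv g) y" using gset_inv1[OF aT g, of z] aTi[OF g, of y] by auto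
   then show "dlt y (aT g z) = dlt (aT (inv g) y) z" by (simp add: dlt_def)
  qed
  then show ?thesis by (simp add: ent_def ap_cj[OF g])
 qed
 have 1: "par x \<noteq> par y" if "ent f x y \<noteq> 0" for x y
 proof -
  have "ap (f * fst (parity_pair u v a)) (dlt y) x = ap (snd (parity_pair u v a) * f) (dlt y) x"
   using f(2) by (simp add: oddP_def)
  moreover have "ap (dgo c) (dlt y) = (\<lambda>z. c y * dlt y z)" for c by (rule ext) (simp add: ap_dgo dlt_def)
  ultimately have "(if par y then 0 else 1) * ent f x y = (if par x then 1 else 0) * ent f x y"
   by (simp only: pp fst_conv snd_conv ap_mult ap_scale ap_dgo ent_def)
  then show ?thesis using that by (auto split: if_splits)
 qed
 have 2: "ent f (aT g x) (aT g y) = ent f x y" if g: "g \<in> carrier G" for g x y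
 proof -
  have "cj (inv g) f = f" using f(3) g by (simp add: inve_def)
  then show ?thesis using entcj[OF inv_closed[OF g], of f x y] g by simp
 qed
 have 3: "(\<Sum>z\<in>V. ent f x z * ent f z y) = (if x = y then c else 0) - (\<Sum>g\<in>carrier G. ent theta (aT (inv g) x) (aT (inv g) y))"
  if "x \<in> V" for x y
 proof -
  have "ent (f * f) x y = (\<Sum>z\<in>V. ent f x z * ent f z y)"
   by (rule ent_mult[OF finV _ that]) (use f(1) in \<open>simp add: L_def\<close>)
  then show ?thesis unfolding f(5) th by (simp add: ent_simps ent_sum entcj)
 qed
 have 2: "ent f (aV g x) (aV g y) = ent f x y" if "g \<in> carrier G" "x \<in> V" "y \<in> V" for g x y
  using 2[OF that(1), of x y] aVT[OF that(2), of g] aVT[OF that(3), of g] by simp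
 have 3: "(\<Sum>z\<in>V. ent f x z * ent f z y) = (if x = y then c else 0) - (\<Sum>g\<in>carrier G. ent theta (aV (inv g) x) (aV (inv g) y))"
  if "x \<in> V" "y \<in> V" for x y using 3[OF that(1)] aVT[OF that(1)] aVT[OF that(2)] by simp
 have "(\<forall>x\<in>V. \<forall>y\<in>V. ent f x y \<noteq> 0 \<longrightarrow> par x \<noteq> par y) \<and>
    (\<forall>g\<in>carrier G. \<forall>x\<in>V. \<forall>y\<in>V. ent f (aV g x) (aV g y) = ent f x y) \<and> coprime c (int p) \<and>
    (\<forall>x\<in>V. \<forall>y\<in>V. (\<Sum>z\<in>V. ent f x z * ent f z y) =
     (if x = y then c else 0) - (\<Sum>g\<in>carrier G. ent theta (aV (inv g) x) (aV (inv g) y)))"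
  using 1 2 3 f(4) by blast
 then show ?thesis unfolding V_def aV_def par_def Let_def by blast
qed

section \<open>Linear algebra modulo a prime\<close>

definition cg :: "int => 'r::ring_1 => 'r => bool" where "cg M A B \<longleftrightarrow> (\<exists>Z. A - B = of_int M * Z)"

lemma cg_refl: "cg M A A" unfolding cg_def by (rule exI[of _ 0]) simp
lemma cg_sym:
 assumes "cg M A B" shows "cg M B A"
proof -
 obtain Z where "A - B = of_int M * Z" using assms by (auto simp: cg_def)
 then have "B - A = of_int M * (- Z)" using minus_diff_eq[of A B] by simp
 then show ?thesis unfolding cg_def by (rule exI)
qed
lemma cg_trans:
 assumes "cg M A B" "cg M B C" shows "cg M A C"
proof -
 obtain Y Z where "A - B = of_int M * Y" "B - C = of_int M * Z" using assms by (auto simp: cg_def)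
 then have "A - C = of_int M * (Y + Z)" by (simp add: distrib_left algebra_simps)
 then show ?thesis by (auto simp: cg_def)
qed
lemma cg_add:
 assumes "cg M A B" "cg M C D" shows "cg M (A + C) (B + D)"
proof -
 obtain Y Z where "A - B = of_int M * Y" "C - D = of_int M * Z" using assms by (auto simp: cg_def)
 then have "A + C - (B + D) = of_int M * (Y + Z)" by (simp add: distrib_left algebra_simps)
 then show ?thesis by (auto simp: cg_def)
qed
lemma cg_diff:
 assumes "cg M A B" "cg M C D" shows "cg M (A - C) (B - D)"
proof -
 obtain Y Z where "A - B = of_int M * Y" "C - D = of_int M * Z" using assms by (auto simp: cg_def)
 then have "A - C - (B - D) = of_int M * (Y - Z)" by (simp add: right_diff_distrib algebra_simps)
 then show ?thesis by (auto simp: cg_def)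
qed
lemma cg_mult:
 assumes "cg M A B" "cg M C D" shows "cg M (A * C) (B * D)"
proof -
 obtain Y Z where YZ: "A - B = of_int M * Y" "C - D = of_int M * Z" using assms by (auto simp: cg_def)
 have "A * C - B * D = (A - B) * C + B * (C - D)" by (simp add: algebra_simps)
 also have "\<dots> = of_int M * (Y * C) + (B * of_int M) * Z" unfolding YZ by (simp add: mult.assoc)
 also have "B * of_int M = of_int M * B" by (rule mult_of_int_commute[symmetric])
 finally have "A * C - B * D = of_int M * (Y * C + B * Z)" by (simp add: distrib_left mult.assoc)
 then show ?thesis by (auto simp: cg_def)
qed
lemma cg_power: "cg M A B ==> cg M (A ^ n) (B ^ n)"
 by (induction n) (auto simp: cg_refl cg_mult)
lemma cg_idem_power:
 assumes F: "cg M (F * F) F" and n: "n \<ge> 1" shows "cg M (F ^ n) F"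
 using n
proof (induction n rule: nat_induct_at_least)
 case (Suc n)
 then show ?case using cg_trans[OF cg_mult[OF cg_refl[of M F] Suc.IH] F] by simp
qed (simp add: cg_refl)

lemma binomial_first_order:
 fixes B D :: "'r::ring_1"
 assumes "D * B = B * D"
 shows "\<exists>Y. (B + D) ^ Suc n = B ^ Suc n + of_nat (Suc n) * D * B ^ n + D * D * Y"
proof (induction n)
 case 0 show ?case by (rule exI[of _ 0]) simp
next
 case (Suc n)
 then obtain Y where Y: "(B + D) ^ Suc n = B ^ Suc n + of_nat (Suc n) * D * B ^ n + D * D * Y" by blast
 have c: "B * (of_nat k * x) = of_nat k * (B * x)" "D * (of_nat k * x) = of_nat k * (D * x)" for k and x :: 'r
  by (simp_all add: mult.assoc[symmetric] mult_of_nat_commute[of k B] mult_of_nat_commute[of k D])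
 have BD: "B * (D * x) = D * (B * x)" for x using assms by (simp add: mult.assoc[symmetric])
 have "(B + D) ^ Suc (Suc n) = (B + D) * (B ^ Suc n + of_nat (Suc n) * D * B ^ n + D * D * Y)"
  unfolding Y[symmetric] by simp
 also have "\<dots> = B ^ Suc (Suc n) + of_nat (Suc (Suc n)) * D * B ^ Suc n + D * D * (B * Y + of_nat (Suc n) * B ^ n + D * Y)"
  by (simp add: distrib_left distrib_right mult.assoc c BD add_ac)
 finally show ?case by blast
qed

text \<open>Write \<open>A = B + D\<close>. In the binomial expansion the linear term carries a
  factor \<open>p\<close> besides \<open>D\<close>, and the later terms contain
  \<open>D * D\<close>. Since \<open>M\<close> divides \<open>D\<close> and \<open>p\<close> divides
  \<open>M\<close>, both are divisible by \<open>p * M\<close>.\<close>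

lemma cg_lift:
 fixes A B :: "'r::ring_1" and p :: nat
 assumes "cg M A B" "A * B = B * A" "int p dvd M" "p \<ge> 1"
 shows "cg (int p * M) (A ^ p) (B ^ p)"
proof -
 obtain Z where Z: "A - B = of_int M * Z" using assms(1) by (auto simp: cg_def)
 define D where "D = A - B"
 have "D * B = B * D" using assms(2) by (simp add: D_def algebra_simps)
 from binomial_first_order[OF this, of "p - 1"] obtain Y where
  Y: "A ^ p = B ^ p + of_nat p * D * B ^ (p - 1) + D * D * Y" using assms(4) by (auto simp: D_def)
 obtain q where q: "M = int p * q" using assms(3) by (auto elim: dvdE)
 have D: "D = of_int M * Z" using Z by (simp add: D_def)
 have "D * D * Y = of_int M * (Z * of_int M) * Z * Y" unfolding D by (simp add: mult.assoc)
 also have "Z * of_int M = of_int M * Z" by (rule mult_of_int_commute[symmetric])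
 also have "of_int M * (of_int M * Z) * Z * Y = of_int (int p * M) * (of_int q * Z * Z * Y)"
 proof -
  have "M * M = int p * M * q" by (simp add: q)
  then have "of_int M * of_int M = (of_int (int p * M) * of_int q :: 'r)" by (metis of_int_mult)
  then show ?thesis by (simp add: mult.assoc[symmetric])
 qed
 finally have "A ^ p - B ^ p = of_int (int p * M) * (Z * B ^ (p - 1)) + of_int (int p * M) * (of_int q * Z * Z * Y)"
  using Y by (simp add: D mult.assoc)
 then have "A ^ p - B ^ p = of_int (int p * M) * (Z * B ^ (p - 1) + of_int q * Z * Z * Y)" by (simp only: distrib_left)
 then show ?thesis by (auto simp: cg_def)
qed

lemma cg_lift_iterate:
 fixes A B :: "'r::ring_1" and p :: nat
 assumes "cg (int p) A B" "A * B = B * A" "p \<ge> 1"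
 shows "cg (int (p ^ Suc k)) (A ^ (p ^ k)) (B ^ (p ^ k))"
proof (induction k)
 case (Suc k)
 have "A ^ m * B ^ m' = B ^ m' * A ^ m" for m m'
 proof -
  have "A ^ m * B = B * A ^ m" by (rule power_commuting_commutes[OF assms(2)])
  then have "B ^ m' * A ^ m = A ^ m * B ^ m'" by (intro power_commuting_commutes) simp
  then show ?thesis by simp
 qed
 then have "cg (int p * int (p ^ Suc k)) ((A ^ (p ^ k)) ^ p) ((B ^ (p ^ k)) ^ p)"
  using Suc assms(3) by (intro cg_lift) auto
 then show ?case by (simp add: power_mult[symmetric] mult.commute)
qed (use assms in simp)

definition mop :: "'v set => ('v => 'v => int) => 'v aop" where
 "mop V m = Aop (\<lambda>f x. if x \<in> V then \<Sum>y\<in>V. m x y * f y else 0)"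

lemma ap_mop: "ap (mop V m) f x = (if x \<in> V then \<Sum>y\<in>V. m x y * f y else 0)"
 unfolding mop_def by (subst ap_Aop) (auto simp: fun_eq_iff distrib_left sum.distrib)

lemma ent_mop: "finite V ==> ent (mop V m) x y = (if x \<in> V \<and> y \<in> V then m x y else 0)"
 by (simp add: ent_def ap_mop dlt_def if_distrib[of "\<lambda>t. _ * t"] cong: if_cong)

lemma loco_mop: "loco V (mop V m)" by (simp add: loco_def ap_mop)

lemma loco_mult: "loco V A ==> loco V B ==> loco V (A * B)" by (simp add: loco_def ap_mult)
lemma loco_power: "loco V A ==> loco V (A ^ n)"
 using subrng_power[OF subrng_loco[of V], of A n] by simp

lemma mop_cong: "(\<And>x y. x \<in> V ==> y \<in> V ==> m x y = m' x y) ==> mop V m = mop V m'"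
 by (rule aop_eqI) (auto simp: ap_mop intro!: sum.cong)

lemma mop_mult: "finite V ==> mop V m * mop V m' = mop V (\<lambda>x y. \<Sum>z\<in>V. m x z * m' z y)"
proof (rule aop_eqI)
 fix f x assume V: "finite V"
 have "(\<Sum>z\<in>V. m x z * (\<Sum>y\<in>V. m' z y * f y)) = (\<Sum>z\<in>V. \<Sum>y\<in>V. m x z * m' z y * f y)"
  by (simp add: sum_distrib_left mult.assoc)
 also have "\<dots> = (\<Sum>y\<in>V. \<Sum>z\<in>V. m x z * m' z y * f y)" by (rule sum.swap)
 finally show "ap (mop V m * mop V m') f x = ap (mop V (\<lambda>x y. \<Sum>z\<in>V. m x z * m' z y)) f x"
  by (simp add: ap_mult ap_mop sum_distrib_right)
qed

lemma mop_diff: "mop V m - mop V m' = mop V (\<lambda>x y. m x y - m' x y)"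
 by (rule aop_eqI) (simp add: ap_ops ap_mop left_diff_distrib sum_subtractf)

lemma mop_scale: "of_int c * mop V m = mop V (\<lambda>x y. c * m x y)"
 by (rule aop_eqI) (simp add: ap_mult ap_of_int ap_mop sum_distrib_left mult.assoc)

lemma cg_mop: "(\<And>x y. x \<in> V ==> y \<in> V ==> M dvd m x y - m' x y) ==> cg M (mop V m) (mop V m')"
 unfolding cg_def mop_diff
 by (rule exI[of _ "mop V (\<lambda>x y. (m x y - m' x y) div M)"]) (auto simp: mop_scale intro!: mop_cong)

lemma cg_ent: "cg M A B ==> M dvd ent A x y - ent B x y"
proof -
 assume "cg M A B"
 then obtain Z where "A - B = of_int M * Z" by (auto simp: cg_def)
 then have "ent A x y - ent B x y = M * ent Z x y"
  unfolding ent_simps(2)[symmetric] by (simp add: ent_def ap_mult ap_of_int)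
 then show ?thesis by simp
qed

text \<open>Positive powers only, since the identity operator is in general not of the form
  \<open>mop V m\<close>, which produces functions that vanish outside \<open>V\<close>.\<close>

lemma mop_power: "finite V ==> \<exists>m'. mop V m ^ Suc n = mop V m'"
 by (induction n) (auto simp: mop_mult)

definition tr :: "'v set => 'v aop => int" where "tr V A = (\<Sum>x\<in>V. ent A x x)"

lemma tr_mult: "finite V ==> loco V A ==> loco V B ==> tr V (A * B) = tr V (B * A)"
 unfolding tr_def by (simp add: ent_mult mult.commute) (rule sum.swap)

lemma cg_tr: "cg M A B ==> M dvd tr V A - tr V B"
 unfolding tr_def sum_subtractf[symmetric] by (intro dvd_sum cg_ent)

text \<open>There are finitely many matrices modulo \<open>p\<close>, so the powers become periodic.
  An exponent that is a multiple of the period and lies beyond the preperiod gives an idempotent;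
  here \<open>j - i\<close> is a period from the exponent \<open>Suc i\<close> on.\<close>

lemma idempotent_power:
 assumes V: "finite V" and p: "(p::nat) \<ge> 1"
 shows "\<exists>n\<ge>1. cg (int p) (mop V m ^ n * mop V m ^ n) (mop V m ^ n)"
proof -
 define E where "E = mop V m"
 define F where "F i = (\<lambda>q\<in>V \<times> V. ent (E ^ Suc i) (fst q) (snd q) mod int p)" for i
 have "F i \<in> PiE (V \<times> V) (\<lambda>_. {0..<int p})" for i using p by (auto simp: F_def)
 moreover have "finite (PiE (V \<times> V) (\<lambda>_. {0..<int p}))" using V by (intro finite_PiE) auto
 ultimately have "finite (range F)" by (meson finite_subset image_subsetI)
 then have "\<not> inj F" using finite_imageD infinite_UNIV_nat by blast
 then obtain i j where ij: "F i = F j" "i < j" unfolding inj_def by (metis linorder_neqE_nat)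
 have E0: "cg (int p) (E ^ Suc i) (E ^ Suc j)"
 proof -
  obtain mi mj where mm: "E ^ Suc i = mop V mi" "E ^ Suc j = mop V mj" using mop_power[OF V] unfolding E_def by metis
  have "mi x y mod int p = mj x y mod int p" if "x \<in> V" "y \<in> V" for x y
   using fun_cong[OF ij(1), of "(x, y)"] that V by (simp add: F_def mm ent_mop del: power_Suc)
  then show ?thesis unfolding mm by (intro cg_mop) (simp add: mod_eq_dvd_iff)
 qed
 have 1: "cg (int p) (E ^ (k + Suc i)) (E ^ (k + Suc i + (j - i)))" for k
 proof -
  have "k + Suc i + (j - i) = k + Suc j" using ij(2) by simp
  moreover have "cg (int p) (E ^ k * E ^ Suc i) (E ^ k * E ^ Suc j)" by (rule cg_mult[OF cg_refl E0])
  ultimately show ?thesis by (simp only: power_add)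
 qed
 have 2: "cg (int p) (E ^ (k + Suc i)) (E ^ (k + Suc i + t * (j - i)))" for k t
 proof (induction t)
  case (Suc t)
  have "cg (int p) (E ^ (k + t * (j - i) + Suc i)) (E ^ (k + t * (j - i) + Suc i + (j - i)))" by (rule 1)
  then show ?case using cg_trans[OF Suc] by (simp add: add_ac)
 qed (simp add: cg_refl)
 define n where "n = Suc i * (j - i)"
 have n: "n \<ge> Suc i" using ij(2) by (cases "j - i") (auto simp: n_def)
 have "cg (int p) (E ^ n) (E ^ (n + n))" 
 proof -
  have "n - Suc i + Suc i = n" using n by simp
  then show ?thesis using 2[of "n - Suc i" "Suc i"] by (simp only: n_def[symmetric])
 qed
 then show ?thesis using n cg_sym by (intro exI[of _ n]) (auto simp: E_def power_add)
qed

section \<open>Vector spaces over the field with \<open>p\<close> elements, represented by reduced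
  integer functions\<close>

definition redv :: "nat => 'v set => ('v => int) => 'v => int" where
 "redv p V f = (\<lambda>x. if x \<in> V then f x mod int p else 0)"

definition FV :: "nat => 'v set => ('v => int) set" where "FV p V = {f. redv p V f = f}"

definition lins :: "nat => 'v set => ('v => int) set => bool" where
 "lins p V W \<longleftrightarrow> W \<subseteq> FV p V \<and> (\<lambda>x. 0) \<in> W \<and> (\<forall>u\<in>W. \<forall>w\<in>W. \<forall>c. redv p V (\<lambda>x. u x + c * w x) \<in> W)"

lemma linsD:
 assumes "lins p V W"
 shows "W \<subseteq> FV p V" "(\<lambda>x. 0) \<in> W" "\<And>u w c. u \<in> W ==> w \<in> W ==> redv p V (\<lambda>x. u x + c * w x) \<in> W"
 using assms by (auto simp: lins_def)

lemma redv_redv: "redv p V (redv p V f) = redv p V f" by (auto simp: redv_def)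
lemma redv_FV: "redv p V f \<in> FV p V" by (simp add: FV_def redv_redv)
lemma redv_eq_iff: "redv p V f = redv p V h \<longleftrightarrow> (\<forall>x\<in>V. int p dvd f x - h x)"
 by (auto simp: redv_def fun_eq_iff mod_eq_dvd_iff)

lemma FV_range: "f \<in> FV p V ==> p \<ge> 1 ==> x \<in> V ==> 0 \<le> f x \<and> f x < int p"
proof -
 assume "f \<in> FV p V" and p: "p \<ge> 1" and "x \<in> V"
 then have "f x = f x mod int p" by (metis (mono_tags, lifting) FV_def mem_Collect_eq redv_def)
 then show ?thesis using pos_mod_sign[of "int p" "f x"] pos_mod_bound[of "int p" "f x"] p by simp
qed

lemma FV_outside: "f \<in> FV p V ==> x \<notin> V ==> f x = 0"
 by (metis (mono_tags, lifting) FV_def mem_Collect_eq redv_def)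

lemma FV_I: "(\<And>x. x \<in> V ==> 0 \<le> f x \<and> f x < int p) ==> (\<And>x. x \<notin> V ==> f x = 0) ==> f \<in> FV p V"
 by (auto simp: FV_def redv_def fun_eq_iff)

lemma FV_bij:
 assumes p: "p \<ge> 1" shows "bij_betw (\<lambda>f. restrict f V) (FV p V) (PiE V (\<lambda>_. {0..<int p}))"
proof (rule bij_betw_byWitness[where f' = "\<lambda>f x. if x \<in> V then f x else 0"])
 show "\<forall>f\<in>FV p V. (\<lambda>x. if x \<in> V then restrict f V x else 0) = f"
  by (auto simp: fun_eq_iff FV_outside)
 show "\<forall>f\<in>PiE V (\<lambda>_. {0..<int p}). restrict (\<lambda>x. if x \<in> V then f x else 0) V = f"
  by (auto simp: fun_eq_iff PiE_def extensional_def)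
 show "(\<lambda>f. restrict f V) ` FV p V \<subseteq> PiE V (\<lambda>_. {0..<int p})" using FV_range[OF _ p] by fastforce
 show "(\<lambda>f x. if x \<in> V then f x else 0) ` PiE V (\<lambda>_. {0..<int p}) \<subseteq> FV p V"
  by (auto intro!: FV_I)
qed

lemma card_FV: "finite V ==> p \<ge> 1 ==> card (FV p V) = p ^ card V"
 using bij_betw_same_card[OF FV_bij[of p V]] by (simp add: card_PiE)

lemma finite_FV: "finite V ==> p \<ge> 1 ==> finite (FV p V)"
 using bij_betw_finite[OF FV_bij[of p V]] by (simp add: finite_PiE)

lemma lins_sum:
 assumes W: "lins p V W" and "\<And>j. j \<in> J ==> b j \<in> W"
 shows "redv p V (\<lambda>x. \<Sum>j\<in>J. c j * b j x) \<in> W"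
 using assms(2)
proof (induction J rule: infinite_finite_induct)
 case (insert j J)
 have "redv p V (\<lambda>x. redv p V (\<lambda>x. \<Sum>j\<in>J. c j * b j x) x + c j * b j x) \<in> W"
  using insert W by (auto simp: lins_def)
 also have "redv p V (\<lambda>x. redv p V (\<lambda>x. \<Sum>j\<in>J. c j * b j x) x + c j * b j x) = redv p V (\<lambda>x. \<Sum>j\<in>insert j J. c j * b j x)"
  using insert by (auto simp: redv_def fun_eq_iff mod_simps add.commute)
 finally show ?case .
next
 case (infinite J)
 have "redv p V (\<lambda>x. 0) = (\<lambda>x. 0)" by (simp add: redv_def fun_eq_iff)
 then show ?case using infinite W by (simp add: lins_def)
next
 case empty
 have "redv p V (\<lambda>x. 0) = (\<lambda>x. 0)" by (simp add: redv_def fun_eq_iff)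
 then show ?case using W by (simp add: lins_def)
qed

text \<open>Gaussian elimination in the form of a maximality argument. Consider the sets
  \<open>J\<close> of positions that admit a family in \<open>W\<close> dual to the coordinates in
  \<open>J\<close>, and take a largest one. If some vector of \<open>W\<close> were not recovered
  from its coordinates in \<open>J\<close>, subtracting would leave a vector of \<open>W\<close>
  that vanishes on \<open>J\<close> and has an invertible entry elsewhere, and that position could
  be added.\<close>

lemma pivots:
 assumes V: "finite V" and p: "Factorial_Ring.prime (p::nat)" and W: "lins p V W"
 shows "\<exists>J b. J \<subseteq> V \<and> (\<forall>j\<in>J. b j \<in> W) \<and> (\<forall>j\<in>J. \<forall>i\<in>J. b j i = (if i = j then 1 else 0)) \<and>
   (\<forall>w\<in>W. w = redv p V (\<lambda>x. \<Sum>j\<in>J. w j * b j x))"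
proof -
 define good where "good J \<longleftrightarrow> J \<subseteq> V \<and> (\<exists>b. (\<forall>j\<in>J. b j \<in> W) \<and> (\<forall>j\<in>J. \<forall>i\<in>J. b j i = (if i = j then 1 else 0)))" for J
 have "good {}" by (simp add: good_def)
 moreover have "card J < Suc (card V)" if "good J" for J
  using that V card_mono by (fastforce simp: good_def less_Suc_eq_le)
 ultimately have "\<exists>J. good J \<and> (\<forall>J'. good J' \<longrightarrow> card J' \<le> card J)"
  using ex_has_greatest_nat[of good "{}" card] by blast
 then obtain J where J: "good J" "\<And>J'. good J' ==> card J' \<le> card J" by blast
 obtain b where b: "J \<subseteq> V" "\<And>j. j \<in> J ==> b j \<in> W" "\<And>j i. j \<in> J ==> i \<in> J ==> b j i = (if i = j then 1 else 0)"
  using J(1) unfolding good_def by blast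
 have finJ: "finite J" using b(1) V finite_subset by auto
 have p1: "int p > 1" using prime_gt_1_nat[OF p] by simp
 have wb: "w = redv p V (\<lambda>x. \<Sum>j\<in>J. w j * b j x)" if w: "w \<in> W" for w
 proof (rule ccontr)
  assume ne: "w \<noteq> redv p V (\<lambda>x. \<Sum>j\<in>J. w j * b j x)"
  define w' where "w' = redv p V (\<lambda>x. \<Sum>j\<in>J. w j * b j x)"
  define d where "d = redv p V (\<lambda>x. w x + (-1) * w' x)"
  have w'W: "w' \<in> W" unfolding w'_def by (rule lins_sum[OF W b(2)])
  have dW: "d \<in> W" unfolding d_def by (rule linsD(3)[OF W w w'W])
  have wF: "redv p V w = w" "redv p V w' = w'" using w w'W W by (auto simp: lins_def FV_def)
  have wJ: "w' i = w i" if "i \<in> J" for i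
  proof -
   have "(\<Sum>j\<in>J. w j * b j i) = (\<Sum>j\<in>J. if j = i then w i else 0)"
    using b(3) that by (intro sum.cong) auto
   then have "w' i = w i mod int p" using that b(1) finJ by (auto simp: w'_def redv_def)
   then show ?thesis using fun_cong[OF wF(1), of i] that b(1) by (auto simp: redv_def)
  qed
  have "\<exists>o1\<in>V. \<not> int p dvd d o1"
  proof (rule ccontr)
   assume "\<not> ?thesis"
   then have "\<forall>x\<in>V. int p dvd w x - w' x" by (auto simp: d_def redv_def dvd_mod_iff)
   then have "redv p V w = redv p V w'" by (simp add: redv_eq_iff)
   then show False using wF ne by (simp add: w'_def)
  qed
  then obtain o1 where o1: "o1 \<in> V" "\<not> int p dvd d o1" by blast
  have dJ: "d i = 0" if "i \<in> J" for i using wJ[OF that] by (simp add: d_def redv_def)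
  have o1J: "o1 \<notin> J" using dJ o1(2) by auto
  have "Factorial_Ring.prime (int p)" using p by (simp add: prime_int_nat_transfer)
  then have "coprime (d o1) (int p)" using prime_imp_coprime[OF _ o1(2)] by (simp add: coprime_commute)
  then obtain r where r: "[d o1 * r = 1] (mod int p)" using cong_solve_coprime_int by blast
  define e where "e = redv p V (\<lambda>x. 0 + r * d x)"
  have eW: "e \<in> W" unfolding e_def using linsD(3)[OF W linsD(2)[OF W] dW, of r] .
  have e1: "e o1 = 1" using r o1(1) p1 by (simp add: e_def redv_def cong_def mult.commute)
  have eJ: "e i = 0" if "i \<in> J" for i using dJ[OF that] by (simp add: e_def redv_def)
  define b' where "b' j = (if j = o1 then e else redv p V (\<lambda>x. b j x + (- b j o1) * e x))" for j
  have "good (insert o1 J)" unfolding good_def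
  proof (intro conjI exI[of _ b'] ballI)
   show "insert o1 J \<subseteq> V" using o1 b(1) by auto
   show "b' j \<in> W" if "j \<in> insert o1 J" for j
   proof (cases "j = o1")
    case False
    then have "b j \<in> W" using that b(2) by simp
    then have "redv p V (\<lambda>x. b j x + (- b j o1) * e x) \<in> W" by (rule linsD(3)[OF W _ eW])
    then show ?thesis using False by (simp add: b'_def)
   qed (simp add: b'_def eW)
   show "b' j i = (if i = j then 1 else 0)" if "j \<in> insert o1 J" "i \<in> insert o1 J" for j i
    using that e1 eJ b(1,3) o1 o1J p1 by (auto simp: b'_def redv_def)
  qed
  then show False using J(2)[of "insert o1 J"] finJ o1J by simp
 qed
 show ?thesis
 proof (intro exI[of _ J] exI[of _ b] conjI ballI)
  show "J \<subseteq> V" by (rule b(1))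
  show "b j \<in> W" if "j \<in> J" for j by (rule b(2)[OF that])
  show "b j i = (if i = j then 1 else 0)" if "j \<in> J" "i \<in> J" for j i by (rule b(3)[OF that])
  show "w = redv p V (\<lambda>x. \<Sum>j\<in>J. w j * b j x)" if "w \<in> W" for w by (rule wb[OF that])
 qed
qed

lemma card_pivots:
 assumes V: "finite V" and p: "p \<ge> 2" and W: "lins p V W" and J: "J \<subseteq> V" and bW: "\<And>j. j \<in> J ==> b j \<in> W"
  and bd: "\<And>j i. j \<in> J ==> i \<in> J ==> b j i = (if i = j then 1 else 0)"
  and wb: "\<And>w. w \<in> W ==> w = redv p V (\<lambda>x. \<Sum>j\<in>J. w j * b j x)"
 shows "card W = p ^ card J"
proof -
 have finJ: "finite J" using J V finite_subset by auto
 have "bij_betw (\<lambda>w. redv p J w) W (FV p J)"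
 proof (rule bij_betw_byWitness[where f' = "\<lambda>c. redv p V (\<lambda>x. \<Sum>j\<in>J. c j * b j x)"])
  show "\<forall>w\<in>W. redv p V (\<lambda>x. \<Sum>j\<in>J. redv p J w j * b j x) = w"
  proof
   fix w assume w: "w \<in> W"
   have "redv p J w j = w j" if "j \<in> J" for j
   proof -
    have "redv p V w j = w j" using w W by (auto simp: lins_def FV_def)
    then show ?thesis using that J by (auto simp: redv_def)
   qed
   then show "redv p V (\<lambda>x. \<Sum>j\<in>J. redv p J w j * b j x) = w" using wb[OF w] by simp
  qed
  show "\<forall>c\<in>FV p J. redv p J (redv p V (\<lambda>x. \<Sum>j\<in>J. c j * b j x)) = c"
  proof
   fix c assume c: "c \<in> FV p J"
   have "(\<Sum>j\<in>J. c j * b j i) = c i" if "i \<in> J" for i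
   proof -
    have "(\<Sum>j\<in>J. c j * b j i) = (\<Sum>j\<in>J. if j = i then c i else 0)" using bd that by (intro sum.cong) auto
    then show ?thesis using finJ that by simp
   qed
   then have "redv p J (redv p V (\<lambda>x. \<Sum>j\<in>J. c j * b j x)) = redv p J c" using J by (auto simp: redv_def fun_eq_iff)
   then show "redv p J (redv p V (\<lambda>x. \<Sum>j\<in>J. c j * b j x)) = c" using c by (simp add: FV_def)
  qed
  show "(\<lambda>w. redv p J w) ` W \<subseteq> FV p J" by (auto simp: redv_FV)
  show "(\<lambda>c. redv p V (\<lambda>x. \<Sum>j\<in>J. c j * b j x)) ` FV p J \<subseteq> W" using lins_sum[OF W bW] by auto
 qed
 then show ?thesis using bij_betw_same_card card_FV[OF finJ] p by fastforce
qed

definition Imp :: "nat => 'v set => 'v aop => ('v => int) set" where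
 "Imp p V A = (\<lambda>f. redv p V (ap A f)) ` FV p V"

lemma redv_ap: "redv p V (ap (mop V m) (redv p V f)) = redv p V (ap (mop V m) f)"
 unfolding redv_eq_iff
proof
 fix x assume x: "x \<in> V"
 have "ap (mop V m) (redv p V f) x - ap (mop V m) f x = (\<Sum>y\<in>V. m x y * (f y mod int p - f y))"
  using x by (simp add: ap_mop redv_def sum_subtractf right_diff_distrib)
 also have "int p dvd \<dots>"
  by (intro dvd_sum dvd_mult) (metis dvd_minus_mod dvd_diff_commute)
 finally show "int p dvd ap (mop V m) (redv p V f) x - ap (mop V m) f x" .
qed

lemma redv_cg: "cg (int p) A B ==> redv p V (ap A f) = redv p V (ap B f)"
proof -
 assume "cg (int p) A B"
 then obtain Z where "A - B = of_int (int p) * Z" by (auto simp: cg_def)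
 then have "ap (A - B) f x = int p * ap Z f x" for x by (simp add: ap_mult ap_of_int del: of_int_of_nat_eq)
 then show ?thesis by (auto simp: redv_eq_iff ap_ops)
qed

lemma lins_Imp: "lins p V (Imp p V (mop V m))"
 unfolding lins_def
proof (intro conjI ballI allI)
 show "Imp p V (mop V m) \<subseteq> FV p V" by (auto simp: Imp_def redv_FV)
 have "redv p V (ap (mop V m) (\<lambda>x. 0)) = (\<lambda>x. 0)" by (simp add: ap_zero redv_def fun_eq_iff)
 moreover have "(\<lambda>x. 0) \<in> FV p V" by (simp add: FV_def redv_def fun_eq_iff)
 ultimately show "(\<lambda>x. 0) \<in> Imp p V (mop V m)" unfolding Imp_def by (metis (no_types, lifting) imageI)
 fix u w c assume "u \<in> Imp p V (mop V m)" "w \<in> Imp p V (mop V m)"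
 then obtain f h where fh: "u = redv p V (ap (mop V m) f)" "w = redv p V (ap (mop V m) h)" by (auto simp: Imp_def)
 have m: "(x mod int p + c * (y mod int p)) mod int p = (x + c * y) mod int p" for x y
  by (rule mod_add_cong) (simp_all add: mod_mult_right_eq)
 have "redv p V (\<lambda>x. u x + c * w x) = redv p V (ap (mop V m) (\<lambda>x. f x + c * h x))"
  unfolding fh by (auto simp: redv_def fun_eq_iff ap_add ap_scale m)
 also have "\<dots> = redv p V (ap (mop V m) (redv p V (\<lambda>x. f x + c * h x)))" by (simp add: redv_ap)
 finally show "redv p V (\<lambda>x. u x + c * w x) \<in> Imp p V (mop V m)"
  unfolding Imp_def using redv_FV by (metis (no_types, lifting) imageI)
qed

text \<open>Raising to the power \<open>p ^ k\<close> lifts an idempotent modulo \<open>p\<close> to one modulo \<open>p ^ Suc k\<close>, so the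
 traces determine its rank.\<close>

lemma trace_rank:
 assumes V: "finite V" and p: "Factorial_Ring.prime (p::nat)" and n: "n \<ge> 1" and k: "k \<ge> 1"
  and idem: "cg (int p) (mop V m ^ n * mop V m ^ n) (mop V m ^ n)"
 shows "\<exists>r\<le>card V. card (Imp p V (mop V m ^ n)) = p ^ r \<and>
  (\<forall>k\<ge>1. int (p ^ Suc k) dvd tr V (mop V m ^ (n * p ^ k)) - int r)"
proof -
 obtain m0 where m0: "mop V m ^ n = mop V m0" using mop_power[OF V, of m "n - 1"] n by auto
 define F0 where "F0 = mop V m0"
 have idem0: "cg (int p) (F0 * F0) F0" using idem by (simp add: m0 F0_def)
 have p2: "p \<ge> 2" using prime_ge_2_nat[OF p] .
 have W: "lins p V (Imp p V F0)" unfolding F0_def by (rule lins_Imp)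
 obtain J b where Jb: "J \<subseteq> V \<and> (\<forall>j\<in>J. b j \<in> Imp p V F0) \<and> (\<forall>j\<in>J. \<forall>i\<in>J. b j i = (if i = j then 1 else 0)) \<and>
   (\<forall>w\<in>Imp p V F0. w = redv p V (\<lambda>x. \<Sum>j\<in>J. w j * b j x))"
  using pivots[OF V p W] by (elim exE) (rule that)
 have J: "J \<subseteq> V" using Jb by (rule conjunct1)
 have bW: "b j \<in> Imp p V F0" if "j \<in> J" for j using Jb[THEN conjunct2, THEN conjunct1] that by (rule bspec)
 have bd: "b j i = (if i = j then 1 else 0)" if "j \<in> J" "i \<in> J" for j i
  by (rule bspec[OF bspec[OF Jb[THEN conjunct2, THEN conjunct2, THEN conjunct1] that(1)] that(2)])
 have wb: "w = redv p V (\<lambda>x. \<Sum>j\<in>J. w j * b j x)" if "w \<in> Imp p V F0" for w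
  by (rule bspec[OF Jb[THEN conjunct2, THEN conjunct2, THEN conjunct2] that])
 have cardW: "card (Imp p V F0) = p ^ card J" by (rule card_pivots[OF V p2 W J bW bd wb])
 \<comment> \<open>A rank factorization modulo \<open>p\<close>: the columns of \<open>C\<close> are
   the pivot basis of the image, the rows of \<open>D\<close> are those rows of the idempotent that
   belong to pivots, and \<open>I1\<close> is the identity matrix of size \<open>card J\<close>,
   padded with zeros so that all matrices act on functions on \<open>V\<close>.\<close>
 define C where "C = mop V (\<lambda>x j. if j \<in> J then b j x else 0)"
 define D where "D = mop V (\<lambda>j y. if j \<in> J then m0 j y else 0)"
 define I1 where "I1 = mop V (\<lambda>x y. if x = y \<and> x \<in> J then (1::int) else 0)"
 have dl: "(if x = y \<and> P then (1::int) else 0) * c = (if x = y then if P then c else 0 else 0)"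
  "c * (if x = y \<and> P then (1::int) else 0) = (if x = y then if P then c else 0 else 0)" for x y :: 'a and P c by auto
 have ID: "I1 * D = D" unfolding I1_def D_def mop_mult[OF V] by (rule mop_cong) (simp add: dl V)
 have CI: "C * I1 = C" unfolding I1_def C_def mop_mult[OF V] by (rule mop_cong) (simp add: dl V)
 have II: "I1 * I1 = I1" unfolding I1_def mop_mult[OF V] by (rule mop_cong) (simp add: dl V)
 have Ipow: "I1 ^ q = I1" if "q \<ge> 1" for q using that by (induction q rule: nat_induct_at_least) (simp_all add: II)
 have CD: "cg (int p) (C * D) F0" unfolding C_def D_def F0_def mop_mult[OF V]
 proof (rule cg_mop)
  fix x y assume x: "x \<in> V" and y: "y \<in> V"
  define w where "w = redv p V (ap F0 (dlt y))"
  have "dlt y \<in> FV p V" using y p2 by (auto intro!: FV_I simp: dlt_def)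
  then have w: "w \<in> Imp p V F0" by (simp add: Imp_def w_def)
  have wv: "w z = m0 z y mod int p" if "z \<in> V" for z
   using that y V ent_mop[OF V, of m0 z y] by (simp add: w_def redv_def F0_def ent_def)
  have "w x = (\<Sum>j\<in>J. w j * b j x) mod int p" using fun_cong[OF wb[OF w], of x] x by (simp add: redv_def)
  also have "(\<Sum>j\<in>J. w j * b j x) = (\<Sum>j\<in>J. (m0 j y mod int p) * b j x)" using wv J by (intro sum.cong) auto
  also have "\<dots> mod int p = (\<Sum>j\<in>J. b j x * m0 j y) mod int p"
   by (subst (1 2) mod_sum_eq[symmetric]) (simp add: mod_simps mult.commute)
  finally have "m0 x y mod int p = (\<Sum>j\<in>J. b j x * m0 j y) mod int p" using wv[OF x] by simp
  moreover have "(\<Sum>z\<in>V. (if z \<in> J then b z x else 0) * (if z \<in> J then m0 z y else 0)) = (\<Sum>j\<in>J. b j x * m0 j y)"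
   using V J by (intro sum.mono_neutral_cong_right) auto
  ultimately show "int p dvd (\<Sum>z\<in>V. (if z \<in> J then b z x else 0) * (if z \<in> J then m0 z y else 0)) - m0 x y"
   by (metis mod_eq_dvd_iff)
 qed
 have DC: "cg (int p) (D * C) I1" unfolding C_def D_def I1_def mop_mult[OF V]
 proof (rule cg_mop)
  fix j i assume ji: "j \<in> V" "i \<in> V"
  show "int p dvd (\<Sum>z\<in>V. (if j \<in> J then m0 j z else 0) * (if i \<in> J then b i z else 0)) - (if j = i \<and> j \<in> J then 1 else 0)"
  proof (cases "j \<in> J \<and> i \<in> J")
   case True
   obtain f where f: "b i = redv p V (ap F0 f)" using bW True by (auto simp: Imp_def)
   have "redv p V (ap F0 (b i)) = redv p V (ap F0 (ap F0 f))" unfolding f F0_def by (rule redv_ap)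
   also have "\<dots> = redv p V (ap F0 f)" using redv_cg[OF idem0] by (simp add: ap_mult)
   also have "\<dots> = redv p V (b i)" by (simp add: f redv_redv)
   finally have "int p dvd ap F0 (b i) j - b i j" using ji by (simp add: redv_eq_iff)
   then show ?thesis using True bd ji by (auto simp: F0_def ap_mop)
  qed auto
 qed
 have all: "int (p ^ Suc k) dvd tr V (mop V m ^ (n * p ^ k)) - int (card J)" if k: "k \<ge> 1" for k
 proof -
  let ?M = "int (p ^ Suc k)"
  define q where "q = p ^ k"
  have "p ^ 1 \<le> p ^ k" using p2 k by (intro power_increasing) auto
  then have q2: "q \<ge> 2" using p2 by (simp add: q_def)
  define F where "F = F0 ^ q"
  have FF: "cg ?M (F * F) F"
  proof -
   have "cg ?M ((F0 * F0) ^ (p ^ k)) (F0 ^ (p ^ k))"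
    by (rule cg_lift_iterate[OF idem0]) (use p2 in \<open>auto simp: mult.assoc\<close>)
   then show ?thesis by (simp add: F_def q_def power_mult_distrib[symmetric] power_add[symmetric] power2_eq_square[symmetric] power_mult[symmetric] mult.commute flip: mult_2)
  qed
  have FF0: "cg (int p) F F0" unfolding F_def by (rule cg_idem_power[OF idem0]) (use q2 in simp)
  \<comment> \<open>Modulo \<open>p\<close> this is \<open>I1\<close>. Hence its power with exponent
    \<open>q\<close> is \<open>I1\<close> modulo \<open>p ^ Suc k\<close>, and
    \<open>U ^ (q - 1)\<close> inverts it in the corner cut out by \<open>I1\<close>.\<close>
  define U where "U = D * F * C"
  have IU: "I1 * U = U" "U * I1 = U" unfolding U_def by (simp_all add: mult.assoc CI) (simp add: mult.assoc[symmetric] ID)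
  have U: "cg (int p) U I1"
  proof -
   have "cg (int p) U (D * (C * D) * C)" unfolding U_def
    by (intro cg_mult cg_refl cg_trans[OF FF0] cg_sym[OF CD])
   moreover have "cg (int p) (D * C * (D * C)) (I1 * I1)" by (intro cg_mult DC)
   ultimately show ?thesis using cg_trans by (fastforce simp: mult.assoc II)
  qed
  have Uq: "cg ?M (U ^ q) I1"
   using cg_lift_iterate[OF U, of k] IU p2 Ipow[of q] q2 by (simp add: q_def)
  define Ui where "Ui = U ^ (q - 1)"
  have UiU: "Ui * U = U ^ q" "U * Ui = U ^ q" using q2 by (simp_all add: Ui_def power_Suc2[symmetric] power_Suc[symmetric] del: power_Suc)
  have IUi: "I1 * Ui = Ui"
  proof -
   have "q - 1 = Suc (q - 2)" using q2 by simp
   then have "U ^ (q - 1) = U * U ^ (q - 2)" by (simp only: power_Suc)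
   then show ?thesis unfolding Ui_def by (simp add: mult.assoc[symmetric] IU)
  qed
  have Uip: "cg (int p) Ui I1" using cg_power[OF U, of "q - 1"] Ipow[of "q - 1"] q2 by (simp add: Ui_def)
  \<comment> \<open>A second idempotent modulo \<open>p ^ Suc k\<close> that visibly factors through
    a space of rank \<open>card J\<close>. It agrees with \<open>F\<close> modulo \<open>p\<close>,
    and its products with \<open>F\<close> on either side are \<open>F'\<close> again.\<close>
  define F' where "F' = F * C * Ui * D * F"
  have F'F': "cg ?M (F' * F') F'"
  proof -
   have "cg ?M (F * C * Ui * (D * (F * F) * C) * Ui * D * F) (F * C * Ui * (D * F * C) * Ui * D * F)"
    by (intro cg_mult cg_refl FF)
   also have "F * C * Ui * (D * F * C) * Ui * D * F = F * C * (Ui * U) * Ui * D * F" by (simp add: U_def mult.assoc)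
   finally have "cg ?M (F' * F') (F * C * (Ui * U) * Ui * D * F)" by (simp add: F'_def mult.assoc)
   moreover have "cg ?M (F * C * (Ui * U) * Ui * D * F) (F * C * I1 * Ui * D * F)"
    unfolding UiU by (intro cg_mult cg_refl Uq)
   moreover have "F * C * I1 * Ui * D * F = F'" by (simp add: F'_def mult.assoc) (simp add: mult.assoc[symmetric] IUi CI)
   ultimately show ?thesis using cg_trans by metis
  qed
  have FF': "cg ?M (F * F') F'"
  proof -
   have "cg ?M (F * F * (C * Ui * D * F)) (F * (C * Ui * D * F))" by (intro cg_mult cg_refl FF)
   then show ?thesis by (simp add: F'_def mult.assoc)
  qed
  have F'F: "cg ?M (F' * F) F'"
  proof -
   have "cg ?M (F * C * Ui * D * (F * F)) (F * C * Ui * D * F)" by (intro cg_mult cg_refl FF)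
   then show ?thesis by (simp add: F'_def mult.assoc)
  qed
  \<comment> \<open>The difference is idempotent modulo \<open>p ^ Suc k\<close> and divisible by
    \<open>p\<close>. An idempotent is congruent to its power with exponent \<open>Suc k\<close>,
    which is divisible by \<open>p ^ Suc k\<close>; so \<open>F\<close> and \<open>F'\<close> agree
    to the full precision.\<close>
  define H where "H = F - F'"
  have HH: "cg ?M (H * H) H"
  proof -
   have "cg ?M (F * F - F * F' - (F' * F - F' * F')) (F - F' - (F' - F'))"
    by (intro cg_diff FF FF' F'F F'F')
   then show ?thesis by (simp add: H_def algebra_simps)
  qed
  have Hp: "cg (int p) H 0"
  proof -
   have "cg (int p) F' (F0 * C * I1 * D * F0)" unfolding F'_def by (intro cg_mult cg_refl FF0 Uip)
   moreover have "F0 * C * I1 * D * F0 = F0 * (C * D) * F0" by (simp add: mult.assoc) (simp add: mult.assoc[symmetric] ID)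
   moreover have "cg (int p) (F0 * (C * D) * F0) (F0 * F0 * F0)" by (intro cg_mult cg_refl CD)
   moreover have "cg (int p) (F0 * F0 * F0) F0" using cg_trans[OF cg_mult[OF idem0 cg_refl] idem0] .
   ultimately have "cg (int p) F' F0" using cg_trans by metis
   from cg_diff[OF FF0 this] show ?thesis by (simp add: H_def)
  qed
  have "cg ?M H 0"
  proof -
   obtain Y where Y: "H = of_int (int p) * Y" using Hp by (auto simp: cg_def)
   have "of_int c * Y * (of_int d * Z) = of_int (c * d) * (Y * Z)" for c d and Z :: "'a aop"
    using mult_of_int_commute[of d Y] by (simp add: mult.assoc[symmetric]) (simp add: mult.assoc)
   then have HY: "H ^ i = of_int (int p ^ i) * Y ^ i" for i
    by (induction i) (simp_all add: Y del: of_int_mult of_int_power of_int_of_nat_eq)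
   have "H ^ Suc k - 0 = of_int ?M * Y ^ Suc k" unfolding HY by simp
   then have "cg ?M (H ^ Suc k) 0" unfolding cg_def by (rule exI)
   moreover have "cg ?M (H ^ Suc k) H" by (rule cg_idem_power[OF HH]) simp
   ultimately show ?thesis using cg_trans cg_sym by metis
  qed
  then have "cg ?M F F'" using cg_add[OF _ cg_refl, of ?M H 0 F'] by (simp add: H_def)
  then have t1: "?M dvd tr V F - tr V F'" by (rule cg_tr)
  have lC: "loco V C" "loco V D" "loco V F" "loco V Ui" "loco V U"
   unfolding C_def D_def F_def F0_def Ui_def U_def by (intro loco_mop loco_power loco_mult)+
  \<comment> \<open>Rotating the factors under the trace collects \<open>Ui * U\<close>, which is
    congruent to \<open>I1\<close>.\<close>
  have "tr V F' = tr V ((F * C) * (Ui * D * F))" by (simp add: F'_def mult.assoc)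
  also have "\<dots> = tr V ((Ui * D * F) * (F * C))" by (rule tr_mult[OF V]) (intro loco_mult lC)+
  also have "\<dots> = tr V (Ui * (D * (F * F) * C))" by (simp add: mult.assoc)
  finally have t2: "?M dvd tr V F' - tr V (Ui * (D * F * C))"
   using cg_tr[of ?M "Ui * (D * (F * F) * C)" "Ui * (D * F * C)" V] cg_mult[OF cg_refl cg_mult[OF cg_mult[OF cg_refl FF] cg_refl]] by metis
  have t3: "?M dvd tr V (Ui * (D * F * C)) - tr V I1" using cg_tr[OF Uq] UiU by (simp add: U_def)
  have "tr V I1 = (\<Sum>x\<in>V. if x \<in> J then 1 else 0)" using V by (simp add: tr_def I1_def ent_mop)
  also have "\<dots> = int (card J)" using V J by (simp add: sum.If_cases Int_absorb1)
  finally have "?M dvd tr V F - int (card J)" using dvd_add[OF t1 dvd_add[OF t2 t3]] by simp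
  moreover have "F = mop V m ^ (n * p ^ k)" by (simp add: F_def F0_def m0[symmetric] power_mult q_def)
  ultimately show ?thesis by simp
 qed
 show ?thesis using all cardW card_mono[OF V J] by (intro exI[of _ "card J"]) (auto simp: m0 F0_def)
qed

text \<open>Traces modulo \<open>p\<close> would determine the ranks only modulo \<open>p\<close>.
  With a precision \<open>p ^ Suc k\<close> that exceeds the sum of the two dimensions, equal traces
  force equal ranks, even for matrices of different sizes.\<close>

lemma stable_rank_eq:
 fixes V1 :: "'v set" and V2 :: "'w set"
 assumes V1: "finite V1" and V2: "finite V2" and p: "Factorial_Ring.prime (p::nat)" and n: "n \<ge> 1"
  and id1: "cg (int p) (mop V1 m1 ^ n * mop V1 m1 ^ n) (mop V1 m1 ^ n)"
  and id2: "cg (int p) (mop V2 m2 ^ n * mop V2 m2 ^ n) (mop V2 m2 ^ n)"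
  and trs: "\<And>q. q \<ge> 1 ==> tr V1 (mop V1 m1 ^ q) = tr V2 (mop V2 m2 ^ q)"
 shows "card (Imp p V1 (mop V1 m1 ^ n)) = card (Imp p V2 (mop V2 m2 ^ n))"
proof -
 obtain r1 where r1: "r1 \<le> card V1" "card (Imp p V1 (mop V1 m1 ^ n)) = p ^ r1"
  "\<And>k. k \<ge> 1 ==> int (p ^ Suc k) dvd tr V1 (mop V1 m1 ^ (n * p ^ k)) - int r1"
  using trace_rank[OF V1 p n le_refl id1] by blast
 obtain r2 where r2: "r2 \<le> card V2" "card (Imp p V2 (mop V2 m2 ^ n)) = p ^ r2"
  "\<And>k. k \<ge> 1 ==> int (p ^ Suc k) dvd tr V2 (mop V2 m2 ^ (n * p ^ k)) - int r2"
  using trace_rank[OF V2 p n le_refl id2] by blast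
 define k where "k = card V1 + card V2 + 1"
 have "n * p ^ k \<ge> 1" using n prime_gt_0_nat[OF p] by simp
 then have "int (p ^ Suc k) dvd int r1 - int r2"
  using dvd_diff[OF r2(3)[of k] r1(3)[of k]] trs[of "n * p ^ k"] by (simp add: k_def)
 moreover have "\<bar>int r1 - int r2\<bar> < int (p ^ Suc k)"
 proof -
  have "k < 2 ^ k" by (rule less_exp)
  also have "(2::nat) ^ k \<le> p ^ k" using prime_ge_2_nat[OF p] by (intro power_mono) auto
  also have "p ^ k \<le> p ^ Suc k" using prime_gt_0_nat[OF p] by simp
  finally have "int k < int (p ^ Suc k)" using of_nat_less_iff by blast
  moreover have "\<bar>int r1 - int r2\<bar> \<le> int k" using r1(1) r2(1) by (simp add: k_def)
  ultimately show ?thesis by linarith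
 qed
 ultimately have "r1 = r2" using zdvd_not_zless[of "\<bar>int r1 - int r2\<bar>" "int (p ^ Suc k)"] by auto
 then show ?thesis by (simp add: r1 r2)
qed

section \<open>Twisted matrices over a group set\<close>

text \<open>A matrix over the integral group ring with coefficients \<open>m g\<close>, in which
  each group element acts by its permutation of \<open>X\<close>. This form separates the
  coefficients from the group set.\<close>

definition twmat :: "('g, 'm) monoid_scheme => 'i set => 'x set => ('g => 'x => 'x) => ('g => 'i => 'i => int) => ('i \<times> 'x) aop" where
 "twmat G I X a m = mop (I \<times> X) (\<lambda>p q. \<Sum>g\<in>carrier G. if snd p = a g (snd q) then m g (fst p) (fst q) else 0)"

context group
begin

lemma sum_reindex_left:
 assumes "h \<in> carrier G" shows "(\<Sum>g\<in>carrier G. f (h \<otimes> g)) = (\<Sum>g\<in>carrier G. f g)"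
proof (rule sum.reindex_bij_witness[where i = "\<lambda>g. inv h \<otimes> g" and j = "\<lambda>g. h \<otimes> g"])
 fix g assume "g \<in> carrier G"
 then show "inv h \<otimes> (h \<otimes> g) = g" "h \<otimes> (inv h \<otimes> g) = g" "h \<otimes> g \<in> carrier G" "inv h \<otimes> g \<in> carrier G"
  using assms by (simp_all add: m_assoc[symmetric])
qed simp

lemma twmat_mult:
 assumes finG: "finite (carrier G)" and I: "finite I" and X: "finite X" "gset G X a"
 shows "twmat G I X a m * twmat G I X a m' = twmat G I X a (\<lambda>g i j. \<Sum>h\<in>carrier G. \<Sum>l\<in>I. m h i l * m' (inv h \<otimes> g) l j)"
 unfolding twmat_def mop_mult[OF finite_cartesian_product[OF I X(1)]]
proof (rule mop_cong)
 fix p q assume p: "p \<in> I \<times> X" and q: "q \<in> I \<times> X"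
 obtain i x j y where pq: "p = (i, x)" "q = (j, y)" by (cases p, cases q)
 have y: "y \<in> X" using q pq by simp
 have "(\<Sum>r\<in>I \<times> X. (\<Sum>h\<in>carrier G. if snd p = a h (snd r) then m h (fst p) (fst r) else 0) *
   (\<Sum>k\<in>carrier G. if snd r = a k (snd q) then m' k (fst r) (fst q) else 0)) =
  (\<Sum>l\<in>I. \<Sum>z\<in>X. \<Sum>h\<in>carrier G. \<Sum>k\<in>carrier G. if z = a k y then if x = a h z then m h i l * m' k l j else 0 else 0)"
  unfolding sum.cartesian_product' sum_product by (intro sum.cong refl) (auto simp: pq)
 also have "\<dots> = (\<Sum>l\<in>I. \<Sum>h\<in>carrier G. \<Sum>k\<in>carrier G. \<Sum>z\<in>X. if z = a k y then if x = a h z then m h i l * m' k l j else 0 else 0)"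
  by (rule sum.cong[OF refl], subst sum.swap, rule sum.cong[OF refl], rule sum.swap)
 also have "\<dots> = (\<Sum>l\<in>I. \<Sum>h\<in>carrier G. \<Sum>k\<in>carrier G. if x = a h (a k y) then m h i l * m' k l j else 0)"
  using X(1) gsetD(1)[OF X(2) _ y] by (intro sum.cong refl) simp
 also have "\<dots> = (\<Sum>l\<in>I. \<Sum>h\<in>carrier G. \<Sum>g\<in>carrier G. if x = a g y then m h i l * m' (inv h \<otimes> g) l j else 0)"
 proof (rule sum.cong[OF refl], rule sum.cong[OF refl])
  fix l h assume "l \<in> I" and h: "h \<in> carrier G"
  have "(\<Sum>k\<in>carrier G. if x = a h (a k y) then m h i l * m' k l j else 0) =
   (\<Sum>k\<in>carrier G. (\<lambda>g. if x = a g y then m h i l * m' (inv h \<otimes> g) l j else 0) (h \<otimes> k))"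
   using gsetD(3)[OF X(2) h _ y] h by (intro sum.cong refl) (simp add: m_assoc[symmetric])
  also have "\<dots> = (\<Sum>g\<in>carrier G. if x = a g y then m h i l * m' (inv h \<otimes> g) l j else 0)"
   by (rule sum_reindex_left[OF h])
  finally show "(\<Sum>k\<in>carrier G. if x = a h (a k y) then m h i l * m' k l j else 0) =
   (\<Sum>g\<in>carrier G. if x = a g y then m h i l * m' (inv h \<otimes> g) l j else 0)" .
 qed
 also have "\<dots> = (\<Sum>g\<in>carrier G. \<Sum>h\<in>carrier G. \<Sum>l\<in>I. if x = a g y then m h i l * m' (inv h \<otimes> g) l j else 0)"
 proof -
  have "(\<Sum>l\<in>I. \<Sum>h\<in>carrier G. \<Sum>g\<in>carrier G. c l h g) = (\<Sum>g\<in>carrier G. \<Sum>h\<in>carrier G. \<Sum>l\<in>I. c l h g)" for c :: "_ => _ => _ => int"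
  proof -
   have "(\<Sum>l\<in>I. \<Sum>h\<in>carrier G. \<Sum>g\<in>carrier G. c l h g) = (\<Sum>l\<in>I. \<Sum>g\<in>carrier G. \<Sum>h\<in>carrier G. c l h g)"
    by (rule sum.cong[OF refl]) (rule sum.swap)
   also have "\<dots> = (\<Sum>g\<in>carrier G. \<Sum>l\<in>I. \<Sum>h\<in>carrier G. c l h g)" by (rule sum.swap)
   also have "\<dots> = (\<Sum>g\<in>carrier G. \<Sum>h\<in>carrier G. \<Sum>l\<in>I. c l h g)" by (rule sum.cong[OF refl]) (rule sum.swap)
   finally show ?thesis .
  qed
  then show ?thesis .
 qed
 also have "\<dots> = (\<Sum>g\<in>carrier G. if snd p = a g (snd q) then \<Sum>h\<in>carrier G. \<Sum>l\<in>I. m h (fst p) l * m' (inv h \<otimes> g) l (fst q) else 0)"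
  by (rule sum.cong[OF refl]) (simp add: pq)
 finally show "(\<Sum>r\<in>I \<times> X. (\<Sum>h\<in>carrier G. if snd p = a h (snd r) then m h (fst p) (fst r) else 0) *
   (\<Sum>k\<in>carrier G. if snd r = a k (snd q) then m' k (fst r) (fst q) else 0)) =
  (\<Sum>g\<in>carrier G. if snd p = a g (snd q) then \<Sum>h\<in>carrier G. \<Sum>l\<in>I. m h (fst p) l * m' (inv h \<otimes> g) l (fst q) else 0)" .
qed

text \<open>The matrices of the powers do not depend on the group set.\<close>

primrec twpow :: "'i set => ('a => 'i => 'i => int) => nat => 'a => 'i => 'i => int" where
 "twpow I m 0 = m"
| "twpow I m (Suc n) = (\<lambda>g i j. \<Sum>h\<in>carrier G. \<Sum>l\<in>I. m h i l * twpow I m n (inv h \<otimes> g) l j)"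

lemma twmat_power:
 assumes "finite (carrier G)" "finite I" "finite X" "gset G X a"
 shows "twmat G I X a m ^ Suc n = twmat G I X a (twpow I m n)"
proof (induction n)
 case (Suc n)
 have "twmat G I X a m ^ Suc (Suc n) = twmat G I X a m * twmat G I X a (twpow I m n)"
  unfolding Suc[symmetric] by simp
 then show ?case by (simp add: twmat_mult[OF assms])
qed simp

lemma tr_twmat:
 assumes "finite I" "finite X"
 shows "tr (I \<times> X) (twmat G I X a m) = (\<Sum>g\<in>carrier G. (\<Sum>i\<in>I. m g i i) * int (card {x \<in> X. a g x = x}))"
proof -
 have "tr (I \<times> X) (twmat G I X a m) = (\<Sum>i\<in>I. \<Sum>x\<in>X. \<Sum>g\<in>carrier G. if x = a g x then m g i i else 0)"
  unfolding tr_def twmat_def using assms by (simp add: ent_mop sum.cartesian_product' cong del: if_weak_cong)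
 also have "\<dots> = (\<Sum>g\<in>carrier G. \<Sum>i\<in>I. \<Sum>x\<in>X. if x = a g x then m g i i else 0)"
 proof -
  have "(\<Sum>i\<in>I. \<Sum>x\<in>X. \<Sum>g\<in>carrier G. if x = a g x then m g i i else 0) = (\<Sum>i\<in>I. \<Sum>g\<in>carrier G. \<Sum>x\<in>X. if x = a g x then m g i i else 0)"
   by (rule sum.cong[OF refl]) (rule sum.swap)
  also have "\<dots> = (\<Sum>g\<in>carrier G. \<Sum>i\<in>I. \<Sum>x\<in>X. if x = a g x then m g i i else 0)" by (rule sum.swap)
  finally show ?thesis .
 qed
 also have "\<dots> = (\<Sum>g\<in>carrier G. \<Sum>i\<in>I. m g i i * int (card {x \<in> X. a g x = x}))"
 proof (intro sum.cong refl)
  fix g i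
  have "{x \<in> X. x = a g x} = {x \<in> X. a g x = x}" by auto
  then show "(\<Sum>x\<in>X. if x = a g x then m g i i else 0) = m g i i * int (card {x \<in> X. a g x = x})"
   using assms(2) by (simp add: sum.If_cases Int_def)
 qed
 finally show ?thesis by (simp add: sum_distrib_right)
qed

text \<open>Powers are formed by convolution of the coefficients alone, and the trace sees the group
  set only through the number of fixed points of each element.\<close>

lemma tr_twmat_power_eq:
 assumes "finite (carrier G)" "finite I" "finite X" "gset G X a" "finite X'" "gset G X' a'"
  and "\<And>g. g \<in> carrier G ==> card {x \<in> X. a g x = x} = card {x \<in> X'. a' g x = x}" and "q \<ge> 1"
 shows "tr (I \<times> X) (twmat G I X a m ^ q) = tr (I \<times> X') (twmat G I X' a' m ^ q)"
proof -
 obtain n where n: "q = Suc n" using assms(8) by (cases q) auto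
 show ?thesis unfolding n twmat_power[OF assms(1-4)] twmat_power[OF assms(1,2,5,6)] using assms by (simp add: tr_twmat)
qed

end

section \<open>Equivariant maps into modular representations\<close>

text \<open>Rank and nullity in multiplicative form: all nonempty fibres of \<open>T\<close> are
  translates of its kernel.\<close>

lemma card_ker_im:
 assumes V: "finite V" and p: "p \<ge> 1" and H: "lins p V H"
  and T: "\<And>u w c. u \<in> H ==> w \<in> H ==> T (redv p V (\<lambda>x. u x + c * w x)) = redv p V' (\<lambda>x. T u x + c * T w x)"
  and TF: "\<And>u. u \<in> H ==> T u \<in> FV p V'"
 shows "card H = card {u \<in> H. T u = (\<lambda>x. 0)} * card (T ` H)"
proof -
 note Hs = linsD[OF H]
 have finH: "finite H" using finite_subset[OF Hs(1) finite_FV[OF V p]] .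
 have fib: "card {u \<in> H. T u = T u0} = card {u \<in> H. T u = (\<lambda>x. 0)}" if u0: "u0 \<in> H" for u0
 proof (rule bij_betw_same_card[OF bij_betw_byWitness[where f = "\<lambda>u. redv p V (\<lambda>x. u x + (-1) * u0 x)" and f' = "\<lambda>k. redv p V (\<lambda>x. k x + 1 * u0 x)"]])
  have r: "redv p V u = u" if "u \<in> H" for u using that Hs(1) by (auto simp: FV_def)
  have r': "redv p V' (T u) = T u" if "u \<in> H" for u using TF[OF that] by (simp add: FV_def)
  show "\<forall>u\<in>{u \<in> H. T u = T u0}. redv p V (\<lambda>x. redv p V (\<lambda>x. u x + (-1) * u0 x) x + 1 * u0 x) = u"
  proof
   fix u assume "u \<in> {u \<in> H. T u = T u0}"
   then have "redv p V u = u" using r by simp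
   moreover have "redv p V (\<lambda>x. redv p V (\<lambda>x. u x + (-1) * u0 x) x + 1 * u0 x) = redv p V u"
    by (auto simp: redv_def fun_eq_iff mod_simps)
   ultimately show "redv p V (\<lambda>x. redv p V (\<lambda>x. u x + (-1) * u0 x) x + 1 * u0 x) = u" by simp
  qed
  show "\<forall>k\<in>{u \<in> H. T u = (\<lambda>x. 0)}. redv p V (\<lambda>x. redv p V (\<lambda>x. k x + 1 * u0 x) x + (-1) * u0 x) = k"
  proof
   fix u assume "u \<in> {u \<in> H. T u = (\<lambda>x. 0)}"
   then have "redv p V u = u" using r by simp
   moreover have "redv p V (\<lambda>x. redv p V (\<lambda>x. u x + 1 * u0 x) x + (-1) * u0 x) = redv p V u"
    by (auto simp: redv_def fun_eq_iff mod_simps)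
   ultimately show "redv p V (\<lambda>x. redv p V (\<lambda>x. u x + 1 * u0 x) x + (-1) * u0 x) = u" by simp
  qed
  show "(\<lambda>u. redv p V (\<lambda>x. u x + (-1) * u0 x)) ` {u \<in> H. T u = T u0} \<subseteq> {u \<in> H. T u = (\<lambda>x. 0)}"
  proof (rule image_subsetI)
   fix u assume u: "u \<in> {u \<in> H. T u = T u0}"
   then have "T (redv p V (\<lambda>x. u x + (-1) * u0 x)) = redv p V' (\<lambda>x. T u0 x + (-1) * T u0 x)"
    using T[of u u0 "-1"] u0 by simp
   also have "\<dots> = (\<lambda>x. 0)" by (simp add: redv_def fun_eq_iff)
   finally show "redv p V (\<lambda>x. u x + (-1) * u0 x) \<in> {u \<in> H. T u = (\<lambda>x. 0)}"
    using Hs(3)[of u u0 "-1"] u u0 by simp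
  qed
  show "(\<lambda>k. redv p V (\<lambda>x. k x + 1 * u0 x)) ` {u \<in> H. T u = (\<lambda>x. 0)} \<subseteq> {u \<in> H. T u = T u0}"
  proof (rule image_subsetI)
   fix u assume u: "u \<in> {u \<in> H. T u = (\<lambda>x. 0)}"
   then have "T (redv p V (\<lambda>x. u x + 1 * u0 x)) = redv p V' (\<lambda>x. 0 + 1 * T u0 x)"
    using T[of u u0 1] u0 by simp
   also have "\<dots> = T u0" using r'[OF u0] by simp
   finally show "redv p V (\<lambda>x. u x + 1 * u0 x) \<in> {u \<in> H. T u = T u0}"
    using Hs(3)[of u u0 1] u u0 by simp
  qed
 qed
 have "card H = (\<Sum>t\<in>T ` H. card {u \<in> H. T u = t})"
  using sum.group[OF finH finite_imageI[OF finH], of T T "\<lambda>_. 1::nat"] finH by simp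
 also have "\<dots> = (\<Sum>t\<in>T ` H. card {u \<in> H. T u = (\<lambda>x. 0)})" by (rule sum.cong) (auto simp: fib)
 finally show ?thesis by (simp add: mult.commute)
qed

lemma idem_multiple:
 assumes "cg M (E ^ n * E ^ n) (E ^ n)" "k \<ge> 1"
 shows "cg M (E ^ (n * k) * E ^ (n * k)) (E ^ (n * k))"
proof -
 have 1: "cg M (E ^ (n * k)) (E ^ n)" unfolding power_mult by (rule cg_idem_power[OF assms])
 show ?thesis by (rule cg_trans[OF cg_mult[OF 1 1] cg_trans[OF assms(1) cg_sym[OF 1]]])
qed

text \<open>A representation over the field with \<open>p\<close> elements, given as an invariant
  subspace \<open>W\<close> of the functions on a finite group set \<open>Y\<close>. The counting
  argument only compares maps into subrepresentations of a single permutation representation, so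
  this format is sufficient.\<close>

locale fp_rep = group G for G (structure) +
 fixes p :: nat and Y :: "'y set" and w :: "'a => 'y => 'y" and W :: "('y => int) set"
 assumes finG: "finite (carrier G)" and p: "Factorial_Ring.prime p" and Y: "finite Y" and w: "gset G Y w"
  and W: "lins p Y W"
  and Wst: "\<And>u g. u \<in> W ==> g \<in> carrier G ==> (\<lambda>y. if y \<in> Y then u (w (inv g) y) else 0) \<in> W"
begin

definition slice :: "(('v \<times> 'y) \<times> 'x => int) => 'v => 'x => 'y => int" where
 "slice z v x = (\<lambda>y. if y \<in> Y then z ((v, y), x) else 0)"

text \<open>The equivariant maps from \<open>A \<times> X\<close> to \<open>W\<close>, see
  \<open>card_Mp_Hs\<close>. They are written as invariant functions of all three variables so that
  matrices over \<open>(A \<times> Y) \<times> X\<close> can be applied to them.\<close>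

definition Hs :: "'v set => ('a => 'v => 'v) => 'x set => ('a => 'x => 'x) => (('v \<times> 'y) \<times> 'x => int) set" where
 "Hs A a X b = {z \<in> FV p ((A \<times> Y) \<times> X).
   (\<forall>g\<in>carrier G. \<forall>v\<in>A. \<forall>y\<in>Y. \<forall>x\<in>X. z ((a g v, w g y), b g x) = z ((v, y), x)) \<and>
   (\<forall>v\<in>A. \<forall>x\<in>X. slice z v x \<in> W)}"

text \<open>The matrix \<open>k\<close> applied to the first variable. By \<open>opz_Hs\<close>, an
  invariant \<open>k\<close> sends equivariant maps on \<open>A' \<times> X\<close> to equivariant
  maps on \<open>A \<times> X\<close>.\<close>

definition opz :: "'v set => 'x set => ('v => 'u => int) => 'u set => (('u \<times> 'y) \<times> 'x => int) => ('v \<times> 'y) \<times> 'x => int" where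
 "opz A X k A' z = redv p ((A \<times> Y) \<times> X) (\<lambda>q. \<Sum>v'\<in>A'. k (fst (fst q)) v' * z ((v', snd (fst q)), snd q))"

lemma p1: "p \<ge> 1" using prime_gt_0_nat[OF p] by simp

lemma HsD:
 assumes "z \<in> Hs A a X b"
 shows "z \<in> FV p ((A \<times> Y) \<times> X)"
  "\<And>g v y x. g \<in> carrier G ==> v \<in> A ==> y \<in> Y ==> x \<in> X ==> z ((a g v, w g y), b g x) = z ((v, y), x)"
  "\<And>v x. v \<in> A ==> x \<in> X ==> slice z v x \<in> W"
 using assms by (auto simp: Hs_def)

lemma msum: "(\<Sum>v\<in>A. k v * (f v mod int p)) mod int p = (\<Sum>v\<in>A. k v * f v) mod int p"
proof -
 have "(\<Sum>v\<in>A. k v * (f v mod int p) mod int p) mod int p = (\<Sum>v\<in>A. k v * f v mod int p) mod int p"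
  by (simp add: mod_mult_right_eq)
 then show ?thesis by (simp add: mod_sum_eq)
qed

lemma lins_Hs:
 assumes b: "gset G X b" and a: "gset G A a"
 shows "lins p ((A \<times> Y) \<times> X) (Hs A a X b)"
 unfolding lins_def
proof (intro conjI ballI allI)
 show "Hs A a X b \<subseteq> FV p ((A \<times> Y) \<times> X)" by (auto simp: Hs_def)
 show "(\<lambda>x. 0) \<in> Hs A a X b" using linsD(2)[OF W] p1 by (auto simp: Hs_def slice_def intro!: FV_I)
 fix u z c assume u: "u \<in> Hs A a X b" and z: "z \<in> Hs A a X b"
 show "redv p ((A \<times> Y) \<times> X) (\<lambda>x. u x + c * z x) \<in> Hs A a X b"
  unfolding Hs_def
 proof (intro CollectI conjI ballI)
  show "redv p ((A \<times> Y) \<times> X) (\<lambda>x. u x + c * z x) \<in> FV p ((A \<times> Y) \<times> X)" by (rule redv_FV)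
  fix v x assume v: "v \<in> A" and x: "x \<in> X"
  show "redv p ((A \<times> Y) \<times> X) (\<lambda>x. u x + c * z x) ((a g v, w g y), b g x) =
   redv p ((A \<times> Y) \<times> X) (\<lambda>x. u x + c * z x) ((v, y), x)" if "g \<in> carrier G" "y \<in> Y" for g y
   using HsD(2)[OF u that(1) v that(2) x] HsD(2)[OF z that(1) v that(2) x] that v x
    gsetD(1)[OF a that(1) v] gsetD(1)[OF w that] gsetD(1)[OF b that(1) x] by (simp add: redv_def)
  have "slice (redv p ((A \<times> Y) \<times> X) (\<lambda>x. u x + c * z x)) v x = redv p Y (\<lambda>y. slice u v x y + c * slice z v x y)"
   using v x by (auto simp: slice_def redv_def fun_eq_iff)
  also have "\<dots> \<in> W" by (rule linsD(3)[OF W HsD(3)[OF u v x] HsD(3)[OF z v x]])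
  finally show "slice (redv p ((A \<times> Y) \<times> X) (\<lambda>x. u x + c * z x)) v x \<in> W" .
 qed
qed

lemma opz_Hs:
 assumes a: "gset G A a" and a': "gset G A' a'" and b: "gset G X b"
  and k: "\<And>g v v'. g \<in> carrier G ==> v \<in> A ==> v' \<in> A' ==> k (a g v) (a' g v') = k v v'"
  and z: "z \<in> Hs A' a' X b"
 shows "opz A X k A' z \<in> Hs A a X b"
 unfolding Hs_def
proof (intro CollectI conjI ballI)
 show "opz A X k A' z \<in> FV p ((A \<times> Y) \<times> X)" unfolding opz_def by (rule redv_FV)
 fix v x assume v: "v \<in> A" and x: "x \<in> X"
 show "opz A X k A' z ((a g v, w g y), b g x) = opz A X k A' z ((v, y), x)" if g: "g \<in> carrier G" and y: "y \<in> Y" for g y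
 proof -
  have "(\<Sum>v'\<in>A'. k (a g v) v' * z ((v', w g y), b g x)) = (\<Sum>v'\<in>A'. k (a g v) (a' g v') * z ((a' g v', w g y), b g x))"
   by (rule sum.reindex_bij_betw[OF gset_bij[OF a' g], symmetric])
  also have "\<dots> = (\<Sum>v'\<in>A'. k v v' * z ((v', y), x))" using k[OF g v] HsD(2)[OF z g _ y x] by simp
  finally show ?thesis using v x y gsetD(1)[OF a g v] gsetD(1)[OF w g y] gsetD(1)[OF b g x] by (simp add: opz_def redv_def)
 qed
 have "slice (opz A X k A' z) v x = redv p Y (\<lambda>y. \<Sum>v'\<in>A'. k v v' * slice z v' x y)"
  using v x by (auto simp: slice_def opz_def redv_def fun_eq_iff)
 also have "\<dots> \<in> W" by (rule lins_sum[OF W HsD(3)[OF z _ x]])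
 finally show "slice (opz A X k A' z) v x \<in> W" .
qed

lemma opz_opz:
 "opz A X k A' (opz A' X k' A'' z) = opz A X (\<lambda>v v''. \<Sum>v'\<in>A'. k v v' * k' v' v'') A'' z"
proof -
 have *: "opz A X k A' (opz A' X k' A'' z) q = opz A X (\<lambda>v v''. \<Sum>v'\<in>A'. k v v' * k' v' v'') A'' z q"
  if q: "q = ((v, y), x)" for q v y x
 proof (cases "v \<in> A \<and> y \<in> Y \<and> x \<in> X")
  case True
  have "(\<Sum>v'\<in>A'. k v v' * opz A' X k' A'' z ((v', y), x)) = (\<Sum>v'\<in>A'. k v v' * ((\<Sum>v''\<in>A''. k' v' v'' * z ((v'', y), x)) mod int p))"
   using True by (intro sum.cong refl) (simp add: opz_def redv_def)
  then have "opz A X k A' (opz A' X k' A'' z) q = (\<Sum>v'\<in>A'. k v v' * (\<Sum>v''\<in>A''. k' v' v'' * z ((v'', y), x))) mod int p"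
   using True msum[of "k v" "\<lambda>v'. \<Sum>v''\<in>A''. k' v' v'' * z ((v'', y), x)" A'] by (simp add: opz_def[of A X k] redv_def q)
  also have "(\<Sum>v'\<in>A'. k v v' * (\<Sum>v''\<in>A''. k' v' v'' * z ((v'', y), x))) = (\<Sum>v''\<in>A''. (\<Sum>v'\<in>A'. k v v' * k' v' v'') * z ((v'', y), x))"
   by (simp add: sum_distrib_left sum_distrib_right mult.assoc) (rule sum.swap)
  finally show ?thesis using True by (simp add: opz_def redv_def q)
 qed (auto simp: opz_def redv_def q)
 from *[OF refl] show ?thesis by (simp only: fun_eq_iff split_paired_All simp_thms all_simps)
qed

lemma opz_lin:
 assumes "V = (A' \<times> Y) \<times> X"
 shows "opz A X k A' (redv p V (\<lambda>q. u q + c * z q)) = redv p ((A \<times> Y) \<times> X) (\<lambda>q. opz A X k A' u q + c * opz A X k A' z q)"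
proof -
 have *: "opz A X k A' (redv p V (\<lambda>q. u q + c * z q)) q = redv p ((A \<times> Y) \<times> X) (\<lambda>q. opz A X k A' u q + c * opz A X k A' z q) q"
  if q: "q = ((v, y), x)" for q v y x
 proof (cases "v \<in> A \<and> y \<in> Y \<and> x \<in> X")
  case True
  have "(\<Sum>v'\<in>A'. k v v' * redv p V (\<lambda>q. u q + c * z q) ((v', y), x)) = (\<Sum>v'\<in>A'. k v v' * ((u ((v', y), x) + c * z ((v', y), x)) mod int p))"
   using True by (intro sum.cong refl) (simp add: redv_def assms)
  then have "opz A X k A' (redv p V (\<lambda>q. u q + c * z q)) q = (\<Sum>v'\<in>A'. k v v' * (u ((v', y), x) + c * z ((v', y), x))) mod int p"
   using True msum[of "k v" "\<lambda>v'. u ((v', y), x) + c * z ((v', y), x)" A'] by (simp add: opz_def redv_def[of p "(A \<times> Y) \<times> X"] q)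
  also have "(\<Sum>v'\<in>A'. k v v' * (u ((v', y), x) + c * z ((v', y), x))) = (\<Sum>v'\<in>A'. k v v' * u ((v', y), x)) + c * (\<Sum>v'\<in>A'. k v v' * z ((v', y), x))"
   by (simp add: distrib_left sum.distrib sum_distrib_left mult.left_commute)
  also have "\<dots> mod int p = (opz A X k A' u q + c * opz A X k A' z q) mod int p"
  proof -
   have "((s mod int p) + c * (t mod int p)) mod int p = (s + c * t) mod int p" for s t
    by (rule mod_add_cong) (simp_all add: mod_mult_right_eq)
   then show ?thesis using True by (simp add: opz_def redv_def q)
  qed
  finally show ?thesis using True by (simp add: redv_def[of p "(A \<times> Y) \<times> X"] q)
 qed (auto simp: opz_def redv_def q)
 from *[OF refl] show ?thesis by (simp only: fun_eq_iff split_paired_All simp_thms all_simps)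
qed

lemma opz_cong:
 assumes "\<And>v v'. v \<in> A ==> v' \<in> A' ==> k v v' = k' v v'" shows "opz A X k A' z = opz A X k' A' z"
 unfolding opz_def redv_def using assms by (intro ext if_cong refl arg_cong[of _ _ "\<lambda>x. x mod int p"] sum.cong) auto

lemma opz_power_lin:
 assumes a: "gset G A a" and b: "gset G X b" and k: "\<And>g v v'. g \<in> carrier G ==> v \<in> A ==> v' \<in> A ==> k (a g v) (a g v') = k v v'"
  and V: "V = (A \<times> Y) \<times> X"
 shows "z \<in> Hs A a X b ==> (opz A X k A ^^ n) z \<in> Hs A a X b"
  and "u \<in> Hs A a X b ==> z \<in> Hs A a X b ==>
   (opz A X k A ^^ n) (redv p V (\<lambda>q. u q + c * z q)) = redv p V (\<lambda>q. (opz A X k A ^^ n) u q + c * (opz A X k A ^^ n) z q)"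
proof -
 show H: "(opz A X k A ^^ n) z \<in> Hs A a X b" if "z \<in> Hs A a X b" for z n
 proof (induction n)
  case (Suc n)
  show ?case unfolding funpow.simps comp_apply by (rule opz_Hs[OF a a b _ Suc]) (rule k)
 qed (use that in simp)
 show "(opz A X k A ^^ n) (redv p V (\<lambda>q. u q + c * z q)) = redv p V (\<lambda>q. (opz A X k A ^^ n) u q + c * (opz A X k A ^^ n) z q)"
  if u: "u \<in> Hs A a X b" and z: "z \<in> Hs A a X b"
  by (induction n) (simp_all add: opz_lin[OF V] V[symmetric])
qed

text \<open>On the kernel of a power of \<open>\<tau>\<close> the composite \<open>f' f = c - \<tau>\<close> is injective, as \<open>c\<close> is a unit.\<close>

lemma kernel_card_le:
 assumes fin: "finite A" "finite B" "finite X"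
  and a: "gset G A a" and b: "gset G B a'" and x: "gset G X ax"
  and f: "\<And>g v v'. g \<in> carrier G ==> v \<in> A ==> v' \<in> B ==> f (a g v) (a' g v') = f v v'"
  and tA: "\<And>g v v'. g \<in> carrier G ==> v \<in> A ==> v' \<in> A ==> tA (a g v) (a g v') = tA v v'"
  and tB: "\<And>g v v'. g \<in> carrier G ==> v \<in> B ==> v' \<in> B ==> tB (a' g v) (a' g v') = tB v v'"
  and ff': "\<And>v v'. v \<in> A ==> v' \<in> A ==> (\<Sum>z\<in>B. f v z * f' z v') = (if v = v' then c else 0) - tA v v'"
  and f'f: "\<And>v v'. v \<in> B ==> v' \<in> B ==> (\<Sum>z\<in>A. f' v z * f z v') = (if v = v' then c else 0) - tB v v'"
  and c: "coprime c (int p)"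
 shows "card {z \<in> Hs B a' X ax. (opz B X tB B ^^ n) z = (\<lambda>q. 0)} \<le> card {z \<in> Hs A a X ax. (opz A X tA A ^^ n) z = (\<lambda>q. 0)}"
proof -
 let ?VA = "(A \<times> Y) \<times> X" and ?VB = "(B \<times> Y) \<times> X"
 let ?F = "opz A X f B" and ?TA = "opz A X tA A" and ?TB = "opz B X tB B"
 have LB: "lins p ?VB (Hs B a' X ax)" by (rule lins_Hs[OF x b])
 \<comment> \<open>Associativity of \<open>f * f' * f\<close>: both ways of bracketing contain
   \<open>f\<close> multiplied by \<open>c\<close>, and comparing the rest shows that
   \<open>f\<close> intertwines \<open>tB\<close> with \<open>tA\<close>.\<close>
 have comm: "?F (?TB z) = ?TA (?F z)" for z
 proof -
  have "(\<Sum>v'\<in>B. f v v' * tB v' v'') = (\<Sum>v'\<in>A. tA v v' * f v' v'')" if v: "v \<in> A" and v'': "v'' \<in> B" for v v''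
  proof -
   have "(\<Sum>v'\<in>B. f v v' * (\<Sum>z\<in>A. f' v' z * f z v'')) = (\<Sum>z\<in>A. (\<Sum>v'\<in>B. f v v' * f' v' z) * f z v'')"
    by (simp add: sum_distrib_left sum_distrib_right mult.assoc) (rule sum.swap)
   moreover have "(\<Sum>v'\<in>B. f v v' * (\<Sum>z\<in>A. f' v' z * f z v'')) = (\<Sum>v'\<in>B. f v v' * (if v' = v'' then c else 0)) - (\<Sum>v'\<in>B. f v v' * tB v' v'')"
    using f'f[OF _ v''] by (simp add: right_diff_distrib sum_subtractf)
   moreover have "(\<Sum>z\<in>A. (\<Sum>v'\<in>B. f v v' * f' v' z) * f z v'') = (\<Sum>z\<in>A. (if v = z then c else 0) * f z v'') - (\<Sum>z\<in>A. tA v z * f z v'')"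
    using ff'[OF v] by (simp add: left_diff_distrib sum_subtractf)
   moreover have "(\<Sum>v'\<in>B. f v v' * (if v' = v'' then c else 0)) = f v v'' * c" "(\<Sum>z\<in>A. (if v = z then c else 0) * f z v'') = c * f v v''"
    using fin v v'' by (simp_all add: if_distrib[of "\<lambda>t. _ * t"] if_distrib[of "\<lambda>t. t * _"] cong: if_cong)
   ultimately show ?thesis by simp
  qed
  then show ?thesis unfolding opz_opz by (intro opz_cong)
 qed
 have commn: "?F ((?TB ^^ n) z) = (?TA ^^ n) (?F z)" for z n
  by (induction n) (simp_all add: comm)
 have inj0: "z = (\<lambda>q. 0)" if z: "z \<in> Hs B a' X ax" "(?TB ^^ n) z = (\<lambda>q. 0)" "?F z = (\<lambda>q. 0)" for z
 proof -
  have zF: "redv p ?VB z = z" using HsD(1)[OF z(1)] by (simp add: FV_def)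
  have "opz B X f' A (?F z) = (\<lambda>q. 0)" unfolding z(3) by (simp add: opz_def redv_def fun_eq_iff)
  moreover have "opz B X (\<lambda>v v''. \<Sum>v'\<in>A. f' v v' * f v' v'') B z = opz B X (\<lambda>v v'. (if v = v' then c else 0) - tB v v') B z"
   by (intro opz_cong f'f)
  ultimately have 0: "opz B X (\<lambda>v v'. (if v = v' then c else 0) - tB v v') B z = (\<lambda>q. 0)"
   unfolding opz_opz by simp
  \<comment> \<open>If \<open>f\<close> kills \<open>z\<close>, so does \<open>f' * f\<close>, which
    means that \<open>tB\<close> multiplies \<open>z\<close> by \<open>c\<close>. Its power with
    exponent \<open>n\<close> multiplies \<open>z\<close> by a unit and yet annihilates it.\<close>
  have T1: "?TB z = redv p ?VB (\<lambda>q. c * z q)"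
  proof -
   have "?TB z q = redv p ?VB (\<lambda>q. c * z q) q" if q: "q = ((v, y), xx)" for q v y xx
   proof (cases "v \<in> B \<and> y \<in> Y \<and> xx \<in> X")
    case True
    have "(\<Sum>v'\<in>B. ((if v = v' then c else 0) - tB v v') * z ((v', y), xx)) mod int p = 0"
     using fun_cong[OF 0, of q] True by (simp add: opz_def redv_def q)
    moreover have "(\<Sum>v'\<in>B. ((if v = v' then c else 0) - tB v v') * z ((v', y), xx)) = c * z ((v, y), xx) - (\<Sum>v'\<in>B. tB v v' * z ((v', y), xx))"
     using fin True by (simp add: left_diff_distrib sum_subtractf if_distrib[of "\<lambda>t. t * _"] cong: if_cong)
    ultimately have "int p dvd c * z ((v, y), xx) - (\<Sum>v'\<in>B. tB v v' * z ((v', y), xx))" by (simp add: dvd_eq_mod_eq_0)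
    then have "(\<Sum>v'\<in>B. tB v v' * z ((v', y), xx)) mod int p = c * z ((v, y), xx) mod int p"
     by (simp add: mod_eq_dvd_iff dvd_diff_commute)
    then show ?thesis using True by (simp add: opz_def redv_def q)
   qed (auto simp: opz_def redv_def q)
   then show ?thesis by (intro ext) (metis surj_pair)
  qed
  have Tn: "(?TB ^^ i) z = redv p ?VB (\<lambda>q. c ^ i * z q)" for i
  proof (induction i)
   case 0 show ?case by (simp add: zF)
  next
   case (Suc i)
   have "(?TB ^^ Suc i) z = ?TB (redv p ?VB (\<lambda>q. 0 + c ^ i * z q))" using Suc by simp
   also have "\<dots> = redv p ?VB (\<lambda>q. ?TB (\<lambda>q. 0) q + c ^ i * ?TB z q)" by (rule opz_lin[OF refl])
   also have "\<dots> = redv p ?VB (\<lambda>q. c ^ i * redv p ?VB (\<lambda>q. c * z q) q)" unfolding T1 by (simp add: opz_def redv_def fun_eq_iff)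
   also have "\<dots> = redv p ?VB (\<lambda>q. c ^ Suc i * z q)" by (auto simp: redv_def fun_eq_iff mod_mult_right_eq mult_ac)
   finally show ?case .
  qed
  show ?thesis
  proof
   fix q
   show "z q = 0"
   proof (cases "q \<in> ?VB")
    case True
    have "redv p ?VB (\<lambda>q. c ^ n * z q) q = 0" using fun_cong[OF z(2)[unfolded Tn], of q] by simp
    then have "int p dvd c ^ n * z q" using True by (simp add: redv_def dvd_eq_mod_eq_0)
    moreover have "coprime (int p) (c ^ n)" using c by (simp add: coprime_commute)
    ultimately have "int p dvd z q" by (simp add: coprime_dvd_mult_right_iff)
    moreover have "0 \<le> z q \<and> z q < int p" by (rule FV_range[OF HsD(1)[OF z(1)] p1 True])
    ultimately show ?thesis using zdvd_not_zless[of "z q" "int p"] by linarith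
   next
    case False
    then show ?thesis using FV_outside[OF HsD(1)[OF z(1)]] by simp
   qed
  qed
 qed
 have finA: "finite (Hs A a X ax)"
  by (rule finite_subset[OF linsD(1)[OF lins_Hs[OF x a]] finite_FV]) (use fin Y p1 in auto)
 show ?thesis
 proof (rule card_inj_on_le[where f = ?F])
  show "?F ` {z \<in> Hs B a' X ax. (?TB ^^ n) z = (\<lambda>q. 0)} \<subseteq> {z \<in> Hs A a X ax. (?TA ^^ n) z = (\<lambda>q. 0)}"
  proof (rule image_subsetI)
   fix z assume z: "z \<in> {z \<in> Hs B a' X ax. (?TB ^^ n) z = (\<lambda>q. 0)}"
   have "?F z \<in> Hs A a X ax" by (rule opz_Hs[OF a b x, of f]) (use f z in auto)
   moreover have "(?TA ^^ n) (?F z) = ?F (\<lambda>q. 0)" using z by (simp add: commn[symmetric])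
   moreover have "?F (\<lambda>q. 0) = (\<lambda>q. 0)" by (simp add: opz_def redv_def fun_eq_iff)
   ultimately show "?F z \<in> {z \<in> Hs A a X ax. (?TA ^^ n) z = (\<lambda>q. 0)}" by simp
  qed
  show "inj_on ?F {z \<in> Hs B a' X ax. (?TB ^^ n) z = (\<lambda>q. 0)}"
  proof (rule inj_onI)
   fix u z assume u: "u \<in> {z \<in> Hs B a' X ax. (?TB ^^ n) z = (\<lambda>q. 0)}" and z: "z \<in> {z \<in> Hs B a' X ax. (?TB ^^ n) z = (\<lambda>q. 0)}"
    and e: "?F u = ?F z"
   define d where "d = redv p ?VB (\<lambda>q. u q + (-1) * z q)"
   have d: "d \<in> Hs B a' X ax" unfolding d_def by (rule linsD(3)[OF LB]) (use u z in auto)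
   have "(?TB ^^ n) d = redv p ?VB (\<lambda>q. (?TB ^^ n) u q + (-1) * (?TB ^^ n) z q)"
    unfolding d_def by (rule opz_power_lin(2)[OF b x _ refl]) (use tB u z in auto)
   then have d2: "(?TB ^^ n) d = (\<lambda>q. 0)" using u z by (simp add: redv_def fun_eq_iff)
   have "?F d = redv p ?VA (\<lambda>q. ?F u q + (-1) * ?F z q)" unfolding d_def by (rule opz_lin[OF refl])
   then have d3: "?F d = (\<lambda>q. 0)" using e by (simp add: redv_def fun_eq_iff)
   have "redv p ?VB (\<lambda>q. u q + (-1) * z q) = redv p ?VB (\<lambda>q. 0)"
    using inj0[OF d d2 d3] unfolding d_def by (simp add: redv_def fun_eq_iff)
   then have "redv p ?VB u = redv p ?VB z" unfolding redv_eq_iff by simp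
   moreover have "redv p ?VB u = u" "redv p ?VB z = z" using HsD(1)[of u] HsD(1)[of z] u z by (auto simp: FV_def)
   ultimately show "u = z" by simp
  qed
  show "finite {z \<in> Hs A a X ax. (?TA ^^ n) z = (\<lambda>q. 0)}" using finA by simp
 qed
qed

text \<open>An integer matrix which, modulo \<open>p\<close>, is the identity on \<open>W\<close>
  and has its image in \<open>W\<close>: a projection onto \<open>W\<close>, in general not
  equivariant.\<close>

definition projker :: "('y => 'y => int) => bool" where
 "projker \<pi> \<longleftrightarrow> (\<forall>u\<in>W. \<forall>y\<in>Y. int p dvd (\<Sum>y'\<in>Y. \<pi> y y' * u y') - u y) \<and>
   (\<forall>y'\<in>Y. (\<lambda>y. if y \<in> Y then \<pi> y y' else 0) \<in> W)"

text \<open>With these coefficients, the twisted matrix applies \<open>\<theta>\<close> to the first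
  variable and \<open>\<pi>\<close> to the second, moves the result by \<open>g\<close>, and sums
  over all \<open>g\<close>. Such a sum is invariant with slices in \<open>W\<close>, whatever
  vector it is applied to.\<close>

definition Em :: "('a => 'v => 'v) => ('v => 'v => int) => ('y => 'y => int) => 'a => 'v \<times> 'y => 'v \<times> 'y => int" where
 "Em a \<theta> \<pi> g i i' = \<theta> (a (inv g) (fst i)) (fst i') * \<pi> (w (inv g) (snd i)) (snd i')"

lemma ex_projker: "\<exists>\<pi>. projker \<pi>"
proof -
 obtain J b where J: "J \<subseteq> Y" and bW: "\<forall>j\<in>J. b j \<in> W"
  and wb: "\<forall>u\<in>W. u = redv p Y (\<lambda>x. \<Sum>j\<in>J. u j * b j x)"
  using pivots[OF Y p W] by (elim exE conjE) (rule that)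
 define \<pi> where "\<pi> y y' = (if y' \<in> J then b y' y else 0)" for y y'
 have "int p dvd (\<Sum>y'\<in>Y. \<pi> y y' * u y') - u y" if u: "u \<in> W" and y: "y \<in> Y" for u y
 proof -
  have "(\<Sum>y'\<in>Y. \<pi> y y' * u y') = (\<Sum>y'\<in>J. \<pi> y y' * u y')"
   by (rule sum.mono_neutral_right[OF Y J]) (auto simp: \<pi>_def)
  also have "\<dots> = (\<Sum>j\<in>J. u j * b j y)" by (rule sum.cong) (auto simp: \<pi>_def)
  finally have 1: "(\<Sum>y'\<in>Y. \<pi> y y' * u y') = (\<Sum>j\<in>J. u j * b j y)" .
  have "u y = redv p Y (\<lambda>x. \<Sum>j\<in>J. u j * b j x) y" by (rule fun_cong[OF bspec[OF wb u]])
  then have "u y = (\<Sum>j\<in>J. u j * b j y) mod int p" using y by (simp add: redv_def)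
  then show ?thesis unfolding 1 by (metis dvd_minus_mod)
 qed
 moreover have "(\<lambda>y. if y \<in> Y then \<pi> y y' else 0) \<in> W" if "y' \<in> Y" for y'
 proof (cases "y' \<in> J")
  case True
  then have b: "b y' \<in> W" using bW by blast
  have "(\<lambda>y. if y \<in> Y then \<pi> y y' else 0) = b y'"
   using True FV_outside[of "b y'" p Y] b linsD(1)[OF W] by (auto simp: \<pi>_def fun_eq_iff)
  then show ?thesis using b by simp
 next
  case False
  then have "(\<lambda>y. if y \<in> Y then \<pi> y y' else 0) = (\<lambda>y. 0)" by (auto simp: \<pi>_def)
  then show ?thesis using linsD(2)[OF W] by simp
 qed
 ultimately show ?thesis unfolding projker_def by blast
qed

lemma ap_twmat:
 assumes X: "finite X" "gset G X b" and I: "finite I" and i: "i \<in> I" and x: "x \<in> X"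
 shows "ap (twmat G I X b m) z (i, x) = (\<Sum>g\<in>carrier G. \<Sum>j\<in>I. m g i j * z (j, b (inv g) x))"
proof -
 have e: "x = b g x' \<longleftrightarrow> x' = b (inv g) x" if "g \<in> carrier G" "x' \<in> X" for g x'
  using gset_inv1[OF X(2) that] gset_inv2[OF X(2) that(1) x] by metis
 have "ap (twmat G I X b m) z (i, x) = (\<Sum>j\<in>I. \<Sum>x'\<in>X. \<Sum>g\<in>carrier G. (if x = b g x' then m g i j else 0) * z (j, x'))"
  unfolding twmat_def ap_mop using i x by (simp add: sum.cartesian_product' sum_distrib_right cong del: if_weak_cong)
 also have "\<dots> = (\<Sum>j\<in>I. \<Sum>g\<in>carrier G. \<Sum>x'\<in>X. (if x = b g x' then m g i j else 0) * z (j, x'))"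
  by (rule sum.cong[OF refl]) (rule sum.swap)
 also have "\<dots> = (\<Sum>j\<in>I. \<Sum>g\<in>carrier G. m g i j * z (j, b (inv g) x))"
 proof (rule sum.cong[OF refl], rule sum.cong[OF refl])
  fix j g assume g: "g \<in> carrier G"
  have "(\<Sum>x'\<in>X. (if x = b g x' then m g i j else 0) * z (j, x')) = (\<Sum>x'\<in>X. if x' = b (inv g) x then m g i j * z (j, x') else 0)"
   by (rule sum.cong[OF refl]) (use e[OF g] in auto)
  then show "(\<Sum>x'\<in>X. (if x = b g x' then m g i j else 0) * z (j, x')) = m g i j * z (j, b (inv g) x)"
   using gsetD(1)[OF X(2) inv_closed[OF g] x] X(1) by simp
 qed
 also have "\<dots> = (\<Sum>g\<in>carrier G. \<Sum>j\<in>I. m g i j * z (j, b (inv g) x))" by (rule sum.swap)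
 finally show ?thesis .
qed

lemma Ef_in_Hs:
 assumes X: "finite X" "gset G X b" and A: "finite A" "gset G A a" and pk: "projker \<pi>"
 shows "redv p ((A \<times> Y) \<times> X) (ap (twmat G (A \<times> Y) X b (Em a \<theta> \<pi>)) z) \<in> Hs A a X b" (is "redv p ?V (ap ?E z) \<in> _")
 unfolding Hs_def
proof (intro CollectI conjI ballI)
 show "redv p ?V (ap ?E z) \<in> FV p ?V" by (rule redv_FV)
 note E = ap_twmat[OF X finite_cartesian_product[OF A(1) Y]]
 fix v x assume v: "v \<in> A" and x: "x \<in> X"
 show "redv p ?V (ap ?E z) ((a h v, w h y), b h x) = redv p ?V (ap ?E z) ((v, y), x)" if h: "h \<in> carrier G" and y: "y \<in> Y" for h y
 proof -
  have *: "e (inv (h \<otimes> g)) (e h t) = e (inv g) t" if "gset G S e" "t \<in> S" "g \<in> carrier G" for g t S and e :: "_ => 's => 's"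
  proof -
   have "e (inv (h \<otimes> g)) (e h t) = e (inv (h \<otimes> g) \<otimes> h) t"
    by (rule gsetD(3)[OF that(1) _ h that(2), symmetric]) (use h that in auto)
   also have "inv (h \<otimes> g) \<otimes> h = inv g" using h that(3) by (simp add: inv_mult_group m_assoc)
   finally show ?thesis .
  qed
  have m: "((a h v, w h y), b h x) \<in> ?V" using gsetD(1)[OF A(2) h v] gsetD(1)[OF w h y] gsetD(1)[OF X(2) h x] by simp
  have "ap ?E z ((a h v, w h y), b h x) = (\<Sum>g\<in>carrier G. \<Sum>j\<in>A \<times> Y. Em a \<theta> \<pi> g (a h v, w h y) j * z (j, b (inv g) (b h x)))"
   by (rule E) (use m in auto)
  also have "\<dots> = (\<Sum>g\<in>carrier G. \<Sum>j\<in>A \<times> Y. Em a \<theta> \<pi> (h \<otimes> g) (a h v, w h y) j * z (j, b (inv (h \<otimes> g)) (b h x)))"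
   by (rule sum_reindex_left[OF h, symmetric])
  also have "\<dots> = (\<Sum>g\<in>carrier G. \<Sum>j\<in>A \<times> Y. Em a \<theta> \<pi> g (v, y) j * z (j, b (inv g) x))"
   by (rule sum.cong[OF refl]) (simp add: Em_def *[OF A(2) v] *[OF w y] *[OF X(2) x])
  also have "\<dots> = ap ?E z ((v, y), x)" by (rule E[symmetric]) (use v x y in auto)
  finally show ?thesis using m v x y unfolding redv_def by simp
 qed
 have "slice (redv p ?V (ap ?E z)) v x = redv p Y (\<lambda>y. \<Sum>q\<in>carrier G \<times> A \<times> Y.
   (\<theta> (a (inv (fst q)) v) (fst (snd q)) * z (snd q, b (inv (fst q)) x)) *
   (if y \<in> Y then (if w (inv (fst q)) y \<in> Y then \<pi> (w (inv (fst q)) y) (snd (snd q)) else 0) else 0))"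
 proof
  fix y
  show "slice (redv p ?V (ap ?E z)) v x y = redv p Y (\<lambda>y. \<Sum>q\<in>carrier G \<times> A \<times> Y.
   (\<theta> (a (inv (fst q)) v) (fst (snd q)) * z (snd q, b (inv (fst q)) x)) *
   (if y \<in> Y then (if w (inv (fst q)) y \<in> Y then \<pi> (w (inv (fst q)) y) (snd (snd q)) else 0) else 0)) y"
  proof (cases "y \<in> Y")
   case True
   have "ap ?E z ((v, y), x) = (\<Sum>g\<in>carrier G. \<Sum>j\<in>A \<times> Y. Em a \<theta> \<pi> g (v, y) j * z (j, b (inv g) x))"
    by (rule E) (use v x True in auto)
   also have "\<dots> = (\<Sum>q\<in>carrier G \<times> A \<times> Y. Em a \<theta> \<pi> (fst q) (v, y) (snd q) * z (snd q, b (inv (fst q)) x))"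
    by (simp only: sum.cartesian_product split_def)
   also have "\<dots> = (\<Sum>q\<in>carrier G \<times> A \<times> Y.
   (\<theta> (a (inv (fst q)) v) (fst (snd q)) * z (snd q, b (inv (fst q)) x)) *
   (if y \<in> Y then (if w (inv (fst q)) y \<in> Y then \<pi> (w (inv (fst q)) y) (snd (snd q)) else 0) else 0))"
   proof (rule sum.cong[OF refl])
    fix q assume "q \<in> carrier G \<times> A \<times> Y"
    then have "w (inv (fst q)) y \<in> Y" using gsetD(1)[OF w _ True] by auto
    then show "Em a \<theta> \<pi> (fst q) (v, y) (snd q) * z (snd q, b (inv (fst q)) x) = (\<theta> (a (inv (fst q)) v) (fst (snd q)) * z (snd q, b (inv (fst q)) x)) *
     (if y \<in> Y then (if w (inv (fst q)) y \<in> Y then \<pi> (w (inv (fst q)) y) (snd (snd q)) else 0) else 0)"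
     using True by (simp add: Em_def)
   qed
   finally show ?thesis using True v x by (simp add: slice_def redv_def)
  qed (simp add: slice_def redv_def)
 qed
 also have "\<dots> \<in> W"
 proof (rule lins_sum[OF W])
  fix q assume "q \<in> carrier G \<times> A \<times> Y"
  then have q: "fst q \<in> carrier G" "snd (snd q) \<in> Y" by auto
  have "(\<lambda>y. if y \<in> Y then \<pi> y (snd (snd q)) else 0) \<in> W" using pk q(2) by (simp add: projker_def)
  from Wst[OF this q(1)] show "(\<lambda>y. if y \<in> Y then (if w (inv (fst q)) y \<in> Y then \<pi> (w (inv (fst q)) y) (snd (snd q)) else 0) else 0) \<in> W" .
 qed
 finally show "slice (redv p ?V (ap ?E z)) v x \<in> W" .
qed

text \<open>On an invariant \<open>z\<close> with slices in \<open>W\<close> the projection acts as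
  the identity, and the invariance of \<open>z\<close> moves the group element from the variables
  \<open>x\<close> and \<open>y\<close> to the second argument of \<open>\<theta>\<close>. So the
  twisted matrix restricts to the sum of the conjugates of \<open>\<theta>\<close>.\<close>

lemma Ef_eq_opz:
 assumes X: "finite X" "gset G X b" and A: "finite A" "gset G A a" and pk: "projker \<pi>"
  and z: "z \<in> Hs A a X b"
 shows "redv p ((A \<times> Y) \<times> X) (ap (twmat G (A \<times> Y) X b (Em a \<theta> \<pi>)) z) =
  opz A X (\<lambda>v v'. \<Sum>g\<in>carrier G. \<theta> (a (inv g) v) (a (inv g) v')) A z"
 unfolding opz_def redv_eq_iff
proof
 note E = ap_twmat[OF X finite_cartesian_product[OF A(1) Y]]
 have *: "int p dvd ap (twmat G (A \<times> Y) X b (Em a \<theta> \<pi>)) z ((v, y), x) - (\<Sum>v'\<in>A. (\<Sum>g\<in>carrier G. \<theta> (a (inv g) v) (a (inv g) v')) * z ((v', y), x))"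
  if v: "v \<in> A" and y: "y \<in> Y" and x: "x \<in> X" for v y x
 proof -
  have 1: "ap (twmat G (A \<times> Y) X b (Em a \<theta> \<pi>)) z ((v, y), x) =
   (\<Sum>g\<in>carrier G. \<Sum>v'\<in>A. \<theta> (a (inv g) v) v' * (\<Sum>y'\<in>Y. \<pi> (w (inv g) y) y' * z ((v', y'), b (inv g) x)))"
   using E[of "(v, y)" x "Em a \<theta> \<pi>" z] v y x
   by (simp add: sum.cartesian_product' Em_def sum_distrib_left mult.assoc)
  have "(\<Sum>v'\<in>A. (\<Sum>g\<in>carrier G. \<theta> (a (inv g) v) (a (inv g) v')) * z ((v', y), x)) =
   (\<Sum>g\<in>carrier G. \<Sum>v'\<in>A. \<theta> (a (inv g) v) (a (inv g) v') * z ((v', y), x))"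
   unfolding sum_distrib_right by (rule sum.swap)
  also have "\<dots> = (\<Sum>g\<in>carrier G. \<Sum>v'\<in>A. \<theta> (a (inv g) v) v' * z ((v', w (inv g) y), b (inv g) x))"
  proof (rule sum.cong[OF refl])
   fix g assume g: "g \<in> carrier G"
   have "(\<Sum>v'\<in>A. \<theta> (a (inv g) v) v' * z ((v', w (inv g) y), b (inv g) x)) =
    (\<Sum>v'\<in>A. \<theta> (a (inv g) v) (a (inv g) v') * z ((a (inv g) v', w (inv g) y), b (inv g) x))"
    by (rule sum.reindex_bij_betw[OF gset_bij[OF A(2) inv_closed[OF g]], symmetric])
   then show "(\<Sum>v'\<in>A. \<theta> (a (inv g) v) (a (inv g) v') * z ((v', y), x)) = (\<Sum>v'\<in>A. \<theta> (a (inv g) v) v' * z ((v', w (inv g) y), b (inv g) x))"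
    using HsD(2)[OF z inv_closed[OF g] _ y x] by simp
  qed
  finally have 2: "(\<Sum>v'\<in>A. (\<Sum>g\<in>carrier G. \<theta> (a (inv g) v) (a (inv g) v')) * z ((v', y), x)) = \<dots>" .
  have 3: "int p dvd (\<Sum>y'\<in>Y. \<pi> (w (inv g) y) y' * z ((v', y'), b (inv g) x)) - z ((v', w (inv g) y), b (inv g) x)"
   if g: "g \<in> carrier G" and v': "v' \<in> A" for g v'
  proof -
   have "slice z v' (b (inv g) x) \<in> W" by (rule HsD(3)[OF z v' gsetD(1)[OF X(2) inv_closed[OF g] x]])
   moreover have wy: "w (inv g) y \<in> Y" by (rule gsetD(1)[OF w inv_closed[OF g] y])
   ultimately have "int p dvd (\<Sum>y'\<in>Y. \<pi> (w (inv g) y) y' * slice z v' (b (inv g) x) y') - slice z v' (b (inv g) x) (w (inv g) y)"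
    using pk by (simp add: projker_def)
   then show ?thesis using wy by (simp add: slice_def)
  qed
  show ?thesis unfolding 1 2 sum_subtractf[symmetric] right_diff_distrib[symmetric] by (intro dvd_sum dvd_mult 3)
 qed
 fix q assume "q \<in> (A \<times> Y) \<times> X"
 then show "int p dvd ap (twmat G (A \<times> Y) X b (Em a \<theta> \<pi>)) z q - (\<Sum>v'\<in>A. (\<Sum>g\<in>carrier G. \<theta> (a (inv g) (fst (fst q))) (a (inv g) v')) * z ((v', snd (fst q)), snd q))"
  using *[of "fst (fst q)" "snd (fst q)" "snd q"] by auto
qed

text \<open>All values of \<open>E\<close> lie in \<open>Hs\<close>, and on \<open>Hs\<close> it
  agrees with the operator of the conjugate sum. Since \<open>E ^ n\<close> is idempotent modulo
  \<open>p\<close>, its image on all vectors is already attained on \<open>Hs\<close>. An image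
  inside the invariants, whose size is hard to compare for different \<open>X\<close>, thus becomes
  the image of a matrix to which the trace argument applies.\<close>

lemma image_Imp:
 assumes X: "finite X" "gset G X b" and A: "finite A" "gset G A a" and pk: "projker \<pi>" and n: "n \<ge> 1"
  and E: "E = twmat G (A \<times> Y) X b (Em a \<theta> \<pi>)" and idem: "cg (int p) (E ^ n * E ^ n) (E ^ n)"
 shows "(opz A X (\<lambda>v v'. \<Sum>g\<in>carrier G. \<theta> (a (inv g) v) (a (inv g) v')) A ^^ n) ` Hs A a X b = Imp p ((A \<times> Y) \<times> X) (E ^ n)"
  (is "(?T ^^ n) ` ?H = Imp p ?V _")
proof -
 define Ef where "Ef z = redv p ?V (ap E z)" for z
 note 1 = Ef_in_Hs[OF X A pk, where \<theta> = \<theta>, folded E, folded Ef_def]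
 note 2 = Ef_eq_opz[OF X A pk, where \<theta> = \<theta>, folded E, folded Ef_def]
 have 3: "(Ef ^^ i) z \<in> ?H" if "i \<ge> 1" for i z using that 1 by (cases i) auto
 have 4: "(?T ^^ i) z = (Ef ^^ i) z" if "z \<in> ?H" for i z
 proof (induction i)
  case (Suc i)
  have "(Ef ^^ i) z \<in> ?H" using 3[of i z] that by (cases i) auto
  then show ?case using Suc 2[of "(Ef ^^ i) z"] by simp
 qed simp
 have 5: "(Ef ^^ i) z = redv p ?V (ap (E ^ i) z)" if "z \<in> FV p ?V" for i z
 proof (induction i)
  case 0 show ?case using that by (simp add: FV_def ap_ops)
 next
  case (Suc i)
  then show ?case by (simp add: Ef_def ap_mult E twmat_def redv_ap)
 qed
 have HF: "?H \<subseteq> FV p ?V" by (auto simp: Hs_def)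
 have I: "Imp p ?V (E ^ n) = (Ef ^^ n) ` FV p ?V" unfolding Imp_def by (rule image_cong[OF refl]) (simp add: 5)
 show ?thesis
 proof (intro equalityI subsetI)
  fix u assume "u \<in> (?T ^^ n) ` ?H"
  then show "u \<in> Imp p ?V (E ^ n)" using HF by (auto simp: I 4)
 next
  fix u assume "u \<in> Imp p ?V (E ^ n)"
  then obtain z where z: "z \<in> FV p ?V" "u = (Ef ^^ n) z" unfolding I by blast
  have "(Ef ^^ n) ((Ef ^^ n) z) = (Ef ^^ (n + n)) z" by (simp add: funpow_add)
  also have "\<dots> = redv p ?V (ap (E ^ (n + n)) z)" by (rule 5[OF z(1)])
  also have "\<dots> = redv p ?V (ap (E ^ n) z)" unfolding power_add by (rule redv_cg[OF idem])
  also have "\<dots> = u" by (simp add: z(2) 5[OF z(1)])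
  finally have "u = (?T ^^ n) ((Ef ^^ n) z)" using 4[OF 3[OF n]] by simp
  then show "u \<in> (?T ^^ n) ` ?H" using 3[OF n] by blast
 qed
qed

text \<open>Combine \<open>image_Imp\<close> with \<open>stable_rank_eq\<close>: the traces of the
  twisted matrices agree by the assumption on fixed points. All multiples of \<open>n\<close> are
  allowed as exponents, so that one exponent can later serve both the even and the odd part.\<close>

lemma image_card_eq:
 fixes \<theta> :: "'v => 'v => int"
 assumes X: "finite X" "gset G X b" and X': "finite X'" "gset G X' b'" and A: "finite A" "gset G A a"
  and fx: "\<And>g. g \<in> carrier G ==> card {x \<in> X. b g x = x} = card {x \<in> X'. b' g x = x}"
 defines "\<tau> \<equiv> (\<lambda>v v'. \<Sum>g\<in>carrier G. \<theta> (a (inv g) v) (a (inv g) v'))"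
 shows "\<exists>n\<ge>1. \<forall>k\<ge>1. card ((opz A X \<tau> A ^^ (n * k)) ` Hs A a X b) = card ((opz A X' \<tau> A ^^ (n * k)) ` Hs A a X' b')"
proof -
 obtain \<pi> where pk: "projker \<pi>" using ex_projker by blast
 have AY: "finite (A \<times> Y)" using A Y by simp
 have fin: "finite ((A \<times> Y) \<times> X)" "finite ((A \<times> Y) \<times> X')" using AY X X' by auto
 define E where "E = twmat G (A \<times> Y) X b (Em a \<theta> \<pi>)"
 define E' where "E' = twmat G (A \<times> Y) X' b' (Em a \<theta> \<pi>)"
 obtain n where n: "n \<ge> 1" "cg (int p) (E ^ n * E ^ n) (E ^ n)"
  using idempotent_power[OF fin(1) p1] unfolding E_def twmat_def by blast
 obtain n' where n': "n' \<ge> 1" "cg (int p) (E' ^ n' * E' ^ n') (E' ^ n')"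
  using idempotent_power[OF fin(2) p1] unfolding E'_def twmat_def by blast
 show ?thesis
 proof (intro exI[of _ "n * n'"] conjI allI impI)
  show "1 \<le> n * n'" using n n' by simp
  fix k :: nat assume k: "k \<ge> 1"
  let ?m = "n * n' * k"
  have m: "?m \<ge> 1" using n n' k by simp
  have i1: "cg (int p) (E ^ ?m * E ^ ?m) (E ^ ?m)" using idem_multiple[OF n(2), of "n' * k"] n' k by (simp add: mult.assoc)
  have i2: "cg (int p) (E' ^ ?m * E' ^ ?m) (E' ^ ?m)" using idem_multiple[OF n'(2), of "n * k"] n k by (simp add: ac_simps)
  let ?w = "\<lambda>b r s. \<Sum>g\<in>carrier G. if snd r = b g (snd s) then Em a \<theta> \<pi> g (fst r) (fst s) else 0"
  have E: "E = mop ((A \<times> Y) \<times> X) (?w b)" and E': "E' = mop ((A \<times> Y) \<times> X') (?w b')"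
   by (simp_all only: E_def E'_def twmat_def)
  have "card (Imp p ((A \<times> Y) \<times> X) (E ^ ?m)) = card (Imp p ((A \<times> Y) \<times> X') (E' ^ ?m))"
   unfolding E E'
  proof (rule stable_rank_eq[OF fin p m i1[unfolded E] i2[unfolded E']])
   fix q :: nat assume q: "q \<ge> 1"
   show "tr ((A \<times> Y) \<times> X) (mop ((A \<times> Y) \<times> X) (?w b) ^ q) = tr ((A \<times> Y) \<times> X') (mop ((A \<times> Y) \<times> X') (?w b') ^ q)"
    unfolding E[symmetric] E'[symmetric] E_def E'_def by (rule tr_twmat_power_eq[OF finG AY X X' fx q])
  qed
  then show "card ((opz A X \<tau> A ^^ ?m) ` Hs A a X b) = card ((opz A X' \<tau> A ^^ ?m) ` Hs A a X' b')"
   unfolding \<tau>_def image_Imp[OF X A pk m E_def i1] image_Imp[OF X' A pk m E'_def i2] .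
 qed
qed

text \<open>The number of maps is the size of the kernel times the size of the image of a power of
  \<open>\<tau>\<close>. For fixed \<open>X\<close> the kernels on the even and odd points of
  \<open>V\<close> have the same size, by \<open>kernel_card_le\<close> in both directions; for a
  fixed parity the images over \<open>X\<close> and \<open>X'\<close> have the same size.
  Multiplying crosswise, both sides become the same product of four numbers.\<close>

lemma card_Hs_cross:
 assumes V: "finite V" "gset G V a" and par: "\<And>g v. g \<in> carrier G ==> v \<in> V ==> par (a g v) = par v"
  and odd: "\<And>x y. x \<in> V ==> y \<in> V ==> par x = par y ==> f x y = 0"
  and inv: "\<And>g x y. g \<in> carrier G ==> x \<in> V ==> y \<in> V ==> f (a g x) (a g y) = f x y"
  and c: "coprime c (int p)"
  and sq: "\<And>x y. x \<in> V ==> y \<in> V ==> (\<Sum>z\<in>V. f x z * f z y) = (if x = y then c else 0) - (\<Sum>g\<in>carrier G. \<theta> (a (inv g) x) (a (inv g) y))"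
  and X: "finite X" "gset G X b" and X': "finite X'" "gset G X' b'"
  and fx: "\<And>g. g \<in> carrier G ==> card {x \<in> X. b g x = x} = card {x \<in> X'. b' g x = x}"
 shows "card (Hs {v\<in>V. \<not> par v} a X b) * card (Hs {v\<in>V. par v} a X' b') = card (Hs {v\<in>V. \<not> par v} a X' b') * card (Hs {v\<in>V. par v} a X b)"
proof -
 define \<tau> where "\<tau> v v' = (\<Sum>g\<in>carrier G. \<theta> (a (inv g) v) (a (inv g) v'))" for v v'
 define A where "A = {v\<in>V. \<not> par v}"
 define B where "B = {v\<in>V. par v}"
 have AB: "finite A" "finite B" using V by (auto simp: A_def B_def)
 have gA: "gset G A a" using gset_subset[OF V(2), of A] gsetD(1)[OF V(2)] par unfolding A_def by auto
 have gB: "gset G B a" using gset_subset[OF V(2), of B] gsetD(1)[OF V(2)] par unfolding B_def by auto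
 have tinv: "\<tau> (a h v) (a h v') = \<tau> v v'" if h: "h \<in> carrier G" and v: "v \<in> V" "v' \<in> V" for h v v'
 proof -
  have *: "a (inv (h \<otimes> g)) (a h t) = a (inv g) t" if "t \<in> V" "g \<in> carrier G" for g t
  proof -
   have "a (inv (h \<otimes> g)) (a h t) = a (inv (h \<otimes> g) \<otimes> h) t"
    by (rule gsetD(3)[OF V(2) _ h that(1), symmetric]) (use h that in auto)
   also have "inv (h \<otimes> g) \<otimes> h = inv g" using h that(2) by (simp add: inv_mult_group m_assoc)
   finally show ?thesis .
  qed
  have "\<tau> (a h v) (a h v') = (\<Sum>g\<in>carrier G. \<theta> (a (inv (h \<otimes> g)) (a h v)) (a (inv (h \<otimes> g)) (a h v')))"
   unfolding \<tau>_def by (rule sum_reindex_left[OF h, symmetric])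
  then show ?thesis by (simp add: * v \<tau>_def)
 qed
 have sA: "(\<Sum>z\<in>B. f v z * f z v') = (if v = v' then c else 0) - \<tau> v v'" if "v \<in> A" "v' \<in> A" for v v'
 proof -
  have "(\<Sum>z\<in>V. f v z * f z v') = (\<Sum>z\<in>B. f v z * f z v')"
   by (rule sum.mono_neutral_right[OF V(1)]) (use that odd in \<open>auto simp: A_def B_def\<close>)
  then show ?thesis using sq[of v v'] that by (simp add: A_def \<tau>_def)
 qed
 have sB: "(\<Sum>z\<in>A. f v z * f z v') = (if v = v' then c else 0) - \<tau> v v'" if "v \<in> B" "v' \<in> B" for v v'
 proof -
  have "(\<Sum>z\<in>V. f v z * f z v') = (\<Sum>z\<in>A. f v z * f z v')"
   by (rule sum.mono_neutral_right[OF V(1)]) (use that odd in \<open>auto simp: A_def B_def\<close>)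
  then show ?thesis using sq[of v v'] that by (simp add: B_def \<tau>_def)
 qed
 have iAV: "\<And>v. v \<in> A ==> v \<in> V" "\<And>v. v \<in> B ==> v \<in> V" by (auto simp: A_def B_def)
 let ?K = "\<lambda>S X b n. card {z \<in> Hs S a X b. (opz S X \<tau> S ^^ n) z = (\<lambda>q. 0)}"
 have ker: "?K A X b n = ?K B X b n" if "finite X" "gset G X b" for X b n
 proof (rule antisym)
  show "?K B X b n \<le> ?K A X b n"
   by (rule kernel_card_le[OF AB that(1) gA gB that(2), of f \<tau> \<tau> f c]) (use inv tinv iAV sA sB c in auto)
  show "?K A X b n \<le> ?K B X b n"
   by (rule kernel_card_le[OF AB(2,1) that(1) gB gA that(2), of f \<tau> \<tau> f c]) (use inv tinv iAV sA sB c in auto)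
 qed
 have dec: "card (Hs S a X b) = ?K S X b n * card ((opz S X \<tau> S ^^ n) ` Hs S a X b)"
  if S: "finite S" "gset G S a" "S \<subseteq> V" and X: "finite X" "gset G X b" for S X b n
 proof -
  have t: "\<And>g v v'. g \<in> carrier G ==> v \<in> S ==> v' \<in> S ==> \<tau> (a g v) (a g v') = \<tau> v v'" using tinv S(3) by blast
  have fin: "finite ((S \<times> Y) \<times> X)" using S X Y by simp
  show ?thesis
  proof (rule card_ker_im[OF fin p1 lins_Hs[OF X(2) S(2)]])
   show "(opz S X \<tau> S ^^ n) (redv p ((S \<times> Y) \<times> X) (\<lambda>x. u x + c * w x)) =
    redv p ((S \<times> Y) \<times> X) (\<lambda>x. (opz S X \<tau> S ^^ n) u x + c * (opz S X \<tau> S ^^ n) w x)"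
    if "u \<in> Hs S a X b" "w \<in> Hs S a X b" for u w c
    by (rule opz_power_lin(2)[OF S(2) X(2) _ refl that]) (rule t)
   show "(opz S X \<tau> S ^^ n) u \<in> FV p ((S \<times> Y) \<times> X)" if "u \<in> Hs S a X b" for u
    by (rule HsD(1)[OF opz_power_lin(1)[OF S(2) X(2) _ refl that]]) (rule t)
  qed
 qed
 obtain n where n: "n \<ge> 1" "\<And>k. k \<ge> 1 ==> card ((opz A X \<tau> A ^^ (n * k)) ` Hs A a X b) = card ((opz A X' \<tau> A ^^ (n * k)) ` Hs A a X' b')"
  using image_card_eq[OF X X' AB(1) gA fx, of \<theta>] unfolding \<tau>_def[abs_def] by blast
 obtain n' where n': "n' \<ge> 1" "\<And>k. k \<ge> 1 ==> card ((opz B X \<tau> B ^^ (n' * k)) ` Hs B a X b) = card ((opz B X' \<tau> B ^^ (n' * k)) ` Hs B a X' b')"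
  using image_card_eq[OF X X' AB(2) gB fx, of \<theta>] unfolding \<tau>_def[abs_def] by blast
 have AV: "A \<subseteq> V" "B \<subseteq> V" by (auto simp: A_def B_def)
 have iA: "card ((opz A X \<tau> A ^^ (n * n')) ` Hs A a X b) = card ((opz A X' \<tau> A ^^ (n * n')) ` Hs A a X' b')" by (rule n(2)[OF n'(1)])
 have iB: "card ((opz B X \<tau> B ^^ (n * n')) ` Hs B a X b) = card ((opz B X' \<tau> B ^^ (n * n')) ` Hs B a X' b')" using n'(2)[OF n(1)] by (simp add: mult.commute)
 show ?thesis unfolding A_def[symmetric] B_def[symmetric]
  unfolding dec[OF AB(1) gA AV(1) X, of "n * n'"] dec[OF AB(1) gA AV(1) X', of "n * n'"] dec[OF AB(2) gB AV(2) X, of "n * n'"] dec[OF AB(2) gB AV(2) X', of "n * n'"]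
   ker[OF X] ker[OF X'] iA iB by simp
qed


end

section \<open>Counting equivariant maps after Lovasz\<close>

context group
begin

definition gmv :: "'y set => ('a => 'y => 'y) => 'a => ('y => int) => 'y => int" where
 "gmv Y w g u = (\<lambda>y. if y \<in> Y then u (w (inv g) y) else 0)"

definition stsub :: "nat => 'y set => ('a => 'y => 'y) => ('y => int) set => bool" where
 "stsub p Y w W \<longleftrightarrow> lins p Y W \<and> (\<forall>u\<in>W. \<forall>g\<in>carrier G. gmv Y w g u \<in> W)"

definition Mp :: "'s set => ('a => 's => 's) => 'y set => ('a => 'y => 'y) => ('y => int) set => ('s => 'y => int) set" where
 "Mp S a Y w W = {u \<in> S \<rightarrow>\<^sub>E W. \<forall>g\<in>carrier G. \<forall>s\<in>S. u (a g s) = gmv Y w g (u s)}"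

text \<open>Maps in \<open>Ep\<close> are those whose image is contained in no smaller subrepresentation.\<close>

definition Ep :: "nat => 's set => ('a => 's => 's) => 'y set => ('a => 'y => 'y) => ('y => int) set => ('s => 'y => int) set" where
 "Ep p S a Y w W = {u \<in> Mp S a Y w W. \<forall>W'. stsub p Y w W' \<and> W' \<subseteq> W \<and> u \<in> Mp S a Y w W' \<longrightarrow> W' = W}"

lemma Mp_union:
 assumes "S \<inter> S' = {}" and S: "gset G S a" and S': "gset G S' a"
 shows "card (Mp (S \<union> S') a Y w W) = card (Mp S a Y w W) * card (Mp S' a Y w W)"
proof -
 have mem: "a g s \<in> S" if "g \<in> carrier G" "s \<in> S" for g s by (rule gsetD(1)[OF S that])
 have mem': "a g s \<in> S'" if "g \<in> carrier G" "s \<in> S'" for g s by (rule gsetD(1)[OF S' that])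
 have nm: "a g s \<notin> S" if "g \<in> carrier G" "s \<in> S'" for g s using mem'[OF that] assms(1) by blast
 have "bij_betw (\<lambda>u. (restrict u S, restrict u S')) (Mp (S \<union> S') a Y w W) (Mp S a Y w W \<times> Mp S' a Y w W)"
 proof (rule bij_betw_byWitness[where f' = "\<lambda>(u, v) s. if s \<in> S then u s else v s"])
  show "\<forall>u\<in>Mp (S \<union> S') a Y w W. (case (restrict u S, restrict u S') of (u, v) => \<lambda>s. if s \<in> S then u s else v s) = u"
   by (auto simp: Mp_def fun_eq_iff PiE_def extensional_def)
  show "\<forall>q\<in>Mp S a Y w W \<times> Mp S' a Y w W. (restrict (case q of (u, v) => \<lambda>s. if s \<in> S then u s else v s) S,
    restrict (case q of (u, v) => \<lambda>s. if s \<in> S then u s else v s) S') = q"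
   using assms(1) by (auto simp: Mp_def fun_eq_iff PiE_def extensional_def)
  show "(\<lambda>u. (restrict u S, restrict u S')) ` Mp (S \<union> S') a Y w W \<subseteq> Mp S a Y w W \<times> Mp S' a Y w W"
   using mem mem' by (auto simp: Mp_def)
  show "(\<lambda>(u, v) s. if s \<in> S then u s else v s) ` (Mp S a Y w W \<times> Mp S' a Y w W) \<subseteq> Mp (S \<union> S') a Y w W"
  proof (rule image_subsetI, clarify)
   fix u v assume u: "u \<in> Mp S a Y w W" and v: "v \<in> Mp S' a Y w W"
   have "(\<lambda>s. if s \<in> S then u s else v s) \<in> (S \<union> S') \<rightarrow>\<^sub>E W"
    using u v by (auto simp: Mp_def PiE_def extensional_def Pi_def)
   moreover have "(if a g s \<in> S then u (a g s) else v (a g s)) = gmv Y w g (if s \<in> S then u s else v s)"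
    if g: "g \<in> carrier G" and s: "s \<in> S \<union> S'" for g s
   proof (cases "s \<in> S")
    case True
    then show ?thesis using u mem[OF g True] g by (simp add: Mp_def)
   next
    case False
    then have "s \<in> S'" using s by simp
    then show ?thesis using v nm[OF g] g False by (simp add: Mp_def)
   qed
   ultimately show "(\<lambda>s. if s \<in> S then u s else v s) \<in> Mp (S \<union> S') a Y w W" by (simp add: Mp_def)
  qed
 qed
 from bij_betw_same_card[OF this] show ?thesis by (simp add: card_cartesian_product)
qed

lemma finite_Mp: "finite S ==> finite W ==> finite (Mp S a Y w W)"
 unfolding Mp_def by (simp add: finite_PiE)

lemma stsub_Int: "stsub p Y w W ==> stsub p Y w W' ==> stsub p Y w (W \<inter> W')"
 unfolding stsub_def lins_def by blast

lemma Mp_Int: "u \<in> Mp S a Y w W ==> u \<in> Mp S a Y w W' ==> u \<in> Mp S a Y w (W \<inter> W')"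
 by (auto simp: Mp_def PiE_def Pi_def)

lemma Mp_mono: "W' \<subseteq> W ==> Mp S a Y w W' \<subseteq> Mp S a Y w W"
 by (auto simp: Mp_def PiE_def Pi_def)

text \<open>Subrepresentations are closed under intersection, so each map has exactly one smallest
  subrepresentation containing its values; the maps are sorted by it.\<close>

lemma card_Mp_sum:
 assumes Y: "finite Y" and p: "p \<ge> 1" and W: "stsub p Y w W" and S: "finite S"
 shows "card (Mp S a Y w W) = (\<Sum>W'\<in>{W'. stsub p Y w W' \<and> W' \<subseteq> W}. card (Ep p S a Y w W'))"
proof -
 have sF: "W' \<subseteq> FV p Y" if "stsub p Y w W'" for W' by (rule linsD(1)) (use that in \<open>simp add: stsub_def\<close>)
 have finW: "finite W'" if "stsub p Y w W'" for W' using finite_subset[OF sF[OF that] finite_FV[OF Y p]] .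
 let ?D = "{W'. stsub p Y w W' \<and> W' \<subseteq> W}"
 have finD: "finite ?D" by (rule finite_subset[of _ "Pow W"]) (use finW[OF W] in auto)
 have "Mp S a Y w W = (\<Union>W'\<in>?D. Ep p S a Y w W')"
 proof (intro equalityI subsetI)
  fix u assume u: "u \<in> Mp S a Y w W"
  let ?Q = "{W' \<in> ?D. u \<in> Mp S a Y w W'}"
  have "finite ?Q" by (rule finite_subset[OF _ finD]) blast
  moreover have "?Q \<noteq> {}" using u W by blast
  ultimately have "\<exists>m\<in>?Q. \<forall>b\<in>?Q. b \<le> m \<longrightarrow> m = b" by (rule finite_has_minimal)
  then obtain M where M: "M \<in> ?Q" "\<forall>b\<in>?Q. b \<le> M \<longrightarrow> M = b" by (rule bexE)
  have "u \<in> Ep p S a Y w M"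
   unfolding Ep_def
  proof (intro CollectI conjI allI impI)
   show "u \<in> Mp S a Y w M" using M(1) by simp
   fix W' assume W': "stsub p Y w W' \<and> W' \<subseteq> M \<and> u \<in> Mp S a Y w W'"
   then have "W' \<in> ?Q" using M(1) by auto
   then have "W' \<le> M \<longrightarrow> M = W'" by (rule bspec[OF M(2)])
   then show "W' = M" using W' by simp
  qed
  then show "u \<in> (\<Union>W'\<in>?D. Ep p S a Y w W')" using M(1) by blast
 next
  fix u assume "u \<in> (\<Union>W'\<in>?D. Ep p S a Y w W')"
  then obtain W' where "W' \<subseteq> W" "u \<in> Mp S a Y w W'" by (auto simp: Ep_def)
  then show "u \<in> Mp S a Y w W" using Mp_mono by blast
 qed
 moreover have "card (\<Union>W'\<in>?D. Ep p S a Y w W') = (\<Sum>W'\<in>?D. card (Ep p S a Y w W'))"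
 proof (rule card_UN_disjoint[OF finD])
  show "\<forall>W'\<in>?D. finite (Ep p S a Y w W')"
  proof
   fix W' assume "W' \<in> ?D"
   then have "finite (Mp S a Y w W')" by (intro finite_Mp S finW) simp
   then show "finite (Ep p S a Y w W')" by (simp add: Ep_def)
  qed
  show "\<forall>W1\<in>?D. \<forall>W2\<in>?D. W1 \<noteq> W2 \<longrightarrow> Ep p S a Y w W1 \<inter> Ep p S a Y w W2 = {}"
  proof (intro ballI impI)
   fix W1 W2 assume W12: "W1 \<in> ?D" "W2 \<in> ?D" "W1 \<noteq> W2"
   show "Ep p S a Y w W1 \<inter> Ep p S a Y w W2 = {}"
   proof (rule ccontr)
    assume "Ep p S a Y w W1 \<inter> Ep p S a Y w W2 \<noteq> {}"
    then obtain u where u: "u \<in> Ep p S a Y w W1" "u \<in> Ep p S a Y w W2" by blast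
    then have m: "u \<in> Mp S a Y w (W1 \<inter> W2)" by (intro Mp_Int) (simp_all add: Ep_def)
    have s: "stsub p Y w (W1 \<inter> W2)" by (rule stsub_Int) (use W12 in simp_all)
    have "W1 \<inter> W2 = W1" using u(1) m s unfolding Ep_def by blast
    moreover have "W1 \<inter> W2 = W2" using u(2) m s unfolding Ep_def by blast
    ultimately show False using W12(3) by simp
   qed
  qed
 qed
 ultimately show ?thesis by (simp only:)
qed

text \<open>Inclusion and exclusion as a strong induction: by \<open>card_Mp_sum\<close>, the maps
  that do not fit into a proper subrepresentation are all maps minus those already known to be
  equinumerous.\<close>

lemma card_Ep_eq:
 assumes Y: "finite Y" and p: "p \<ge> 1" and S: "finite S" "finite S'"
  and eq: "\<And>W. stsub p Y w W ==> card (Mp S a Y w W) = card (Mp S' a' Y w W)"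
 shows "stsub p Y w W ==> card (Ep p S a Y w W) = card (Ep p S' a' Y w W)"
proof (induction "card W" arbitrary: W rule: less_induct)
 case less
 have "lins p Y W" using less.prems by (simp add: stsub_def)
 then have finW: "finite W" by (rule finite_subset[OF linsD(1) finite_FV[OF Y p]])
 let ?D = "{W'. stsub p Y w W' \<and> W' \<subseteq> W}"
 have D: "finite ?D" by (rule finite_subset[of _ "Pow W"]) (use finW in auto)
 have WD: "W \<in> ?D" using less.prems by simp
 have "(\<Sum>W'\<in>?D - {W}. card (Ep p S a Y w W')) = (\<Sum>W'\<in>?D - {W}. card (Ep p S' a' Y w W'))"
 proof (rule sum.cong[OF refl])
  fix W' assume W': "W' \<in> ?D - {W}"
  then have "card W' < card W" by (intro psubset_card_mono finW) auto
  then show "card (Ep p S a Y w W') = card (Ep p S' a' Y w W')" using less.hyps W' by simp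
 qed
 then show ?case using eq[OF less.prems] unfolding card_Mp_sum[OF Y p less.prems S(1)] card_Mp_sum[OF Y p less.prems S(2)]
  sum.remove[OF D WD] by simp
qed

text \<open>The basis vectors define a map from \<open>S\<close> into the full space of functions on
  \<open>S\<close> that fits into no proper subrepresentation. By the counts there is such a map
  from \<open>S'\<close> as well, and its values must span. They are the columns of
  \<open>U\<close>, and \<open>C\<close> expresses the basis vectors through them.\<close>

lemma spanning_matrix:
 fixes S :: "'s set"
 assumes p: "p \<ge> 2" and S: "finite S" "gset G S a" and S': "finite S'" "gset G S' a'"
  and eq: "\<And>W. stsub p S a W ==> card (Mp S a S a W) = card (Mp S' a' S a W)"
 shows "\<exists>U C. (\<forall>g\<in>carrier G. \<forall>y\<in>S. \<forall>s\<in>S'. U (a g y) (a' g s) = U y s) \<and>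
   (\<forall>y\<in>S. \<forall>y'\<in>S. int p dvd (\<Sum>s\<in>S'. U y s * C s y') - (if y = y' then 1 else 0))"
proof -
 have p1: "p \<ge> 1" using p by simp
 have gF: "gmv S a g u \<in> FV p S" if u: "u \<in> FV p S" and g: "g \<in> carrier G" for u g
  by (rule FV_I) (use FV_range[OF u p1 gsetD(1)[OF S(2) inv_closed[OF g]]] in \<open>auto simp: gmv_def\<close>)
 have lF: "lins p S (FV p S)"
  unfolding lins_def by (auto simp: redv_FV intro!: FV_I) (use p1 in auto)
 have stF: "stsub p S a (FV p S)" unfolding stsub_def using lF gF by blast
 define e where "e s = (\<lambda>y. if y = s then (1::int) else 0)" for s :: 's
 have eF: "e s \<in> FV p S" if "s \<in> S" for s by (rule FV_I) (use that p in \<open>auto simp: e_def\<close>)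
 have "restrict e S \<in> Mp S a S a (FV p S)"
 proof -
  have "e (a g s) = gmv S a g (e s)" if g: "g \<in> carrier G" and s: "s \<in> S" for g s
  proof
   fix y
   show "e (a g s) y = gmv S a g (e s) y"
    using gset_inv1[OF S(2) g s] gset_inv2[OF S(2) g, of y] gsetD(1)[OF S(2) g s] by (auto simp: e_def gmv_def)
  qed
  then show ?thesis using eF gsetD(1)[OF S(2)] by (auto simp: Mp_def)
 qed
 moreover have "W' = FV p S" if W': "stsub p S a W'" "W' \<subseteq> FV p S" "restrict e S \<in> Mp S a S a W'" for W'
 proof -
  have eW: "e s \<in> W'" if s: "s \<in> S" for s
  proof -
   have "restrict e S s \<in> W'" using W'(3) s unfolding Mp_def by (intro PiE_mem[of _ S "\<lambda>_. W'"]) auto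
   then show ?thesis using s by simp
  qed
  have "f \<in> W'" if f: "f \<in> FV p S" for f
  proof -
   have "redv p S (\<lambda>y. \<Sum>s\<in>S. f s * e s y) \<in> W'"
    by (rule lins_sum) (use W'(1) eW in \<open>auto simp: stsub_def\<close>)
   also have "redv p S (\<lambda>y. \<Sum>s\<in>S. f s * e s y) = redv p S f"
    using S(1) by (auto simp: redv_def e_def fun_eq_iff if_distrib[of "\<lambda>t. _ * t"] cong: if_cong)
   finally show ?thesis using f by (simp add: FV_def)
  qed
  then show ?thesis using W'(2) by blast
 qed
 ultimately have "restrict e S \<in> Ep p S a S a (FV p S)" unfolding Ep_def by blast
 moreover have "finite (Ep p S a S a (FV p S))" using finite_Mp[OF S(1) finite_FV[OF S(1) p1]] by (simp add: Ep_def)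
 ultimately have "card (Ep p S a S a (FV p S)) \<noteq> 0" by auto
 then have "card (Ep p S' a' S a (FV p S)) \<noteq> 0" using card_Ep_eq[OF S(1) p1 S(1) S'(1) eq stF] by simp
 then have "Ep p S' a' S a (FV p S) \<noteq> {}" by force
 then obtain u where u: "u \<in> Mp S' a' S a (FV p S)" and min: "\<And>W'. stsub p S a W' ==> W' \<subseteq> FV p S ==> u \<in> Mp S' a' S a W' ==> W' = FV p S"
  unfolding Ep_def by blast
 have ueq: "u (a' g s) = gmv S a g (u s)" if "g \<in> carrier G" "s \<in> S'" for g s using u that by (simp add: Mp_def)
 have uF: "u s \<in> FV p S" if "s \<in> S'" for s using u that unfolding Mp_def by (intro PiE_mem[of _ S' "\<lambda>_. FV p S"]) auto
 \<comment> \<open>The span of the values of \<open>u\<close>. It is a subrepresentation containing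
   all values, hence the whole space by the choice of \<open>u\<close>.\<close>
 define L where "L = range (\<lambda>c. redv p S (\<lambda>y. \<Sum>s\<in>S'. c s * u s y))"
 have LI: "redv p S f \<in> L" if "\<And>y. y \<in> S ==> int p dvd f y - (\<Sum>s\<in>S'. c s * u s y)" for f c
 proof -
  have "redv p S f = redv p S (\<lambda>y. \<Sum>s\<in>S'. c s * u s y)" using that by (simp add: redv_eq_iff)
  then show ?thesis by (simp add: L_def)
 qed
 have LF: "L \<subseteq> FV p S" by (auto simp: L_def redv_FV)
 have r: "int p dvd redv p S f y - f y" if "y \<in> S" for f y
  using that by (simp add: redv_def) (metis dvd_minus_mod dvd_diff_commute)
 have "stsub p S a L"
  unfolding stsub_def lins_def
 proof (intro conjI ballI allI LF)
  show "(\<lambda>x. 0) \<in> L" using LI[of "\<lambda>_. 0" "\<lambda>_. 0"] by (simp add: redv_def cong: if_cong)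
  fix f assume f: "f \<in> L"
  then obtain c where c: "f = redv p S (\<lambda>y. \<Sum>s\<in>S'. c s * u s y)" by (auto simp: L_def)
  show "redv p S (\<lambda>x. f x + k * h x) \<in> L" if h: "h \<in> L" for h k
  proof -
   obtain c' where c': "h = redv p S (\<lambda>y. \<Sum>s\<in>S'. c' s * u s y)" using h by (auto simp: L_def)
   show ?thesis
   proof (rule LI[of _ "\<lambda>s. c s + k * c' s"])
    fix y assume y: "y \<in> S"
    have "f y + k * h y - (\<Sum>s\<in>S'. (c s + k * c' s) * u s y) = (f y - (\<Sum>s\<in>S'. c s * u s y)) + k * (h y - (\<Sum>s\<in>S'. c' s * u s y))"
     by (simp add: algebra_simps sum.distrib sum_distrib_left)
    also have "int p dvd \<dots>" unfolding c c' by (intro dvd_add dvd_mult r y)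
    finally show "int p dvd f y + k * h y - (\<Sum>s\<in>S'. (c s + k * c' s) * u s y)" .
   qed
  qed
  show "gmv S a g f \<in> L" if g: "g \<in> carrier G" for g
  proof -
   have "redv p S (gmv S a g f) \<in> L"
   proof (rule LI[of _ "\<lambda>s. c (a' (inv g) s)"])
    fix y assume y: "y \<in> S"
    have y': "a (inv g) y \<in> S" by (rule gsetD(1)[OF S(2) inv_closed[OF g] y])
    have "(\<Sum>s\<in>S'. c (a' (inv g) s) * u s y) = (\<Sum>s\<in>S'. c (a' (inv g) (a' g s)) * u (a' g s) y)"
     by (rule sum.reindex_bij_betw[OF gset_bij[OF S'(2) g], symmetric])
    also have "\<dots> = (\<Sum>s\<in>S'. c s * u s (a (inv g) y))"
     by (rule sum.cong[OF refl]) (simp add: gset_inv1[OF S'(2) g] ueq[OF g] gmv_def y)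
    finally have e: "(\<Sum>s\<in>S'. c (a' (inv g) s) * u s y) = (\<Sum>s\<in>S'. c s * u s (a (inv g) y))" .
    show "int p dvd gmv S a g f y - (\<Sum>s\<in>S'. c (a' (inv g) s) * u s y)"
     unfolding e using r[OF y', of "\<lambda>y. \<Sum>s\<in>S'. c s * u s y"] y by (simp add: gmv_def c)
   qed
   moreover have "gmv S a g f \<in> FV p S" by (rule gF) (use f LF g in auto)
   ultimately show ?thesis by (simp add: FV_def)
  qed
 qed
 moreover have "u \<in> Mp S' a' S a L"
 proof -
  have "u s \<in> L" if s: "s \<in> S'" for s
  proof -
   have "redv p S (u s) \<in> L"
    by (rule LI[of _ "\<lambda>s'. if s' = s then 1 else 0"]) (use s S' in \<open>simp add: if_distrib[of "\<lambda>t. t * _"] cong: if_cong\<close>)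
   then show ?thesis using uF[OF s] by (simp add: FV_def)
  qed
  then show ?thesis using u by (auto simp: Mp_def PiE_def)
 qed
 ultimately have L: "L = FV p S" using min LF by blast
 have "\<forall>y'\<in>S. \<exists>c. e y' = redv p S (\<lambda>y. \<Sum>s\<in>S'. c s * u s y)" using eF L unfolding L_def by blast
 from bchoice[OF this] obtain c where c: "\<And>y'. y' \<in> S ==> e y' = redv p S (\<lambda>y. \<Sum>s\<in>S'. c y' s * u s y)" by blast
 show ?thesis
 proof (intro exI[of _ "\<lambda>y s. u s y"] exI[of _ "\<lambda>s y'. c y' s"] conjI ballI)
  fix g y s assume g: "g \<in> carrier G" and y: "y \<in> S" and s: "s \<in> S'"
  show "u (a' g s) (a g y) = u s y"
   using gset_inv1[OF S(2) g y] gsetD(1)[OF S(2) g y] by (simp add: ueq[OF g s] gmv_def)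
 next
  fix y y' assume y: "y \<in> S" and y': "y' \<in> S"
  have "int p dvd (\<Sum>s\<in>S'. c y' s * u s y) - e y' y" unfolding c[OF y'] using r[OF y] by (simp add: dvd_diff_commute)
  then show "int p dvd (\<Sum>s\<in>S'. u s y * c y' s) - (if y = y' then 1 else 0)" by (simp add: e_def mult.commute)
 qed
qed

end

context fp_rep
begin

lemma card_Mp_Hs:
 assumes A: "gset G A a" and X: "gset G X b"
 shows "card (Mp (A \<times> X) (\<lambda>g (v, x). (a g v, b g x)) Y w W) = card (Hs A a X b)"
proof (rule bij_betw_same_card[OF bij_betw_byWitness[where f = "\<lambda>u. \<lambda>((v, y), x). if v \<in> A \<and> y \<in> Y \<and> x \<in> X then u (v, x) y else 0"
   and f' = "\<lambda>z. \<lambda>q\<in>A \<times> X. slice z (fst q) (snd q)"]])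
 have WF: "u \<in> W ==> u \<in> FV p Y" for u using linsD(1)[OF W] by blast
 have M: "u (v, x) \<in> W" if "u \<in> Mp (A \<times> X) (\<lambda>g (v, x). (a g v, b g x)) Y w W" "v \<in> A" "x \<in> X" for u v x
  using that unfolding Mp_def by (intro PiE_mem[of _ "A \<times> X" "\<lambda>_. W"]) auto
 have Me: "u (a g v, b g x) = gmv Y w g (u (v, x))" if "u \<in> Mp (A \<times> X) (\<lambda>g (v, x). (a g v, b g x)) Y w W" "v \<in> A" "x \<in> X" "g \<in> carrier G" for u v x g
  using that unfolding Mp_def by fastforce
 let ?f = "\<lambda>u. \<lambda>((v, y), x). if v \<in> A \<and> y \<in> Y \<and> x \<in> X then u (v, x) y else 0"
 let ?g = "\<lambda>z. \<lambda>q\<in>A \<times> X. slice z (fst q) (snd q)"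
 have sl: "slice (?f u) v x = u (v, x)" if "u \<in> Mp (A \<times> X) (\<lambda>g (v, x). (a g v, b g x)) Y w W" "v \<in> A" "x \<in> X" for u v x
  using FV_outside[OF WF[OF M[OF that]]] that by (auto simp: slice_def fun_eq_iff)
 show "\<forall>u\<in>Mp (A \<times> X) (\<lambda>g (v, x). (a g v, b g x)) Y w W. ?g (?f u) = u"
 proof
  fix u assume u: "u \<in> Mp (A \<times> X) (\<lambda>g (v, x). (a g v, b g x)) Y w W"
  then have "u \<in> A \<times> X \<rightarrow>\<^sub>E W" by (simp add: Mp_def)
  then have ex: "u q = undefined" if "q \<notin> A \<times> X" for q using PiE_arb[OF _ that, of u "\<lambda>_. W"] by simp
  show "?g (?f u) = u"
  proof
   fix q
   show "?g (?f u) q = u q"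
    using sl[OF u, of "fst q" "snd q"] ex[of q] by (cases "q \<in> A \<times> X") auto
  qed
 qed
 show "\<forall>z\<in>Hs A a X b. ?f (?g z) = z"
 proof
  fix z assume z: "z \<in> Hs A a X b"
  have *: "?f (?g z) ((v, y), x) = z ((v, y), x)" for v y x
   using FV_outside[OF HsD(1)[OF z], of "((v, y), x)"] by (auto simp: slice_def)
  from * show "?f (?g z) = z" by (simp only: fun_eq_iff split_paired_All simp_thms all_simps)
 qed
 show "?f ` Mp (A \<times> X) (\<lambda>g (v, x). (a g v, b g x)) Y w W \<subseteq> Hs A a X b"
 proof (rule image_subsetI)
  fix u assume u: "u \<in> Mp (A \<times> X) (\<lambda>g (v, x). (a g v, b g x)) Y w W"
  show "?f u \<in> Hs A a X b"
   unfolding Hs_def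
  proof (intro CollectI conjI ballI)
   show "?f u \<in> FV p ((A \<times> Y) \<times> X)"
    by (rule FV_I) (use FV_range[OF WF[OF M[OF u]] p1] in auto)
   fix v x assume v: "v \<in> A" and x: "x \<in> X"
   show "slice (?f u) v x \<in> W" using sl[OF u v x] M[OF u v x] by simp
   fix g y assume g: "g \<in> carrier G" and y: "y \<in> Y"
   show "?f u ((a g v, w g y), b g x) = ?f u ((v, y), x)"
    using gsetD(1)[OF A g v] gsetD(1)[OF X g x] gsetD(1)[OF w g y] v x y Me[OF u v x g] gset_inv1[OF w g y]
    by (simp add: gmv_def)
  qed
 qed
 show "?g ` Hs A a X b \<subseteq> Mp (A \<times> X) (\<lambda>g (v, x). (a g v, b g x)) Y w W"
 proof (rule image_subsetI)
  fix z assume z: "z \<in> Hs A a X b"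
  have "slice z (a g v) (b g x) = gmv Y w g (slice z v x)" if g: "g \<in> carrier G" and v: "v \<in> A" and x: "x \<in> X" for g v x
  proof
   fix y
   show "slice z (a g v) (b g x) y = gmv Y w g (slice z v x) y"
    using HsD(2)[OF z g v gsetD(1)[OF w inv_closed[OF g]] x, of y] gset_inv2[OF w g, of y] gsetD(1)[OF w inv_closed[OF g], of y]
    by (simp add: slice_def gmv_def)
  qed
  then show "?g z \<in> Mp (A \<times> X) (\<lambda>g (v, x). (a g v, b g x)) Y w W"
   using HsD(3)[OF z] gsetD(1)[OF A] gsetD(1)[OF X] by (auto simp: Mp_def)
 qed
qed

end

section \<open>From counting to odd operators\<close>

lemma det_cong_mod:
 fixes A B :: "int mat"
 assumes A: "A \<in> carrier_mat n n" and B: "B \<in> carrier_mat n n"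
  and c: "\<And>i j. i < n ==> j < n ==> m dvd A $$ (i, j) - B $$ (i, j)"
 shows "m dvd det A - det B"
proof -
 have pr: "m dvd (\<Prod>i\<in>I. f i) - (\<Prod>i\<in>I. g i)" if "finite I" "\<And>i. i \<in> I ==> m dvd f i - g i" for I :: "nat set" and f g :: "nat => int"
  using that
 proof (induction I rule: finite_induct)
  case (insert i I)
  have "(\<Prod>i\<in>insert i I. f i) - (\<Prod>i\<in>insert i I. g i) = f i * ((\<Prod>i\<in>I. f i) - (\<Prod>i\<in>I. g i)) + (f i - g i) * (\<Prod>i\<in>I. g i)"
   using insert.hyps by (simp add: algebra_simps)
  then show ?case using insert by (auto intro!: dvd_add dvd_mult dvd_mult2)
 qed simp
 have "det A - det B = (\<Sum>q\<in>{q. q permutes {0..<n}}. signof q * ((\<Prod>i = 0..<n. A $$ (i, q i)) - (\<Prod>i = 0..<n. B $$ (i, q i))))"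
  using A B by (simp add: det_def'[OF A] det_def'[OF B] sum_subtractf right_diff_distrib)
 also have "m dvd \<dots>"
 proof (intro dvd_sum dvd_mult)
  fix q assume "q \<in> {q. q permutes {0..<n}}"
  then have "q permutes {0..<n}" by simp
  then have "q i < n" if "i < n" for i using permutes_in_image[of q "{0..<n}" i] that by simp
  then show "m dvd (\<Prod>i = 0..<n. A $$ (i, q i)) - (\<Prod>i = 0..<n. B $$ (i, q i))" by (intro pr c) auto
 qed
 finally show ?thesis .
qed

text \<open>An inverse modulo \<open>p\<close> makes the determinant of \<open>U\<close> prime to
  \<open>p\<close>. The adjugate inverts \<open>U\<close> up to this determinant, from both sides
  and with integer entries.\<close>

lemma adjugate_of_mod_inverse:
 fixes U :: "'s => 't => int" and p :: nat
 assumes S: "finite S" and T: "finite T" and ST: "card S = card T" and p: "Factorial_Ring.prime p"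
  and UC: "\<And>y y'. y \<in> S ==> y' \<in> S ==> int p dvd (\<Sum>s\<in>T. U y s * C s y') - (if y = y' then 1 else 0)"
 shows "\<exists>d Ad. \<not> int p dvd d \<and> (\<forall>y\<in>S. \<forall>y'\<in>S. (\<Sum>s\<in>T. U y s * Ad s y') = (if y = y' then d else 0)) \<and>
  (\<forall>s\<in>T. \<forall>s'\<in>T. (\<Sum>y\<in>S. Ad s y * U y s') = (if s = s' then d else 0))"
proof -
 define n where "n = card S"
 obtain f where f: "bij_betw f {0..<n} S" using ex_bij_betw_nat_finite[OF S] n_def by blast
 obtain h where h: "bij_betw h {0..<n} T" using ex_bij_betw_nat_finite[OF T] n_def ST by metis
 define fi where "fi = inv_into {0..<n} f"
 define hi where "hi = inv_into {0..<n} h"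
 have fm: "f i \<in> S" if "i < n" for i using f that by (auto simp: bij_betw_def)
 have fe: "f i = f j \<longleftrightarrow> i = j" if "i < n" "j < n" for i j using f that by (auto simp: bij_betw_def inj_on_def)
 have fi: "fi y < n" "f (fi y) = y" if "y \<in> S" for y
  using bij_betw_apply[OF bij_betw_inv_into[OF f] that] bij_betw_inv_into_right[OF f that] by (auto simp: fi_def)
 have hi: "hi y < n" "h (hi y) = y" if "y \<in> T" for y
  using bij_betw_apply[OF bij_betw_inv_into[OF h] that] bij_betw_inv_into_right[OF h that] by (auto simp: hi_def)
 have fi': "fi (f i) = i" if "i < n" for i using bij_betw_inv_into_left[OF f] that by (simp add: fi_def)
 have hi': "hi (h i) = i" if "i < n" for i using bij_betw_inv_into_left[OF h] that by (simp add: hi_def)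
 define A where "A = mat n n (\<lambda>(i, j). U (f i) (h j))"
 define B where "B = mat n n (\<lambda>(i, j). C (h i) (f j))"
 have A: "A \<in> carrier_mat n n" and B: "B \<in> carrier_mat n n" by (auto simp: A_def B_def)
 note adj = adj_mat[OF A]
 define d where "d = det A"
 define Ad where "Ad s y = adj_mat A $$ (hi s, fi y)" for s y
 have "int p dvd (A * B) $$ (i, j) - (1\<^sub>m n :: int mat) $$ (i, j)" if ij: "i < n" "j < n" for i j
 proof -
  have "(A * B) $$ (i, j) = (\<Sum>k = 0..<n. U (f i) (h k) * C (h k) (f j))"
   using ij by (simp add: A_def B_def scalar_prod_def)
  also have "\<dots> = (\<Sum>s\<in>T. U (f i) s * C s (f j))" by (rule sum.reindex_bij_betw[OF h])
  finally show ?thesis using UC[OF fm[OF ij(1)] fm[OF ij(2)]] ij by (simp add: fe)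
 qed
 then have "int p dvd det (A * B) - det (1\<^sub>m n :: int mat)"
  using A B by (intro det_cong_mod[of _ n]) auto
 then have 1: "int p dvd d * det B - 1" by (simp add: det_mult[OF A B] d_def)
 have "\<not> int p dvd d"
 proof
  assume "int p dvd d"
  then have "int p dvd d * det B" by simp
  then have "int p dvd d * det B - (d * det B - 1)" using 1 by (rule dvd_diff)
  then have "p dvd 1" by (simp add: int_dvd_int_iff[symmetric] del: int_dvd_int_iff)
  then show False using p by (metis One_nat_def nat_dvd_1_iff_1 not_prime_1)
 qed
 moreover have "(\<Sum>s\<in>T. U y s * Ad s y') = (if y = y' then d else 0)" if y: "y \<in> S" "y' \<in> S" for y y'
 proof -
  have "(A * adj_mat A) $$ (fi y, fi y') = (d \<cdot>\<^sub>m 1\<^sub>m n) $$ (fi y, fi y')" by (simp add: adj(2) d_def)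
  moreover have "(A * adj_mat A) $$ (fi y, fi y') = (\<Sum>k = 0..<n. U y (h k) * Ad (h k) y')"
   using fi y adj(1) by (auto simp: scalar_prod_def A_def Ad_def hi' intro!: sum.cong)
  moreover have "\<dots> = (\<Sum>s\<in>T. U y s * Ad s y')" by (rule sum.reindex_bij_betw[OF h])
  moreover have "fi y = fi y' \<longleftrightarrow> y = y'" using fi y by metis
  ultimately show ?thesis using fi y by simp
 qed
 moreover have "(\<Sum>y\<in>S. Ad s y * U y s') = (if s = s' then d else 0)" if s: "s \<in> T" "s' \<in> T" for s s'
 proof -
  have "(adj_mat A * A) $$ (hi s, hi s') = (d \<cdot>\<^sub>m 1\<^sub>m n) $$ (hi s, hi s')" by (simp add: adj(3) d_def)
  moreover have "(adj_mat A * A) $$ (hi s, hi s') = (\<Sum>k = 0..<n. Ad s (f k) * U (f k) s')"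
   using hi s adj(1) by (auto simp: scalar_prod_def A_def Ad_def fi' intro!: sum.cong)
  moreover have "\<dots> = (\<Sum>y\<in>S. Ad s y * U y s')" by (rule sum.reindex_bij_betw[OF f])
  moreover have "hi s = hi s' \<longleftrightarrow> s = s'" using hi s by metis
  ultimately show ?thesis using hi s by simp
 qed
 ultimately show ?thesis by blast
qed

context group
begin

text \<open>The two blocks of the operator are \<open>U\<close> and its adjugate. The invariance of
  the adjugate is deduced from that of \<open>U\<close>: a conjugate of it inverts \<open>U\<close>
  up to the same nonzero scalar \<open>d\<close>, and such an inverse is unique.\<close>

lemma odd_operator_of_counts:
 fixes S :: "'s set"
 assumes p: "Factorial_Ring.prime p" and S: "finite S" "gset G S a" and S': "finite S'" "gset G S' a" and dis: "S \<inter> S' = {}"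
  and c: "card S = card S'"
  and eq: "\<And>W. stsub p S a W ==> card (Mp S a S a W) = card (Mp S' a S a W)"
 shows "\<exists>d h. \<not> int p dvd d \<and> oddop G (S \<union> S') a (\<lambda>s. s \<in> S') h d"
proof -
 have "\<exists>U C. (\<forall>g\<in>carrier G. \<forall>y\<in>S. \<forall>s\<in>S'. U (a g y) (a g s) = (U y s :: int)) \<and>
   (\<forall>y\<in>S. \<forall>y'\<in>S. int p dvd (\<Sum>s\<in>S'. U y s * C s y') - (if y = y' then 1 else 0))"
  by (rule spanning_matrix[OF prime_ge_2_nat[OF p] S S']) (rule eq)
 then obtain U C where U: "\<forall>g\<in>carrier G. \<forall>y\<in>S. \<forall>s\<in>S'. U (a g y) (a g s) = (U y s :: int)"
  and UC: "\<forall>y\<in>S. \<forall>y'\<in>S. int p dvd (\<Sum>s\<in>S'. U y s * C s y') - (if y = y' then 1 else 0)"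
  by (elim exE conjE)
 have "\<exists>d Ad. \<not> int p dvd d \<and> (\<forall>y\<in>S. \<forall>y'\<in>S. (\<Sum>s\<in>S'. U y s * Ad s y') = (if y = y' then d else 0)) \<and>
  (\<forall>s\<in>S'. \<forall>s'\<in>S'. (\<Sum>y\<in>S. Ad s y * U y s') = (if s = s' then d else 0))"
  by (rule adjugate_of_mod_inverse[OF S(1) S'(1) c p, of U C]) (rule bspec[OF bspec[OF UC]])
 then obtain d Ad where d: "\<not> int p dvd d" and UA': "\<forall>y\<in>S. \<forall>y'\<in>S. (\<Sum>s\<in>S'. U y s * Ad s y') = (if y = y' then d else 0)"
  and AU': "\<forall>s\<in>S'. \<forall>s'\<in>S'. (\<Sum>y\<in>S. Ad s y * U y s') = (if s = s' then d else 0)"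
  by (elim exE conjE)
 note UA = bspec[OF bspec[OF UA']] and AU = bspec[OF bspec[OF AU']]
 have d0: "d \<noteq> 0" using d by auto
 have Ainv: "Ad (a g s) (a g y') = Ad s y'" if g: "g \<in> carrier G" and s: "s \<in> S'" and y': "y' \<in> S" for g s y'
 proof -
  define A' where "A' s y = Ad (a g s) (a g y)" for s y
  have A'U: "(\<Sum>y\<in>S. A' s y * U y s') = (if s = s' then d else 0)" if s': "s' \<in> S'" for s'
  proof -
   have "(\<Sum>y\<in>S. A' s y * U y s') = (\<Sum>y\<in>S. Ad (a g s) (a g y) * U (a g y) (a g s'))"
    by (rule sum.cong[OF refl]) (use U g s' in \<open>simp add: A'_def\<close>)
   also have "\<dots> = (\<Sum>y\<in>S. Ad (a g s) y * U y (a g s'))"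
    by (rule sum.reindex_bij_betw[OF gset_bij[OF S(2) g]])
   also have "\<dots> = (if a g s = a g s' then d else 0)" by (rule AU) (use gsetD(1)[OF S'(2) g] s s' in auto)
   finally show ?thesis using gset_inj[OF S'(2) g s s'] by simp
  qed
  have "d * A' s y' = (\<Sum>y\<in>S. A' s y * (if y = y' then d else 0))"
   using S(1) y' by (simp add: if_distrib[of "\<lambda>t. _ * t"] cong: if_cong)
  also have "\<dots> = (\<Sum>y\<in>S. \<Sum>s'\<in>S'. A' s y * U y s' * Ad s' y')"
   by (rule sum.cong[OF refl]) (simp add: UA[OF _ y', symmetric] sum_distrib_left mult.assoc)
  also have "\<dots> = (\<Sum>s'\<in>S'. \<Sum>y\<in>S. A' s y * U y s' * Ad s' y')" by (rule sum.swap)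
  also have "\<dots> = (\<Sum>s'\<in>S'. (if s = s' then d else 0) * Ad s' y')"
   by (rule sum.cong[OF refl]) (simp only: A'U[symmetric] sum_distrib_right)
  also have "\<dots> = d * Ad s y'" using S'(1) s by (simp add: if_distrib[of "\<lambda>t. t * _"] cong: if_cong)
  finally show ?thesis using d0 by (simp add: A'_def)
 qed
 define h where "h x y = (if x \<in> S \<and> y \<in> S' then U x y else if x \<in> S' \<and> y \<in> S then Ad x y else 0)" for x y
 have nS: "x \<in> S ==> x \<notin> S'" for x using dis by blast
 have "oddop G (S \<union> S') a (\<lambda>s. s \<in> S') h d"
  unfolding oddop_def
 proof (intro conjI ballI impI)
  fix x y assume x: "x \<in> S \<union> S'" and y: "y \<in> S \<union> S'"
  show "h x y \<noteq> 0 ==> (x \<in> S') \<noteq> (y \<in> S')" using nS by (auto simp: h_def split: if_splits)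
  show "h (a g x) (a g y) = h x y" if g: "g \<in> carrier G" for g
  proof -
   have m: "a g z \<in> S \<longleftrightarrow> z \<in> S" "a g z \<in> S' \<longleftrightarrow> z \<in> S'" if "z \<in> S \<union> S'" for z
    using gsetD(1)[OF S(2) g, of z] gsetD(1)[OF S'(2) g, of z] nS[of z] nS[of "a g z"] that by blast+
   show ?thesis using U g Ainv[OF g] by (simp add: h_def m[OF x] m[OF y])
  qed
  have "(\<Sum>z\<in>S \<union> S'. h x z * h z y) = (\<Sum>z\<in>S. h x z * h z y) + (\<Sum>z\<in>S'. h x z * h z y)"
   by (rule sum.union_disjoint[OF S(1) S'(1) dis])
  moreover have "(\<Sum>z\<in>S. h x z * h z y) = (if x \<in> S' \<and> x = y then d else 0)"
  proof (cases "x \<in> S' \<and> y \<in> S'")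
   case True
   then have "(\<Sum>z\<in>S. h x z * h z y) = (\<Sum>z\<in>S. Ad x z * U z y)"
    by (intro sum.cong refl) (use nS in \<open>auto simp: h_def\<close>)
   then show ?thesis using AU True by simp
  next
   case False
   then have "(\<Sum>z\<in>S. h x z * h z y) = 0"
    by (intro sum.neutral ballI) (use nS in \<open>auto simp: h_def\<close>)
   then show ?thesis using False by auto
  qed
  moreover have "(\<Sum>z\<in>S'. h x z * h z y) = (if x \<in> S \<and> x = y then d else 0)"
  proof (cases "x \<in> S \<and> y \<in> S")
   case True
   then have "(\<Sum>z\<in>S'. h x z * h z y) = (\<Sum>z\<in>S'. U x z * Ad z y)"
    by (intro sum.cong refl) (use nS in \<open>auto simp: h_def\<close>)
   then show ?thesis using UA True by simp
  next
   case False
   then have "(\<Sum>z\<in>S'. h x z * h z y) = 0"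
    by (intro sum.neutral ballI) (use nS in \<open>auto simp: h_def\<close>)
   then show ?thesis using False by auto
  qed
  ultimately show "(\<Sum>z\<in>S \<union> S'. h x z * h z y) = (if x = y then d else 0)" using x nS[of x] by (cases "x \<in> S") simp_all
 qed
 then show ?thesis using d by blast
qed

end

section \<open>Groups with an odd operator\<close>

lemma sgn_of_odd_card:
 assumes "finite I" shows "sgn_of (odd (card {i\<in>I. P i})) = (\<Prod>i\<in>I. sgn_of (P i))"
 using assms
proof (induction I rule: finite_induct)
 case (insert i I)
 have f: "finite {j\<in>I. P j}" using insert.hyps(1) by simp
 have "{j \<in> insert i I. P j} = (if P i then insert i {j\<in>I. P j} else {j\<in>I. P j})" by auto
 then have "card {j \<in> insert i I. P j} = (if P i then Suc (card {j\<in>I. P j}) else card {j\<in>I. P j})"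
  using f insert.hyps(2) by simp
 then show ?case using insert.hyps insert.IH by (simp add: sgn_of_def split: if_splits)
qed (simp add: sgn_of_def)

lemma smark_cong:
 "(\<And>x. x \<in> X ==> s x = t x) ==> smark G X a s = smark G X a t"
 unfolding smark_def by (rule ext, rule sum.cong[OF refl]) (simp add: fixpts_def)

context group
begin

lemma sgset_parts:
 assumes "sgset G X a s" shows "finite {x\<in>X. s x = b}" "gset G {x\<in>X. s x = b} a"
proof -
 note X = sgsetD[OF assms]
 show "finite {x\<in>X. s x = b}" using X(1) by simp
 show "gset G {x\<in>X. s x = b} a" by (rule gset_subset[OF X(2)]) (use X(3) gsetD(1)[OF X(2)] in auto)
qed

lemma smark_parts:
 assumes "finite X"
 shows "smark G X a s H = int (card (fixpts G {x\<in>X. s x = False} a H)) - int (card (fixpts G {x\<in>X. s x = True} a H))"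
proof -
 have f: "fixpts G X a H = fixpts G {x\<in>X. s x = False} a H \<union> fixpts G {x\<in>X. s x = True} a H" by (auto simp: fixpts_def)
 have "smark G X a s H = (\<Sum>x\<in>fixpts G {x\<in>X. s x = False} a H. sgn_of (s x)) + (\<Sum>x\<in>fixpts G {x\<in>X. s x = True} a H. sgn_of (s x))"
  unfolding smark_def f by (rule sum.union_disjoint) (use assms in \<open>auto simp: fixpts_def\<close>)
 also have "(\<Sum>x\<in>fixpts G {x\<in>X. s x = False} a H. sgn_of (s x)) = (\<Sum>x\<in>fixpts G {x\<in>X. s x = False} a H. 1)"
  by (rule sum.cong) (auto simp: fixpts_def sgn_of_def)
 also have "(\<Sum>x\<in>fixpts G {x\<in>X. s x = True} a H. sgn_of (s x)) = (\<Sum>x\<in>fixpts G {x\<in>X. s x = True} a H. -1)"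
  by (rule sum.cong) (auto simp: fixpts_def sgn_of_def)
 finally show ?thesis by simp
qed

lemma fixpts_coset_self:
 assumes L: "subgroup L G" shows "L \<in> fixpts G (lcosets L) (\<lambda>g X. g <# X) L"
proof -
 have "L = \<one> <# L" using lcos_mult_one[OF subgroup.subset[OF L]] by simp
 then have "L \<in> lcosets L" unfolding LCOSETS_def by blast
 moreover have "h <# L = L" if h: "h \<in> L" for h
  using coset_join3[OF _ L h] subgroup.mem_carrier[OF L h] by simp
 ultimately show ?thesis by (simp add: fixpts_def)
qed

lemma fixpts_coset_top:
 assumes L: "subgroup L G" "L \<noteq> carrier G" shows "fixpts G (lcosets L) (\<lambda>g X. g <# X) (carrier G) = {}"
proof (rule ccontr)
 assume "fixpts G (lcosets L) (\<lambda>g X. g <# X) (carrier G) \<noteq> {}"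
 then obtain X where X: "X \<in> lcosets L" "\<And>g. g \<in> carrier G ==> g <# X = X" by (auto simp: fixpts_def)
 obtain x where x: "x \<in> carrier G" "X = x <# L" using X(1) by (auto simp: LCOSETS_def)
 have "g \<in> L" if g: "g \<in> carrier G" for g
 proof -
  have e: "h <# L = X" if h: "h \<in> carrier G" for h
  proof -
   have "(h \<otimes> inv x) <# X = h <# L"
    unfolding x(2) using x(1) h by (simp add: lcos_m_assoc[OF subgroup.subset[OF L(1)]] m_assoc)
   then show ?thesis using X(2)[of "h \<otimes> inv x"] x(1) h by simp
  qed
  have "g <# L = \<one> <# L" using e[OF g] e[OF one_closed] by simp
  moreover have "g \<in> g <# L" using subgroup.one_closed[OF L(1)] g unfolding l_coset_def by force
  ultimately show ?thesis using lcos_mult_one[OF subgroup.subset[OF L(1)]] by simp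
 qed
 then show False using L subgroup.subset[OF L(1)] by blast
qed

lemma Vm_coset:
 assumes finG: "finite (carrier G)" and L: "subgroup L G"
 shows "Vm G (\<lambda>H. int (card (fixpts G (lcosets L) (\<lambda>g X. g <# X) H)))"
proof -
 have "sgset G (lcosets L) (\<lambda>g X. g <# X) (\<lambda>_. False)"
  using coset_gset[OF L] lcosets_finite[OF finG] by (simp add: sgset_def)
 from Vm_intro[OF this] show ?thesis by (simp add: smark_def[abs_def] sgn_of_def)
qed

text \<open>The product of \<open>|(G/L)\<^sup>L| - G/L\<close> over all proper subgroups \<open>L\<close>.\<close>

lemma exists_Vm_proper_zero:
 assumes finG: "finite (carrier G)"
 shows "\<exists>v. Vm G v \<and> (\<forall>L. subgroup L G \<and> L \<noteq> carrier G \<longrightarrow> v L = 0) \<and> v (carrier G) \<noteq> 0"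
proof -
 define P where "P = {L. subgroup L G \<and> L \<noteq> carrier G}"
 have finP: "finite P" by (rule finite_subset[of _ "Pow (carrier G)"]) (use finG subgroup.subset in \<open>auto simp: P_def\<close>)
 define q where "q L H = int (card (fixpts G (lcosets L) (\<lambda>g X. g <# X) H))" for L H
 define v where "v H = (\<Prod>L\<in>P. q L L - q L H)" for H
 have "Vm G v" unfolding v_def
 proof (rule Vm_prod[OF finP])
  fix L assume "L \<in> P"
  then have "Vm G (q L)" unfolding q_def[abs_def] by (intro Vm_coset finG) (simp add: P_def)
  then show "Vm G (\<lambda>H. q L L - q L H)" by (rule Vm_diff[OF Vm_const])
 qed
 moreover have "v L = 0" if L: "L \<in> P" for L unfolding v_def by (rule prod_zero[OF finP bexI[OF _ L]]) simp
 \<comment> \<open>\<open>L\<close> fixes its own coset, whereas the whole group fixes no coset of a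
   proper subgroup; so no factor vanishes at \<open>carrier G\<close>.\<close>
 moreover have "q L L - q L (carrier G) \<noteq> 0" if "L \<in> P" for L
 proof -
  have "q L (carrier G) = 0" using fixpts_coset_top that by (simp add: q_def P_def)
  moreover have "finite (fixpts G (lcosets L) (\<lambda>g X. g <# X) L)" by (rule finite_fixpts[OF lcosets_finite[OF finG]])
  then have "q L L \<noteq> 0" using fixpts_coset_self[of L] that by (auto simp: q_def P_def)
  ultimately show ?thesis by simp
 qed
 then have "v (carrier G) \<noteq> 0" using finP by (simp add: v_def)
 ultimately show ?thesis unfolding P_def by blast
qed

lemma fixpts_generate:
 assumes X: "gset G X a" and g: "g \<in> carrier G"
 shows "fixpts G X a (generate G {g}) = {x \<in> X. a g x = x}"
proof (intro equalityI subsetI)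
 fix x assume "x \<in> fixpts G X a (generate G {g})"
 then show "x \<in> {x \<in> X. a g x = x}" using g generate.incl[of g "{g}" G] by (auto simp: fixpts_def)
next
 fix x assume x: "x \<in> {x \<in> X. a g x = x}"
 then have "generate G {g} \<subseteq> gstab G a x"
  by (intro generate_subgroup_incl gstab_subgroup[OF X]) (use g in \<open>auto simp: gstab_def\<close>)
 then show "x \<in> fixpts G X a (generate G {g})" using x by (auto simp: fixpts_def gstab_def)
qed

lemma noncyclic_generate:
 assumes "\<not> cyclic_group G" "g \<in> carrier G" shows "generate G {g} \<noteq> carrier G"
proof
 assume "generate G {g} = carrier G"
 then have "subgroup_generated G {g} = G" using assms(2) by (simp add: subgroup_generated_def)
 then show False using assms unfolding cyclic_group_def by blast
qed

text \<open>The trivial subgroup is proper because \<open>G\<close> is not cyclic. The vanishing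
  mark there says that the two halves have equally many points, so both actions can be placed on
  \<open>{..<n}\<close>.\<close>

lemma proper_pair:
 assumes finG: "finite (carrier G)" and nc: "\<not> cyclic_group G"
 shows "\<exists>n a0 a1. gset G {..<n::nat} a0 \<and> gset G {..<n} a1 \<and>
  (\<forall>L. subgroup L G \<and> L \<noteq> carrier G \<longrightarrow> card (fixpts G {..<n} a0 L) = card (fixpts G {..<n} a1 L)) \<and>
  card (fixpts G {..<n} a0 (carrier G)) \<noteq> card (fixpts G {..<n} a1 (carrier G))"
proof -
 obtain v where v: "Vm G v" "\<And>L. subgroup L G ==> L \<noteq> carrier G ==> v L = 0" "v (carrier G) \<noteq> 0"
  using exists_Vm_proper_zero[OF finG] by (elim exE conjE) (rule that, auto)
 obtain X :: "nat set" and a s where X: "sgset G X a s" and vX: "v = smark G X a s" using v(1) unfolding Vm_def by blast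
 note X' = sgsetD[OF X]
 let ?E = "\<lambda>b. {x\<in>X. s x = b}"
 note gE = sgset_parts(2)[OF X]
 have vE: "v H = int (card (fixpts G (?E False) a H)) - int (card (fixpts G (?E True) a H))" for H
  unfolding vX by (rule smark_parts[OF X'(1)])
 have t: "subgroup {\<one>} G" by (rule triv_subgroup)
 have tn: "{\<one>} \<noteq> carrier G"
 proof
  assume "{\<one>} = carrier G"
  then have "trivial_group G" using is_group by (simp add: trivial_group_def)
  then show False using nc trivial_imp_cyclic_group by blast
 qed
 have fE: "fixpts G (?E b) a {\<one>} = ?E b" for b using gsetD(2)[OF X'(2)] by (auto simp: fixpts_def)
 then have c: "card (?E False) = card (?E True)" using v(2)[OF t tn, unfolded vE fE] by simp
 define n where "n = card (?E False)"
 have n: "card (?E b) = n" for b unfolding n_def using c by (cases b) simp_all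
 have "\<exists>f. bij_betw f (?E b) {..<n}" for b
  using ex_bij_betw_finite_nat[of "?E b"] X'(1) n[of b] by (simp add: lessThan_atLeast0)
 then obtain f where f: "\<And>b. bij_betw (f b) (?E b) {..<n}" by metis
 define c where "c b = (\<lambda>g y. f b (a g (inv_into (?E b) (f b) y)))" for b
 have gc: "gset G {..<n} (c b)" and ic: "giso G (?E b) a {..<n} (c b) (f b)" for b
  using gset_transport[OF gE f, of b] unfolding c_def by auto
 have cf: "card (fixpts G {..<n} (c b) H) = card (fixpts G (?E b) a H)" for b H
  using bij_betw_same_card[OF giso_fixpts[OF gE ic]] by metis
 show ?thesis
 proof (rule exI[of _ n], rule exI[of _ "c False"], rule exI[of _ "c True"], intro conjI allI impI gc)
  fix L assume "subgroup L G \<and> L \<noteq> carrier G"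
  then show "card (fixpts G {..<n} (c False) L) = card (fixpts G {..<n} (c True) L)" using v(2)[of L] unfolding cf vE by simp
 next
  show "card (fixpts G {..<n} (c False) (carrier G)) \<noteq> card (fixpts G {..<n} (c True) (carrier G))"
   using v(3) unfolding cf vE by simp
 qed
qed

text \<open>\<open>V\<close> is the tensor power with the operator of square \<open>c - tau\<close>,
  and \<open>Z\<close> is the virtual set itself. The even part \<open>S0\<close> and the odd part
  \<open>S1\<close> of \<open>V \<times> Z\<close> both mix the two parities of \<open>V\<close>,
  and \<open>card_Hs_cross\<close> is exactly the statement that they admit equally many maps into
  each representation. The mark at the whole group is the one of \<open>Z\<close> raised to the
  exponent \<open>N + 1\<close>, hence not zero.\<close>

lemma Rel_noncyclic:
 assumes finG: "finite (carrier G)" and nc: "\<not> cyclic_group G" and p: "Factorial_Ring.prime (p::nat)"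
  and nonorm: "\<And>D k. D \<lhd> G ==> card D = p ^ k ==> k = 0"
 shows "\<exists>d m. Rel G d m \<and> m (carrier G) \<noteq> 0 \<and> \<not> int p dvd d"
proof -
 obtain n a0 a1 where a0: "gset G {..<n::nat} a0" and a1: "gset G {..<n} a1"
  and eqm: "\<And>L. subgroup L G ==> L \<noteq> carrier G ==> card (fixpts G {..<n} a0 L) = card (fixpts G {..<n} a1 L)"
  and neqm: "card (fixpts G {..<n} a0 (carrier G)) \<noteq> card (fixpts G {..<n} a1 (carrier G))"
  using proper_pair[OF finG nc] by (elim exE conjE) (rule that, auto)
 have iso: "\<exists>f. bij_betw f {..<n} {..<n} \<and> (\<forall>g\<in>L. \<forall>x\<in>{..<n}. f (a0 g x) = a1 g (f x))"
  if L: "subgroup L G" "L \<noteq> carrier G" for L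
 proof -
  interpret L: group "G\<lparr>carrier := L\<rparr>" by (rule subgroup_imp_group[OF L(1)])
  have "\<exists>f. giso (G\<lparr>carrier := L\<rparr>) {..<n} a0 {..<n} a1 f"
  proof (rule L.burnside_iso)
   show "finite (carrier (G\<lparr>carrier := L\<rparr>))" using finite_subset[OF subgroup.subset[OF L(1)] finG] by simp
   show "gset (G\<lparr>carrier := L\<rparr>) {..<n} a0" "gset (G\<lparr>carrier := L\<rparr>) {..<n} a1" using gset_restrict a0 a1 L(1) by blast+
   fix H assume H: "subgroup H (G\<lparr>carrier := L\<rparr>)"
   have HL: "H \<subseteq> L" using subgroup.subset[OF H] by simp
   have "H \<noteq> carrier G" using HL L subgroup.subset[OF L(1)] by blast
   from eqm[OF incl_subgroup[OF L(1) H] this]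
   show "card (fixpts (G\<lparr>carrier := L\<rparr>) {..<n} a0 H) = card (fixpts (G\<lparr>carrier := L\<rparr>) {..<n} a1 H)"
    using HL subgroup.subset[OF L(1)] by (simp add: fixpts_def Int_absorb2)
  qed auto
  then show ?thesis by (simp add: giso_def)
 qed
 define Z where "Z = {..<n} \<times> (UNIV :: bool set)"
 define az where "az g z = (if snd z then a1 g (fst z) else a0 g (fst z), snd z)" for g and z :: "nat \<times> bool"
 have gZ: "gset G Z az" using a0 a1 unfolding gset_def Z_def az_def by auto
 have "\<exists>(N::nat) f theta c.
  (\<forall>x\<in>{..<N} \<rightarrow>\<^sub>E Z. \<forall>y\<in>{..<N} \<rightarrow>\<^sub>E Z. f x y \<noteq> 0 \<longrightarrow>
    odd (card {i. i < N \<and> snd (x i)}) \<noteq> odd (card {i. i < N \<and> snd (y i)})) \<and>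
  (\<forall>g\<in>carrier G. \<forall>x\<in>{..<N} \<rightarrow>\<^sub>E Z. \<forall>y\<in>{..<N} \<rightarrow>\<^sub>E Z.
    f (\<lambda>i. if i < N then az g (x i) else x i) (\<lambda>i. if i < N then az g (y i) else y i) = f x y) \<and>
  coprime c (int p) \<and>
  (\<forall>x\<in>{..<N} \<rightarrow>\<^sub>E Z. \<forall>y\<in>{..<N} \<rightarrow>\<^sub>E Z. (\<Sum>z\<in>{..<N} \<rightarrow>\<^sub>E Z. f x z * f z y) = (if x = y then c else 0) -
    (\<Sum>g\<in>carrier G. theta (\<lambda>i. if i < N then az (inv g) (x i) else x i) (\<lambda>i. if i < N then az (inv g) (y i) else y i)))"
  (is "\<exists>N f theta c. ?odd N f \<and> ?inv N f \<and> _ c \<and> ?sq N f theta c")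
  unfolding az_def Z_def by (rule green_operator[OF finG p _ a0 a1, unfolded Let_def]) (erule (1) nonorm, erule (1) iso)
 then obtain N :: nat and f theta c where odd: "?odd N f" and inv: "?inv N f" and c: "coprime c (int p)" and sq: "?sq N f theta c"
  by (elim exE conjE)
 define V where "V = {..<N} \<rightarrow>\<^sub>E Z"
 define aV where "aV g x = (\<lambda>i. if i < N then az g (x i) else x i)" for g and x :: "nat => nat \<times> bool"
 define par where "par x \<longleftrightarrow> odd (card {i. i < N \<and> snd (x i)})" for x :: "nat => nat \<times> bool"
 note odd = odd[folded V_def, folded par_def]
 note inv = inv[folded V_def, folded aV_def]
 note sq = sq[folded V_def, folded aV_def]
 have finZ: "finite Z" by (simp add: Z_def)
 have finV: "finite V" unfolding V_def by (rule finite_PiE) (use finZ in auto)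
 have gV: "gset G V aV"
  unfolding gset_def
 proof (intro conjI ballI)
  fix x assume x: "x \<in> V"
  then have xZ: "x i \<in> Z" if "i < N" for i using that by (auto simp: V_def)
  have xo: "x i = undefined" if "\<not> i < N" for i using x that by (auto simp: V_def PiE_def extensional_def)
  show "aV g x \<in> V" if "g \<in> carrier G" for g
   unfolding V_def using gsetD(1)[OF gZ that xZ] xo by (intro PiE_I) (auto simp: aV_def)
  show "aV \<one> x = x" using gsetD(2)[OF gZ xZ] by (auto simp: aV_def)
  show "aV (g \<otimes> h) x = aV g (aV h x)" if "g \<in> carrier G" "h \<in> carrier G" for g h
   using gsetD(3)[OF gZ that xZ] by (auto simp: aV_def)
 qed
 have par: "par (aV g v) = par v" for g v by (simp add: par_def aV_def az_def cong: conj_cong)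
 define Zb where "Zb b = {..<n} \<times> {b}" for b :: bool
 have Zb: "finite (Zb b)" "gset G (Zb b) az" for b
  using a0 a1 unfolding Zb_def gset_def az_def by (auto split: if_splits)
 \<comment> \<open>An element generates a proper subgroup, where the marks of the two halves agree;
   this number is its number of fixed points.\<close>
 have fx: "card {x \<in> Zb False. az g x = x} = card {x \<in> Zb True. az g x = x}" if g: "g \<in> carrier G" for g
 proof -
  have 0: "{x \<in> Zb False. az g x = x} = (\<lambda>x. (x, False)) ` {x \<in> {..<n}. a0 g x = x}" by (auto simp: Zb_def az_def)
  have 1: "{x \<in> Zb True. az g x = x} = (\<lambda>x. (x, True)) ` {x \<in> {..<n}. a1 g x = x}" by (auto simp: Zb_def az_def)
  have "card {x \<in> {..<n}. a0 g x = x} = card {x \<in> {..<n}. a1 g x = x}"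
   using eqm[OF generate_is_subgroup[of "{g}"] noncyclic_generate[OF nc g]] g
   unfolding fixpts_generate[OF a0 g] fixpts_generate[OF a1 g] by simp
  then show ?thesis unfolding 0 1 by (simp add: card_image inj_on_def)
 qed
 define act where "act = (\<lambda>g (v, z). (aV g v, az g z))"
 define A where "A = {v \<in> V. \<not> par v}"
 define B where "B = {v \<in> V. par v}"
 have AB: "finite A" "finite B" using finV by (auto simp: A_def B_def)
 have gA: "gset G A aV" by (rule gset_subset[OF gV]) (use gsetD(1)[OF gV] par in \<open>auto simp: A_def\<close>)
 have gB: "gset G B aV" by (rule gset_subset[OF gV]) (use gsetD(1)[OF gV] par in \<open>auto simp: B_def\<close>)
 define S0 where "S0 = A \<times> Zb False \<union> B \<times> Zb True"
 define S1 where "S1 = A \<times> Zb True \<union> B \<times> Zb False"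
 have g2: "gset G (A \<times> Zb b) act" "gset G (B \<times> Zb b) act" for b
  unfolding act_def by (rule gset_prod[OF gA Zb(2)], rule gset_prod[OF gB Zb(2)])
 have gU: "gset G (S \<union> S') act" if "gset G S act" "gset G S' act" for S S'
  using that unfolding gset_def by blast
 have gS: "gset G S0 act" "gset G S1 act" unfolding S0_def S1_def by (intro gU g2)+
 have finS: "finite S0" "finite S1" using AB Zb by (auto simp: S0_def S1_def)
 have dAB: "A \<times> Zb b \<inter> B \<times> Zb b' = {}" for b b' by (auto simp: A_def B_def)
 have cS: "card S0 = card S1"
  unfolding S0_def S1_def using AB Zb dAB by (simp add: card_Un_disjoint card_cartesian_product Zb_def)
 have count: "card (Mp S0 act S0 act W) = card (Mp S1 act S0 act W)" if W: "stsub p S0 act W" for W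
 proof -
  have WW: "lins p S0 W" using W by (simp only: stsub_def)
  have "\<forall>u\<in>W. \<forall>g\<in>carrier G. gmv S0 act g u \<in> W" using W unfolding stsub_def by (rule conjunct2)
  then have Ws: "(\<lambda>y. if y \<in> S0 then u (act (inv g) y) else 0) \<in> W" if "u \<in> W" "g \<in> carrier G" for u g
   unfolding gmv_def using that by simp
  interpret fp_rep G p S0 act W
   by (rule fp_rep.intro[OF is_group fp_rep_axioms.intro[OF finG p finS(1) gS(1) WW]]) (rule Ws)
  have M: "card (Mp (A \<times> Zb b \<union> B \<times> Zb b') act S0 act W) = card (Hs A aV (Zb b) az) * card (Hs B aV (Zb b') az)" for b b'
   unfolding Mp_union[OF dAB g2(1) g2(2)]
   using card_Mp_Hs[OF gA Zb(2)[of b]] card_Mp_Hs[OF gB Zb(2)[of b']] by (simp add: act_def)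
  have "card (Hs {v\<in>V. \<not> par v} aV (Zb False) az) * card (Hs {v\<in>V. par v} aV (Zb True) az) =
   card (Hs {v\<in>V. \<not> par v} aV (Zb True) az) * card (Hs {v\<in>V. par v} aV (Zb False) az)"
  proof (rule card_Hs_cross[where f = f and c = c and \<theta> = theta])
   show "par (aV g v) = par v" for g v by (rule par)
   show "card {x \<in> Zb False. az g x = x} = card {x \<in> Zb True. az g x = x}" if "g \<in> carrier G" for g by (rule fx[OF that])
   show "f x y = 0" if "x \<in> V" "y \<in> V" "par x = par y" for x y using odd that by blast
   show "f (aV g x) (aV g y) = f x y" if "g \<in> carrier G" "x \<in> V" "y \<in> V" for g x y using inv that by blast
   show "(\<Sum>z\<in>V. f x z * f z y) = (if x = y then c else 0) - (\<Sum>g\<in>carrier G. theta (aV (inv g) x) (aV (inv g) y))"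
    if "x \<in> V" "y \<in> V" for x y using sq that by blast
  qed (rule finV gV c Zb)+
  then show ?thesis unfolding S0_def S1_def M[unfolded S0_def] A_def[symmetric] B_def[symmetric] .
 qed
 have dis: "S0 \<inter> S1 = {}" by (auto simp: S0_def S1_def A_def B_def Zb_def)
 obtain d h where d: "\<not> int p dvd d" and h: "oddop G (S0 \<union> S1) act (\<lambda>s. s \<in> S1) h d"
  using odd_operator_of_counts[OF p finS(1) gS(1) finS(2) gS(2) dis cS count] by blast
 have SV: "S0 \<union> S1 = V \<times> Z" by (auto simp: S0_def S1_def A_def B_def Zb_def Z_def)
 have sS: "sgset G (S0 \<union> S1) act (\<lambda>s. s \<in> S1)"
  unfolding sgset_def
 proof (intro conjI ballI gU gS)
  show "finite (S0 \<union> S1)" using finS by simp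
  fix g x assume g: "g \<in> carrier G" and x: "x \<in> S0 \<union> S1"
  show "(act g x \<in> S1) = (x \<in> S1)"
   using gsetD(1)[OF gS(1) g, of x] gsetD(1)[OF gS(2) g, of x] x dis by blast
 qed
 have sV: "sgset G V aV par" unfolding sgset_def using finV gV par by simp
 have sZ: "sgset G Z az snd" unfolding sgset_def using finZ gZ by (simp add: az_def)
 have "smark G (S0 \<union> S1) act (\<lambda>s. s \<in> S1) = smark G (V \<times> Z) act (\<lambda>(x, y). par x \<noteq> snd y)"
  unfolding SV by (rule smark_cong) (auto simp: S1_def A_def B_def Zb_def Z_def)
 then have sm: "smark G (S0 \<union> S1) act (\<lambda>s. s \<in> S1) (carrier G) = smark G V aV par (carrier G) * smark G Z az snd (carrier G)"
  unfolding act_def sgset_prod(2)[OF sV sZ] by simp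
 have mZ: "smark G Z az snd (carrier G) \<noteq> 0"
 proof -
  have f: "fixpts G Z az (carrier G) = (\<lambda>x. (x, False)) ` fixpts G {..<n} a0 (carrier G) \<union> (\<lambda>x. (x, True)) ` fixpts G {..<n} a1 (carrier G)" (is "_ = ?R")
  proof (rule Set.set_eqI)
   fix q :: "nat \<times> bool"
   show "q \<in> fixpts G Z az (carrier G) \<longleftrightarrow> q \<in> ?R"
    by (cases q; cases "snd q") (auto simp: fixpts_def Z_def az_def)
  qed
  have "smark G Z az snd (carrier G) = (\<Sum>x\<in>(\<lambda>x. (x, False)) ` fixpts G {..<n} a0 (carrier G). sgn_of (snd x)) +
    (\<Sum>x\<in>(\<lambda>x. (x, True)) ` fixpts G {..<n} a1 (carrier G). sgn_of (snd x))"
   unfolding smark_def f by (rule sum.union_disjoint) (auto simp: finite_fixpts)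
  also have "\<dots> = int (card (fixpts G {..<n} a0 (carrier G))) - int (card (fixpts G {..<n} a1 (carrier G)))"
   by (simp add: sum.reindex inj_on_def sgn_of_def)
  finally show ?thesis using neqm by simp
 qed
 \<comment> \<open>The sign of a tuple is the product of the signs of its entries, and a tuple is
   fixed if and only if its entries are; so the signed count is multiplicative.\<close>
 have "smark G V aV par (carrier G) = smark G Z az snd (carrier G) ^ N"
 proof -
  let ?F = "fixpts G Z az (carrier G)"
  have F: "fixpts G V aV (carrier G) = {..<N} \<rightarrow>\<^sub>E ?F"
  proof (intro equalityI subsetI)
   fix x assume "x \<in> fixpts G V aV (carrier G)"
   then have x: "x \<in> V" "\<And>g. g \<in> carrier G ==> aV g x = x" by (auto simp: fixpts_def)
   have "az g (x i) = x i" if "i < N" "g \<in> carrier G" for i g using fun_cong[OF x(2)[OF that(2)], of i] that by (simp add: aV_def)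
   then show "x \<in> {..<N} \<rightarrow>\<^sub>E ?F" using x(1) by (auto simp: V_def fixpts_def PiE_def)
  next
   fix x assume x: "x \<in> {..<N} \<rightarrow>\<^sub>E ?F"
   then have "az g (x i) = x i" if "i < N" "g \<in> carrier G" for i g
    using PiE_mem[OF x, of i] that by (auto simp: fixpts_def)
   moreover have "x \<in> V" using x unfolding V_def by (rule subsetD[OF PiE_mono, rotated]) (auto simp: fixpts_def)
   ultimately show "x \<in> fixpts G V aV (carrier G)" by (auto simp: fixpts_def aV_def fun_eq_iff)
  qed
  have "smark G V aV par (carrier G) = (\<Sum>x\<in>{..<N} \<rightarrow>\<^sub>E ?F. \<Prod>i\<in>{..<N}. sgn_of (snd (x i)))"
   unfolding smark_def F using sgn_of_odd_card[of "{..<N}"] by (simp add: par_def)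
  also have "\<dots> = (\<Prod>i\<in>{..<N}. \<Sum>z\<in>?F. sgn_of (snd z))"
   by (rule prod_sum_PiE[symmetric]) (auto intro: finite_fixpts finZ)
  finally show ?thesis by (simp add: smark_def)
 qed
 then have "smark G (S0 \<union> S1) act (\<lambda>s. s \<in> S1) (carrier G) \<noteq> 0" using sm mZ by simp
 then show ?thesis by (intro exI[of _ d] exI[of _ "smark G (S0 \<union> S1) act (\<lambda>s. s \<in> S1)"] conjI Rel_intro[OF sS h] d)
qed


end

section \<open>Relations passed on from subgroups and from quotients\<close>

context group
begin

text \<open>With coset representatives \<open>r\<close>, the induced set is \<open>G/K \<times> X\<close> with the action twisted by the
 cocycle \<open>r(gC)\<^sup>-\<^sup>1 g r(C) \<in> K\<close>.\<close>

lemma Rel_induce: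
 assumes finG: "finite (carrier G)" and K: "subgroup K G" and R: "Rel (G\<lparr>carrier := K\<rparr>) d m"
 shows "\<exists>m' c. Rel G d m' \<and> m' K = c * m K \<and> c \<noteq> 0"
proof -
 obtain X :: "nat set" and a s f where X: "sgset (G\<lparr>carrier := K\<rparr>) X a s" and f: "oddop (G\<lparr>carrier := K\<rparr>) X a s f d"
  and m: "m = smark (G\<lparr>carrier := K\<rparr>) X a s" using R unfolding Rel_def by blast
 note X' = sgsetD[OF X] and f' = oddopD[OF f]
 have gX: "gset (G\<lparr>carrier := K\<rparr>) X a" by (rule X'(2))
 have KG: "K \<subseteq> carrier G" by (rule subgroup.subset[OF K])
 let ?L = "lcosets K"
 note gL = coset_gset[OF K] and finL = lcosets_finite[OF finG, of K]
 define r where "r C = (SOME g. g \<in> carrier G \<and> C = g <# K)" for C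
 have r: "r C \<in> carrier G" "C = r C <# K" if "C \<in> ?L" for C
 proof -
  have "\<exists>g. g \<in> carrier G \<and> C = g <# K" using that by (auto simp: LCOSETS_def)
  then have "r C \<in> carrier G \<and> C = r C <# K" unfolding r_def by (rule someI_ex)
  then show "r C \<in> carrier G" "C = r C <# K" by blast+
 qed
 define ka where "ka g C = inv (r (g <# C)) \<otimes> (g \<otimes> r C)" for g C
 have gC: "g <# C \<in> ?L" if "g \<in> carrier G" "C \<in> ?L" for g C by (rule gsetD(1)[OF gL that])
 have kaK: "ka g C \<in> K" if g: "g \<in> carrier G" and C: "C \<in> ?L" for g C
 proof -
  have "g <# C = (g \<otimes> r C) <# K" using r[OF C] lcos_m_assoc[OF KG g r(1)[OF C]] by simp
  moreover have "g \<otimes> r C \<in> (g \<otimes> r C) <# K" using subgroup.one_closed[OF K] g r(1)[OF C] unfolding l_coset_def by force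
  ultimately have "g \<otimes> r C \<in> r (g <# C) <# K" using r(2)[OF gC[OF g C]] by simp
  then obtain k where k: "k \<in> K" "g \<otimes> r C = r (g <# C) \<otimes> k" unfolding l_coset_def by blast
  have "ka g C = k" unfolding ka_def k(2) using r(1)[OF gC[OF g C]] k(1) KG by (simp add: m_assoc[symmetric] subset_eq)
  then show ?thesis using k by simp
 qed
 have kam: "ka (g \<otimes> h) C = ka g (h <# C) \<otimes> ka h C" if g: "g \<in> carrier G" and h: "h \<in> carrier G" and C: "C \<in> ?L" for g h C
 proof -
  note rr = r(1)[OF C] r(1)[OF gC[OF h C]] r(1)[OF gC[OF g gC[OF h C]]]
  have e: "(g \<otimes> h) <# C = g <# (h <# C)" by (rule gsetD(3)[OF gL g h C])
  have "r (h <# C) \<otimes> (inv (r (h <# C)) \<otimes> (h \<otimes> r C)) = h \<otimes> r C"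
   using rr g h by (simp add: m_assoc[symmetric])
  then show ?thesis unfolding ka_def e using rr g h by (simp add: m_assoc)
 qed
 have ka1: "ka \<one> C = \<one>" if C: "C \<in> ?L" for C
  unfolding ka_def using gsetD(2)[OF gL C] r(1)[OF C] by simp
 define b where "b g q = (g <# fst q, a (ka g (fst q)) (snd q))" for g and q :: "'a set \<times> nat"
 define Q where "Q = ?L \<times> X"
 define t where "t q = s (snd q)" for q :: "'a set \<times> nat"
 define F where "F q q' = (if fst q = fst q' then f (snd q) (snd q') else 0)" for q q' :: "'a set \<times> nat"
 have aX: "a k x \<in> X" if "k \<in> K" "x \<in> X" for k x using gsetD(1)[OF gX, of k x] that by simp
 have a1: "a \<one> x = x" if "x \<in> X" for x using gsetD(2)[OF gX that] by simp
 have am: "a (k \<otimes> l) x = a k (a l x)" if "k \<in> K" "l \<in> K" "x \<in> X" for k l x using gsetD(3)[OF gX, of k l x] that by simp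
 have sa: "s (a k x) = s x" if "k \<in> K" "x \<in> X" for k x using X'(3)[of k x] that by simp
 have fa: "f (a k x) (a k y) = f x y" if "k \<in> K" "x \<in> X" "y \<in> X" for k x y using f'(2)[of k x y] that by simp
 have Q: "sgset G Q b t"
  unfolding sgset_def gset_def
 proof (intro conjI ballI)
  show "finite Q" using finL X'(1) by (simp add: Q_def)
  fix q assume "q \<in> Q"
  then have q: "fst q \<in> ?L" "snd q \<in> X" by (auto simp: Q_def)
  show "b g q \<in> Q" if g: "g \<in> carrier G" for g using gC[OF g q(1)] aX[OF kaK[OF g q(1)] q(2)] by (simp add: Q_def b_def)
  show "b \<one> q = q" using gsetD(2)[OF gL q(1)] ka1[OF q(1)] a1[OF q(2)] by (simp add: b_def)
  show "b (g \<otimes> h) q = b g (b h q)" if g: "g \<in> carrier G" and h: "h \<in> carrier G" for g h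
   using gsetD(3)[OF gL g h q(1)] kam[OF g h q(1)] am[OF kaK[OF g gC[OF h q(1)]] kaK[OF h q(1)] q(2)] by (simp add: b_def)
  show "t (b g q) = t q" if g: "g \<in> carrier G" for g using sa[OF kaK[OF g q(1)] q(2)] by (simp add: b_def t_def)
 qed
 have F: "oddop G Q b t F d"
  unfolding oddop_def
 proof (intro conjI ballI impI)
  fix q q' assume "q \<in> Q" "q' \<in> Q"
  then have q: "fst q \<in> ?L" "snd q \<in> X" and q': "fst q' \<in> ?L" "snd q' \<in> X" by (auto simp: Q_def)
  show "F q q' \<noteq> 0 ==> t q \<noteq> t q'" using f'(1)[OF q(2) q'(2)] by (auto simp: F_def t_def)
  show "F (b g q) (b g q') = F q q'" if g: "g \<in> carrier G" for g
   using gset_inj[OF gL g q(1) q'(1)] fa[OF kaK[OF g q(1)] q(2) q'(2)]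
   by (cases "fst q = fst q'") (simp_all add: F_def b_def)
  have "(\<Sum>z\<in>Q. F q z * F z q') = (\<Sum>C\<in>?L. \<Sum>x\<in>X. if C = fst q then (if fst q = fst q' then f (snd q) x * f x (snd q') else 0) else 0)"
   unfolding Q_def sum.cartesian_product' by (intro sum.cong refl) (auto simp: F_def)
  also have "\<dots> = (\<Sum>C\<in>?L. if C = fst q then (\<Sum>x\<in>X. if fst q = fst q' then f (snd q) x * f x (snd q') else 0) else 0)"
   by (intro sum.cong refl) auto
  also have "\<dots> = (\<Sum>x\<in>X. if fst q = fst q' then f (snd q) x * f x (snd q') else 0)"
   using finL q(1) by simp
  also have "\<dots> = (if q = q' then d else 0)" using f'(3)[OF q(2) q'(2)] by (cases "fst q = fst q'") (simp_all add: prod_eq_iff)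
  finally show "(\<Sum>z\<in>Q. F q z * F z q') = (if q = q' then d else 0)" .
 qed
 \<comment> \<open>If \<open>K\<close> fixes a coset, the cocycle restricted to \<open>K\<close> is
   conjugation by the coset representative. It maps \<open>K\<close> injectively into the finite set
   \<open>K\<close>, hence onto it, so twisted and original action of \<open>K\<close> have the same
   fixed points in \<open>X\<close>.\<close>
 have fx: "fixpts G Q b K = fixpts G ?L (\<lambda>g X. g <# X) K \<times> fixpts (G\<lparr>carrier := K\<rparr>) X a K"
 proof (intro equalityI subsetI)
  fix q assume "q \<in> fixpts G Q b K"
  then have q: "fst q \<in> ?L" "snd q \<in> X" and fq: "\<And>k. k \<in> K ==> k <# fst q = fst q \<and> a (ka k (fst q)) (snd q) = snd q"
   using KG by (auto simp: fixpts_def Q_def b_def)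
  note rC = r(1)[OF q(1)]
  have kae: "ka k (fst q) = inv (r (fst q)) \<otimes> (k \<otimes> r (fst q))" if "k \<in> K" for k using fq[OF that] by (simp add: ka_def)
  have "inj_on (\<lambda>k. ka k (fst q)) K"
  proof (rule inj_onI)
   fix k l assume kl: "k \<in> K" "l \<in> K" "ka k (fst q) = ka l (fst q)"
   then have "k \<in> carrier G" "l \<in> carrier G" using KG by auto
   then show "k = l" using kl(3) rC unfolding kae[OF kl(1)] kae[OF kl(2)] by simp
  qed
  moreover have "(\<lambda>k. ka k (fst q)) ` K \<subseteq> K" using kaK[OF _ q(1)] KG by blast
  ultimately have im: "(\<lambda>k. ka k (fst q)) ` K = K" by (intro endo_inj_surj finite_subset[OF KG finG])
  have "a k (snd q) = snd q" if k: "k \<in> K" for k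
  proof -
   obtain l where "l \<in> K" "k = ka l (fst q)" using k im by (metis (no_types) imageE)
   then show ?thesis using fq by simp
  qed
  then show "q \<in> fixpts G ?L (\<lambda>g X. g <# X) K \<times> fixpts (G\<lparr>carrier := K\<rparr>) X a K"
   using q fq by (cases q) (auto simp: fixpts_def)
 next
  fix q assume "q \<in> fixpts G ?L (\<lambda>g X. g <# X) K \<times> fixpts (G\<lparr>carrier := K\<rparr>) X a K"
  then have q: "fst q \<in> ?L" "snd q \<in> X" and fq: "\<And>k. k \<in> K ==> k <# fst q = fst q" "\<And>k. k \<in> K ==> a k (snd q) = snd q"
   using KG by (auto simp: fixpts_def)
  then show "q \<in> fixpts G Q b K" using kaK[OF _ q(1)] by (cases q) (auto simp: fixpts_def Q_def b_def)
 qed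
 have "smark G Q b t K = int (card (fixpts G ?L (\<lambda>g X. g <# X) K)) * m K"
  unfolding smark_def m fx sum.cartesian_product' by (simp add: t_def)
 moreover have "finite (fixpts G ?L (\<lambda>g X. g <# X) K)" by (rule finite_fixpts[OF finL])
 then have "card (fixpts G ?L (\<lambda>g X. g <# X) K) = 0 \<longleftrightarrow> fixpts G ?L (\<lambda>g X. g <# X) K = {}" by (rule card_0_eq)
 then have "card (fixpts G ?L (\<lambda>g X. g <# X) K) \<noteq> 0" using fixpts_coset_self[OF K] by (metis empty_iff)
 ultimately show ?thesis
  by (intro exI[of _ "smark G Q b t"] exI[of _ "int (card (fixpts G ?L (\<lambda>g X. g <# X) K))"] conjI Rel_intro[OF Q F]) simp_all
qed

lemma Rel_inflate:
 assumes N: "N \<lhd> G" and R: "Rel (G Mod N) d m"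
 shows "\<exists>m'. Rel G d m' \<and> m' (carrier G) = m (carrier (G Mod N))"
proof -
 interpret normal N G by (rule N)
 obtain X :: "nat set" and a s f where X: "sgset (G Mod N) X a s" and f: "oddop (G Mod N) X a s f d"
  and m: "m = smark (G Mod N) X a s" using R unfolding Rel_def by blast
 note X' = sgsetD[OF X] and f' = oddopD[OF f]
 define b where "b g = a (N #> g)" for g
 have c: "N #> g \<in> carrier (G Mod N)" if "g \<in> carrier G" for g using that by (auto simp: FactGroup_def RCOSETS_def)
 have c1: "N #> \<one> = \<one>\<^bsub>G Mod N\<^esub>" using coset_mult_one[OF subset] by (simp add: FactGroup_def)
 have cm: "N #> (g \<otimes> h) = (N #> g) \<otimes>\<^bsub>G Mod N\<^esub> (N #> h)" if "g \<in> carrier G" "h \<in> carrier G" for g h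
  using rcos_sum[OF that] by (simp add: FactGroup_def)
 have Q: "sgset G X b s"
  unfolding sgset_def gset_def
 proof (intro conjI ballI)
  fix x assume x: "x \<in> X"
  show "b g x \<in> X" if g: "g \<in> carrier G" for g using gsetD(1)[OF X'(2) c[OF g] x] by (simp add: b_def)
  show "b \<one> x = x" using gsetD(2)[OF X'(2) x] by (simp add: b_def c1)
  show "b (g \<otimes> h) x = b g (b h x)" if g: "g \<in> carrier G" and h: "h \<in> carrier G" for g h
   using gsetD(3)[OF X'(2) c[OF g] c[OF h] x] by (simp add: b_def cm[OF g h])
  show "s (b g x) = s x" if g: "g \<in> carrier G" for g using X'(3)[OF c[OF g] x] by (simp add: b_def)
 qed (rule X'(1))
 have F: "oddop G X b s f d"
  unfolding oddop_def
 proof (intro conjI ballI impI)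
  fix x y assume x: "x \<in> X" and y: "y \<in> X"
  show "f x y \<noteq> 0 ==> s x \<noteq> s y" using f'(1)[OF x y] by auto
  show "f (b g x) (b g y) = f x y" if g: "g \<in> carrier G" for g using f'(2)[OF c[OF g] x y] by (simp add: b_def)
  show "(\<Sum>z\<in>X. f x z * f z y) = (if x = y then d else 0)" by (rule f'(3)[OF x y])
 qed
 have "fixpts G X b (carrier G) = fixpts (G Mod N) X a (carrier (G Mod N))"
 proof -
  have "carrier (G Mod N) = (\<lambda>g. N #> g) ` carrier G" by (auto simp: FactGroup_def RCOSETS_def)
  then show ?thesis by (simp add: fixpts_def b_def)
 qed
 then have "smark G X b s (carrier G) = m (carrier (G Mod N))" by (simp add: m smark_def)
 then show ?thesis by (intro exI[of _ "smark G X b s"] conjI Rel_intro[OF Q F])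
qed

section \<open>The largest normal \<open>p\<close>-subgroup and its quotient\<close>

lemma card_set_mult:
 assumes finG: "finite (carrier G)" and H: "subgroup H G" and N: "subgroup N G"
 shows "card (H <#> N) * card (H \<inter> N) = card H * card N"
proof -
 have HG: "H \<subseteq> carrier G" and NG: "N \<subseteq> carrier G" using subgroup.subset H N by auto
 have fin: "finite (H \<times> N)" using finite_subset[OF HG finG] finite_subset[OF NG finG] by simp
 let ?m = "\<lambda>q. fst q \<otimes> snd q"
 have im: "H <#> N = ?m ` (H \<times> N)" unfolding set_mult_def by force
 have fib: "card {q \<in> H \<times> N. ?m q = ?m q0} = card (H \<inter> N)" if q0: "q0 \<in> H \<times> N" for q0
 proof (rule bij_betw_same_card[OF bij_betw_byWitness[where f = "\<lambda>q. inv (fst q0) \<otimes> fst q" and f' = "\<lambda>t. (fst q0 \<otimes> t, inv t \<otimes> snd q0)"]])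
  have c0: "fst q0 \<in> H" "snd q0 \<in> N" "fst q0 \<in> carrier G" "snd q0 \<in> carrier G" using q0 HG NG by auto
  have key: "inv (fst q0) \<otimes> fst q = snd q0 \<otimes> inv (snd q)" if "q \<in> {q \<in> H \<times> N. ?m q = ?m q0}" for q
  proof -
   have q: "fst q \<in> carrier G" "snd q \<in> carrier G" "fst q \<otimes> snd q = fst q0 \<otimes> snd q0" using that HG NG by auto
   have "fst q = fst q \<otimes> snd q \<otimes> inv (snd q)" using q(1,2) by (simp add: m_assoc)
   then have a: "fst q = fst q0 \<otimes> snd q0 \<otimes> inv (snd q)" unfolding q(3) .
   have "inv (fst q0) \<otimes> (fst q0 \<otimes> snd q0 \<otimes> inv (snd q)) = snd q0 \<otimes> inv (snd q)"
    using c0 q(1,2) by (simp add: m_assoc[symmetric])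
   then show ?thesis using a by simp
  qed
  show "\<forall>q\<in>{q \<in> H \<times> N. ?m q = ?m q0}. (fst q0 \<otimes> (inv (fst q0) \<otimes> fst q), inv (inv (fst q0) \<otimes> fst q) \<otimes> snd q0) = q"
  proof
   fix q assume qq: "q \<in> {q \<in> H \<times> N. ?m q = ?m q0}"
   then have q: "fst q \<in> carrier G" "snd q \<in> carrier G" using HG NG by auto
   have "inv (inv (fst q0) \<otimes> fst q) \<otimes> snd q0 = snd q" unfolding key[OF qq] using c0 q by (simp add: inv_mult_group m_assoc)
   moreover have "fst q0 \<otimes> (inv (fst q0) \<otimes> fst q) = fst q" using c0 q by (simp add: m_assoc[symmetric])
   ultimately show "(fst q0 \<otimes> (inv (fst q0) \<otimes> fst q), inv (inv (fst q0) \<otimes> fst q) \<otimes> snd q0) = q" by (simp add: prod_eq_iff)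
  qed
  show "\<forall>t\<in>H \<inter> N. inv (fst q0) \<otimes> fst (fst q0 \<otimes> t, inv t \<otimes> snd q0) = t"
   using c0 HG by (auto simp: m_assoc[symmetric] subset_eq)
  show "(\<lambda>q. inv (fst q0) \<otimes> fst q) ` {q \<in> H \<times> N. ?m q = ?m q0} \<subseteq> H \<inter> N"
  proof (rule image_subsetI)
   fix q assume qq: "q \<in> {q \<in> H \<times> N. ?m q = ?m q0}"
   then have "inv (fst q0) \<otimes> fst q \<in> H" using c0(1) subgroup.m_closed[OF H] subgroup.m_inv_closed[OF H] by auto
   moreover have "inv (fst q0) \<otimes> fst q \<in> N"
    unfolding key[OF qq] using qq c0(2) subgroup.m_closed[OF N] subgroup.m_inv_closed[OF N] by auto
   ultimately show "inv (fst q0) \<otimes> fst q \<in> H \<inter> N" by simp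
  qed
  show "(\<lambda>t. (fst q0 \<otimes> t, inv t \<otimes> snd q0)) ` (H \<inter> N) \<subseteq> {q \<in> H \<times> N. ?m q = ?m q0}"
  proof (rule image_subsetI)
   fix t assume t: "t \<in> H \<inter> N"
   then have tG: "t \<in> carrier G" using HG by auto
   have "fst q0 \<otimes> t \<otimes> (inv t \<otimes> snd q0) = fst q0 \<otimes> (t \<otimes> inv t) \<otimes> snd q0" using c0 tG by (simp only: m_assoc m_closed inv_closed)
   then have "fst q0 \<otimes> t \<otimes> (inv t \<otimes> snd q0) = fst q0 \<otimes> snd q0" using c0 tG by simp
   then show "(fst q0 \<otimes> t, inv t \<otimes> snd q0) \<in> {q \<in> H \<times> N. ?m q = ?m q0}"
    using t c0 subgroup.m_closed[OF H] subgroup.m_closed[OF N] subgroup.m_inv_closed[OF N] by simp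
  qed
 qed
 have "card (H \<times> N) = (\<Sum>z\<in>?m ` (H \<times> N). card {q \<in> H \<times> N. ?m q = z})"
  using sum.group[OF fin finite_imageI[OF fin], of ?m ?m "\<lambda>_. 1::nat"] fin by simp
 also have "\<dots> = (\<Sum>z\<in>?m ` (H \<times> N). card (H \<inter> N))" by (rule sum.cong[OF refl]) (use fib in force)
 finally show ?thesis unfolding im by (simp add: card_cartesian_product)
qed

lemma normal_set_mult:
 assumes H: "H \<lhd> G" and N: "N \<lhd> G" shows "H <#> N \<lhd> G"
 unfolding normal_inv_iff
proof (intro conjI ballI)
 have HG: "H \<subseteq> carrier G" and NG: "N \<subseteq> carrier G"
  using H N normal_imp_subgroup subgroup.subset by blast+
 show "subgroup (H <#> N) G" by (rule mult_norm_subgroup[OF H normal_imp_subgroup[OF N]])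
 fix x z assume x: "x \<in> carrier G" and "z \<in> H <#> N"
 then obtain h n where hn: "h \<in> H" "n \<in> N" "z = h \<otimes> n" unfolding set_mult_def by blast
 then have c: "h \<in> carrier G" "n \<in> carrier G" using HG NG by auto
 have "x \<otimes> h \<otimes> inv x \<in> H" "x \<otimes> n \<otimes> inv x \<in> N" using H N x hn unfolding normal_inv_iff by auto
 moreover have "x \<otimes> z \<otimes> inv x = (x \<otimes> h \<otimes> inv x) \<otimes> (x \<otimes> n \<otimes> inv x)"
 proof -
  have "(x \<otimes> h \<otimes> inv x) \<otimes> (x \<otimes> n \<otimes> inv x) = x \<otimes> h \<otimes> (inv x \<otimes> x) \<otimes> n \<otimes> inv x"
   using x c by (simp only: m_assoc m_closed inv_closed)
  then show ?thesis using x c by (simp add: hn(3) m_assoc)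
 qed
 ultimately show "x \<otimes> z \<otimes> inv x \<in> H <#> N" unfolding set_mult_def by blast
qed

text \<open>\<open>GREATEST\<close> refers to inclusion here. A maximal normal
  \<open>p\<close>-subgroup exists by finiteness, and it contains all others because the product of
  two normal \<open>p\<close>-subgroups is one again.\<close>

lemma p_core_props:
 assumes finG: "finite (carrier G)" and p: "Factorial_Ring.prime (p::nat)"
 shows "p_core p G \<lhd> G" "\<exists>n. card (p_core p G) = p ^ n"
  "\<And>N n. N \<lhd> G ==> card N = p ^ n ==> N \<subseteq> p_core p G"
proof -
 define P where "P N \<longleftrightarrow> N \<lhd> G \<and> (\<exists>n. card N = p ^ n)" for N
 have sG: "N \<subseteq> carrier G" if "P N" for N using that normal_imp_subgroup subgroup.subset unfolding P_def by blast
 have "finite {N. P N}" by (rule finite_subset[of _ "Pow (carrier G)"]) (use finG sG in auto)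
 have "P {\<one>}" unfolding P_def using one_is_normal by (auto intro: exI[of _ 0])
 then have "{N. P N} \<noteq> {}" by blast
 with \<open>finite {N. P N}\<close> have "\<exists>M\<in>{N. P N}. \<forall>N\<in>{N. P N}. M \<le> N \<longrightarrow> M = N" by (rule finite_has_maximal)
 then obtain M where "M \<in> {N. P N}" and M2: "\<forall>N\<in>{N. P N}. M \<le> N \<longrightarrow> M = N" by (rule bexE)
 then have M: "P M" by simp
 have le: "N \<subseteq> M" if N: "P N" for N
 proof -
  have nN: "N \<lhd> G" "M \<lhd> G" using N M by (auto simp: P_def)
  note sN = nN[THEN normal_imp_subgroup]
  obtain i j where ij: "card N = p ^ i" "card M = p ^ j" using N M by (auto simp: P_def)
  have "card (N <#> M) dvd p ^ (i + j)"
   using card_set_mult[OF finG sN(1) sN(2)] unfolding ij power_add by (metis dvd_triv_left)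
  then obtain k where "card (N <#> M) = p ^ k" using divides_primepow_nat[OF p] by blast
  then have "P (N <#> M)" unfolding P_def using normal_set_mult[OF nN] by blast
  moreover have "M \<subseteq> N <#> M"
  proof
   fix x assume x: "x \<in> M"
   then have "x = \<one> \<otimes> x" using sG[OF M] by auto
   then show "x \<in> N <#> M" unfolding set_mult_def using x subgroup.one_closed[OF sN(1)] by blast
  qed
  ultimately have "M = N <#> M" using M2 by simp
  moreover have "N \<subseteq> N <#> M"
  proof
   fix x assume x: "x \<in> N"
   then have "x = x \<otimes> \<one>" using sG[OF N] by auto
   then show "x \<in> N <#> M" unfolding set_mult_def using x subgroup.one_closed[OF sN(2)] by blast
  qed
  ultimately show ?thesis by simp
 qed
 have e: "p_core p G = M" unfolding p_core_def P_def[symmetric] by (rule Greatest_equality) (rule M, rule le)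
 show "p_core p G \<lhd> G" "\<exists>n. card (p_core p G) = p ^ n" using M unfolding e P_def by blast+
 show "N \<subseteq> p_core p G" if "N \<lhd> G" "card N = p ^ n" for N n unfolding e by (rule le) (use that in \<open>auto simp: P_def\<close>)
qed

text \<open>The union of the cosets in \<open>D\<close> is a normal subgroup of \<open>G\<close> of
  \<open>p\<close>-power order. It is contained in the core, so \<open>D\<close> consists of a
  single coset.\<close>

lemma p_core_quotient:
 assumes finG: "finite (carrier G)" and p: "Factorial_Ring.prime (p::nat)"
  and D: "D \<lhd> (G Mod p_core p G)" and cD: "card D = p ^ k"
 shows "k = 0"
proof -
 define N where "N = p_core p G"
 note pc = p_core_props[OF finG p, folded N_def]
 interpret N: normal N G by (rule pc(1))
 interpret Q: group "G Mod N" by (rule N.factorgroup_is_group)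
 note D = D[folded N_def]
 interpret D: normal D "G Mod N" by (rule D)
 have NG: "N \<subseteq> carrier G" by (rule N.subset)
 have c: "N #> g \<in> carrier (G Mod N)" if "g \<in> carrier G" for g using that by (auto simp: FactGroup_def RCOSETS_def)
 have cm: "N #> (g \<otimes> h) = (N #> g) \<otimes>\<^bsub>G Mod N\<^esub> (N #> h)" if "g \<in> carrier G" "h \<in> carrier G" for g h
  using N.rcos_sum[OF that] by (simp add: FactGroup_def)
 have c1: "N #> \<one> = \<one>\<^bsub>G Mod N\<^esub>" using coset_mult_one[OF NG] by (simp add: FactGroup_def)
 have ci: "N #> inv g = inv\<^bsub>G Mod N\<^esub> (N #> g)" if g: "g \<in> carrier G" for g
  by (rule Q.inv_equality[symmetric]) (use g c c1 cm[of "inv g" g] in auto)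
 define U where "U = {u \<in> carrier G. N #> u \<in> D}"
 have DU: "\<Union>D = U"
 proof (intro equalityI subsetI)
  fix u assume "u \<in> \<Union>D"
  then obtain d where d: "d \<in> D" "u \<in> d" by blast
  then have "d \<in> rcosets N" using D.subset by (auto simp: FactGroup_def)
  then obtain x where x: "x \<in> carrier G" "d = N #> x" by (auto simp: RCOSETS_def)
  have "N #> u = d" using repr_independence[of u N x] d x N.subgroup_axioms by simp
  moreover have "u \<in> carrier G" using d x NG r_coset_subset_G by blast
  ultimately show "u \<in> U" using d by (simp add: U_def)
 next
  fix u assume "u \<in> U"
  then show "u \<in> \<Union>D" using rcos_self[of u N] N.subgroup_axioms by (auto simp: U_def)
 qed
 have sU: "subgroup U G"
 proof
  show "U \<subseteq> carrier G" by (auto simp: U_def)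
  show "g \<otimes> h \<in> U" if "g \<in> U" "h \<in> U" for g h using that cm D.m_closed by (auto simp: U_def)
  show "\<one> \<in> U" using c1 D.one_closed by (simp add: U_def)
  show "inv g \<in> U" if "g \<in> U" for g using that ci D.m_inv_closed by (auto simp: U_def)
 qed
 have nU: "U \<lhd> G"
  unfolding normal_inv_iff
 proof (intro conjI ballI sU)
  fix x u assume x: "x \<in> carrier G" and u: "u \<in> U"
  then have uG: "u \<in> carrier G" "N #> u \<in> D" by (auto simp: U_def)
  have "N #> (x \<otimes> u \<otimes> inv x) = (N #> x) \<otimes>\<^bsub>G Mod N\<^esub> (N #> u) \<otimes>\<^bsub>G Mod N\<^esub> inv\<^bsub>G Mod N\<^esub> (N #> x)"
   using x uG(1) by (simp add: cm ci)
  also have "\<dots> \<in> D" by (rule D.inv_op_closed2[OF c[OF x] uG(2)])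
  finally show "x \<otimes> u \<otimes> inv x \<in> U" using x uG by (simp add: U_def)
 qed
 have Dr: "D \<subseteq> rcosets N" using D.subset by (auto simp: FactGroup_def)
 have "card N * card D = card (\<Union>D)"
 proof (rule card_partition)
  show "finite D" by (rule finite_subset[OF Dr]) (use finG in \<open>simp add: RCOSETS_def\<close>)
  show "finite (\<Union>D)" unfolding DU using finite_subset[OF subgroup.subset[OF sU] finG] .
  show "card d = card N" if "d \<in> D" for d using card_rcosets_equal[OF _ NG, of d] that Dr by auto
  show "c1 \<inter> c2 = {}" if "c1 \<in> D" "c2 \<in> D" "c1 \<noteq> c2" for c1 c2
   using rcos_disjoint[OF N.subgroup_axioms] that Dr unfolding pairwise_def disjnt_def by blast
 qed
 then obtain j where "card U = p ^ (j + k)" using pc(2) cD unfolding DU by (metis power_add)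
 then have UN: "U \<subseteq> N" by (rule pc(3)[OF nU])
 have "D \<subseteq> {N}"
 proof
  fix d assume d: "d \<in> D"
  then obtain x where x: "x \<in> carrier G" "d = N #> x" using Dr by (auto simp: RCOSETS_def)
  have "x \<in> U" using d x by (simp add: U_def)
  then show "d \<in> {N}" using coset_join2[OF x(1) N.subgroup_axioms] UN x by auto
 qed
 then have "card D \<le> 1" using card_mono[of "{N}" D] by simp
 then have "p ^ k \<le> 1" using cD by simp
 then show "k = 0" using prime_ge_2_nat[OF p] by (cases k) (auto simp: le_Suc_eq)
qed

lemma Rel_noncyclic_mod_p_core:
 assumes finG: "finite (carrier G)" and p: "Factorial_Ring.prime (p::nat)" and nc: "\<not> cyclic_group (G Mod p_core p G)"
 shows "\<exists>d m. Rel G d m \<and> m (carrier G) \<noteq> 0 \<and> \<not> int p dvd d"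
proof -
 note N = p_core_props(1)[OF finG p]
 interpret Q: group "G Mod p_core p G" by (rule normal.factorgroup_is_group[OF N])
 have "finite (carrier (G Mod p_core p G))" using finG by (simp add: FactGroup_def RCOSETS_def)
 then have "\<exists>d m. Rel (G Mod p_core p G) d m \<and> m (carrier (G Mod p_core p G)) \<noteq> 0 \<and> \<not> int p dvd d"
  by (rule Q.Rel_noncyclic[OF _ nc p]) (rule p_core_quotient[OF finG p])
 then obtain d m where dm: "Rel (G Mod p_core p G) d m" "m (carrier (G Mod p_core p G)) \<noteq> 0" "\<not> int p dvd d"
  by blast
 obtain m' where "Rel G d m'" "m' (carrier G) = m (carrier (G Mod p_core p G))" using Rel_inflate[OF N dm(1)] by blast
 then show ?thesis using dm by metis
qed

text \<open>A prime \<open>p0\<close> beyond the group order divides the order of no normal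
  subgroup, so \<open>Rel_noncyclic\<close> applies to \<open>G\<close> itself and produces a scalar
  \<open>d0\<close> whose only needed property is that it is not zero. Finitely many bad primes
  divide \<open>d0\<close>, and each is removed by a greatest common divisor with a scalar prime to
  it. The scalars keep dividing \<open>d0\<close>, so removed primes cannot return and no others can
  appear.\<close>

lemma Rel_unit:
 assumes finG: "finite (carrier G)" and nc: "\<not> cyclic_group G"
  and bad: "\<And>p::nat. Factorial_Ring.prime p ==> bad p ==> \<not> cyclic_group (G Mod p_core p G)"
 shows "\<exists>d m. Rel G d m \<and> m (carrier G) \<noteq> 0 \<and> d \<noteq> 0 \<and> (\<forall>p::nat. Factorial_Ring.prime p \<and> bad p \<longrightarrow> \<not> int p dvd d)"
proof -
 obtain p0 :: nat where p0: "Factorial_Ring.prime p0" "p0 > card (carrier G)" using bigger_prime by blast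
 have "k = 0" if D: "D \<lhd> G" and k: "card D = p0 ^ k" for D k
 proof (rule ccontr)
  assume "k \<noteq> 0"
  then have "p0 dvd card D" unfolding k by (simp add: dvd_power)
  moreover have "card D > 0" using k prime_gt_0_nat[OF p0(1)] by simp
  ultimately have "p0 \<le> card D" by (rule dvd_imp_le)
  moreover have "card D \<le> card (carrier G)" by (rule card_mono[OF finG subgroup.subset[OF normal_imp_subgroup[OF D]]])
  ultimately show False using p0(2) by simp
 qed
 then have "\<exists>d m. Rel G d m \<and> m (carrier G) \<noteq> 0 \<and> \<not> int p0 dvd d" by (rule Rel_noncyclic[OF finG nc p0(1)])
 then obtain d0 m0 where dm0: "Rel G d0 m0" "m0 (carrier G) \<noteq> 0" "\<not> int p0 dvd d0" by blast
 have d00: "d0 \<noteq> 0" using dm0(3) by auto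
 define P where "P = {p::nat. Factorial_Ring.prime p \<and> bad p \<and> int p dvd d0}"
 have finP: "finite P"
 proof (rule finite_subset)
  show "P \<subseteq> {..nat \<bar>d0\<bar>}"
  proof
   fix p assume "p \<in> P"
   then have "int p \<le> \<bar>d0\<bar>" using dvd_imp_le_int[OF d00, of "int p"] by (simp add: P_def)
   then show "p \<in> {..nat \<bar>d0\<bar>}" by simp
  qed
 qed simp
 have "\<exists>d m. Rel G d m \<and> m (carrier G) \<noteq> 0 \<and> d dvd d0 \<and> d \<noteq> 0 \<and> (\<forall>p\<in>P. \<not> int p dvd d)"
  using finP subset_refl[of P]
 proof (induction P rule: finite_subset_induct')
  case empty
  show ?case by (rule exI[of _ d0], rule exI[of _ m0]) (use dm0 d00 in simp)
 next
  case (insert p Q)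
  then obtain d m where dm: "Rel G d m" "m (carrier G) \<noteq> 0" "d dvd d0" "d \<noteq> 0" "\<forall>p\<in>Q. \<not> int p dvd d" by blast
  have pp: "Factorial_Ring.prime p" "bad p" using insert.hyps by (auto simp: P_def)
  obtain e m' where e: "Rel G e m'" "m' (carrier G) \<noteq> 0" "\<not> int p dvd e"
   using Rel_noncyclic_mod_p_core[OF finG pp(1) bad[OF pp]] by blast
  have "gcd d e dvd d0" by (rule dvd_trans[OF gcd_dvd1 dm(3)])
  moreover have "\<forall>q\<in>insert p Q. \<not> int q dvd gcd d e" using dm(5) e(3) by auto
  moreover have "gcd d e \<noteq> 0" using dm(4) by simp
  ultimately show ?case using Rel_gcd[OF dm(1) e(1)] dm(2) e(2)
   by (intro exI[of _ "gcd d e"] exI[of _ "\<lambda>H. m H * m' H"]) simp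
 qed
 then obtain d m where dm: "Rel G d m" "m (carrier G) \<noteq> 0" "d dvd d0" "d \<noteq> 0" "\<forall>p\<in>P. \<not> int p dvd d" by blast
 have "\<not> int p dvd d" if pp: "Factorial_Ring.prime p" "bad p" for p :: nat
 proof
  assume pd: "int p dvd d"
  have "p \<in> P" unfolding P_def using pp dvd_trans[OF pd dm(3)] by simp
  then show False using dm(5) pd by simp
 qed
 then show ?thesis using dm by blast
qed

end

section \<open>Permutation modules\<close>

text \<open>Formulated by the fields of the record, so that it covers \<open>free_module\<close> as
  well as the extended records with an action.\<close>

lemma module_of_functions:
 fixes M :: "('r, 'b => 'r, 'z) module_scheme"
 assumes R: "cring R" and c: "carrier M = {f \<in> B \<rightarrow>\<^sub>E carrier R. finite {b \<in> B. f b \<noteq> \<zero>\<^bsub>R\<^esub>}}"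
  and z: "zero M = (\<lambda>b\<in>B. \<zero>\<^bsub>R\<^esub>)" and ad: "add M = (\<lambda>f h. \<lambda>b\<in>B. f b \<oplus>\<^bsub>R\<^esub> h b)"
  and sm: "module.smult M = (\<lambda>r f. \<lambda>b\<in>B. r \<otimes>\<^bsub>R\<^esub> f b)"
 shows "module R M"
proof -
 interpret cring R by (rule R)
 have fin: "finite {b \<in> B. P b \<noteq> \<zero>\<^bsub>R\<^esub>}" if "finite {b \<in> B. f b \<noteq> \<zero>\<^bsub>R\<^esub>}" "finite {b \<in> B. h b \<noteq> \<zero>\<^bsub>R\<^esub>}"
  "\<And>b. b \<in> B ==> f b = \<zero>\<^bsub>R\<^esub> ==> h b = \<zero>\<^bsub>R\<^esub> ==> P b = \<zero>\<^bsub>R\<^esub>" for f h P :: "'b => 'r"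
  by (rule finite_subset[OF _ finite_UnI[OF that(1,2)]]) (use that(3) in blast)
 have cl: "f b \<in> carrier R" if "f \<in> carrier M" "b \<in> B" for f b using that by (auto simp: c)
 have fs: "finite {b \<in> B. f b \<noteq> \<zero>\<^bsub>R\<^esub>}" if "f \<in> carrier M" for f using that by (simp add: c)
 have I: "(\<lambda>b\<in>B. P b) \<in> carrier M" if "\<And>b. b \<in> B ==> P b \<in> carrier R" "finite {b \<in> B. P b \<noteq> \<zero>\<^bsub>R\<^esub>}" for P
  using that by (auto simp: c cong: conj_cong)
 have ex: "f = h" if "f \<in> carrier M" "h \<in> carrier M" "\<And>b. b \<in> B ==> f b = h b" for f h
  by (rule PiE_ext[of f B "\<lambda>_. carrier R" h]) (use that in \<open>auto simp: c\<close>)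
 have ac: "(\<lambda>b\<in>B. f b \<oplus>\<^bsub>R\<^esub> h b) \<in> carrier M" if "f \<in> carrier M" "h \<in> carrier M" for f h
  by (rule I) (use that cl fin[OF fs[OF that(1)] fs[OF that(2)], of "\<lambda>b. f b \<oplus>\<^bsub>R\<^esub> h b"] in auto)
 have sc: "(\<lambda>b\<in>B. r \<otimes>\<^bsub>R\<^esub> f b) \<in> carrier M" if "f \<in> carrier M" "r \<in> carrier R" for f r
  by (rule I) (use that cl fin[OF fs[OF that(1)] fs[OF that(1)], of "\<lambda>b. r \<otimes>\<^bsub>R\<^esub> f b"] in auto)
 have zc: "(\<lambda>b\<in>B. \<zero>\<^bsub>R\<^esub>) \<in> carrier M" by (rule I) auto
 have mc: "(\<lambda>b\<in>B. \<ominus>\<^bsub>R\<^esub> f b) \<in> carrier M" if "f \<in> carrier M" for f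
  by (rule I) (use that cl fin[OF fs[OF that(1)] fs[OF that(1)], of "\<lambda>b. \<ominus>\<^bsub>R\<^esub> f b"] in auto)
 have "abelian_group M"
 proof (rule abelian_groupI)
  fix f assume f: "f \<in> carrier M"
  show "\<zero>\<^bsub>M\<^esub> \<oplus>\<^bsub>M\<^esub> f = f" unfolding z ad by (rule ex, rule ac[OF zc f], rule f) (simp add: cl[OF f])
  have "(\<lambda>b\<in>B. \<ominus>\<^bsub>R\<^esub> f b) \<oplus>\<^bsub>M\<^esub> f = \<zero>\<^bsub>M\<^esub>" unfolding z ad by (rule ex, rule ac[OF mc[OF f] f], rule zc) (simp add: cl[OF f] l_neg)
  then show "\<exists>h\<in>carrier M. h \<oplus>\<^bsub>M\<^esub> f = \<zero>\<^bsub>M\<^esub>" using mc[OF f] by blast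
  fix h assume h: "h \<in> carrier M"
  show "f \<oplus>\<^bsub>M\<^esub> h \<in> carrier M" unfolding ad by (rule ac[OF f h])
  show "f \<oplus>\<^bsub>M\<^esub> h = h \<oplus>\<^bsub>M\<^esub> f" unfolding ad by (rule ex, rule ac[OF f h], rule ac[OF h f]) (simp add: cl[OF f] cl[OF h] a_comm)
  fix k assume k: "k \<in> carrier M"
  show "f \<oplus>\<^bsub>M\<^esub> h \<oplus>\<^bsub>M\<^esub> k = f \<oplus>\<^bsub>M\<^esub> (h \<oplus>\<^bsub>M\<^esub> k)" unfolding ad by (rule ex, rule ac[OF ac[OF f h] k], rule ac[OF f ac[OF h k]]) (simp add: cl[OF f] cl[OF h] cl[OF k] a_assoc)
 qed (simp add: z zc)
 then show ?thesis
 proof (rule moduleI[OF R])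
  fix r f assume r: "r \<in> carrier R" and f: "f \<in> carrier M"
  show "r \<odot>\<^bsub>M\<^esub> f \<in> carrier M" unfolding sm by (rule sc[OF f r])
  show "(r \<oplus>\<^bsub>R\<^esub> s) \<odot>\<^bsub>M\<^esub> f = r \<odot>\<^bsub>M\<^esub> f \<oplus>\<^bsub>M\<^esub> s \<odot>\<^bsub>M\<^esub> f" if s: "s \<in> carrier R" for s
   unfolding sm ad by (rule ex, rule sc[OF f add.m_closed[OF r s]], rule ac[OF sc[OF f r] sc[OF f s]]) (simp add: cl[OF f] r s l_distr)
  show "r \<odot>\<^bsub>M\<^esub> (f \<oplus>\<^bsub>M\<^esub> h) = r \<odot>\<^bsub>M\<^esub> f \<oplus>\<^bsub>M\<^esub> r \<odot>\<^bsub>M\<^esub> h" if h: "h \<in> carrier M" for h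
   unfolding sm ad by (rule ex, rule sc[OF ac[OF f h] r], rule ac[OF sc[OF f r] sc[OF h r]]) (simp add: cl[OF f] cl[OF h] r r_distr)
  show "(r \<otimes>\<^bsub>R\<^esub> s) \<odot>\<^bsub>M\<^esub> f = r \<odot>\<^bsub>M\<^esub> (s \<odot>\<^bsub>M\<^esub> f)" if s: "s \<in> carrier R" for s
   unfolding sm by (rule ex, rule sc[OF f m_closed[OF r s]], rule sc[OF sc[OF f s] r]) (simp add: cl[OF f] r s m_assoc)
 next
  fix f assume f: "f \<in> carrier M"
  show "\<one>\<^bsub>R\<^esub> \<odot>\<^bsub>M\<^esub> f = f" unfolding sm by (rule ex, rule sc[OF f one_closed], rule f) (simp add: cl[OF f])
 qed
qed

lemma module_free_module: "cring R ==> module R (free_module R B)"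
 by (rule module_of_functions) (auto simp: free_module_def)

text \<open>\<open>ind_trivial\<close> with an arbitrary group set in place of the cosets, see
  \<open>ind_trivial_perm_module\<close>. Disjoint unions and signed sets lead out of the transitive
  case.\<close>

definition perm_module ::
 "('g, 'x) monoid_scheme => ('r, 'y) ring_scheme => 'b set => ('g => 'b => 'b) => ('g, 'r, 'b => 'r) rgmod" where
 "perm_module G R X a = module.extend (free_module R X) \<lparr>act = (\<lambda>g f. \<lambda>x\<in>X. f (a (inv\<^bsub>G\<^esub> g) x))\<rparr>"

lemma perm_module_sel:
 "carrier (perm_module G R X a) = {f \<in> X \<rightarrow>\<^sub>E carrier R. finite {b \<in> X. f b \<noteq> \<zero>\<^bsub>R\<^esub>}}"
 "zero (perm_module G R X a) = (\<lambda>b\<in>X. \<zero>\<^bsub>R\<^esub>)"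
 "add (perm_module G R X a) = (\<lambda>f h. \<lambda>b\<in>X. f b \<oplus>\<^bsub>R\<^esub> h b)"
 "module.smult (perm_module G R X a) = (\<lambda>r f. \<lambda>b\<in>X. r \<otimes>\<^bsub>R\<^esub> f b)"
 "act (perm_module G R X a) = (\<lambda>g f. \<lambda>x\<in>X. f (a (inv\<^bsub>G\<^esub> g) x))"
 by (simp_all add: perm_module_def module.defs free_module_def)

lemma perm_module_carrier: "finite X ==> carrier (perm_module G R X a) = (X \<rightarrow>\<^sub>E carrier R)"
 by (simp add: perm_module_sel)

lemma module_perm_module: "cring R ==> module R (perm_module G R X a)"
 by (rule module_of_functions[OF _ perm_module_sel(1-4)])

lemma (in group) rg_module_perm_module:
 assumes R: "cring R" and X: "finite X" "gset G X a" shows "rg_module G R (perm_module G R X a)"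
proof -
 interpret M: module R "perm_module G R X a" by (rule module_perm_module[OF R])
 note c = perm_module_carrier[OF X(1)]
 have i: "a (inv g) x \<in> X" if "g \<in> carrier G" "x \<in> X" for g x by (rule gsetD(1)[OF X(2) inv_closed[OF that(1)] that(2)])
 show ?thesis
 proof (rule rg_module.intro[OF is_group M.module_axioms], unfold_locales)
  fix g f assume g: "g \<in> carrier G" and f: "f \<in> carrier (perm_module G R X a)"
  show "act (perm_module G R X a) g f \<in> carrier (perm_module G R X a)"
   using f i[OF g] unfolding c perm_module_sel(5) by auto
  show "act (perm_module G R X a) g (f \<oplus>\<^bsub>perm_module G R X a\<^esub> h) =
   act (perm_module G R X a) g f \<oplus>\<^bsub>perm_module G R X a\<^esub> act (perm_module G R X a) g h" for h
   unfolding perm_module_sel by (rule restrict_ext) (simp add: i[OF g])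
  show "act (perm_module G R X a) g (r \<odot>\<^bsub>perm_module G R X a\<^esub> f) = r \<odot>\<^bsub>perm_module G R X a\<^esub> act (perm_module G R X a) g f" for r
   unfolding perm_module_sel by (rule restrict_ext) (simp add: i[OF g])
  show "act (perm_module G R X a) (g \<otimes> h) f = act (perm_module G R X a) g (act (perm_module G R X a) h f)" if h: "h \<in> carrier G" for h
   unfolding perm_module_sel
  proof (rule restrict_ext)
   fix x assume x: "x \<in> X"
   have "a (inv (g \<otimes> h)) x = a (inv h) (a (inv g) x)"
    unfolding inv_mult_group[OF g h] by (rule gsetD(3)[OF X(2) inv_closed[OF h] inv_closed[OF g] x])
   then show "f (a (inv (g \<otimes> h)) x) = (\<lambda>x\<in>X. f (a (inv h) x)) (a (inv g) x)" using i[OF g x] by simp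
  qed
 next
  fix f assume f: "f \<in> carrier (perm_module G R X a)"
  show "act (perm_module G R X a) \<one> f = f"
   unfolding perm_module_sel
  proof
   fix x
   show "(\<lambda>x\<in>X. f (a (inv \<one>) x)) x = f x"
    using f gsetD(2)[OF X(2), of x] by (cases "x \<in> X") (auto simp: c PiE_def extensional_def)
  qed
 qed
qed

context rg_module
begin

lemma rg_submoduleI:
 assumes "U \<subseteq> carrier M" "\<zero>\<^bsub>M\<^esub> \<in> U" "\<And>x y. x \<in> U ==> y \<in> U ==> x \<oplus>\<^bsub>M\<^esub> y \<in> U"
  "\<And>r x. r \<in> carrier R ==> x \<in> U ==> r \<odot>\<^bsub>M\<^esub> x \<in> U" "\<And>g x. g \<in> carrier G ==> x \<in> U ==> act M g x \<in> U"
 shows "rg_submodule G R M U"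
 unfolding rg_submodule_def
proof (intro conjI ballI submoduleI)
 fix x assume x: "x \<in> U"
 then have "x \<in> carrier M" using assms(1) by blast
 then have "\<ominus>\<^bsub>M\<^esub> x = (\<ominus>\<^bsub>R\<^esub> \<one>\<^bsub>R\<^esub>) \<odot>\<^bsub>M\<^esub> x" by (simp add: smult_l_minus)
 then show "\<ominus>\<^bsub>M\<^esub> x \<in> U" using assms(4)[OF _ x, of "\<ominus>\<^bsub>R\<^esub> \<one>\<^bsub>R\<^esub>"] by simp
qed (use assms in auto)

lemma rg_submoduleD:
 assumes "rg_submodule G R M U"
 shows "U \<subseteq> carrier M" "\<zero>\<^bsub>M\<^esub> \<in> U" "\<And>x y. x \<in> U ==> y \<in> U ==> x \<oplus>\<^bsub>M\<^esub> y \<in> U"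
  "\<And>r x. r \<in> carrier R ==> x \<in> U ==> r \<odot>\<^bsub>M\<^esub> x \<in> U" "\<And>g x. g \<in> carrier G ==> x \<in> U ==> act M g x \<in> U"
proof -
 have s: "submodule U R M" using assms by (simp add: rg_submodule_def)
 show "U \<subseteq> carrier M" by (rule submoduleE(1)[OF s])
 show "\<zero>\<^bsub>M\<^esub> \<in> U" by (rule submodule_zero[OF s])
 show "x \<oplus>\<^bsub>M\<^esub> y \<in> U" if "x \<in> U" "y \<in> U" for x y by (rule submodule_add[OF s that])
 show "r \<odot>\<^bsub>M\<^esub> x \<in> U" if "r \<in> carrier R" "x \<in> U" for r x by (rule submoduleE(4)[OF s that])
 show "act M g x \<in> U" if "g \<in> carrier G" "x \<in> U" for g x using assms that by (simp add: rg_submodule_def)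
qed

lemma fgI:
 assumes "finite S" "S \<subseteq> carrier M" "\<And>U. rg_submodule G R M U ==> S \<subseteq> U ==> carrier M \<subseteq> U"
 shows "fg_rg_module G R M"
proof -
 have "rg_submodule G R M (carrier M)" by (rule rg_submoduleI) (auto simp: act_closed)
 then have "rg_submodule G R M hull S \<subseteq> carrier M" using assms(2) by (rule hull_minimal[rotated])
 moreover have "carrier M \<subseteq> rg_submodule G R M hull S" using assms(3) unfolding hull_def by blast
 ultimately show ?thesis unfolding fg_rg_module_def using assms(1,2) rg_module_axioms by blast
qed

lemma iso_symI:
 fixes N :: "('g, 'r, 'n, 'w) rgmod_scheme"
 assumes "rg_isomorphic G R M N" shows "rg_isomorphic G R N M"
proof -
 obtain \<phi> where b: "bij_betw \<phi> (carrier M) (carrier N)"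
  and ad: "\<And>x y. x \<in> carrier M ==> y \<in> carrier M ==> \<phi> (x \<oplus>\<^bsub>M\<^esub> y) = \<phi> x \<oplus>\<^bsub>N\<^esub> \<phi> y"
  and sm: "\<And>r x. r \<in> carrier R ==> x \<in> carrier M ==> \<phi> (r \<odot>\<^bsub>M\<^esub> x) = r \<odot>\<^bsub>N\<^esub> \<phi> x"
  and ac: "\<And>g x. g \<in> carrier G ==> x \<in> carrier M ==> \<phi> (act M g x) = act N g (\<phi> x)"
  using assms unfolding rg_isomorphic_def by (elim exE conjE) (rule that, auto)
 define \<psi> where "\<psi> = inv_into (carrier M) \<phi>"
 have \<psi>: "\<psi> y \<in> carrier M" "\<phi> (\<psi> y) = y" if "y \<in> carrier N" for y
  using bij_betw_apply[OF bij_betw_inv_into[OF b] that] bij_betw_inv_into_right[OF b that] by (auto simp: \<psi>_def)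
 have \<psi>\<phi>: "\<psi> (\<phi> x) = x" if "x \<in> carrier M" for x using bij_betw_inv_into_left[OF b that] by (simp add: \<psi>_def)
 show ?thesis
  unfolding rg_isomorphic_def
 proof (intro exI[of _ \<psi>] conjI ballI)
  show "bij_betw \<psi> (carrier N) (carrier M)" unfolding \<psi>_def by (rule bij_betw_inv_into[OF b])
  fix x assume x: "x \<in> carrier N"
  show "\<psi> (x \<oplus>\<^bsub>N\<^esub> y) = \<psi> x \<oplus>\<^bsub>M\<^esub> \<psi> y" if y: "y \<in> carrier N" for y
   using \<psi>\<phi>[of "\<psi> x \<oplus>\<^bsub>M\<^esub> \<psi> y"] ad[OF \<psi>(1)[OF x] \<psi>(1)[OF y]] \<psi>[OF x] \<psi>[OF y] by simp
 next
  fix r x assume r: "r \<in> carrier R" and x: "x \<in> carrier N"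
  show "\<psi> (r \<odot>\<^bsub>N\<^esub> x) = r \<odot>\<^bsub>M\<^esub> \<psi> x"
   using \<psi>\<phi>[of "r \<odot>\<^bsub>M\<^esub> \<psi> x"] sm[OF r \<psi>(1)[OF x]] \<psi>[OF x] r by simp
 next
  fix g x assume g: "g \<in> carrier G" and x: "x \<in> carrier N"
  show "\<psi> (act N g x) = act M g (\<psi> x)"
   using \<psi>\<phi>[OF act_closed[OF g \<psi>(1)[OF x]]] ac[OF g \<psi>(1)[OF x]] \<psi>[OF x] by simp
 qed
qed

end

lemma iso_transI:
 assumes "rg_isomorphic G R M N" "rg_isomorphic G R N P" shows "rg_isomorphic G R M P"
proof -
 obtain \<phi> where b: "bij_betw \<phi> (carrier M) (carrier N)"
  and ad: "\<forall>x\<in>carrier M. \<forall>y\<in>carrier M. \<phi> (x \<oplus>\<^bsub>M\<^esub> y) = \<phi> x \<oplus>\<^bsub>N\<^esub> \<phi> y"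
  and sm: "\<forall>r\<in>carrier R. \<forall>x\<in>carrier M. \<phi> (r \<odot>\<^bsub>M\<^esub> x) = r \<odot>\<^bsub>N\<^esub> \<phi> x"
  and ac: "\<forall>g\<in>carrier G. \<forall>x\<in>carrier M. \<phi> (act M g x) = act N g (\<phi> x)"
  using assms(1) unfolding rg_isomorphic_def by (elim exE conjE)
 obtain \<psi> where b': "bij_betw \<psi> (carrier N) (carrier P)"
  and ad': "\<forall>x\<in>carrier N. \<forall>y\<in>carrier N. \<psi> (x \<oplus>\<^bsub>N\<^esub> y) = \<psi> x \<oplus>\<^bsub>P\<^esub> \<psi> y"
  and sm': "\<forall>r\<in>carrier R. \<forall>x\<in>carrier N. \<psi> (r \<odot>\<^bsub>N\<^esub> x) = r \<odot>\<^bsub>P\<^esub> \<psi> x"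
  and ac': "\<forall>g\<in>carrier G. \<forall>x\<in>carrier N. \<psi> (act N g x) = act P g (\<psi> x)"
  using assms(2) unfolding rg_isomorphic_def by (elim exE conjE)
 have m: "\<phi> x \<in> carrier N" if "x \<in> carrier M" for x by (rule bij_betw_apply[OF b that])
 show ?thesis unfolding rg_isomorphic_def
  by (intro exI[of _ "\<lambda>x. \<psi> (\<phi> x)"] conjI ballI)
   (use bij_betw_trans[OF b b'] ad sm ac ad' sm' ac' m in \<open>simp_all add: comp_def\<close>)
qed

lemma iso_class_cong:
 assumes "rg_module G R M" "rg_isomorphic G R M N" shows "iso_class G R M = iso_class G R N"
 using iso_transI[OF rg_module.iso_symI[OF assms]] iso_transI[OF assms(2)] unfolding iso_class_def by blast

lemma fg_rg_moduleD: "fg_rg_module G R M ==> rg_module G R M" by (simp add: fg_rg_module_def)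

lemma direct_sum_sel:
 "carrier (rg_direct_sum M N) = carrier M \<times> carrier N" "zero (rg_direct_sum M N) = (\<zero>\<^bsub>M\<^esub>, \<zero>\<^bsub>N\<^esub>)"
 "(x, y) \<oplus>\<^bsub>rg_direct_sum M N\<^esub> (x', y') = (x \<oplus>\<^bsub>M\<^esub> x', y \<oplus>\<^bsub>N\<^esub> y')"
 "r \<odot>\<^bsub>rg_direct_sum M N\<^esub> (x, y) = (r \<odot>\<^bsub>M\<^esub> x, r \<odot>\<^bsub>N\<^esub> y)" "act (rg_direct_sum M N) g (x, y) = (act M g x, act N g y)"
 by (simp_all add: rg_direct_sum_def)

lemma rg_module_direct_sum:
 assumes "rg_module G R M" "rg_module G R N" shows "rg_module G R (rg_direct_sum M N)"
proof -
 interpret M: rg_module G R M by fact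
 interpret N: rg_module G R N by fact
 let ?D = "rg_direct_sum M N"
 have "abelian_group ?D"
 proof (rule abelian_groupI)
  fix q assume q: "q \<in> carrier ?D"
  then obtain x y where xy: "q = (x, y)" "x \<in> carrier M" "y \<in> carrier N" by (auto simp: direct_sum_sel)
  show "\<exists>z\<in>carrier ?D. z \<oplus>\<^bsub>?D\<^esub> q = \<zero>\<^bsub>?D\<^esub>"
   by (rule bexI[of _ "(\<ominus>\<^bsub>M\<^esub> x, \<ominus>\<^bsub>N\<^esub> y)"]) (use xy in \<open>auto simp: direct_sum_sel M.M.l_neg N.M.l_neg\<close>)
 qed (auto simp: direct_sum_sel M.M.a_ac N.M.a_ac)
 then have "module R ?D"
  by (rule moduleI[OF M.R.is_cring])
   (auto simp: direct_sum_sel M.smult_l_distr N.smult_l_distr M.smult_r_distr N.smult_r_distr M.smult_assoc1 N.smult_assoc1)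
 then show ?thesis
  by (rule rg_module.intro[OF M.G.is_group]) (unfold_locales,
   auto simp: direct_sum_sel M.act_closed N.act_closed M.act_add N.act_add M.act_smult N.act_smult M.act_one N.act_one M.act_mult N.act_mult)
qed

lemma fg_direct_sum:
 assumes fM: "fg_rg_module G R M" and fN: "fg_rg_module G R N" shows "fg_rg_module G R (rg_direct_sum M N)"
proof -
 interpret M: rg_module G R M by (rule fg_rg_moduleD[OF fM])
 interpret N: rg_module G R N by (rule fg_rg_moduleD[OF fN])
 let ?D = "rg_direct_sum M N"
 interpret D: rg_module G R ?D by (rule rg_module_direct_sum) unfold_locales
 obtain S where S: "finite S" "S \<subseteq> carrier M" "rg_submodule G R M hull S = carrier M" using fM by (auto simp: fg_rg_module_def)
 obtain T where T: "finite T" "T \<subseteq> carrier N" "rg_submodule G R N hull T = carrier N" using fN by (auto simp: fg_rg_module_def)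
 have a0: "act M g \<zero>\<^bsub>M\<^esub> = \<zero>\<^bsub>M\<^esub>" "act N g \<zero>\<^bsub>N\<^esub> = \<zero>\<^bsub>N\<^esub>" if "g \<in> carrier G" for g
  using M.act_smult[OF that M.R.zero_closed M.M.zero_closed] N.act_smult[OF that M.R.zero_closed N.M.zero_closed]
   M.act_closed[OF that M.M.zero_closed] N.act_closed[OF that N.M.zero_closed] by simp_all
 show ?thesis
 proof (rule D.fgI[of "(\<lambda>x. (x, \<zero>\<^bsub>N\<^esub>)) ` S \<union> (\<lambda>y. (\<zero>\<^bsub>M\<^esub>, y)) ` T"])
  show "finite ((\<lambda>x. (x, \<zero>\<^bsub>N\<^esub>)) ` S \<union> (\<lambda>y. (\<zero>\<^bsub>M\<^esub>, y)) ` T)" using S T by simp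
  show "(\<lambda>x. (x, \<zero>\<^bsub>N\<^esub>)) ` S \<union> (\<lambda>y. (\<zero>\<^bsub>M\<^esub>, y)) ` T \<subseteq> carrier ?D" using S(2) T(2) by (auto simp: direct_sum_sel)
  fix U assume U: "rg_submodule G R ?D U" and g: "(\<lambda>x. (x, \<zero>\<^bsub>N\<^esub>)) ` S \<union> (\<lambda>y. (\<zero>\<^bsub>M\<^esub>, y)) ` T \<subseteq> U"
  note UD = D.rg_submoduleD[OF U]
  have "rg_submodule G R M {x \<in> carrier M. (x, \<zero>\<^bsub>N\<^esub>) \<in> U}"
  proof (rule M.rg_submoduleI)
   show "\<zero>\<^bsub>M\<^esub> \<in> {x \<in> carrier M. (x, \<zero>\<^bsub>N\<^esub>) \<in> U}" using UD(2) by (simp add: direct_sum_sel)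
   fix x assume x: "x \<in> {x \<in> carrier M. (x, \<zero>\<^bsub>N\<^esub>) \<in> U}"
   show "x \<oplus>\<^bsub>M\<^esub> y \<in> {x \<in> carrier M. (x, \<zero>\<^bsub>N\<^esub>) \<in> U}" if "y \<in> {x \<in> carrier M. (x, \<zero>\<^bsub>N\<^esub>) \<in> U}" for y
    using UD(3)[of "(x, \<zero>\<^bsub>N\<^esub>)" "(y, \<zero>\<^bsub>N\<^esub>)"] x that by (simp add: direct_sum_sel)
   show "r \<odot>\<^bsub>M\<^esub> x \<in> {x \<in> carrier M. (x, \<zero>\<^bsub>N\<^esub>) \<in> U}" if "r \<in> carrier R" for r
    using UD(4)[OF that, of "(x, \<zero>\<^bsub>N\<^esub>)"] x that by (simp add: direct_sum_sel)
   show "act M h x \<in> {x \<in> carrier M. (x, \<zero>\<^bsub>N\<^esub>) \<in> U}" if "h \<in> carrier G" for h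
    using UD(5)[OF that, of "(x, \<zero>\<^bsub>N\<^esub>)"] x that a0(2)[OF that] M.act_closed[OF that] by (simp add: direct_sum_sel)
  qed auto
  moreover have "S \<subseteq> {x \<in> carrier M. (x, \<zero>\<^bsub>N\<^esub>) \<in> U}" using S(2) g by auto
  ultimately have 1: "carrier M \<subseteq> {x \<in> carrier M. (x, \<zero>\<^bsub>N\<^esub>) \<in> U}" unfolding S(3)[symmetric] by (rule hull_minimal[rotated])
  have "rg_submodule G R N {y \<in> carrier N. (\<zero>\<^bsub>M\<^esub>, y) \<in> U}"
  proof (rule N.rg_submoduleI)
   show "\<zero>\<^bsub>N\<^esub> \<in> {y \<in> carrier N. (\<zero>\<^bsub>M\<^esub>, y) \<in> U}" using UD(2) by (simp add: direct_sum_sel)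
   fix x assume x: "x \<in> {y \<in> carrier N. (\<zero>\<^bsub>M\<^esub>, y) \<in> U}"
   show "x \<oplus>\<^bsub>N\<^esub> y \<in> {y \<in> carrier N. (\<zero>\<^bsub>M\<^esub>, y) \<in> U}" if "y \<in> {y \<in> carrier N. (\<zero>\<^bsub>M\<^esub>, y) \<in> U}" for y
    using UD(3)[of "(\<zero>\<^bsub>M\<^esub>, x)" "(\<zero>\<^bsub>M\<^esub>, y)"] x that by (simp add: direct_sum_sel)
   show "r \<odot>\<^bsub>N\<^esub> x \<in> {y \<in> carrier N. (\<zero>\<^bsub>M\<^esub>, y) \<in> U}" if "r \<in> carrier R" for r
    using UD(4)[OF that, of "(\<zero>\<^bsub>M\<^esub>, x)"] x that by (simp add: direct_sum_sel)
   show "act N h x \<in> {y \<in> carrier N. (\<zero>\<^bsub>M\<^esub>, y) \<in> U}" if "h \<in> carrier G" for h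
    using UD(5)[OF that, of "(\<zero>\<^bsub>M\<^esub>, x)"] x that a0(1)[OF that] N.act_closed[OF that] by (simp add: direct_sum_sel)
  qed auto
  moreover have "T \<subseteq> {y \<in> carrier N. (\<zero>\<^bsub>M\<^esub>, y) \<in> U}" using T(2) g by auto
  ultimately have 2: "carrier N \<subseteq> {y \<in> carrier N. (\<zero>\<^bsub>M\<^esub>, y) \<in> U}" unfolding T(3)[symmetric] by (rule hull_minimal[rotated])
  show "carrier ?D \<subseteq> U"
  proof
   fix q assume "q \<in> carrier ?D"
   then obtain x y where xy: "q = (x, y)" "x \<in> carrier M" "y \<in> carrier N" by (auto simp: direct_sum_sel)
   then have "(x, \<zero>\<^bsub>N\<^esub>) \<in> U" "(\<zero>\<^bsub>M\<^esub>, y) \<in> U" using 1 2 by auto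
   from UD(3)[OF this] show "q \<in> U" using xy by (simp add: direct_sum_sel)
  qed
 qed
qed

lemma (in group) fg_perm_module:
 assumes R: "cring R" and X: "finite X" "gset G X a" shows "fg_rg_module G R (perm_module G R X a)"
proof -
 let ?P = "perm_module G R X a"
 interpret P: rg_module G R ?P by (rule rg_module_perm_module[OF assms])
 note c = perm_module_carrier[OF X(1), of G R a]
 define e where "e x = (\<lambda>y\<in>X. if y = x then \<one>\<^bsub>R\<^esub> else \<zero>\<^bsub>R\<^esub>)" for x
 show ?thesis
 proof (rule P.fgI[of "e ` X"])
  show "finite (e ` X)" using X by simp
  show "e ` X \<subseteq> carrier ?P" unfolding c by (auto simp: e_def)
  fix U assume U: "rg_submodule G R ?P U" and eU: "e ` X \<subseteq> U"
  note UD = P.rg_submoduleD[OF U]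
  \<comment> \<open>Induction on a finite set outside of which \<open>f\<close> vanishes, splitting
    off the value at one point in each step.\<close>
  have "\<forall>f\<in>carrier ?P. (\<forall>x\<in>X - A. f x = \<zero>\<^bsub>R\<^esub>) \<longrightarrow> f \<in> U" if "finite A" "A \<subseteq> X" for A
   using that
  proof (induction A rule: finite_induct)
   case empty
   have "f \<in> U" if "f \<in> carrier ?P" "\<forall>x\<in>X. f x = \<zero>\<^bsub>R\<^esub>" for f
   proof -
    have "f = \<zero>\<^bsub>?P\<^esub>" unfolding perm_module_sel(2)
     by (rule PiE_ext[of f X "\<lambda>_. carrier R"]) (use that c in auto)
    then show ?thesis using UD(2) by simp
   qed
   then show ?case by simp
  next
   case (insert x A)
   show ?case
   proof (intro ballI impI)
    fix f assume f: "f \<in> carrier ?P" and 0: "\<forall>y\<in>X - insert x A. f y = \<zero>\<^bsub>R\<^esub>"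
    have x: "x \<in> X" "f x \<in> carrier R" using insert.prems f c by auto
    define h where "h = (\<lambda>y\<in>X. if y = x then \<zero>\<^bsub>R\<^esub> else f y)"
    have h: "h \<in> carrier ?P" using f unfolding c h_def by auto
    have "h \<in> U" using insert.IH insert.prems h 0 by (auto simp: h_def)
    moreover have "f x \<odot>\<^bsub>?P\<^esub> e x \<in> U" by (rule UD(4)[OF x(2)]) (use eU x in blast)
    ultimately have "h \<oplus>\<^bsub>?P\<^esub> (f x \<odot>\<^bsub>?P\<^esub> e x) \<in> U" by (rule UD(3))
    moreover have "h \<oplus>\<^bsub>?P\<^esub> (f x \<odot>\<^bsub>?P\<^esub> e x) = f"
     unfolding perm_module_sel
    proof (rule PiE_ext[of _ X "\<lambda>_. carrier R"])
     show "f \<in> X \<rightarrow>\<^sub>E carrier R" using f c by simp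
     then have fc: "f y \<in> carrier R" if "y \<in> X" for y using that by auto
     show "(\<lambda>b\<in>X. h b \<oplus>\<^bsub>R\<^esub> (\<lambda>b\<in>X. f x \<otimes>\<^bsub>R\<^esub> e x b) b) \<in> X \<rightarrow>\<^sub>E carrier R" using fc x by (auto simp: h_def e_def)
     show "(\<lambda>b\<in>X. h b \<oplus>\<^bsub>R\<^esub> (\<lambda>b\<in>X. f x \<otimes>\<^bsub>R\<^esub> e x b) b) y = f y" if "y \<in> X" for y
      using that fc[OF that] x by (simp add: h_def e_def)
    qed
    ultimately show "f \<in> U" by simp
   qed
  qed
  from this[OF X(1) subset_refl] show "carrier ?P \<subseteq> U" by auto
 qed
qed

context group
begin

lemma perm_module_pullback:
 assumes X: "finite X" "gset G X a" and Y: "finite Y" "gset G Y b" and i: "giso G Y b X a i"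
 shows "rg_isomorphic G R (perm_module G R X a) (perm_module G R Y b)"
proof -
 note cX = perm_module_carrier[OF X(1), of G R a] and cY = perm_module_carrier[OF Y(1), of G R b]
 have bi: "bij_betw i Y X" and ei: "\<forall>g\<in>carrier G. \<forall>y\<in>Y. i (b g y) = a g (i y)" using i by (auto simp: giso_def)
 define j where "j = inv_into Y i"
 have iX: "i y \<in> X" if "y \<in> Y" for y by (rule bij_betw_apply[OF bi that])
 have jY: "j x \<in> Y" "i (j x) = x" if "x \<in> X" for x
  using bij_betw_apply[OF bij_betw_inv_into[OF bi] that] bij_betw_inv_into_right[OF bi that] by (auto simp: j_def)
 have ji: "j (i y) = y" if "y \<in> Y" for y using bij_betw_inv_into_left[OF bi that] by (simp add: j_def)
 show ?thesis
  unfolding rg_isomorphic_def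
 proof (intro exI[of _ "\<lambda>h. \<lambda>y\<in>Y. h (i y)"] conjI ballI)
  show "bij_betw (\<lambda>h. \<lambda>y\<in>Y. h (i y)) (carrier (perm_module G R X a)) (carrier (perm_module G R Y b))"
   unfolding cX cY
  proof (rule bij_betw_byWitness[where f' = "\<lambda>k. \<lambda>x\<in>X. k (j x)"])
   show "\<forall>h\<in>X \<rightarrow>\<^sub>E carrier R. (\<lambda>x\<in>X. (\<lambda>y\<in>Y. h (i y)) (j x)) = h"
    using jY by (auto simp: fun_eq_iff PiE_def extensional_def)
   show "\<forall>k\<in>Y \<rightarrow>\<^sub>E carrier R. (\<lambda>y\<in>Y. (\<lambda>x\<in>X. k (j x)) (i y)) = k"
    using ji iX by (auto simp: fun_eq_iff PiE_def extensional_def)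
  qed (use iX jY in auto)
  fix h assume h: "h \<in> carrier (perm_module G R X a)"
  show "(\<lambda>y\<in>Y. (h \<oplus>\<^bsub>perm_module G R X a\<^esub> k) (i y)) = (\<lambda>y\<in>Y. h (i y)) \<oplus>\<^bsub>perm_module G R Y b\<^esub> (\<lambda>y\<in>Y. k (i y))" for k
   unfolding perm_module_sel by (rule restrict_ext) (simp add: iX)
 next
  fix r h
  show "(\<lambda>y\<in>Y. (r \<odot>\<^bsub>perm_module G R X a\<^esub> h) (i y)) = r \<odot>\<^bsub>perm_module G R Y b\<^esub> (\<lambda>y\<in>Y. h (i y))"
   unfolding perm_module_sel by (rule restrict_ext) (simp add: iX)
 next
  fix g h assume g: "g \<in> carrier G"
  show "(\<lambda>y\<in>Y. act (perm_module G R X a) g h (i y)) = act (perm_module G R Y b) g (\<lambda>y\<in>Y. h (i y))"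
   unfolding perm_module_sel
  proof (rule restrict_ext)
   fix y assume y: "y \<in> Y"
   have "b (inv g) y \<in> Y" by (rule gsetD(1)[OF Y(2) inv_closed[OF g] y])
   then show "(\<lambda>x\<in>X. h (a (inv g) x)) (i y) = (\<lambda>y\<in>Y. h (i y)) (b (inv g) y)"
    using ei inv_closed[OF g] y iX[OF y] by simp
  qed
 qed
qed

lemma perm_module_giso:
 assumes X: "finite X" "gset G X a" and Y: "finite Y" "gset G Y b" and f: "giso G X a Y b f"
 shows "rg_isomorphic G R (perm_module G R X a) (perm_module G R Y b)"
 by (rule perm_module_pullback[OF X Y giso_inv[OF X(2) f]])

lemma perm_module_union:
 assumes X: "finite X" "gset G X a" and Y: "finite Y" "gset G Y a" and d: "X \<inter> Y = {}"
 shows "rg_isomorphic G R (perm_module G R (X \<union> Y) a) (rg_direct_sum (perm_module G R X a) (perm_module G R Y a))"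
proof -
 have cX: "carrier (perm_module G R X a) = X \<rightarrow>\<^sub>E carrier R" "carrier (perm_module G R Y a) = Y \<rightarrow>\<^sub>E carrier R"
  "carrier (perm_module G R (X \<union> Y) a) = X \<union> Y \<rightarrow>\<^sub>E carrier R"
  by (rule perm_module_carrier, use X Y in simp)+
 have nX: "y \<notin> X" if "y \<in> Y" for y using d that by blast
 show ?thesis
  unfolding rg_isomorphic_def
 proof (intro exI[of _ "\<lambda>h. (restrict h X, restrict h Y)"] conjI ballI)
  show "bij_betw (\<lambda>h. (restrict h X, restrict h Y)) (carrier (perm_module G R (X \<union> Y) a))
   (carrier (rg_direct_sum (perm_module G R X a) (perm_module G R Y a)))"
   unfolding direct_sum_sel cX
  proof (rule bij_betw_byWitness[where f' = "\<lambda>(h, k) x. if x \<in> X then h x else k x"])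
   show "\<forall>h\<in>X \<union> Y \<rightarrow>\<^sub>E carrier R. (case (restrict h X, restrict h Y) of (h, k) => \<lambda>x. if x \<in> X then h x else k x) = h"
    by (auto simp: fun_eq_iff PiE_def extensional_def)
   show "\<forall>q\<in>(X \<rightarrow>\<^sub>E carrier R) \<times> (Y \<rightarrow>\<^sub>E carrier R). (restrict (case q of (h, k) => \<lambda>x. if x \<in> X then h x else k x) X,
    restrict (case q of (h, k) => \<lambda>x. if x \<in> X then h x else k x) Y) = q"
    using nX by (auto simp: fun_eq_iff PiE_def extensional_def)
   show "(\<lambda>h. (restrict h X, restrict h Y)) ` (X \<union> Y \<rightarrow>\<^sub>E carrier R) \<subseteq> (X \<rightarrow>\<^sub>E carrier R) \<times> (Y \<rightarrow>\<^sub>E carrier R)" by auto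
   show "(\<lambda>(h, k) x. if x \<in> X then h x else k x) ` ((X \<rightarrow>\<^sub>E carrier R) \<times> (Y \<rightarrow>\<^sub>E carrier R)) \<subseteq> X \<union> Y \<rightarrow>\<^sub>E carrier R"
    by (auto simp: PiE_def extensional_def Pi_def)
  qed
 next
  fix h k
  show "(restrict (h \<oplus>\<^bsub>perm_module G R (X \<union> Y) a\<^esub> k) X, restrict (h \<oplus>\<^bsub>perm_module G R (X \<union> Y) a\<^esub> k) Y) =
   (restrict h X, restrict h Y) \<oplus>\<^bsub>rg_direct_sum (perm_module G R X a) (perm_module G R Y a)\<^esub> (restrict k X, restrict k Y)"
   unfolding direct_sum_sel perm_module_sel by (auto simp: fun_eq_iff)
 next
  fix r h
  show "(restrict (r \<odot>\<^bsub>perm_module G R (X \<union> Y) a\<^esub> h) X, restrict (r \<odot>\<^bsub>perm_module G R (X \<union> Y) a\<^esub> h) Y) =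
   r \<odot>\<^bsub>rg_direct_sum (perm_module G R X a) (perm_module G R Y a)\<^esub> (restrict h X, restrict h Y)"
   unfolding direct_sum_sel perm_module_sel by (auto simp: fun_eq_iff)
 next
  fix g h assume g: "g \<in> carrier G"
  have "a (inv g) x \<in> X" if "x \<in> X" for x by (rule gsetD(1)[OF X(2) inv_closed[OF g] that])
  moreover have "a (inv g) x \<in> Y" if "x \<in> Y" for x by (rule gsetD(1)[OF Y(2) inv_closed[OF g] that])
  ultimately show "(restrict (act (perm_module G R (X \<union> Y) a) g h) X, restrict (act (perm_module G R (X \<union> Y) a) g h) Y) =
   act (rg_direct_sum (perm_module G R X a) (perm_module G R Y a)) g (restrict h X, restrict h Y)"
   unfolding direct_sum_sel perm_module_sel by (auto simp: fun_eq_iff)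
 qed
qed

lemma perm_module_point:
 assumes "\<And>g. g \<in> carrier G ==> a g x = x"
 shows "rg_isomorphic G R (perm_module G R {x} a) (rg_trivial R)"
proof -
 have c: "carrier (perm_module G R {x} a) = {x} \<rightarrow>\<^sub>E carrier R" by (rule perm_module_carrier) simp
 show ?thesis
  unfolding rg_isomorphic_def
 proof (intro exI[of _ "\<lambda>h. h x"] conjI ballI)
  show "bij_betw (\<lambda>h. h x) (carrier (perm_module G R {x} a)) (carrier (rg_trivial R))"
   unfolding c
   by (rule bij_betw_byWitness[where f' = "\<lambda>r. \<lambda>y\<in>{x}. r"]) (auto simp: rg_trivial_def fun_eq_iff PiE_def extensional_def)
 qed (simp_all add: perm_module_sel rg_trivial_def assms)
qed

end

section \<open>Integer matrices acting on functions with values in \<open>R\<close>\<close>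

definition intr :: "('r, 'y) ring_scheme => int => 'r" where "intr R n = [n] \<cdot>\<^bsub>R\<^esub> \<one>\<^bsub>R\<^esub>"

context cring
begin

lemma intr_closed: "intr R n \<in> carrier R" by (simp add: intr_def)
lemma intr_1: "intr R 1 = \<one>" by (simp add: intr_def add.int_pow_1)
lemma intr_add: "intr R (m + n) = intr R m \<oplus> intr R n" by (simp add: intr_def add.int_pow_mult)
lemma intr_0: "intr R 0 = \<zero>"
proof -
 have "intr R 0 \<oplus> intr R 0 = intr R 0" using intr_add[of 0 0] by simp
 then show ?thesis using add.l_cancel_one[OF intr_closed[of 0] intr_closed[of 0]] by simp
qed
lemma intr_mult: "intr R (m * n) = intr R m \<otimes> intr R n"
proof -
 have "intr R m \<otimes> intr R n = [m] \<cdot> (\<one> \<otimes> ([n] \<cdot> \<one>))" unfolding intr_def by (rule add_pow_ldistr_int) auto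
 also have "\<dots> = [(n * m)] \<cdot> \<one>" by (simp add: add.int_pow_pow)
 finally show ?thesis by (simp add: intr_def mult.commute)
qed

lemma finsum_matrix_mult:
 assumes "finite B" and C: "finite C" and k: "\<And>c. c \<in> C ==> k c \<in> carrier R"
 shows "(\<Oplus>b\<in>B. intr R (P b) \<otimes> (\<Oplus>c\<in>C. intr R (Q b c) \<otimes> k c)) = (\<Oplus>c\<in>C. intr R (\<Sum>b\<in>B. P b * Q b c) \<otimes> k c)"
 using assms(1)
proof (induction B rule: finite_induct)
 case empty
 have "(\<Oplus>c\<in>C. intr R (\<Sum>b\<in>{}. P b * Q b c) \<otimes> k c) = (\<Oplus>c\<in>C. \<zero>)"
  by (rule finsum_cong') (use k in \<open>auto simp: intr_0\<close>)
 then show ?case by simp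
next
 case (insert b B)
 have kc: "(\<lambda>c. intr R (f c) \<otimes> k c) \<in> C \<rightarrow> carrier R" for f using k intr_closed by auto
 have s: "(\<Oplus>c\<in>C. intr R (f c) \<otimes> k c) \<in> carrier R" for f by (rule finsum_closed[OF kc])
 have "intr R (P b) \<otimes> (\<Oplus>c\<in>C. intr R (Q b c) \<otimes> k c) = (\<Oplus>c\<in>C. intr R (P b) \<otimes> (intr R (Q b c) \<otimes> k c))"
  by (rule finsum_rdistr[OF C intr_closed kc])
 also have "\<dots> = (\<Oplus>c\<in>C. intr R (P b * Q b c) \<otimes> k c)"
  by (rule finsum_cong') (use k intr_closed in \<open>auto simp: intr_mult m_assoc\<close>)
 finally have 1: "intr R (P b) \<otimes> (\<Oplus>c\<in>C. intr R (Q b c) \<otimes> k c) = (\<Oplus>c\<in>C. intr R (P b * Q b c) \<otimes> k c)" .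
 have "(\<Oplus>b\<in>insert b B. intr R (P b) \<otimes> (\<Oplus>c\<in>C. intr R (Q b c) \<otimes> k c)) =
  intr R (P b) \<otimes> (\<Oplus>c\<in>C. intr R (Q b c) \<otimes> k c) \<oplus> (\<Oplus>b\<in>B. intr R (P b) \<otimes> (\<Oplus>c\<in>C. intr R (Q b c) \<otimes> k c))"
  by (rule finsum_insert) (use insert.hyps s intr_closed in auto)
 also have "\<dots> = (\<Oplus>c\<in>C. intr R (P b * Q b c) \<otimes> k c \<oplus> intr R (\<Sum>b\<in>B. P b * Q b c) \<otimes> k c)"
  unfolding 1 insert.IH by (rule finsum_addf[symmetric]) (rule kc)+
 also have "\<dots> = (\<Oplus>c\<in>C. intr R (\<Sum>b\<in>insert b B. P b * Q b c) \<otimes> k c)"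
  by (rule finsum_cong') (use k intr_closed insert.hyps in \<open>auto simp: intr_add l_distr\<close>)
 finally show ?case .
qed

lemma finsum_delta:
 assumes "finite C" "x \<in> C" "\<And>c. c \<in> C ==> k c \<in> carrier R"
 shows "(\<Oplus>c\<in>C. intr R (if x = c then d else 0) \<otimes> k c) = intr R d \<otimes> k x"
proof -
 have "(\<Oplus>c\<in>C. intr R (if x = c then d else 0) \<otimes> k c) = (\<Oplus>c\<in>C. if x = c then intr R d \<otimes> k c else \<zero>)"
  by (rule finsum_cong') (use assms intr_closed in \<open>auto simp: intr_0\<close>)
 also have "\<dots> = intr R d \<otimes> k x" by (rule add.finprod_singleton) (use assms intr_closed in auto)
 finally show ?thesis .
qed

end

text \<open>The block of \<open>f\<close> with rows at odd and columns at even points acts as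
  \<open>\<phi>\<close>. The opposite block, multiplied by the inverse \<open>e\<close> of
  \<open>d\<close>, is its inverse, since both composites are blocks of the square of
  \<open>f\<close>.\<close>

lemma (in group) perm_module_oddop:
 assumes R: "cring R" and X: "sgset G X a s" and f: "oddop G X a s f d"
  and e: "e \<in> carrier R" "e \<otimes>\<^bsub>R\<^esub> intr R d = \<one>\<^bsub>R\<^esub>"
 shows "rg_isomorphic G R (perm_module G R {x\<in>X. \<not> s x} a) (perm_module G R {x\<in>X. s x} a)"
proof -
 interpret R: cring R by (rule R)
 note X' = sgsetD[OF X] and f' = oddopD[OF f]
 define A where "A = {x\<in>X. \<not> s x}"
 define B where "B = {x\<in>X. s x}"
 have fin: "finite A" "finite B" using X'(1) by (auto simp: A_def B_def)
 have gA: "gset G A a" by (rule gset_subset[OF X'(2)]) (use X'(3) gsetD(1)[OF X'(2)] in \<open>auto simp: A_def\<close>)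
 have gB: "gset G B a" by (rule gset_subset[OF X'(2)]) (use X'(3) gsetD(1)[OF X'(2)] in \<open>auto simp: B_def\<close>)
 have AX: "x \<in> A ==> x \<in> X" "x \<in> B ==> x \<in> X" for x by (auto simp: A_def B_def)
 have sAB: "(\<Sum>z\<in>B. f x z * f z y) = (if x = y then d else 0)" if "x \<in> A" "y \<in> A" for x y
 proof -
  have "(\<Sum>z\<in>X. f x z * f z y) = (\<Sum>z\<in>B. f x z * f z y)"
   by (rule sum.mono_neutral_right[OF X'(1)]) (use f'(1) that in \<open>auto simp: A_def B_def\<close>)
  then show ?thesis using f'(3) that AX by simp
 qed
 have sBA: "(\<Sum>z\<in>A. f x z * f z y) = (if x = y then d else 0)" if "x \<in> B" "y \<in> B" for x y
 proof -
  have "(\<Sum>z\<in>X. f x z * f z y) = (\<Sum>z\<in>A. f x z * f z y)"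
   by (rule sum.mono_neutral_right[OF X'(1)]) (use f'(1) that in \<open>auto simp: A_def B_def\<close>)
  then show ?thesis using f'(3) that AX by simp
 qed
 note cA = perm_module_carrier[OF fin(1), of G R a] and cB = perm_module_carrier[OF fin(2), of G R a]
 let ?PA = "perm_module G R A a" and ?PB = "perm_module G R B a"
 define \<phi> where "\<phi> h = (\<lambda>y\<in>B. \<Oplus>\<^bsub>R\<^esub>x\<in>A. intr R (f y x) \<otimes>\<^bsub>R\<^esub> h x)" for h
 define \<psi> where "\<psi> k = (\<lambda>x\<in>A. e \<otimes>\<^bsub>R\<^esub> (\<Oplus>\<^bsub>R\<^esub>y\<in>B. intr R (f x y) \<otimes>\<^bsub>R\<^esub> k y))" for k
 have hA: "h x \<in> carrier R" if "h \<in> carrier ?PA" "x \<in> A" for h x using that cA by auto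
 have hB: "h x \<in> carrier R" if "h \<in> carrier ?PB" "x \<in> B" for h x using that cB by auto
 have tA: "(\<lambda>x. intr R (F x) \<otimes>\<^bsub>R\<^esub> h x) \<in> A \<rightarrow> carrier R" if "h \<in> carrier ?PA" for h and F using hA[OF that] R.intr_closed by auto
 have tB: "(\<lambda>x. intr R (F x) \<otimes>\<^bsub>R\<^esub> h x) \<in> B \<rightarrow> carrier R" if "h \<in> carrier ?PB" for h and F using hB[OF that] R.intr_closed by auto
 have \<phi>c: "\<phi> h \<in> carrier ?PB" if "h \<in> carrier ?PA" for h unfolding cB \<phi>_def using R.finsum_closed[OF tA[OF that]] by auto
 have \<psi>c: "\<psi> h \<in> carrier ?PA" if "h \<in> carrier ?PB" for h unfolding cA \<psi>_def using R.finsum_closed[OF tB[OF that]] e by auto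
 have \<psi>\<phi>: "\<psi> (\<phi> h) = h" if h: "h \<in> carrier ?PA" for h
 proof (rule PiE_ext[of _ A "\<lambda>_. carrier R"])
  show "\<psi> (\<phi> h) \<in> A \<rightarrow>\<^sub>E carrier R" "h \<in> A \<rightarrow>\<^sub>E carrier R" using \<psi>c[OF \<phi>c[OF h]] h cA by auto
  fix x assume x: "x \<in> A"
  have "(\<Oplus>\<^bsub>R\<^esub>y\<in>B. intr R (f x y) \<otimes>\<^bsub>R\<^esub> \<phi> h y) = (\<Oplus>\<^bsub>R\<^esub>y\<in>B. intr R (f x y) \<otimes>\<^bsub>R\<^esub> (\<Oplus>\<^bsub>R\<^esub>x'\<in>A. intr R (f y x') \<otimes>\<^bsub>R\<^esub> h x'))"
   by (rule R.finsum_cong') (use R.finsum_closed[OF tA[OF h]] R.intr_closed in \<open>auto simp: \<phi>_def\<close>)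
  also have "\<dots> = (\<Oplus>\<^bsub>R\<^esub>x'\<in>A. intr R (\<Sum>y\<in>B. f x y * f y x') \<otimes>\<^bsub>R\<^esub> h x')"
   by (rule R.finsum_matrix_mult[OF fin(2,1)]) (rule hA[OF h])
  also have "\<dots> = (\<Oplus>\<^bsub>R\<^esub>x'\<in>A. intr R (if x = x' then d else 0) \<otimes>\<^bsub>R\<^esub> h x')"
   by (rule R.finsum_cong') (use hA[OF h] R.intr_closed sAB[OF x] in auto)
  also have "\<dots> = intr R d \<otimes>\<^bsub>R\<^esub> h x" by (rule R.finsum_delta[OF fin(1) x hA[OF h]])
  finally have "\<psi> (\<phi> h) x = e \<otimes>\<^bsub>R\<^esub> (intr R d \<otimes>\<^bsub>R\<^esub> h x)" using x by (simp add: \<psi>_def)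
  then show "\<psi> (\<phi> h) x = h x" using e R.intr_closed hA[OF h x] by (simp add: R.m_assoc[symmetric])
 qed
 have \<phi>\<psi>: "\<phi> (\<psi> h) = h" if h: "h \<in> carrier ?PB" for h
 proof (rule PiE_ext[of _ B "\<lambda>_. carrier R"])
  show "\<phi> (\<psi> h) \<in> B \<rightarrow>\<^sub>E carrier R" "h \<in> B \<rightarrow>\<^sub>E carrier R" using \<phi>c[OF \<psi>c[OF h]] h cB by auto
  fix y assume y: "y \<in> B"
  have sc: "(\<Oplus>\<^bsub>R\<^esub>y'\<in>B. intr R (f x y') \<otimes>\<^bsub>R\<^esub> h y') \<in> carrier R" for x by (rule R.finsum_closed[OF tB[OF h]])
  have "\<phi> (\<psi> h) y = (\<Oplus>\<^bsub>R\<^esub>x\<in>A. e \<otimes>\<^bsub>R\<^esub> (intr R (f y x) \<otimes>\<^bsub>R\<^esub> (\<Oplus>\<^bsub>R\<^esub>y'\<in>B. intr R (f x y') \<otimes>\<^bsub>R\<^esub> h y')))"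
   unfolding \<phi>_def using y sc e R.intr_closed
   by (simp add: \<psi>_def R.m_lcomm cong: R.finsum_cong)
  also have "\<dots> = e \<otimes>\<^bsub>R\<^esub> (\<Oplus>\<^bsub>R\<^esub>x\<in>A. intr R (f y x) \<otimes>\<^bsub>R\<^esub> (\<Oplus>\<^bsub>R\<^esub>y'\<in>B. intr R (f x y') \<otimes>\<^bsub>R\<^esub> h y'))"
   by (rule R.finsum_rdistr[OF fin(1) e(1), symmetric]) (use sc R.intr_closed in auto)
  also have "(\<Oplus>\<^bsub>R\<^esub>x\<in>A. intr R (f y x) \<otimes>\<^bsub>R\<^esub> (\<Oplus>\<^bsub>R\<^esub>y'\<in>B. intr R (f x y') \<otimes>\<^bsub>R\<^esub> h y')) = (\<Oplus>\<^bsub>R\<^esub>y'\<in>B. intr R (\<Sum>x\<in>A. f y x * f x y') \<otimes>\<^bsub>R\<^esub> h y')"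
   by (rule R.finsum_matrix_mult[OF fin]) (rule hB[OF h])
  also have "\<dots> = (\<Oplus>\<^bsub>R\<^esub>y'\<in>B. intr R (if y = y' then d else 0) \<otimes>\<^bsub>R\<^esub> h y')"
   by (rule R.finsum_cong') (use hB[OF h] R.intr_closed sBA[OF y] in auto)
  also have "\<dots> = intr R d \<otimes>\<^bsub>R\<^esub> h y" by (rule R.finsum_delta[OF fin(2) y hB[OF h]])
  finally show "\<phi> (\<psi> h) y = h y" using e R.intr_closed hB[OF h y] by (simp add: R.m_assoc[symmetric])
 qed
 have "rg_isomorphic G R ?PA ?PB"
  unfolding rg_isomorphic_def
 proof (intro exI[of _ \<phi>] conjI ballI)
  show "bij_betw \<phi> (carrier ?PA) (carrier ?PB)"
   by (rule bij_betw_byWitness[where f' = \<psi>]) (use \<psi>\<phi> \<phi>\<psi> \<phi>c \<psi>c in auto)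
  fix h assume h: "h \<in> carrier ?PA"
  show "\<phi> (h \<oplus>\<^bsub>?PA\<^esub> k) = \<phi> h \<oplus>\<^bsub>?PB\<^esub> \<phi> k" if k: "k \<in> carrier ?PA" for k
   unfolding perm_module_sel(3) \<phi>_def
  proof (rule restrict_ext)
   fix y assume y: "y \<in> B"
   have "(\<Oplus>\<^bsub>R\<^esub>x\<in>A. intr R (f y x) \<otimes>\<^bsub>R\<^esub> (\<lambda>b\<in>A. h b \<oplus>\<^bsub>R\<^esub> k b) x) =
    (\<Oplus>\<^bsub>R\<^esub>x\<in>A. intr R (f y x) \<otimes>\<^bsub>R\<^esub> h x \<oplus>\<^bsub>R\<^esub> intr R (f y x) \<otimes>\<^bsub>R\<^esub> k x)"
    by (rule R.finsum_cong') (use hA[OF h] hA[OF k] R.intr_closed in \<open>auto simp: R.r_distr\<close>)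
   also have "\<dots> = (\<Oplus>\<^bsub>R\<^esub>x\<in>A. intr R (f y x) \<otimes>\<^bsub>R\<^esub> h x) \<oplus>\<^bsub>R\<^esub> (\<Oplus>\<^bsub>R\<^esub>x\<in>A. intr R (f y x) \<otimes>\<^bsub>R\<^esub> k x)"
    by (rule R.finsum_addf[OF tA[OF h] tA[OF k]])
   finally show "(\<Oplus>\<^bsub>R\<^esub>x\<in>A. intr R (f y x) \<otimes>\<^bsub>R\<^esub> (\<lambda>b\<in>A. h b \<oplus>\<^bsub>R\<^esub> k b) x) =
    (\<lambda>y\<in>B. \<Oplus>\<^bsub>R\<^esub>x\<in>A. intr R (f y x) \<otimes>\<^bsub>R\<^esub> h x) y \<oplus>\<^bsub>R\<^esub> (\<lambda>y\<in>B. \<Oplus>\<^bsub>R\<^esub>x\<in>A. intr R (f y x) \<otimes>\<^bsub>R\<^esub> k x) y"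
    using y by simp
  qed
 next
  fix r h assume r: "r \<in> carrier R" and h: "h \<in> carrier ?PA"
  show "\<phi> (r \<odot>\<^bsub>?PA\<^esub> h) = r \<odot>\<^bsub>?PB\<^esub> \<phi> h"
   unfolding perm_module_sel(4) \<phi>_def
  proof (rule restrict_ext)
   fix y assume y: "y \<in> B"
   have "(\<Oplus>\<^bsub>R\<^esub>x\<in>A. intr R (f y x) \<otimes>\<^bsub>R\<^esub> (\<lambda>b\<in>A. r \<otimes>\<^bsub>R\<^esub> h b) x) = (\<Oplus>\<^bsub>R\<^esub>x\<in>A. r \<otimes>\<^bsub>R\<^esub> (intr R (f y x) \<otimes>\<^bsub>R\<^esub> h x))"
    by (rule R.finsum_cong') (use hA[OF h] r R.intr_closed in \<open>auto simp: R.m_lcomm\<close>)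
   also have "\<dots> = r \<otimes>\<^bsub>R\<^esub> (\<Oplus>\<^bsub>R\<^esub>x\<in>A. intr R (f y x) \<otimes>\<^bsub>R\<^esub> h x)"
    by (rule R.finsum_rdistr[OF fin(1) r tA[OF h], symmetric])
   finally show "(\<Oplus>\<^bsub>R\<^esub>x\<in>A. intr R (f y x) \<otimes>\<^bsub>R\<^esub> (\<lambda>b\<in>A. r \<otimes>\<^bsub>R\<^esub> h b) x) =
    r \<otimes>\<^bsub>R\<^esub> (\<lambda>y\<in>B. \<Oplus>\<^bsub>R\<^esub>x\<in>A. intr R (f y x) \<otimes>\<^bsub>R\<^esub> h x) y" using y by simp
  qed
 next
  fix g h assume g: "g \<in> carrier G" and h: "h \<in> carrier ?PA"
  show "\<phi> (act ?PA g h) = act ?PB g (\<phi> h)"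
   unfolding perm_module_sel(5) \<phi>_def
  proof (rule restrict_ext)
   fix y assume y: "y \<in> B"
   note gi = inv_closed[OF g]
   have gy: "a (inv g) y \<in> B" by (rule gsetD(1)[OF gB gi y])
   have im: "a (inv g) ` A = A" using gset_bij[OF gA gi] by (simp add: bij_betw_def)
   have inj: "inj_on (a (inv g)) A" using gset_bij[OF gA gi] by (simp add: bij_betw_def)
   have "(\<Oplus>\<^bsub>R\<^esub>x\<in>A. intr R (f (a (inv g) y) x) \<otimes>\<^bsub>R\<^esub> h x) = (\<Oplus>\<^bsub>R\<^esub>x\<in>a (inv g) ` A. intr R (f (a (inv g) y) x) \<otimes>\<^bsub>R\<^esub> h x)"
    by (simp only: im)
   also have "\<dots> = (\<Oplus>\<^bsub>R\<^esub>x\<in>A. intr R (f (a (inv g) y) (a (inv g) x)) \<otimes>\<^bsub>R\<^esub> h (a (inv g) x))"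
    by (rule R.add.finprod_reindex[OF _ inj]) (unfold im, use tA[OF h, of "f (a (inv g) y)"] in simp)
   also have "\<dots> = (\<Oplus>\<^bsub>R\<^esub>x\<in>A. intr R (f y x) \<otimes>\<^bsub>R\<^esub> (\<lambda>x\<in>A. h (a (inv g) x)) x)"
    by (rule R.finsum_cong') (use hA[OF h] gsetD(1)[OF gA gi] R.intr_closed f'(2)[OF gi] AX y in auto)
   finally show "(\<Oplus>\<^bsub>R\<^esub>x\<in>A. intr R (f y x) \<otimes>\<^bsub>R\<^esub> (\<lambda>x\<in>A. h (a (inv g) x)) x) =
    (\<lambda>y\<in>B. \<Oplus>\<^bsub>R\<^esub>x\<in>A. intr R (f y x) \<otimes>\<^bsub>R\<^esub> h x) (a (inv g) y)" using gy by simp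
  qed
 qed
 then show ?thesis by (simp only: A_def B_def)
qed

section \<open>The class of a module in \<open>A\<^sub>R(G)\<close>\<close>

lemma rg_direct_sum_cong:
 assumes "rg_isomorphic G R M M'" "rg_isomorphic G R N N'"
 shows "rg_isomorphic G R (rg_direct_sum M N) (rg_direct_sum M' N')"
proof -
 obtain \<phi> where b: "bij_betw \<phi> (carrier M) (carrier M')"
  and ad: "\<forall>x\<in>carrier M. \<forall>y\<in>carrier M. \<phi> (x \<oplus>\<^bsub>M\<^esub> y) = \<phi> x \<oplus>\<^bsub>M'\<^esub> \<phi> y"
  and sm: "\<forall>r\<in>carrier R. \<forall>x\<in>carrier M. \<phi> (r \<odot>\<^bsub>M\<^esub> x) = r \<odot>\<^bsub>M'\<^esub> \<phi> x"
  and ac: "\<forall>g\<in>carrier G. \<forall>x\<in>carrier M. \<phi> (act M g x) = act M' g (\<phi> x)"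
  using assms(1) unfolding rg_isomorphic_def by (elim exE conjE)
 obtain \<psi> where b': "bij_betw \<psi> (carrier N) (carrier N')"
  and ad': "\<forall>x\<in>carrier N. \<forall>y\<in>carrier N. \<psi> (x \<oplus>\<^bsub>N\<^esub> y) = \<psi> x \<oplus>\<^bsub>N'\<^esub> \<psi> y"
  and sm': "\<forall>r\<in>carrier R. \<forall>x\<in>carrier N. \<psi> (r \<odot>\<^bsub>N\<^esub> x) = r \<odot>\<^bsub>N'\<^esub> \<psi> x"
  and ac': "\<forall>g\<in>carrier G. \<forall>x\<in>carrier N. \<psi> (act N g x) = act N' g (\<psi> x)"
  using assms(2) unfolding rg_isomorphic_def by (elim exE conjE)
 show ?thesis
  unfolding rg_isomorphic_def
 proof (intro exI[of _ "map_prod \<phi> \<psi>"] conjI ballI)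
  show "bij_betw (map_prod \<phi> \<psi>) (carrier (rg_direct_sum M N)) (carrier (rg_direct_sum M' N'))"
   unfolding direct_sum_sel by (rule bij_betw_map_prod[OF b b'])
 qed (use ad sm ac ad' sm' ac' in \<open>auto simp: direct_sum_sel\<close>)
qed

lemma rg_direct_sum_commute: "rg_isomorphic G R (rg_direct_sum M N) (rg_direct_sum N M)"
 unfolding rg_isomorphic_def
proof (intro exI[of _ prod.swap] conjI ballI)
 show "bij_betw prod.swap (carrier (rg_direct_sum M N)) (carrier (rg_direct_sum N M))"
  unfolding direct_sum_sel by (rule bij_betw_byWitness[where f' = prod.swap]) auto
qed (auto simp: direct_sum_sel)

lemma rg_direct_sum_assoc:
 "rg_isomorphic G R (rg_direct_sum (rg_direct_sum M N) P) (rg_direct_sum M (rg_direct_sum N P))"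
 unfolding rg_isomorphic_def
proof (intro exI[of _ "\<lambda>((x, y), z). (x, (y, z))"] conjI ballI)
 show "bij_betw (\<lambda>((x, y), z). (x, (y, z))) (carrier (rg_direct_sum (rg_direct_sum M N) P)) (carrier (rg_direct_sum M (rg_direct_sum N P)))"
  unfolding direct_sum_sel by (rule bij_betw_byWitness[where f' = "\<lambda>(x, (y, z)). ((x, y), z)"]) auto
qed (auto simp: direct_sum_sel)

text \<open>A zero module of the type \<open>rep\<close>; its one element is the empty set of
  sequences. It exhibits the zero of \<open>iso_class_semiring\<close> as an isomorphism
  class.\<close>

definition zero_rep :: "('g, 'r) rep" where
 "zero_rep = \<lparr>carrier = {{}}, monoid.mult = undefined, one = undefined, zero = {}, add = (\<lambda>_ _. {}),
   module.smult = (\<lambda>_ _. {}), act = (\<lambda>_ _. {})\<rparr>"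

lemma fg_zero_rep:
 assumes "Group.group G" "cring R"
 shows "fg_rg_module G R (zero_rep :: ('g, 'r) rep)"
proof -
 interpret cring R by fact
 have "abelian_group (zero_rep :: ('g, 'r) rep)" by (rule abelian_groupI) (auto simp: zero_rep_def)
 then have "module R (zero_rep :: ('g, 'r) rep)" by (rule moduleI[OF assms(2)]) (auto simp: zero_rep_def)
 then interpret Z: rg_module G R "zero_rep :: ('g, 'r) rep"
  by (rule rg_module.intro[OF assms(1)]) (unfold_locales, auto simp: zero_rep_def)
 show ?thesis
 proof (rule Z.fgI[of "{}"])
  fix U assume "rg_submodule G R (zero_rep :: ('g, 'r) rep) U"
  from Z.rg_submoduleD(2)[OF this] show "carrier (zero_rep :: ('g, 'r) rep) \<subseteq> U" by (simp add: zero_rep_def)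
 qed auto
qed

lemma iso_class_zero_rep:
 fixes G :: "('g, 'x) monoid_scheme" and R :: "('r, 'y) ring_scheme"
 shows "iso_class G R (zero_rep :: ('g, 'r) rep) = {L. fg_rg_module G R L \<and> carrier L = {\<zero>\<^bsub>L\<^esub>}}"
proof -
 have "rg_isomorphic G R (zero_rep :: ('g, 'r) rep) L \<longleftrightarrow> carrier L = {\<zero>\<^bsub>L\<^esub>}" if L: "fg_rg_module G R L" for L :: "('g, 'r) rep"
 proof -
  interpret L: rg_module G R L by (rule fg_rg_moduleD[OF L])
  show ?thesis
  proof
   assume "rg_isomorphic G R (zero_rep :: ('g, 'r) rep) L"
   then obtain \<phi> where "bij_betw \<phi> (carrier (zero_rep :: ('g, 'r) rep)) (carrier L)" unfolding rg_isomorphic_def by blast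
   then have "carrier L = {\<phi> {}}" by (simp add: bij_betw_def zero_rep_def)
   moreover have "\<zero>\<^bsub>L\<^esub> \<in> carrier L" by simp
   ultimately show "carrier L = {\<zero>\<^bsub>L\<^esub>}" by simp
  next
   assume c: "carrier L = {\<zero>\<^bsub>L\<^esub>}"
   have a: "act L g \<zero>\<^bsub>L\<^esub> = \<zero>\<^bsub>L\<^esub>" if "g \<in> carrier G" for g using L.act_closed[OF that, of "\<zero>\<^bsub>L\<^esub>"] c by simp
   show "rg_isomorphic G R (zero_rep :: ('g, 'r) rep) L"
    unfolding rg_isomorphic_def
    by (intro exI[of _ "\<lambda>_. \<zero>\<^bsub>L\<^esub>"]) (use a in \<open>simp add: c zero_rep_def bij_betw_def\<close>)
  qed
 qed
 then show ?thesis unfolding iso_class_def by blast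
qed

lemma rg_direct_sum_zero:
 assumes "rg_module G R M"
 shows "rg_isomorphic G R (rg_direct_sum M (zero_rep :: ('g, 'r) rep)) M"
 unfolding rg_isomorphic_def
proof (intro exI[of _ fst] conjI ballI)
 show "bij_betw fst (carrier (rg_direct_sum M (zero_rep :: ('g, 'r) rep))) (carrier M)"
  unfolding direct_sum_sel by (rule bij_betw_byWitness[where f' = "\<lambda>x. (x, {})"]) (auto simp: zero_rep_def)
qed (auto simp: direct_sum_sel)

context
 fixes G :: "('g, 'x) monoid_scheme" and R :: "('r, 'y) ring_scheme"
 assumes gG: "Group.group G" and finG: "finite (carrier G)" and cR: "cring R"
begin

lemma iso_class_carrier:
 assumes M: "fg_rg_module G R M" shows "iso_class G R M \<in> carrier (iso_class_semiring G R)"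
proof -
 obtain L where L: "L \<in> iso_class G R M" using iso_class_nonempty[OF finG M] by blast
 then have "iso_class G R M = iso_class G R L" "fg_rg_module G R L"
  using iso_class_cong[OF fg_rg_moduleD[OF M]] by (auto simp: iso_class_def[of G R M])
 then show ?thesis unfolding iso_class_semiring_def by auto
qed

text \<open>The sum is defined as a union over all representatives. All members of the union
  coincide, and the union is not empty by \<open>iso_class_nonempty\<close>, which also covers
  modules over types other than that of \<open>rep\<close>.\<close>

lemma iso_class_add:
 assumes M: "fg_rg_module G R M" and N: "fg_rg_module G R N"
 shows "iso_class G R M \<oplus>\<^bsub>iso_class_semiring G R\<^esub> iso_class G R N = iso_class G R (rg_direct_sum M N)"
proof -
 have e: "iso_class G R (rg_direct_sum M' N') = iso_class G R (rg_direct_sum M N)"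
  if "M' \<in> iso_class G R M" "N' \<in> iso_class G R N" for M' N' :: "('g, 'r) rep"
  using iso_class_cong[OF rg_module_direct_sum[OF fg_rg_moduleD[OF M] fg_rg_moduleD[OF N]], OF rg_direct_sum_cong] that
  unfolding iso_class_def[of G R M] iso_class_def[of G R N] by auto
 have "iso_class G R M \<oplus>\<^bsub>iso_class_semiring G R\<^esub> iso_class G R N =
  (\<Union>M'\<in>iso_class G R M. \<Union>N'\<in>iso_class G R N. iso_class G R (rg_direct_sum M' N'))" by (simp add: iso_class_semiring_def)
 also have "\<dots> = (\<Union>M'\<in>iso_class G R M. \<Union>N'\<in>iso_class G R N. iso_class G R (rg_direct_sum M N))"
  by (intro SUP_cong refl e)
 finally show ?thesis using iso_class_nonempty[OF finG M] iso_class_nonempty[OF finG N] by simp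
qed

lemma iso_class_semiringE:
 assumes "X \<in> carrier (iso_class_semiring G R)"
 obtains M :: "('g, 'r) rep" where "fg_rg_module G R M" "X = iso_class G R M"
 using assms unfolding iso_class_semiring_def by auto

lemma iso_class_zero: "\<zero>\<^bsub>iso_class_semiring G R\<^esub> = iso_class G R (zero_rep :: ('g, 'r) rep)"
 by (simp add: iso_class_semiring_def iso_class_zero_rep)

lemma abelian_monoid_iso_class_semiring: "abelian_monoid (iso_class_semiring G R)"
proof (rule abelian_monoidI)
 let ?S = "iso_class_semiring G R"
 show "\<zero>\<^bsub>?S\<^esub> \<in> carrier ?S" unfolding iso_class_zero by (rule iso_class_carrier[OF fg_zero_rep[OF gG cR]])
 fix X assume "X \<in> carrier ?S"
 then obtain M :: "('g, 'r) rep" where M: "fg_rg_module G R M" "X = iso_class G R M" by (rule iso_class_semiringE)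
 note mM = fg_rg_moduleD[OF M(1)]
 have "\<zero>\<^bsub>?S\<^esub> \<oplus>\<^bsub>?S\<^esub> X = iso_class G R (rg_direct_sum (zero_rep :: ('g, 'r) rep) M)"
  unfolding M iso_class_zero by (rule iso_class_add[OF fg_zero_rep[OF gG cR] M(1)])
 also have "\<dots> = iso_class G R M"
  by (rule iso_class_cong[OF fg_rg_moduleD[OF fg_direct_sum[OF fg_zero_rep[OF gG cR] M(1)]] iso_transI[OF rg_direct_sum_commute rg_direct_sum_zero[OF mM]]])
 finally show "\<zero>\<^bsub>?S\<^esub> \<oplus>\<^bsub>?S\<^esub> X = X" by (simp add: M)
 fix Y assume "Y \<in> carrier ?S"
 then obtain N :: "('g, 'r) rep" where N: "fg_rg_module G R N" "Y = iso_class G R N" by (rule iso_class_semiringE)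
 show "X \<oplus>\<^bsub>?S\<^esub> Y \<in> carrier ?S" unfolding M N iso_class_add[OF M(1) N(1)] by (rule iso_class_carrier[OF fg_direct_sum[OF M(1) N(1)]])
 show "X \<oplus>\<^bsub>?S\<^esub> Y = Y \<oplus>\<^bsub>?S\<^esub> X"
  unfolding M N iso_class_add[OF M(1) N(1)] iso_class_add[OF N(1) M(1)]
  by (rule iso_class_cong[OF fg_rg_moduleD[OF fg_direct_sum[OF M(1) N(1)]] rg_direct_sum_commute])
 fix Z assume "Z \<in> carrier ?S"
 then obtain P :: "('g, 'r) rep" where P: "fg_rg_module G R P" "Z = iso_class G R P" by (rule iso_class_semiringE)
 show "X \<oplus>\<^bsub>?S\<^esub> Y \<oplus>\<^bsub>?S\<^esub> Z = X \<oplus>\<^bsub>?S\<^esub> (Y \<oplus>\<^bsub>?S\<^esub> Z)"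
  unfolding M N P iso_class_add[OF M(1) N(1)] iso_class_add[OF N(1) P(1)] iso_class_add[OF fg_direct_sum[OF M(1) N(1)] P(1)]
   iso_class_add[OF M(1) fg_direct_sum[OF N(1) P(1)]]
  by (rule iso_class_cong[OF fg_rg_moduleD[OF fg_direct_sum[OF fg_direct_sum[OF M(1) N(1)] P(1)]] rg_direct_sum_assoc])
qed

end

context abelian_monoid
begin

text \<open>For transitivity the two equations are added; the component \<open>d\<close> of the
  middle pair survives on both sides and is absorbed into the auxiliary summand.\<close>

lemma equiv_grothendieck_rel: "equiv (carrier G \<times> carrier G) (grothendieck_rel G)"
proof (rule equivI)
 show "grothendieck_rel G \<subseteq> (carrier G \<times> carrier G) \<times> (carrier G \<times> carrier G)" by (auto simp: grothendieck_rel_def)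
 show "refl_on (carrier G \<times> carrier G) (grothendieck_rel G)"
  by (auto simp: refl_on_def grothendieck_rel_def intro!: bexI[of _ "\<zero>"])
 show "sym (grothendieck_rel G)" unfolding sym_def grothendieck_rel_def by force
 show "trans (grothendieck_rel G)"
  unfolding trans_def
 proof (intro allI impI)
  fix x y z assume "(x, y) \<in> grothendieck_rel G" "(y, z) \<in> grothendieck_rel G"
  then obtain a b c d e f k l where xyz: "x = (a, b)" "y = (c, d)" "z = (e, f)"
   and c: "a \<in> carrier G" "b \<in> carrier G" "c \<in> carrier G" "d \<in> carrier G" "e \<in> carrier G" "f \<in> carrier G" "k \<in> carrier G" "l \<in> carrier G"
   and k: "a \<oplus> d \<oplus> k = c \<oplus> b \<oplus> k" and l: "c \<oplus> f \<oplus> l = e \<oplus> d \<oplus> l"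
   unfolding grothendieck_rel_def by blast
  have "a \<oplus> f \<oplus> (d \<oplus> k \<oplus> l) = (a \<oplus> d \<oplus> k) \<oplus> (f \<oplus> l)" using c by (simp add: a_ac)
  also have "\<dots> = (c \<oplus> f \<oplus> l) \<oplus> (b \<oplus> k)" unfolding k using c by (simp add: a_ac)
  also have "\<dots> = e \<oplus> b \<oplus> (d \<oplus> k \<oplus> l)" unfolding l using c by (simp add: a_ac)
  finally show "(x, z) \<in> grothendieck_rel G"
   unfolding xyz grothendieck_rel_def using c by (auto intro!: bexI[of _ "d \<oplus> k \<oplus> l"])
 qed
qed

lemma grothendieck_diff_closed: "a \<in> carrier G ==> b \<in> carrier G ==> grothendieck_diff G a b \<in> carrier (grothendieck_ring G)"
 unfolding grothendieck_ring_def grothendieck_diff_def by (auto intro!: quotientI)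

lemma grothendieck_diff_add:
 assumes c: "a \<in> carrier G" "b \<in> carrier G" "c \<in> carrier G" "d \<in> carrier G"
 shows "grothendieck_diff G a b \<oplus>\<^bsub>grothendieck_ring G\<^esub> grothendieck_diff G c d = grothendieck_diff G (a \<oplus> c) (b \<oplus> d)"
proof -
 have e: "grothendieck_diff G (a' \<oplus> c') (b' \<oplus> d') = grothendieck_diff G (a \<oplus> c) (b \<oplus> d)"
  if ab: "(a', b') \<in> grothendieck_diff G a b" and cd: "(c', d') \<in> grothendieck_diff G c d" for a' b' c' d'
 proof -
  obtain k where k: "a' \<in> carrier G" "b' \<in> carrier G" "k \<in> carrier G" "a \<oplus> b' \<oplus> k = a' \<oplus> b \<oplus> k"
   using ab unfolding grothendieck_diff_def grothendieck_rel_def by blast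
  obtain l where l: "c' \<in> carrier G" "d' \<in> carrier G" "l \<in> carrier G" "c \<oplus> d' \<oplus> l = c' \<oplus> d \<oplus> l"
   using cd unfolding grothendieck_diff_def grothendieck_rel_def by blast
  have "(a \<oplus> c) \<oplus> (b' \<oplus> d') \<oplus> (k \<oplus> l) = (a \<oplus> b' \<oplus> k) \<oplus> (c \<oplus> d' \<oplus> l)" using c k(1-3) l(1-3) by (simp add: a_ac)
  also have "\<dots> = (a' \<oplus> c') \<oplus> (b \<oplus> d) \<oplus> (k \<oplus> l)" unfolding k(4) l(4) using c k(1-3) l(1-3) by (simp add: a_ac)
  finally have "((a \<oplus> c, b \<oplus> d), (a' \<oplus> c', b' \<oplus> d')) \<in> grothendieck_rel G"
   unfolding grothendieck_rel_def using c k(1-3) l(1-3) by (auto intro!: bexI[of _ "k \<oplus> l"])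
  from equiv_class_eq[OF equiv_grothendieck_rel this] show ?thesis by (simp add: grothendieck_diff_def)
 qed
 have ne: "(a, b) \<in> grothendieck_diff G a b" "(c, d) \<in> grothendieck_diff G c d"
  unfolding grothendieck_diff_def using c equiv_class_self[OF equiv_grothendieck_rel] by auto
 have "grothendieck_diff G a b \<oplus>\<^bsub>grothendieck_ring G\<^esub> grothendieck_diff G c d =
  (\<Union>q\<in>grothendieck_diff G a b. \<Union>r\<in>grothendieck_diff G c d. grothendieck_diff G (fst q \<oplus> fst r) (snd q \<oplus> snd r))"
  by (simp add: grothendieck_ring_def split_def)
 also have "\<dots> = (\<Union>q\<in>grothendieck_diff G a b. \<Union>r\<in>grothendieck_diff G c d. grothendieck_diff G (a \<oplus> c) (b \<oplus> d))"
  by (intro SUP_cong refl) (use e in auto)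
 also have "\<dots> = grothendieck_diff G (a \<oplus> c) (b \<oplus> d)" using ne by blast
 finally show ?thesis .
qed

end

section \<open>Tensor products\<close>

context
 fixes R :: "('r, 'y) ring_scheme" and M :: "('r, 'm, 'z) module_scheme" and N :: "('r, 'n, 'w) module_scheme"
 assumes cR: "cring R"
begin

lemma tensor_gen_closed: "tensor_gen R M N m n \<in> carrier (tensor_free R M N)"
proof -
 interpret cring R by (rule cR)
 have "finite {b \<in> carrier M \<times> carrier N. free_gen R (carrier M \<times> carrier N) (m, n) b \<noteq> \<zero>\<^bsub>R\<^esub>}"
  by (rule finite_subset[of _ "{(m, n)}"]) (auto simp: free_gen_def)
 then show ?thesis by (auto simp: tensor_gen_def tensor_free_def free_module_def free_gen_def)
qed

lemma tensor_kernel_submodule: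
 "submodule (tensor_kernel R M N) R (tensor_free R M N)" "tensor_relators R M N \<subseteq> tensor_kernel R M N"
proof -
 interpret F: module R "tensor_free R M N" unfolding tensor_free_def by (rule module_free_module[OF cR])
 have "tensor_relators R M N \<subseteq> carrier (tensor_free R M N)"
  unfolding tensor_relators_def Let_def using tensor_gen_closed by auto
 then show "submodule (tensor_kernel R M N) R (tensor_free R M N)" unfolding tensor_kernel_def by (rule F.submodule_span)
 show "tensor_relators R M N \<subseteq> tensor_kernel R M N" unfolding tensor_kernel_def by (rule hull_subset)
qed

lemma tensor_kernel_subgroup: "abelian_subgroup (tensor_kernel R M N) (tensor_free R M N)"
proof -
 interpret F: module R "tensor_free R M N" unfolding tensor_free_def by (rule module_free_module[OF cR])
 show ?thesis
  by (rule abelian_subgroupI2[OF F.M.a_comm_group submodule.axioms(1)[OF tensor_kernel_submodule(1)]])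
qed

lemma tensor_algebra_sel:
 "carrier (tensor_algebra R M N) = a_rcosets\<^bsub>tensor_free R M N\<^esub> (tensor_kernel R M N)"
 "zero (tensor_algebra R M N) = tensor_kernel R M N" "add (tensor_algebra R M N) = set_add (tensor_free R M N)"
 by (simp_all add: tensor_algebra_def tensor_module_def quotient_module_def)

lemma abelian_group_tensor_algebra: "abelian_group (tensor_algebra R M N)"
proof -
 interpret K: abelian_subgroup "tensor_kernel R M N" "tensor_free R M N" by (rule tensor_kernel_subgroup)
 interpret C: comm_group "tensor_free R M N A_Mod tensor_kernel R M N" by (rule K.a_factorgroup_is_comm_group)
 have c: "carrier (tensor_algebra R M N) = carrier (tensor_free R M N A_Mod tensor_kernel R M N)"
  "zero (tensor_algebra R M N) = one (tensor_free R M N A_Mod tensor_kernel R M N)"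
  "add (tensor_algebra R M N) = monoid.mult (tensor_free R M N A_Mod tensor_kernel R M N)"
  by (simp_all add: tensor_algebra_sel A_FactGroup_def')
 show ?thesis by (rule abelian_groupI; unfold c) (simp_all add: C.m_ac C.l_inv_ex del: add_A_FactGroup)
qed

lemma pure_tensor_closed: "pure_tensor R M N m n \<in> carrier (tensor_algebra R M N)"
proof -
 interpret K: abelian_subgroup "tensor_kernel R M N" "tensor_free R M N" by (rule tensor_kernel_subgroup)
 show ?thesis unfolding pure_tensor_def tensor_algebra_sel A_RCOSETS_def' using tensor_gen_closed by blast
qed

lemma pure_tensor_relator:
 assumes "tensor_gen R M N m n \<ominus>\<^bsub>tensor_free R M N\<^esub> (tensor_gen R M N m' n' \<oplus>\<^bsub>tensor_free R M N\<^esub> tensor_gen R M N m'' n'') \<in> tensor_relators R M N"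
 shows "pure_tensor R M N m n = pure_tensor R M N m' n' \<oplus>\<^bsub>tensor_algebra R M N\<^esub> pure_tensor R M N m'' n''"
proof -
 interpret K: abelian_subgroup "tensor_kernel R M N" "tensor_free R M N" by (rule tensor_kernel_subgroup)
 note g = tensor_gen_closed
 let ?s = "tensor_gen R M N m' n' \<oplus>\<^bsub>tensor_free R M N\<^esub> tensor_gen R M N m'' n''"
 have s: "?s \<in> carrier (tensor_free R M N)" using g by simp
 have "tensor_gen R M N m n \<oplus>\<^bsub>tensor_free R M N\<^esub> \<ominus>\<^bsub>tensor_free R M N\<^esub> ?s \<in> tensor_kernel R M N"
  using assms tensor_kernel_submodule(2) by (auto simp: a_minus_def)
 from K.a_rcos_module_rev[OF s g this] have "tensor_gen R M N m n \<in> tensor_kernel R M N +>\<^bsub>tensor_free R M N\<^esub> ?s" .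
 from K.a_repr_independence'[OF this s] show ?thesis
  unfolding pure_tensor_def tensor_algebra_sel K.a_rcos_sum[OF g g] by simp
qed

lemma pure_tensor_add_left:
 "m \<in> carrier M ==> m' \<in> carrier M ==> n \<in> carrier N ==>
  pure_tensor R M N (m \<oplus>\<^bsub>M\<^esub> m') n = pure_tensor R M N m n \<oplus>\<^bsub>tensor_algebra R M N\<^esub> pure_tensor R M N m' n"
 by (rule pure_tensor_relator) (unfold tensor_relators_def Let_def, blast)

lemma pure_tensor_add_right:
 "m \<in> carrier M ==> n \<in> carrier N ==> n' \<in> carrier N ==>
  pure_tensor R M N m (n \<oplus>\<^bsub>N\<^esub> n') = pure_tensor R M N m n \<oplus>\<^bsub>tensor_algebra R M N\<^esub> pure_tensor R M N m n'"
 by (rule pure_tensor_relator) (unfold tensor_relators_def Let_def, blast)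

end

context
 fixes G :: "('g, 'x) monoid_scheme" and R :: "('r, 'y) ring_scheme"
 assumes gG: "Group.group G" and finG: "finite (carrier G)" and cR: "cring R"
begin

lemma abelian_group_rat_rep_ring: "abelian_group (rat_rep_ring G R)"
 unfolding rat_rep_ring_def by (rule abelian_group_tensor_algebra[OF int_is_cring])

lemma rat_rep_class_closed: "rat_rep_class G R q M \<in> carrier (rat_rep_ring G R)"
 unfolding rat_rep_ring_def rat_rep_class_def by (rule pure_tensor_closed[OF int_is_cring])

lemma rat_rep_class_iso:
 "fg_rg_module G R M ==> rg_isomorphic G R M N ==> rat_rep_class G R q M = rat_rep_class G R q N"
 unfolding rat_rep_class_def rep_class_def using iso_class_cong[OF fg_rg_moduleD] by metis

lemma rep_class_closed: "fg_rg_module G R M ==> rep_class G R M \<in> carrier (rep_ring G R)"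
 unfolding rep_class_def rep_ring_def
 by (rule abelian_monoid.grothendieck_diff_closed[OF abelian_monoid_iso_class_semiring[OF gG finG cR]])
  (auto intro: iso_class_carrier[OF gG finG cR] abelian_monoid.zero_closed[OF abelian_monoid_iso_class_semiring[OF gG finG cR]])

lemma rep_class_direct_sum:
 assumes M: "fg_rg_module G R M" and N: "fg_rg_module G R N"
 shows "rep_class G R (rg_direct_sum M N) = rep_class G R M \<oplus>\<^bsub>rep_ring G R\<^esub> rep_class G R N"
proof -
 interpret S: abelian_monoid "iso_class_semiring G R" by (rule abelian_monoid_iso_class_semiring[OF gG finG cR])
 note c = iso_class_carrier[OF gG finG cR]
 show ?thesis
  unfolding rep_class_def rep_ring_def S.grothendieck_diff_add[OF c[OF M] S.zero_closed c[OF N] S.zero_closed]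
   iso_class_add[OF gG finG cR M N] by simp
qed

lemma rat_rep_class_direct_sum:
 assumes M: "fg_rg_module G R M" and N: "fg_rg_module G R N"
 shows "rat_rep_class G R q (rg_direct_sum M N) = rat_rep_class G R q M \<oplus>\<^bsub>rat_rep_ring G R\<^esub> rat_rep_class G R q N"
 using pure_tensor_add_right[OF int_is_cring, of q "int_algebra rat_ring" "rep_class G R M" "int_algebra (rep_ring G R)" "rep_class G R N"]
  rep_class_closed[OF M] rep_class_closed[OF N]
 unfolding rat_rep_ring_def rat_rep_class_def rep_class_direct_sum[OF M N] by (simp add: int_algebra_def rat_ring_def)

lemma rat_rep_class_add:
 assumes M: "fg_rg_module G R M"
 shows "rat_rep_class G R (q + r) M = rat_rep_class G R q M \<oplus>\<^bsub>rat_rep_ring G R\<^esub> rat_rep_class G R r M"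
 using pure_tensor_add_left[OF int_is_cring, of q "int_algebra rat_ring" r "rep_class G R M" "int_algebra (rep_ring G R)"] rep_class_closed[OF M]
 unfolding rat_rep_ring_def rat_rep_class_def by (simp add: int_algebra_def rat_ring_def)

end

section \<open>Classes of virtual group sets as a function of their marks\<close>

locale fin_rep = group G for G :: "('g, 'x) monoid_scheme" (structure) +
 fixes R :: "('r, 'y) ring_scheme" (structure)
 assumes finG: "finite (carrier G)" and cR: "cring R"
begin

sublocale A: abelian_group "rat_rep_ring G R" by (rule abelian_group_rat_rep_ring[OF is_group finG cR])

abbreviation (input) AR where "AR \<equiv> rat_rep_ring G R"

abbreviation (input) pcl :: "rat => 'b set => ('g => 'b => 'b) => _" where
 "pcl q X a \<equiv> rat_rep_class G R q (perm_module G R X a)"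

lemma closed: "rat_rep_class G R q M \<in> carrier AR"
 by (rule rat_rep_class_closed[OF is_group finG cR])

lemma pcl_giso:
 assumes X: "finite X" "gset G X a" and Y: "finite Y" "gset G Y b" and f: "giso G X a Y b f"
 shows "pcl q X a = pcl q Y b"
 by (rule rat_rep_class_iso[OF is_group finG cR fg_perm_module[OF cR X] perm_module_giso[OF X Y f]])

lemma pcl_union:
 assumes X: "finite X" "gset G X a" and Y: "finite Y" "gset G Y a" and d: "X \<inter> Y = {}"
 shows "pcl q (X \<union> Y) a = pcl q X a \<oplus>\<^bsub>AR\<^esub> pcl q Y a"
proof -
 have XY: "finite (X \<union> Y)" "gset G (X \<union> Y) a" using X Y unfolding gset_def by auto
 show ?thesis
  unfolding rat_rep_class_iso[OF is_group finG cR fg_perm_module[OF cR XY] perm_module_union[OF X Y d]]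
  by (rule rat_rep_class_direct_sum[OF is_group finG cR fg_perm_module[OF cR X] fg_perm_module[OF cR Y]])
qed

lemma pcl_empty: "pcl q {} a = \<zero>\<^bsub>AR\<^esub>"
proof -
 have "gset G {} a" by (simp add: gset_def)
 from pcl_union[OF _ this _ this, of q] have "pcl q {} a = pcl q {} a \<oplus>\<^bsub>AR\<^esub> pcl q {} a" by simp
 then show ?thesis using A.add.l_cancel_one[OF closed closed] by metis
qed

text \<open>The class of a signed group set multiplied by \<open>q\<close>. With the coefficient
  inside the tensors, all later computations take place in the additive group of
  \<open>A_R(G)\<close>.\<close>

definition ydiff :: "rat => 'b set => ('g => 'b => 'b) => ('b => bool) => _" where
 "ydiff q X a s = pcl q {x\<in>X. \<not> s x} a \<ominus>\<^bsub>AR\<^esub> pcl q {x\<in>X. s x} a"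

lemma ydiff_closed: "ydiff q X a s \<in> carrier AR"
 unfolding ydiff_def by (rule A.minus_closed[OF closed closed])

lemma pcl_plus:
 assumes X: "finite X" "gset G X a" and Y: "finite Y" "gset G Y b"
 shows "pcl q (X <+> Y) (\<lambda>g. map_sum (a g) (b g)) = pcl q X a \<oplus>\<^bsub>AR\<^esub> pcl q Y b"
proof -
 let ?c = "\<lambda>g. map_sum (a g) (b g)"
 have l: "gset G (Inl ` X) ?c" and r: "gset G (Inr ` Y) ?c" using X(2) Y(2) unfolding gset_def by auto
 have il: "giso G X a (Inl ` X) ?c Inl" and ir: "giso G Y b (Inr ` Y) ?c Inr"
  by (auto simp: giso_def bij_betw_def inj_on_def)
 have "pcl q (X <+> Y) ?c = pcl q (Inl ` X \<union> Inr ` Y) ?c" by (simp add: Plus_def)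
 also have "\<dots> = pcl q (Inl ` X) ?c \<oplus>\<^bsub>AR\<^esub> pcl q (Inr ` Y) ?c"
  by (rule pcl_union[OF _ l _ r]) (use X Y in auto)
 also have "pcl q (Inl ` X) ?c = pcl q X a" by (rule pcl_giso[OF X _ l il, symmetric]) (use X in auto)
 also have "pcl q (Inr ` Y) ?c = pcl q Y b" by (rule pcl_giso[OF Y _ r ir, symmetric]) (use Y in auto)
 finally show ?thesis .
qed

text \<open>By Burnside's theorem the difference only depends on the marks at subgroups.\<close>

lemma ydiff_eq:
 assumes X: "sgset G X a s" and Y: "sgset G Y b t"
  and m: "\<And>H. subgroup H G ==> smark G X a s H = smark G Y b t H"
 shows "ydiff q X a s = ydiff q Y b t"
proof -
 let ?X = "\<lambda>c. {x\<in>X. s x = c}" and ?Y = "\<lambda>c. {y\<in>Y. t y = c}"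
 let ?c = "\<lambda>g. map_sum (a g) (b g)" and ?d = "\<lambda>g. map_sum (b g) (a g)"
 note pX = sgset_parts[OF X] and pY = sgset_parts[OF Y]
 have gp: "gset G (S <+> T) (\<lambda>g. map_sum (u g) (v g))" if "gset G S u" "gset G T v" for S :: "'s set" and T :: "'t set" and u v
  using that unfolding gset_def by auto
 have fp: "card (fixpts G (S <+> T) (\<lambda>g. map_sum (u g) (v g)) H) = card (fixpts G S u H) + card (fixpts G T v H)"
  if "finite S" "finite T" for S :: "'s set" and T :: "'t set" and u v H
 proof -
  have "fixpts G (S <+> T) (\<lambda>g. map_sum (u g) (v g)) H = fixpts G S u H <+> fixpts G T v H" by (auto simp: fixpts_def)
  then show ?thesis using that by (simp add: card_Plus finite_fixpts)
 qed
 \<comment> \<open>The even part of each set is joined with the odd part of the other one. Equal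
   signed marks then become equal numbers of fixed points, as Burnside's theorem requires.\<close>
 have "\<exists>f. giso G (?X False <+> ?Y True) ?c (?Y False <+> ?X True) ?d f"
 proof (rule burnside_iso[OF finG])
  fix H assume H: "subgroup H G"
  have "int (card (fixpts G (?X False) a H)) + int (card (fixpts G (?Y True) b H)) =
   int (card (fixpts G (?Y False) b H)) + int (card (fixpts G (?X True) a H))"
   using m[OF H] unfolding smark_parts[OF sgsetD(1)[OF X]] smark_parts[OF sgsetD(1)[OF Y]] by linarith
  then show "card (fixpts G (?X False <+> ?Y True) ?c H) = card (fixpts G (?Y False <+> ?X True) ?d H)"
   unfolding fp[OF pX(1) pY(1)] fp[OF pY(1) pX(1)] by linarith
 qed (intro finite_Plus gp pX pY)+
 then obtain f where f: "giso G (?X False <+> ?Y True) ?c (?Y False <+> ?X True) ?d f" by blast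
 have "pcl q (?X False <+> ?Y True) ?c = pcl q (?Y False <+> ?X True) ?d"
  by (rule pcl_giso[OF _ gp[OF pX(2) pY(2)] _ gp[OF pY(2) pX(2)] f]) (intro finite_Plus pX pY)+
 then have e: "pcl q (?X False) a \<oplus>\<^bsub>AR\<^esub> pcl q (?Y True) b = pcl q (?Y False) b \<oplus>\<^bsub>AR\<^esub> pcl q (?X True) a"
  unfolding pcl_plus[OF pX pY] pcl_plus[OF pY pX] .
 define u v w z where uvwz: "u = pcl q (?X False) a" "v = pcl q (?X True) a" "w = pcl q (?Y False) b" "z = pcl q (?Y True) b"
 have c: "u \<in> carrier AR" "v \<in> carrier AR" "w \<in> carrier AR" "z \<in> carrier AR"
  unfolding uvwz by (rule closed)+
 have e: "u \<oplus>\<^bsub>AR\<^esub> z = w \<oplus>\<^bsub>AR\<^esub> v" using e unfolding uvwz .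
 have "u \<ominus>\<^bsub>AR\<^esub> v = (u \<oplus>\<^bsub>AR\<^esub> z) \<oplus>\<^bsub>AR\<^esub> (\<ominus>\<^bsub>AR\<^esub> z \<oplus>\<^bsub>AR\<^esub> \<ominus>\<^bsub>AR\<^esub> v)"
  using c A.r_neg1 by (simp add: a_minus_def A.a_assoc A.r_neg1 A.r_neg2)
 also have "\<dots> = w \<ominus>\<^bsub>AR\<^esub> z"
  unfolding e using c A.a_comm[of "\<ominus>\<^bsub>AR\<^esub> z" "\<ominus>\<^bsub>AR\<^esub> v"]
  by (simp add: a_minus_def A.a_assoc A.r_neg2)
 finally have "u \<ominus>\<^bsub>AR\<^esub> v = w \<ominus>\<^bsub>AR\<^esub> z" .
 then show ?thesis unfolding uvwz ydiff_def by simp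
qed

text \<open>By \<open>ydiff_eq\<close> the class is determined by the marks, so it becomes an
  additive function of \<open>m\<close>, and the set chosen to realize \<open>m\<close> is
  immaterial.\<close>

definition yv :: "rat => ('g set => int) => _" where
 "yv q m = (SOME t. \<exists>(X :: nat set) a s. sgset G X a s \<and> m = smark G X a s \<and> t = ydiff q X a s)"

lemma yv_eq:
 assumes X: "sgset G X a s" and m: "\<And>H. subgroup H G ==> m H = smark G X a s H" and V: "Vm G m"
 shows "yv q m = ydiff q X a s"
proof -
 have "\<exists>t. \<exists>(Y :: nat set) b u. sgset G Y b u \<and> m = smark G Y b u \<and> t = ydiff q Y b u" using V unfolding Vm_def by blast
 from someI_ex[OF this] obtain Y :: "nat set" and b u where Y: "sgset G Y b u" "m = smark G Y b u" "yv q m = ydiff q Y b u"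
  unfolding yv_def by blast
 show ?thesis unfolding Y(3) by (rule ydiff_eq[OF Y(1) X]) (use m Y(2) in simp)
qed

lemma yv_smark: "sgset G X a s ==> yv q (smark G X a s) = ydiff q X a s"
 by (rule yv_eq) (auto intro: Vm_intro)

lemma yv_closed: assumes "Vm G m" shows "yv q m \<in> carrier AR"
proof -
 obtain X :: "nat set" and a s where X: "sgset G X a s" "m = smark G X a s" using assms unfolding Vm_def by blast
 show ?thesis unfolding X(2) yv_smark[OF X(1)] by (rule ydiff_closed)
qed

lemma four_swap:
 assumes "u \<in> carrier AR" "v \<in> carrier AR" "w \<in> carrier AR" "z \<in> carrier AR"
 shows "(u \<oplus>\<^bsub>AR\<^esub> w) \<ominus>\<^bsub>AR\<^esub> (v \<oplus>\<^bsub>AR\<^esub> z) =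
  (u \<ominus>\<^bsub>AR\<^esub> v) \<oplus>\<^bsub>AR\<^esub> (w \<ominus>\<^bsub>AR\<^esub> z)"
 using assms by (simp add: a_minus_def A.minus_add A.a_ac)

lemma yv_add:
 assumes m: "Vm G m" and n: "Vm G n"
 shows "yv q (\<lambda>H. m H + n H) = yv q m \<oplus>\<^bsub>AR\<^esub> yv q n"
proof -
 obtain X :: "nat set" and a s where X: "sgset G X a s" "m = smark G X a s" using m unfolding Vm_def by blast
 obtain Y :: "nat set" and b t where Y: "sgset G Y b t" "n = smark G Y b t" using n unfolding Vm_def by blast
 let ?c = "\<lambda>g. map_sum (a g) (b g)"
 have e: "{z \<in> X <+> Y. case_sum s t z = c} = {x\<in>X. s x = c} <+> {y\<in>Y. t y = c}" for c by auto
 have p: "pcl q {z \<in> X <+> Y. case_sum s t z = c} ?c = pcl q {x\<in>X. s x = c} a \<oplus>\<^bsub>AR\<^esub> pcl q {y\<in>Y. t y = c} b" for c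
  unfolding e by (rule pcl_plus[OF sgset_parts[OF X(1)] sgset_parts[OF Y(1)]])
 have "yv q (\<lambda>H. m H + n H) = ydiff q (X <+> Y) ?c (case_sum s t)"
  unfolding X(2) Y(2) sgset_sum(2)[OF X(1) Y(1), symmetric] by (rule yv_smark[OF sgset_sum(1)[OF X(1) Y(1)]])
 also have "\<dots> = ydiff q X a s \<oplus>\<^bsub>AR\<^esub> ydiff q Y b t"
  using p[of True] p[of False] unfolding ydiff_def by (simp add: four_swap[OF closed closed closed closed])
 finally show ?thesis by (simp add: X(2) Y(2) yv_smark[OF X(1)] yv_smark[OF Y(1)])
qed

lemma yv_q_add:
 assumes m: "Vm G m" shows "yv (q + r) m = yv q m \<oplus>\<^bsub>AR\<^esub> yv r m"
proof -
 obtain X :: "nat set" and a s where X: "sgset G X a s" "m = smark G X a s" using m unfolding Vm_def by blast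
 have p: "pcl (q + r) {x\<in>X. s x = c} a = pcl q {x\<in>X. s x = c} a \<oplus>\<^bsub>AR\<^esub> pcl r {x\<in>X. s x = c} a" for c
  by (rule rat_rep_class_add[OF is_group finG cR fg_perm_module[OF cR sgset_parts[OF X(1)]]])
 show ?thesis unfolding X(2) yv_smark[OF X(1)]
  using p[of True] p[of False] unfolding ydiff_def by (simp add: four_swap[OF closed closed closed closed])
qed

lemma yv_zero_marks: assumes "Vm G m" "\<And>H. subgroup H G ==> m H = 0" shows "yv q m = \<zero>\<^bsub>AR\<^esub>"
proof -
 have e: "sgset G ({} :: nat set) (\<lambda>g x. x) (\<lambda>_. False)" by (simp add: sgset_def gset_def)
 have "yv q m = ydiff q ({} :: nat set) (\<lambda>g x. x) (\<lambda>_. False)"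
  by (rule yv_eq[OF e _ assms(1)]) (simp add: assms(2) smark_def fixpts_def)
 also have "\<dots> = \<zero>\<^bsub>AR\<^esub>" by (simp add: ydiff_def pcl_empty a_minus_def)
 finally show ?thesis .
qed

lemma yv_Rel:
 assumes Rd: "Rel G d m" and e: "e \<in> carrier R" "e \<otimes>\<^bsub>R\<^esub> intr R d = \<one>\<^bsub>R\<^esub>"
 shows "yv q m = \<zero>\<^bsub>AR\<^esub>"
proof -
 obtain X :: "nat set" and a s f where X: "sgset G X a s" and f: "oddop G X a s f d" and m: "m = smark G X a s"
  using Rd unfolding Rel_def by blast
 have "pcl q {x\<in>X. s x = False} a = pcl q {x\<in>X. s x = True} a"
  using rat_rep_class_iso[OF is_group finG cR fg_perm_module[OF cR sgset_parts[OF X, of False]], of "perm_module G R {x\<in>X. s x} a" q]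
   perm_module_oddop[OF cR X f e] by simp
 then have "ydiff q X a s = pcl q {x\<in>X. s x = True} a \<ominus>\<^bsub>AR\<^esub> pcl q {x\<in>X. s x = True} a"
  unfolding ydiff_def by simp
 also have "\<dots> = \<zero>\<^bsub>AR\<^esub>" unfolding a_minus_def by (rule A.r_neg[OF closed])
 finally show ?thesis unfolding m yv_smark[OF X] .
qed

lemma yv_scale_nat: assumes m: "Vm G m" shows "yv q (\<lambda>H. int n * m H) = yv (of_nat n * q) m"
proof (induction n)
 case 0
 have "yv 0 m = yv 0 m \<oplus>\<^bsub>AR\<^esub> yv 0 m" using yv_q_add[OF m, of 0 0] by simp
 then have "yv 0 m = \<zero>\<^bsub>AR\<^esub>" using A.add.l_cancel_one[OF yv_closed[OF m] yv_closed[OF m]] by metis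
 moreover have "yv q (\<lambda>H. int 0 * m H) = \<zero>\<^bsub>AR\<^esub>" by (rule yv_zero_marks) (use Vm_const[of 0] in auto)
 ultimately show ?case by simp
next
 case (Suc n)
 have "yv q (\<lambda>H. int (Suc n) * m H) = yv q (\<lambda>H. int n * m H + m H)" by (simp add: algebra_simps)
 also have "\<dots> = yv q (\<lambda>H. int n * m H) \<oplus>\<^bsub>AR\<^esub> yv q m" by (rule yv_add[OF Vm_mult[OF Vm_const m] m])
 also have "\<dots> = yv (of_nat n * q + q) m" unfolding Suc by (rule yv_q_add[OF m, symmetric])
 finally show ?case by (simp add: algebra_simps)
qed

lemma yv_uminus:
 assumes m: "Vm G m"
 shows "yv q (\<lambda>H. - m H) = \<ominus>\<^bsub>AR\<^esub> yv q m" "yv (- q) m = \<ominus>\<^bsub>AR\<^esub> yv q m"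
proof -
 have z: "yv q (\<lambda>H. 0) = \<zero>\<^bsub>AR\<^esub>" by (rule yv_zero_marks) (use Vm_const[of 0] in auto)
 have z': "yv 0 m = \<zero>\<^bsub>AR\<^esub>" using yv_scale_nat[OF m, of q 0] z by simp
 show "yv q (\<lambda>H. - m H) = \<ominus>\<^bsub>AR\<^esub> yv q m"
  by (rule A.minus_equality[symmetric]) (use yv_add[OF Vm_minus[OF m] m, of q] z yv_closed[OF m] yv_closed[OF Vm_minus[OF m]] in auto)
 show "yv (- q) m = \<ominus>\<^bsub>AR\<^esub> yv q m"
  by (rule A.minus_equality[symmetric]) (use yv_q_add[OF m, of "- q" q] z' yv_closed[OF m] in auto)
qed

text \<open>Integer factors pass between the marks and the rational coefficient. In
  \<open>null_marks\<close> this is what permits division by a nonzero integer.\<close>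

lemma yv_scale: assumes m: "Vm G m" shows "yv q (\<lambda>H. c * m H) = yv (of_int c * q) m"
proof (cases "c \<ge> 0")
 case True
 then have "c = int (nat c)" "of_int c = (of_nat (nat c) :: rat)" by (simp_all add: of_nat_nat)
 then show ?thesis using yv_scale_nat[OF m, of q "nat c"] by metis
next
 case False
 then have c: "- c = int (nat (- c))" "of_int c = - (of_nat (nat (- c)) :: rat)" by (simp_all add: of_nat_nat)
 have "yv q (\<lambda>H. c * m H) = yv q (\<lambda>H. - (int (nat (- c)) * m H))" using c(1) by simp
 also have "\<dots> = \<ominus>\<^bsub>AR\<^esub> yv (of_nat (nat (- c)) * q) m"
  unfolding yv_uminus(1)[OF Vm_mult[OF Vm_const m]] yv_scale_nat[OF m] ..
 also have "\<dots> = yv (of_int c * q) m" unfolding yv_uminus(2)[OF m, symmetric] c(2) by simp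
 finally show ?thesis .
qed

text \<open>For a prime \<open>p\<close> with \<open>pR = R\<close> the element \<open>1\<close> is
  a multiple of \<open>p\<close>, so the image of \<open>p\<close> is a unit; the rest is induction
  along the prime factorization, with the sign treated at the end.\<close>

lemma unit_of_primes:
 assumes d: "d \<noteq> 0" and p: "\<And>p::nat. Factorial_Ring.prime p ==> int p dvd d ==> (\<lambda>r. [p] \<cdot>\<^bsub>R\<^esub> r) ` carrier R = carrier R"
 shows "\<exists>e\<in>carrier R. e \<otimes>\<^bsub>R\<^esub> intr R d = \<one>\<^bsub>R\<^esub>"
proof -
 interpret R: cring R by (rule cR)
 have "\<exists>e\<in>carrier R. e \<otimes>\<^bsub>R\<^esub> intr R (int n) = \<one>\<^bsub>R\<^esub>"
  if "n \<noteq> 0" "\<And>p. Factorial_Ring.prime p ==> p dvd n ==> (\<lambda>r. [p] \<cdot>\<^bsub>R\<^esub> r) ` carrier R = carrier R" for n :: nat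
  using that
 proof (induction n rule: less_induct)
  case (less n)
  show ?case
  proof (cases "n = 1")
   case True
   then show ?thesis using R.intr_1 by (intro bexI[of _ "\<one>\<^bsub>R\<^esub>"]) auto
  next
   case False
   then obtain p where pp: "Factorial_Ring.prime p" "p dvd n" using prime_factor_nat by blast
   then obtain k where k: "n = p * k" by (elim dvdE)
   have k0: "k \<noteq> 0" "k < n" using k less.prems(1) prime_gt_1_nat[OF pp(1)] by auto
   have "\<exists>e\<in>carrier R. e \<otimes>\<^bsub>R\<^esub> intr R (int k) = \<one>\<^bsub>R\<^esub>"
    by (rule less.IH[OF k0(2,1)]) (use less.prems(2) k in auto)
   then obtain e where e: "e \<in> carrier R" "e \<otimes>\<^bsub>R\<^esub> intr R (int k) = \<one>\<^bsub>R\<^esub>" by blast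
   have "\<one>\<^bsub>R\<^esub> \<in> (\<lambda>r. [p] \<cdot>\<^bsub>R\<^esub> r) ` carrier R" unfolding less.prems(2)[OF pp] by simp
   then obtain r where r: "r \<in> carrier R" "[p] \<cdot>\<^bsub>R\<^esub> r = \<one>\<^bsub>R\<^esub>" by auto
   have "intr R (int p) \<otimes>\<^bsub>R\<^esub> r = [p] \<cdot>\<^bsub>R\<^esub> r"
    using R.add_pow_ldistr[OF R.one_closed r(1), of p] r(1) by (simp add: intr_def add_pow_int_ge)
   then have "intr R (int p) \<otimes>\<^bsub>R\<^esub> r = \<one>\<^bsub>R\<^esub>" using r(2) by simp
   then have "(r \<otimes>\<^bsub>R\<^esub> e) \<otimes>\<^bsub>R\<^esub> intr R (int n) = \<one>\<^bsub>R\<^esub>"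
    unfolding k of_nat_mult R.intr_mult using r(1) e R.intr_closed
    by (metis R.m_assoc R.m_closed R.m_comm R.r_one)
   then show ?thesis using r e by blast
  qed
 qed
 from this[of "nat \<bar>d\<bar>"] obtain e where e: "e \<in> carrier R" "e \<otimes>\<^bsub>R\<^esub> intr R \<bar>d\<bar> = \<one>\<^bsub>R\<^esub>"
  using d p by (auto simp: nat_abs_dvd_iff dvd_nat_abs_iff)
 show ?thesis
 proof (cases "d \<ge> 0")
  case True then show ?thesis using e by auto
 next
  case False
  then have "intr R \<bar>d\<bar> = intr R (-1) \<otimes>\<^bsub>R\<^esub> intr R d" by (simp add: R.intr_mult[symmetric])
  then have "(e \<otimes>\<^bsub>R\<^esub> intr R (-1)) \<otimes>\<^bsub>R\<^esub> intr R d = \<one>\<^bsub>R\<^esub>" using e R.intr_closed by (simp add: R.m_assoc)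
  then show ?thesis using e R.intr_closed by blast
 qed
qed

text \<open>Induction on the number of subgroups with nonzero mark. For \<open>K\<close> among them,
  \<open>Rel_unit\<close> and \<open>Rel_induce\<close> provide a relation \<open>w\<close> whose
  mark \<open>c'\<close> at \<open>K\<close> is not zero and whose scalar is a unit of
  \<open>R\<close>. In \<open>c' * m = m * (c' - w) + m * w\<close> the first summand has the
  additional zero \<open>K\<close>, so the induction hypothesis applies, and the second summand is
  again a relation. Finally \<open>c'\<close> is divided out in the coefficient
  \<open>q\<close>.\<close>

theorem null_marks:
 assumes m: "Vm G m"
  and cyc: "\<And>K. subgroup K G ==> cyclic_group (G\<lparr>carrier := K\<rparr>) ==> m K = 0"
  and core: "\<And>K p. subgroup K G ==> Factorial_Ring.prime (p::nat) ==> (\<lambda>r. [p] \<cdot>\<^bsub>R\<^esub> r) ` carrier R \<noteq> carrier R ==>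
   cyclic_group (G\<lparr>carrier := K\<rparr> Mod p_core p (G\<lparr>carrier := K\<rparr>)) ==> m K = 0"
 shows "yv q m = \<zero>\<^bsub>AR\<^esub>"
 using assms
proof (induction "card {K. subgroup K G \<and> m K \<noteq> 0}" arbitrary: m q rule: less_induct)
 case less
 note m = less.prems(1)
 have finS: "finite {K. subgroup K G \<and> m K \<noteq> 0}"
  by (rule finite_subset[of _ "Pow (carrier G)"]) (use finG subgroup.subset in auto)
 show ?case
 proof (cases "\<exists>K. subgroup K G \<and> m K \<noteq> 0")
  case False
  then show ?thesis by (intro yv_zero_marks[OF m]) blast
 next
  case True
  then obtain K where K: "subgroup K G" "m K \<noteq> 0" by blast
  interpret K: group "G\<lparr>carrier := K\<rparr>" by (rule subgroup_imp_group[OF K(1)])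
  have "\<exists>d u. Rel (G\<lparr>carrier := K\<rparr>) d u \<and> u (carrier (G\<lparr>carrier := K\<rparr>)) \<noteq> 0 \<and> d \<noteq> 0 \<and>
   (\<forall>p::nat. Factorial_Ring.prime p \<and> (\<lambda>r. [p] \<cdot>\<^bsub>R\<^esub> r) ` carrier R \<noteq> carrier R \<longrightarrow> \<not> int p dvd d)"
  proof (rule K.Rel_unit)
   show "finite (carrier (G\<lparr>carrier := K\<rparr>))" using finite_subset[OF subgroup.subset[OF K(1)] finG] by simp
   show "\<not> cyclic_group (G\<lparr>carrier := K\<rparr>)" using less.prems(2)[OF K(1)] K(2) by blast
   show "\<not> cyclic_group (G\<lparr>carrier := K\<rparr> Mod p_core p (G\<lparr>carrier := K\<rparr>))"
    if "Factorial_Ring.prime p" "(\<lambda>r. [p] \<cdot>\<^bsub>R\<^esub> r) ` carrier R \<noteq> carrier R" for p :: nat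
    using less.prems(3)[OF K(1) that] K(2) by blast
  qed
  then obtain d u where u: "Rel (G\<lparr>carrier := K\<rparr>) d u" and u': "u (carrier (G\<lparr>carrier := K\<rparr>)) \<noteq> 0" and d0: "d \<noteq> 0"
   and dp: "\<forall>p::nat. Factorial_Ring.prime p \<and> (\<lambda>r. [p] \<cdot>\<^bsub>R\<^esub> r) ` carrier R \<noteq> carrier R \<longrightarrow> \<not> int p dvd d" by (elim exE conjE)
  have uK: "u K \<noteq> 0" using u' by simp
  have d: "(\<lambda>r. [p] \<cdot>\<^bsub>R\<^esub> r) ` carrier R = carrier R" if "Factorial_Ring.prime p" "int p dvd d" for p :: nat
   using dp that by blast
  obtain e where e: "e \<in> carrier R" "e \<otimes>\<^bsub>R\<^esub> intr R d = \<one>\<^bsub>R\<^esub>" using unit_of_primes[OF d0 d] by blast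
  obtain w c where w: "Rel G d w" "w K = c * u K" "c \<noteq> 0" using Rel_induce[OF finG K(1) u] by blast
  define c' where "c' = c * u K"
  have c': "c' \<noteq> 0" "w K = c'" using w uK by (auto simp: c'_def)
  define n where "n H = m H * (c' - w H)" for H
  have Vw: "Vm G w" by (rule Rel_Vm[OF w(1)])
  have n: "Vm G n" unfolding n_def by (rule Vm_mult[OF m Vm_diff[OF Vm_const Vw]])
  have nz: "n H = 0" if "m H = 0" for H using that by (simp add: n_def)
  have "card {K. subgroup K G \<and> n K \<noteq> 0} < card {K. subgroup K G \<and> m K \<noteq> 0}"
  proof (rule psubset_card_mono[OF finS])
   have "n K = 0" using c' by (simp add: n_def)
   then show "{K. subgroup K G \<and> n K \<noteq> 0} \<subset> {K. subgroup K G \<and> m K \<noteq> 0}" using K nz by blast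
  qed
  then have yn: "yv r n = \<zero>\<^bsub>AR\<^esub>" for r
   by (rule less.hyps[OF _ n]) (use less.prems(2,3) nz in blast)+
  have yw: "yv r (\<lambda>H. m H * w H) = \<zero>\<^bsub>AR\<^esub>" for r
   using yv_Rel[OF Rel_mult_Vm[OF w(1) m] e, of r] by (simp add: mult.commute)
  have "yv r (\<lambda>H. c' * m H) = \<zero>\<^bsub>AR\<^esub>" for r
  proof -
   have "(\<lambda>H. c' * m H) = (\<lambda>H. n H + m H * w H)" by (auto simp: n_def algebra_simps)
   then show ?thesis using yv_add[OF n Vm_mult[OF m Vw], of r] yn yw by simp
  qed
  from this[of "q / of_int c'"] show ?thesis using c'(1) unfolding yv_scale[OF m] by simp
 qed
qed

end

section \<open>Moebius inversion\<close>

text \<open>The values sum to \<open>0\<close> over the closed interval from \<open>None\<close> to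
  \<open>Some L\<close>, and \<open>None\<close> itself contributes \<open>1\<close>.\<close>

lemma moebius_adjoin_bot_sum:
 assumes "finite P" "L \<in> (P :: 'a::order set)"
 shows "(\<Sum>H\<in>{H\<in>P. H \<le> L}. moebius (adjoin_bot P) None (Some H)) = -1"
proof -
 let ?mu = "moebius (adjoin_bot P) None"
 have s: "{z \<in> adjoin_bot P. None \<le> z \<and> z < Some L} = insert None (Some ` {H\<in>P. H < L})"
  by (auto simp: adjoin_bot_def)
 have fin: "finite {H\<in>P. H < L}" using assms(1) by simp
 have 1: "?mu None = 1" by (subst moebius.simps) simp
 have "?mu (Some L) = - (\<Sum>z\<in>insert None (Some ` {H\<in>P. H < L}). ?mu z)"
  using moebius.simps[of "adjoin_bot P" None "Some L"] fin unfolding s by simp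
 also have "\<dots> = -1 - (\<Sum>H\<in>{H\<in>P. H < L}. ?mu (Some H))"
  using fin by (subst sum.insert) (auto simp: 1 sum.reindex)
 finally have "?mu (Some L) + (\<Sum>H\<in>{H\<in>P. H < L}. ?mu (Some H)) = -1" by simp
 moreover have "{H\<in>P. H \<le> L} = insert L {H\<in>P. H < L}" using assms(2) by (auto simp: order.order_iff_strict)
 ultimately show ?thesis using fin by simp
qed

section \<open>Centralizers and fixed points on their cosets\<close>

context group
begin

lemma centralizer_subgroup: assumes "K \<subseteq> carrier G" shows "subgroup (centralizer G K) G"
proof
 show "centralizer G K \<subseteq> carrier G" by (auto simp: centralizer_def)
 show "\<one> \<in> centralizer G K" using assms by (auto simp: centralizer_def)
 fix x assume x: "x \<in> centralizer G K"
 then have xG: "x \<in> carrier G" by (simp add: centralizer_def)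
 have xk: "x \<otimes> k = k \<otimes> x" if "k \<in> K" for k using x that by (simp add: centralizer_def)
 show "inv x \<in> centralizer G K"
 proof -
  have "inv x \<otimes> k = k \<otimes> inv x" if k: "k \<in> K" for k
  proof -
   have kG: "k \<in> carrier G" using assms k by blast
   have "inv x \<otimes> k = inv x \<otimes> (k \<otimes> x) \<otimes> inv x" using xG kG by (simp add: m_assoc)
   also have "\<dots> = k \<otimes> inv x" unfolding xk[OF k, symmetric] using xG kG by (simp add: m_assoc[symmetric])
   finally show ?thesis .
  qed
  then show ?thesis using xG by (simp add: centralizer_def)
 qed
 fix y assume y: "y \<in> centralizer G K"
 then have yG: "y \<in> carrier G" by (simp add: centralizer_def)
 have "x \<otimes> y \<otimes> k = k \<otimes> (x \<otimes> y)" if k: "k \<in> K" for k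
 proof -
  have kG: "k \<in> carrier G" using assms k by blast
  have "x \<otimes> y \<otimes> k = x \<otimes> (k \<otimes> y)" using y k xG yG kG by (simp add: centralizer_def m_assoc)
  also have "\<dots> = k \<otimes> (x \<otimes> y)" using xG yG kG xk[OF k] by (simp add: m_assoc[symmetric])
  finally show ?thesis .
 qed
 then show "x \<otimes> y \<in> centralizer G K" using xG yG by (simp add: centralizer_def)
qed

lemma gstab_coset: assumes L: "subgroup L G" shows "gstab G (\<lambda>g X. g <# X) L = L"
proof (intro equalityI subsetI)
 fix g assume "g \<in> gstab G (\<lambda>g X. g <# X) L"
 then have g: "g \<in> carrier G" "g <# L = L" by (auto simp: gstab_def)
 have "g \<in> g <# L" using subgroup.one_closed[OF L] g(1) unfolding l_coset_def by force
 then show "g \<in> L" using g(2) by simp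
next
 fix g assume g: "g \<in> L"
 then show "g \<in> gstab G (\<lambda>g X. g <# X) L"
  using coset_join3[OF _ L g] subgroup.mem_carrier[OF L g] by (simp add: gstab_def)
qed

lemma lcoset_eq_iff:
 assumes L: "subgroup L G" and g: "g \<in> carrier G" and h: "h \<in> carrier G"
 shows "g <# L = h <# L \<longleftrightarrow> inv h \<otimes> g \<in> L"
proof -
 have "L \<in> lcosets L" using fixpts_coset_self[OF L] by (simp add: fixpts_def)
 from gset_act_eq_iff[OF coset_gset[OF L] this g h] show ?thesis unfolding gstab_coset[OF L] .
qed

text \<open>A coset is fixed by \<open>K\<close> if and only if any of its elements \<open>g\<close>
  satisfies the condition on the right. That set is thus a union of fixed cosets, each with
  \<open>card L\<close> elements.\<close>

lemma card_fixpts_coset: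
 assumes finG: "finite (carrier G)" and L: "subgroup L G" and K: "K \<subseteq> carrier G"
 shows "card L * card (fixpts G (lcosets L) (\<lambda>g X. g <# X) K) = card {g \<in> carrier G. \<forall>k\<in>K. inv g \<otimes> (k \<otimes> g) \<in> L}"
proof -
 note LG = subgroup.subset[OF L]
 let ?F = "fixpts G (lcosets L) (\<lambda>g X. g <# X) K"
 let ?A = "{g \<in> carrier G. \<forall>k\<in>K. inv g \<otimes> (k \<otimes> g) \<in> L}"
 have finF: "finite ?F" by (rule finite_fixpts[OF lcosets_finite[OF finG]])
 have finA: "finite ?A" using finG by simp
 have mem: "g <# L \<in> ?F \<longleftrightarrow> g \<in> ?A" if g: "g \<in> carrier G" for g
 proof -
  have "k <# (g <# L) = g <# L \<longleftrightarrow> inv g \<otimes> (k \<otimes> g) \<in> L" if k: "k \<in> K" for k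
  proof -
   have kG: "k \<in> carrier G" using K k by blast
   show ?thesis unfolding lcos_m_assoc[OF LG kG g] by (rule lcoset_eq_iff[OF L m_closed[OF kG g] g])
  qed
  moreover have "g <# L \<in> lcosets L" using g by (auto simp: LCOSETS_def)
  moreover have "K \<inter> carrier G = K" using K by blast
  ultimately show ?thesis using g by (simp add: fixpts_def)
 qed
 have im: "(\<lambda>g. g <# L) ` ?A \<subseteq> ?F" using mem by auto
 have "card ?A = (\<Sum>X\<in>?F. card {g \<in> ?A. g <# L = X})"
  using sum.group[OF finA finF im, of "\<lambda>_. 1::nat"] by simp
 also have "\<dots> = (\<Sum>X\<in>?F. card L)"
 proof (rule sum.cong[OF refl])
  fix X assume X: "X \<in> ?F"
  then obtain x where x: "x \<in> carrier G" "X = x <# L" by (auto simp: fixpts_def LCOSETS_def)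
  have "bij_betw (\<lambda>l. x \<otimes> l) L {g \<in> ?A. g <# L = X}"
  proof (rule bij_betw_byWitness[where f' = "\<lambda>g. inv x \<otimes> g"])
   show "\<forall>l\<in>L. inv x \<otimes> (x \<otimes> l) = l" using x LG by (auto simp: m_assoc[symmetric] subset_eq)
   show "\<forall>g\<in>{g \<in> ?A. g <# L = X}. x \<otimes> (inv x \<otimes> g) = g" using x by (auto simp: m_assoc[symmetric])
   show "(\<lambda>g. inv x \<otimes> g) ` {g \<in> ?A. g <# L = X} \<subseteq> L" using lcoset_eq_iff[OF L _ x(1)] x(2) by auto
   show "(\<lambda>l. x \<otimes> l) ` L \<subseteq> {g \<in> ?A. g <# L = X}"
   proof (rule image_subsetI)
    fix l assume l: "l \<in> L"
    then have lG: "l \<in> carrier G" using LG by blast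
    have "inv x \<otimes> (x \<otimes> l) \<in> L" using x lG l by (simp add: m_assoc[symmetric])
    then have e: "(x \<otimes> l) <# L = X" unfolding x(2) using lcoset_eq_iff[OF L m_closed[OF x(1) lG] x(1)] by simp
    have "x \<otimes> l \<in> ?A" by (rule iffD1[OF mem[OF m_closed[OF x(1) lG]]]) (use e X in simp)
    then show "x \<otimes> l \<in> {g \<in> ?A. g <# L = X}" using e by simp
   qed
  qed
  from bij_betw_same_card[OF this] show "card {g \<in> ?A. g <# L = X} = card L" by simp
 qed
 finally show ?thesis by simp
qed

lemma conj_commute:
 assumes c: "g \<in> carrier G" "k \<in> carrier G" "h \<in> carrier G" and e: "inv g \<otimes> (k \<otimes> g) \<otimes> h = h \<otimes> (inv g \<otimes> (k \<otimes> g))"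
 shows "k \<otimes> (g \<otimes> (h \<otimes> inv g)) = g \<otimes> (h \<otimes> inv g) \<otimes> k"
proof -
 have "k \<otimes> (g \<otimes> (h \<otimes> inv g)) = g \<otimes> (inv g \<otimes> (k \<otimes> g) \<otimes> h) \<otimes> inv g" using c by (simp add: m_assoc[symmetric])
 also have "\<dots> = g \<otimes> (h \<otimes> inv g) \<otimes> k" unfolding e using c by (simp add: m_assoc)
 finally show ?thesis .
qed

text \<open>Conjugation by \<open>g\<close> moves it from one side of a commutation to the other,
  which exchanges the roles of \<open>K\<close> and \<open>H\<close>. A condition on the variable
  group \<open>centralizer G H\<close> becomes a bound on \<open>H\<close> by a fixed member of the
  poset.\<close>

lemma conj_in_centralizer_iff:
 assumes K: "K \<subseteq> carrier G" and H: "H \<subseteq> carrier G" and g: "g \<in> carrier G"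
 shows "(\<forall>k\<in>K. inv g \<otimes> (k \<otimes> g) \<in> centralizer G H) \<longleftrightarrow> (\<forall>h\<in>H. g \<otimes> (h \<otimes> inv g) \<in> centralizer G K)"
proof -
 have "inv g \<otimes> (k \<otimes> g) \<otimes> h = h \<otimes> (inv g \<otimes> (k \<otimes> g)) \<longleftrightarrow> g \<otimes> (h \<otimes> inv g) \<otimes> k = k \<otimes> (g \<otimes> (h \<otimes> inv g))"
  if "k \<in> carrier G" "h \<in> carrier G" for k h
 proof
  assume "inv g \<otimes> (k \<otimes> g) \<otimes> h = h \<otimes> (inv g \<otimes> (k \<otimes> g))"
  from conj_commute[OF g that this] show "g \<otimes> (h \<otimes> inv g) \<otimes> k = k \<otimes> (g \<otimes> (h \<otimes> inv g))" by simp
 next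
  assume "g \<otimes> (h \<otimes> inv g) \<otimes> k = k \<otimes> (g \<otimes> (h \<otimes> inv g))"
  then have "inv (inv g) \<otimes> (h \<otimes> inv g) \<otimes> k = k \<otimes> (inv (inv g) \<otimes> (h \<otimes> inv g))" using g by simp
  from conj_commute[OF inv_closed[OF g] that(2,1) this]
  show "inv g \<otimes> (k \<otimes> g) \<otimes> h = h \<otimes> (inv g \<otimes> (k \<otimes> g))" using g by simp
 qed
 then show ?thesis using K H g by (auto simp: centralizer_def subset_eq)
qed

text \<open>For \<open>g \<in> G\<close> the condition \<open>g H g\<^sup>-\<^sup>1 \<subseteq> C\<^sub>G(K)\<close> says that \<open>H\<close> lies below the conjugate
 \<open>g\<^sup>-\<^sup>1 C\<^sub>G(K) g\<close>, a member of \<open>C\<close>; so the inner sum of Moebius values is \<open>-1\<close>.\<close>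

lemma moebius_marks:
 assumes finG: "finite (carrier G)" and C: "\<And>H. H \<in> C ==> subgroup H G"
  and conj: "\<And>H g. H \<in> C ==> g \<in> carrier G ==> (g <# H) #> inv g \<in> C"
  and K: "K \<subseteq> carrier G" and KC: "centralizer G K \<in> C"
 shows "(\<Sum>H\<in>C. - moebius (adjoin_bot C) None (Some H) * int (card (centralizer G H)) *
   int (card (fixpts G (lcosets (centralizer G H)) (\<lambda>g X. g <# X) K))) = int (card (carrier G))"
proof -
 let ?mu = "\<lambda>H. moebius (adjoin_bot C) None (Some H)"
 have CG: "H \<subseteq> carrier G" if "H \<in> C" for H by (rule subgroup.subset[OF C[OF that]])
 have finC: "finite C" by (rule finite_subset[of _ "Pow (carrier G)"]) (use CG finG in auto)
 define L where "L g = {x \<in> carrier G. g \<otimes> (x \<otimes> inv g) \<in> centralizer G K}" for g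
 have LC: "L g \<in> C" if g: "g \<in> carrier G" for g
 proof -
  have "L g = (inv g <# centralizer G K) #> inv (inv g)"
  proof (intro equalityI subsetI)
   fix x assume "x \<in> L g"
   then have x: "x \<in> carrier G" "g \<otimes> (x \<otimes> inv g) \<in> centralizer G K" by (auto simp: L_def)
   have "x = inv g \<otimes> (g \<otimes> (x \<otimes> inv g)) \<otimes> inv (inv g)" using x(1) g by (simp add: m_assoc inv_solve_left)
   then show "x \<in> (inv g <# centralizer G K) #> inv (inv g)" using x(2) unfolding l_coset_def r_coset_def by blast
  next
   fix x assume "x \<in> (inv g <# centralizer G K) #> inv (inv g)"
   then obtain c where c: "c \<in> centralizer G K" "x = inv g \<otimes> c \<otimes> inv (inv g)" unfolding l_coset_def r_coset_def by blast
   have cG: "c \<in> carrier G" using c(1) by (simp add: centralizer_def)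
   have "g \<otimes> (x \<otimes> inv g) = (g \<otimes> inv g) \<otimes> c \<otimes> (g \<otimes> inv g)"
    unfolding c(2) inv_inv[OF g] using cG g by (simp only: m_assoc m_closed inv_closed)
   then have "g \<otimes> (x \<otimes> inv g) = c" using cG g by simp
   then show "x \<in> L g" using c cG g by (simp add: L_def)
  qed
  then show ?thesis using conj[OF KC inv_closed[OF g]] by simp
 qed
 have "(\<Sum>H\<in>C. - ?mu H * int (card (centralizer G H)) * int (card (fixpts G (lcosets (centralizer G H)) (\<lambda>g X. g <# X) K))) =
  (\<Sum>H\<in>C. \<Sum>g\<in>carrier G. if H \<le> L g then - ?mu H else 0)"
 proof (rule sum.cong[OF refl])
  fix H assume H: "H \<in> C"
  have "{g \<in> carrier G. \<forall>k\<in>K. inv g \<otimes> (k \<otimes> g) \<in> centralizer G H} = {g \<in> carrier G. H \<le> L g}"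
   using conj_in_centralizer_iff[OF K CG[OF H]] CG[OF H] by (auto simp: L_def)
  then have "card (centralizer G H) * card (fixpts G (lcosets (centralizer G H)) (\<lambda>g X. g <# X) K) = card {g \<in> carrier G. H \<le> L g}"
   using card_fixpts_coset[OF finG centralizer_subgroup[OF CG[OF H]] K] by simp
  then have "int (card (centralizer G H)) * int (card (fixpts G (lcosets (centralizer G H)) (\<lambda>g X. g <# X) K)) = int (card {g \<in> carrier G. H \<le> L g})"
   by (metis of_nat_mult)
  moreover have "(\<Sum>g\<in>carrier G. if H \<le> L g then - ?mu H else 0) = (\<Sum>g\<in>{g \<in> carrier G. H \<le> L g}. - ?mu H)"
   using finG by (intro sum.inter_filter[symmetric])
  ultimately show "- ?mu H * int (card (centralizer G H)) * int (card (fixpts G (lcosets (centralizer G H)) (\<lambda>g X. g <# X) K)) =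
   (\<Sum>g\<in>carrier G. if H \<le> L g then - ?mu H else 0)" by (simp add: mult.assoc)
 qed
 also have "\<dots> = (\<Sum>g\<in>carrier G. \<Sum>H\<in>C. if H \<le> L g then - ?mu H else 0)" by (rule sum.swap)
 also have "\<dots> = (\<Sum>g\<in>carrier G. 1)"
 proof (rule sum.cong[OF refl])
  fix g assume g: "g \<in> carrier G"
  have "(\<Sum>H\<in>C. if H \<le> L g then - ?mu H else 0) = (\<Sum>H\<in>{H\<in>C. H \<le> L g}. - ?mu H)"
   using finC by (intro sum.inter_filter[symmetric])
  also have "\<dots> = 1" using moebius_adjoin_bot_sum[OF finC LC[OF g]] by (simp add: sum_negf)
  finally show "(\<Sum>H\<in>C. if H \<le> L g then - ?mu H else 0) = 1" .
 qed
 finally show ?thesis by simp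
qed

end

context fin_rep
begin

lemma pcl_yv:
 assumes X: "finite X" "gset G X a"
 shows "pcl q X a = yv q (\<lambda>H. int (card (fixpts G X a H)))" "Vm G (\<lambda>H. int (card (fixpts G X a H)))"
proof -
 have s: "sgset G X a (\<lambda>_. False)" using X by (simp add: sgset_def)
 have m: "smark G X a (\<lambda>_. False) = (\<lambda>H. int (card (fixpts G X a H)))" by (simp add: smark_def[abs_def] sgn_of_def)
 show "Vm G (\<lambda>H. int (card (fixpts G X a H)))" using Vm_intro[OF s] unfolding m .
 have "yv q (\<lambda>H. int (card (fixpts G X a H))) = ydiff q X a (\<lambda>_. False)" unfolding m[symmetric] by (rule yv_smark[OF s])
 also have "\<dots> = pcl q X a"
 proof -
  have z: "\<ominus>\<^bsub>AR\<^esub> \<zero>\<^bsub>AR\<^esub> = \<zero>\<^bsub>AR\<^esub>" by (rule A.minus_equality) auto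
  have e: "{x \<in> X. \<not> False} = X" "{x \<in> X. False} = {}" by auto
  show ?thesis unfolding ydiff_def e pcl_empty a_minus_def z by (rule A.r_zero[OF closed])
 qed
 finally show "pcl q X a = yv q (\<lambda>H. int (card (fixpts G X a H)))" by simp
qed

lemma yv_finsum:
 assumes "finite I" "\<And>i. i \<in> I ==> Vm G (m i)"
 shows "yv q (\<lambda>H. \<Sum>i\<in>I. m i H) = (\<Oplus>\<^bsub>AR\<^esub>i\<in>I. yv q (m i))"
 using assms
proof (induction I rule: finite_induct)
 case empty
 have "yv q (\<lambda>H. 0) = \<zero>\<^bsub>AR\<^esub>" by (rule yv_zero_marks) (use Vm_const[of 0] in auto)
 then show ?case by simp
next
 case (insert i I)
 have "yv q (\<lambda>H. \<Sum>i\<in>insert i I. m i H) = yv q (\<lambda>H. m i H + (\<Sum>i\<in>I. m i H))" using insert.hyps by simp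
 also have "\<dots> = yv q (m i) \<oplus>\<^bsub>AR\<^esub> yv q (\<lambda>H. \<Sum>i\<in>I. m i H)"
  by (rule yv_add) (use insert.prems Vm_sum[OF insert.hyps(1)] in auto)
 also have "\<dots> = (\<Oplus>\<^bsub>AR\<^esub>i\<in>insert i I. yv q (m i))"
  using insert by (subst A.finsum_insert) (auto intro!: yv_closed)
 finally show ?case .
qed

lemma ind_trivial_perm_module: "ind_trivial G R K = perm_module G R (lcosets K) (\<lambda>g X. g <# X)"
 by (simp add: ind_trivial_def perm_module_def)

end

theorem theoremC:
  fixes G :: "('g, 'x) monoid_scheme" and R :: "('r, 'y) ring_scheme" and C :: "'g set set"
  assumes "Group.group G" and "finite (carrier G)" and "cring R"
    and subgroups: "\<And>H. H \<in> C \<Longrightarrow> subgroup H G"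
    and conj_closed: "\<And>H g. \<lbrakk>H \<in> C; g \<in> carrier G\<rbrakk> \<Longrightarrow> (g <#\<^bsub>G\<^esub> H) #>\<^bsub>G\<^esub> inv\<^bsub>G\<^esub> g \<in> C"
    and cyclic: "\<And>K. \<lbrakk>subgroup K G; cyclic_group (G\<lparr>carrier := K\<rparr>)\<rbrakk> \<Longrightarrow> centralizer G K \<in> C"
    and cyclic_mod_p_core: "\<And>K p. \<lbrakk>subgroup K G; Factorial_Ring.prime (p :: nat);
        (\<lambda>r. [p] \<cdot>\<^bsub>R\<^esub> r) ` carrier R \<noteq> carrier R;
        cyclic_group (G\<lparr>carrier := K\<rparr> Mod p_core p (G\<lparr>carrier := K\<rparr>))\<rbrakk>
      \<Longrightarrow> centralizer G K \<in> C"
  shows "rat_rep_class G R 1 (rg_trivial R) =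
    (\<Oplus>\<^bsub>rat_rep_ring G R\<^esub> H \<in> C.
       rat_rep_class G R
         (- of_int (moebius (adjoin_bot C) None (Some H)) /
            of_nat (card (rcosets\<^bsub>G\<^esub> (centralizer G H))))
         (ind_trivial G R (centralizer G H)))"
proof -
 interpret fin_rep G R by (rule fin_rep.intro[OF assms(1) fin_rep_axioms.intro[OF assms(2,3)]])
 let ?mu = "\<lambda>H. moebius (adjoin_bot C) None (Some H)"
 define N where "N = card (carrier G)"
 have N0: "N \<noteq> 0" using finG by (auto simp: N_def)
 have CG: "H \<subseteq> carrier G" if "H \<in> C" for H by (rule subgroup.subset[OF subgroups[OF that]])
 have finC: "finite C" by (rule finite_subset[of _ "Pow (carrier G)"]) (use CG finG in auto)
 have cs: "subgroup (centralizer G H) G" if "H \<in> C" for H by (rule centralizer_subgroup[OF CG[OF that]])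
 define f where "f H K = int (card (fixpts G (lcosets\<^bsub>G\<^esub> (centralizer G H)) (\<lambda>g X. g <#\<^bsub>G\<^esub> X) K))" for H K
 define n where "n H = - ?mu H * int (card (centralizer G H))" for H
 have cf: "pcl q (lcosets\<^bsub>G\<^esub> (centralizer G H)) (\<lambda>g X. g <#\<^bsub>G\<^esub> X) = yv q (f H)" "Vm G (f H)" if "H \<in> C" for q H
  unfolding f_def by (rule pcl_yv[OF lcosets_finite[OF finG] coset_gset[OF cs[OF that]]])+
 \<comment> \<open>The marks of the right-hand side multiplied by the group order, which clears the
   denominators: \<open>card (centralizer G H)\<close> is the order divided by the index. The factor
   \<open>q\<close> below undoes this.\<close>
 define S where "S K = (\<Sum>H\<in>C. n H * f H K)" for K
 have VS: "Vm G S" unfolding S_def by (rule Vm_sum[OF finC Vm_mult[OF Vm_const cf(2)]])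
 have SN: "S K = int N" if "K \<subseteq> carrier G" "centralizer G K \<in> C" for K
  unfolding S_def n_def f_def N_def by (rule moebius_marks[OF finG subgroups conj_closed that])
 define q where "q = 1 / (of_nat N :: rat)"
 \<comment> \<open>By \<open>SN\<close> the difference has mark \<open>0\<close> at every subgroup
   whose centralizer belongs to \<open>C\<close>, and the two closure hypotheses place all subgroups
   tested by \<open>null_marks\<close> among these.\<close>
 have "yv q (\<lambda>K. S K + (- int N) * 1) = \<zero>\<^bsub>AR\<^esub>"
 proof (rule null_marks)
  show "Vm G (\<lambda>K. S K + (- int N) * 1)" by (rule Vm_add[OF VS Vm_const])
  fix K assume K: "subgroup K G"
  note KG = subgroup.subset[OF K]
  show "S K + (- int N) * 1 = 0" if "cyclic_group (G\<lparr>carrier := K\<rparr>)"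
   using SN[OF KG cyclic[OF K that]] by simp
  show "S K + (- int N) * 1 = 0" if "Factorial_Ring.prime (p::nat)" "(\<lambda>r. [p] \<cdot>\<^bsub>R\<^esub> r) ` carrier R \<noteq> carrier R"
   "cyclic_group (G\<lparr>carrier := K\<rparr> Mod p_core p (G\<lparr>carrier := K\<rparr>))" for p
   using SN[OF KG cyclic_mod_p_core[OF K that]] by simp
 qed
 then have "yv q S \<oplus>\<^bsub>AR\<^esub> yv q (\<lambda>K. (- int N) * 1) = \<zero>\<^bsub>AR\<^esub>"
  using yv_add[OF VS Vm_const, of q "- int N * 1"] by simp
 moreover have "yv q (\<lambda>K. (- int N) * 1) = \<ominus>\<^bsub>AR\<^esub> yv 1 (\<lambda>K. 1)"
  using yv_scale[OF Vm_const[of 1], of q "- int N"] yv_uminus(2)[OF Vm_const[of 1], of 1] N0 by (simp add: q_def)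
 ultimately have "yv q S = yv 1 (\<lambda>K. 1)"
  using A.minus_equality[of "yv q S" "\<ominus>\<^bsub>AR\<^esub> yv 1 (\<lambda>K. 1)"] yv_closed[OF VS] yv_closed[OF Vm_const[of 1]] by simp
 moreover have "yv 1 (\<lambda>K. 1) = rat_rep_class G R 1 (rg_trivial R)"
 proof -
  have g: "gset G {0::nat} (\<lambda>g x. x)" by (simp add: gset_def)
  have "fixpts G {0::nat} (\<lambda>g x. x) K = {0}" for K by (auto simp: fixpts_def)
  then have "yv 1 (\<lambda>K. 1) = pcl 1 {0::nat} (\<lambda>g x. x)" using pcl_yv(1)[OF _ g, of 1] by simp
  also have "\<dots> = rat_rep_class G R 1 (rg_trivial R)"
   by (rule rat_rep_class_iso[OF is_group finG cR fg_perm_module[OF cR _ g] perm_module_point]) auto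
  finally show ?thesis .
 qed
 moreover have "yv q S = (\<Oplus>\<^bsub>AR\<^esub> H \<in> C. rat_rep_class G R
     (- of_int (?mu H) / of_nat (card (rcosets\<^bsub>G\<^esub> (centralizer G H)))) (ind_trivial G R (centralizer G H)))"
 proof -
  have "yv q S = (\<Oplus>\<^bsub>AR\<^esub> H \<in> C. yv q (\<lambda>K. n H * f H K))"
   unfolding S_def by (rule yv_finsum[OF finC Vm_mult[OF Vm_const cf(2)]])
  also have "\<dots> = (\<Oplus>\<^bsub>AR\<^esub> H \<in> C. rat_rep_class G R
     (- of_int (?mu H) / of_nat (card (rcosets\<^bsub>G\<^esub> (centralizer G H)))) (ind_trivial G R (centralizer G H)))"
  proof (rule A.finsum_cong')
   fix H assume H: "H \<in> C"
   have pr: "card (rcosets\<^bsub>G\<^esub> (centralizer G H)) * card (centralizer G H) = N"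
    using lagrange[OF cs[OF H]] by (simp add: Coset.order_def N_def)
   have e: "(of_nat N :: rat) = of_nat (card (rcosets\<^bsub>G\<^esub> (centralizer G H))) * of_nat (card (centralizer G H))"
    unfolding pr[symmetric] by (rule of_nat_mult)
   have "of_int (n H) * q = - of_int (?mu H) / of_nat (card (rcosets\<^bsub>G\<^esub> (centralizer G H)))"
   proof -
    have "card (centralizer G H) \<noteq> 0" using pr N0 by (metis mult_0_right)
    then show ?thesis by (simp add: n_def q_def e)
   qed
   then show "yv q (\<lambda>K. n H * f H K) = rat_rep_class G R
     (- of_int (?mu H) / of_nat (card (rcosets\<^bsub>G\<^esub> (centralizer G H)))) (ind_trivial G R (centralizer G H))"
    unfolding yv_scale[OF cf(2)[OF H]] ind_trivial_perm_module cf(1)[OF H] by simp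
  qed (auto intro: closed)
  finally show ?thesis .
 qed
 ultimately show ?thesis by simp
qed

end
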